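(* Let $\pi\colon P\to M$ be a principal $\mathbb{X}$-bundle for a Lie groupoid $\mathbb{X}=[X_1\rightrightarrows X_0]$ with an Ehresmann connection $\mathbb{H}$. Then $\mathcal{A}\mathfrak{d}(P)$, as defined in the context, is a diffeological groupoid, and $\bar\pi_{\mathcal{A}\mathfrak{d}(P)}\colon\mathcal{A}\mathfrak{d}(P)\to M$, $[p,\alpha,v]\mapsto\pi(p)$, $([p,\alpha,v],g)\mapsto\pi(p)$ is a smooth surjective functor to the discrete category $M$, such that for each $m\in M$ the set $\mathfrak{Conn}(\bar\pi^{-1}_{\mathcal{A}\mathfrak{d}(P)}(m))$ of connected components of the fibre is a graded vector space with addition $$\langle[p,\alpha,v]\rangle+\langle[q,\beta,v']\rangle=\langle[pg,\lambda^0_{g^{-1}}(\alpha)+\beta,\lambda^1_{g^{-1}}(v)+v']\rangle,$$ where $g\in X_1$ is the unique element with $q=pg$.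
   Context: Lie groupoid $\mathbb{X}=[X_1\rightrightarrows X_0]$: source $s$, target $t$ are submersions, $gh$ is defined when $s(g)=t(h)$, units $1_x$. Right action on $P$ with anchor $a\colon P\to X_0$: $pg$ is defined when $a(p)=t(g)$, $a(pg)=s(g)$, $(pg)h=p(gh)$, $p1_{a(p)}=p$. Principal $\mathbb{X}$-bundle: a surjective submersion $\pi\colon P\to M$ with a right action, $\pi(pg)=\pi(p)$, and $(p,g)\mapsto(p,pg)$ a diffeomorphism $P\times_{X_0}X_1\to P\times_MP$. Lie algebroid $A\to X_0$: $A_x=\ker(ds)_{1_x}$. $r_g\colon A_{t(g)}\to T_gX_1$ is the differential at $1_{t(g)}$ of $h\mapsto hg$; $l_g\colon A_{s(g)}\to T_gX_1$ is the differential at $1_{s(g)}$ of $h\mapsto gh^{-1}$ on $s^{-1}(s(g))$. Ehresmann connection: a subbundle $\mathbb{H}\subset TX_1$ with $TX_1=\mathbb{H}\oplus\ker ds$ and $\mathbb{H}_{1_x}=(d1)_x(T_xX_0)$; $\sigma_g\colon T_{s(g)}X_0\to\mathbb{H}_g$ is the inverse of $ds|_{\mathbb{H}_g}$; $\psi_g\colon T_gX_1\to A_{t(g)}$ satisfies $r_g\psi_g+\sigma_g(ds)_g=\mathrm{Id}$. $\lambda^0_g=-\psi_gl_g\colon A_{s(g)}\to A_{t(g)}$, $\lambda^1_g=(dt)_g\sigma_g\colon T_{s(g)}X_0\to T_{t(g)}X_0$. $\mathcal{A}\mathfrak{d}(P)$: on the manifold $P\times_{X_0}A\oplus a^*TX_0$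 put $(p,\alpha,v)\sim(p',\alpha',v')$ iff $p=p'$, $\alpha-\alpha'=\sum_{i=1}^n(\lambda^0_{h_i^{-1}g_i^{-1}}-\lambda^0_{h_i^{-1}}\lambda^0_{g_i^{-1}})(\alpha_i)$ and $v-v'=\sum_{i=1}^n(\lambda^1_{h_i^{-1}g_i^{-1}}-\lambda^1_{h_i^{-1}}\lambda^1_{g_i^{-1}})(v_i)$ for some $n$, $p_i\in P$, $g_i,h_i\in X_1$, $\alpha_i\in A_{a(p_i)}$, $v_i\in T_{a(p_i)}X_0$ with $p=p_ig_ih_i$. Objects: classes $[p,\alpha,v]$, with the quotient diffeology. Morphisms: $([p,\alpha,v],g)$ with $a(p)=t(g)$, with the fibre product diffeology on $\bigl((P\times_{X_0}A\oplus a^*TX_0)/\!\sim\bigr)\times_{X_0}X_1$. Source $[p,\alpha,v]$, target $[pg,\lambda^0_{g^{-1}}(\alpha),\lambda^1_{g^{-1}}(v)]$; unit arrow $([p,\alpha,v],1_{a(p)})$; the composite of an arrow with $X_1$-component $g$ followed by one with component $h$ has component $gh$; inverse has component $g^{-1}$. A diffeological groupoid is a groupoid internal to diffeological spaces and smooth maps. $\langle[p,\alpha,v]\rangle$ denotes the connected component (isomorphism class) in the fibre subgroupoid $\bar\pi^{-1}(m)$; zero is $\langle[p,0,0]\rangle$, negatives are $\langle[p,-\alpha,-v]\rangle$, scalars act by $c\langle[p,\alpha,v]\rangle=\langle[p,c\alpha,cv]\rangle$; the grading is by the $\alpha$- and $v$-components. *)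

theory Defs
  imports
    "HOL-Analysis.Analysis"
    "HOL-Library.Function_Algebras"
    "HOL-Algebra.Module"
begin

text \<open>
  All Cartesian spaces, including the zero-dimensional one, are the topologies
  \<^term>\<open>Euclidean_space n\<close> on functions \<open>nat \<Rightarrow> real\<close> vanishing from index \<open>n\<close> on.
  A function is of class \<open>C\<^sup>k\<^sup>+\<^sup>1\<close> if it is continuous and its partial derivatives exist and
  are of class \<open>C\<^sup>k\<close>.
\<close>

primrec Ck_on :: "nat \<Rightarrow> nat \<Rightarrow> (nat \<Rightarrow> real) set \<Rightarrow> ((nat \<Rightarrow> real) \<Rightarrow> real) \<Rightarrow> bool" where
  "Ck_on n 0 U f \<longleftrightarrow>
     continuous_map (subtopology (Euclidean_space n) U) euclideanreal f"
| "Ck_on n (Suc k) U f \<longleftrightarrow>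
     continuous_map (subtopology (Euclidean_space n) U) euclideanreal f \<and>
     (\<forall>i<n. \<exists>f'. (\<forall>x\<in>U. ((\<lambda>\<tau>. f (x(i := \<tau>))) has_real_derivative f' x) (at (x i))) \<and>
                 Ck_on n k U f')"

definition smooth_real :: "nat \<Rightarrow> (nat \<Rightarrow> real) set \<Rightarrow> ((nat \<Rightarrow> real) \<Rightarrow> real) \<Rightarrow> bool" where
  "smooth_real n U f \<longleftrightarrow> openin (Euclidean_space n) U \<and> (\<forall>k. Ck_on n k U f)"

definition smooth_cartesian ::
  "nat \<Rightarrow> (nat \<Rightarrow> real) set \<Rightarrow> nat \<Rightarrow> ((nat \<Rightarrow> real) \<Rightarrow> nat \<Rightarrow> real) \<Rightarrow> bool" where
  "smooth_cartesian n U m f \<longleftrightarrow>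
     openin (Euclidean_space n) U \<and> f ` U \<subseteq> topspace (Euclidean_space m) \<and>
     (\<forall>j<m. smooth_real n U (\<lambda>x. f x j))"

text \<open>
  \<open>plot D n U p\<close> says that the restriction of \<open>p\<close> to the open set \<open>U\<close> of the
  \<open>n\<close>-dimensional Cartesian space is a plot; the values of \<open>p\<close> outside \<open>U\<close> are irrelevant.
\<close>

record 'a diffeology =
  points :: "'a set"
  plot :: "nat \<Rightarrow> (nat \<Rightarrow> real) set \<Rightarrow> ((nat \<Rightarrow> real) \<Rightarrow> 'a) \<Rightarrow> bool"

definition diffeological_space :: "'a diffeology \<Rightarrow> bool" where
  "diffeological_space D \<longleftrightarrow>
     (\<forall>n U p. plot D n U p \<longrightarrow> openin (Euclidean_space n) U \<and> p ` U \<subseteq> points D) \<and>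
     (\<forall>n U p q. plot D n U p \<and> (\<forall>u\<in>U. p u = q u) \<longrightarrow> plot D n U q) \<and>
     (\<forall>n U x. openin (Euclidean_space n) U \<and> x \<in> points D \<longrightarrow> plot D n U (\<lambda>_. x)) \<and>
     (\<forall>n U p m V f. plot D n U p \<and> smooth_cartesian m V n f \<and> f ` V \<subseteq> U
        \<longrightarrow> plot D m V (p \<circ> f)) \<and>
     (\<forall>n U p. openin (Euclidean_space n) U \<and>
        (\<forall>u\<in>U. \<exists>W. openin (Euclidean_space n) W \<and> u \<in> W \<and> W \<subseteq> U \<and> plot D n W p)
        \<longrightarrow> plot D n U p)"

definition dsmooth :: "'a diffeology \<Rightarrow> 'b diffeology \<Rightarrow> ('a \<Rightarrow> 'b) \<Rightarrow> bool" where
  "dsmooth D E f \<longleftrightarrow>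
     f ` points D \<subseteq> points E \<and> (\<forall>n U p. plot D n U p \<longrightarrow> plot E n U (f \<circ> p))"

definition diffeomorphism :: "'a diffeology \<Rightarrow> 'b diffeology \<Rightarrow> ('a \<Rightarrow> 'b) \<Rightarrow> bool" where
  "diffeomorphism D E f \<longleftrightarrow>
     bij_betw f (points D) (points E) \<and> dsmooth D E f \<and>
     dsmooth E D (inv_into (points D) f)"

definition subspace_diffeology :: "'a diffeology \<Rightarrow> 'a set \<Rightarrow> 'a diffeology" where
  "subspace_diffeology D S =
     \<lparr>points = points D \<inter> S, plot = (\<lambda>n U p. plot D n U p \<and> p ` U \<subseteq> S)\<rparr>"

definition fibre_product ::
  "'a diffeology \<Rightarrow> 'b diffeology \<Rightarrow> ('a \<Rightarrow> 'c) \<Rightarrow> ('b \<Rightarrow> 'c) \<Rightarrow> ('a \<times> 'b) diffeology" where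
  "fibre_product D E f g =
     \<lparr>points = {(x, y). x \<in> points D \<and> y \<in> points E \<and> f x = g y},
      plot = (\<lambda>n U p. plot D n U (fst \<circ> p) \<and> plot E n U (snd \<circ> p) \<and>
                      (\<forall>u\<in>U. f (fst (p u)) = g (snd (p u))))\<rparr>"

definition quotient_diffeology :: "'a diffeology \<Rightarrow> ('a \<times> 'a) set \<Rightarrow> 'a set diffeology" where
  "quotient_diffeology D R =
     \<lparr>points = points D // R,
      plot = (\<lambda>n U q. openin (Euclidean_space n) U \<and>
        (\<forall>u\<in>U. \<exists>W p. openin (Euclidean_space n) W \<and> u \<in> W \<and> W \<subseteq> U \<and>
           plot D n W p \<and> (\<forall>w\<in>W. q w = R `` {p w})))\<rparr>"

text \<open>
  A chart \<open>(n, D, \<phi>)\<close> has domain \<open>D\<close> and takes values in \<open>n\<close>-dimensional Cartesian space; the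
  dimension may vary between connected components.
\<close>

type_synonym 'a chart = "nat \<times> 'a set \<times> ('a \<Rightarrow> nat \<Rightarrow> real)"

record 'a manifold =
  mtop :: "'a topology"
  atlas :: "'a chart set"

definition smooth_manifold :: "'a manifold \<Rightarrow> bool" where
  "smooth_manifold X \<longleftrightarrow>
     Hausdorff_space (mtop X) \<and> second_countable (mtop X) \<and>
     topspace (mtop X) = (\<Union>(n, D, \<phi>)\<in>atlas X. D) \<and>
     (\<forall>(n, D, \<phi>)\<in>atlas X.
        openin (mtop X) D \<and> openin (Euclidean_space n) (\<phi> ` D) \<and>
        homeomorphic_map (subtopology (mtop X) D) (subtopology (Euclidean_space n) (\<phi> ` D)) \<phi>) \<and>
     (\<forall>(n, D, \<phi>)\<in>atlas X. \<forall>(m, E, \<psi>)\<in>atlas X.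
        smooth_cartesian n (\<phi> ` (D \<inter> E)) m (\<psi> \<circ> inv_into D \<phi>))"

text \<open>
  Manifolds are regarded as diffeological spaces whose plots are the smooth maps from open
  subsets of Cartesian spaces. This embedding is full and faithful, so \<^const>\<open>dsmooth\<close>
  expresses smoothness of maps between manifolds. For fibre products along submersions and other
  embedded submanifolds, the submanifold structure has the same smooth maps as the
  fibre product and subspace diffeologies.
\<close>

definition mdiff :: "'a manifold \<Rightarrow> 'a diffeology" where
  "mdiff X =
     \<lparr>points = topspace (mtop X),
      plot = (\<lambda>n U p. openin (Euclidean_space n) U \<and>
        continuous_map (subtopology (Euclidean_space n) U) (mtop X) p \<and>
        (\<forall>(m, D, \<phi>)\<in>atlas X. smooth_cartesian n {u \<in> U. p u \<in> D} m (\<phi> \<circ> p)))\<rparr>"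

abbreviation mpoints :: "'a manifold \<Rightarrow> 'a set" where
  "mpoints X \<equiv> topspace (mtop X)"

text \<open>
  A tangent vector at \<open>x\<close> is the velocity of a smooth curve \<open>\<gamma>\<close> through \<open>x\<close>, encoded as the
  operator \<open>f \<mapsto> (f \<circ> \<gamma>)'(0)\<close> on functions that are smooth near \<open>x\<close> and extended by zero to all
  other functions. Linear operations on tangent spaces are thus pointwise. The base point is not
  part of the vector.
\<close>

type_synonym 'a tvec = "('a \<Rightarrow> real) \<Rightarrow> real"

definition smooth_near :: "'a manifold \<Rightarrow> 'a \<Rightarrow> ('a \<Rightarrow> real) \<Rightarrow> bool" where
  "smooth_near X x f \<longleftrightarrow>
     (\<exists>W. openin (mtop X) W \<and> x \<in> W \<and>
        (\<forall>(n, D, \<phi>)\<in>atlas X. smooth_real n (\<phi> ` (D \<inter> W)) (f \<circ> inv_into D \<phi>)))"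

definition smooth_curve :: "'a manifold \<Rightarrow> (real \<Rightarrow> 'a) \<Rightarrow> bool" where
  "smooth_curve X \<gamma> \<longleftrightarrow>
     (\<exists>\<epsilon>>0. plot (mdiff X) 1 {u \<in> topspace (Euclidean_space 1). \<bar>u 0\<bar> < \<epsilon>} (\<lambda>u. \<gamma> (u 0)))"

definition velocity :: "'a manifold \<Rightarrow> (real \<Rightarrow> 'a) \<Rightarrow> 'a tvec" where
  "velocity X \<gamma> = (\<lambda>f. if smooth_near X (\<gamma> 0) f then deriv (\<lambda>\<tau>. f (\<gamma> \<tau>)) 0 else 0)"

definition tangent_space :: "'a manifold \<Rightarrow> 'a \<Rightarrow> 'a tvec set" where
  "tangent_space X x = {velocity X \<gamma> |\<gamma>. smooth_curve X \<gamma> \<and> \<gamma> 0 = x}"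

definition tscale :: "real \<Rightarrow> 'a tvec \<Rightarrow> 'a tvec" where
  "tscale c v = (\<lambda>f. c * v f)"

text \<open>
  The map \<open>F\<close> need only be defined on the embedded submanifold \<open>S\<close> of \<open>X\<close>, and \<open>v\<close> is tangent
  to \<open>S\<close> at \<open>x\<close>: translations in a groupoid are only defined on source fibres.
\<close>

definition differential_on ::
  "'a manifold \<Rightarrow> 'a set \<Rightarrow> 'b manifold \<Rightarrow> ('a \<Rightarrow> 'b) \<Rightarrow> 'a \<Rightarrow> 'a tvec \<Rightarrow> 'b tvec" where
  "differential_on X S Y F x v =
     (THE w. \<exists>\<gamma>. smooth_curve X \<gamma> \<and> \<gamma> 0 = x \<and> (\<forall>\<^sub>F \<tau> in nhds 0. \<gamma> \<tau> \<in> S) \<and>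
                 velocity X \<gamma> = v \<and> w = velocity Y (F \<circ> \<gamma>))"

abbreviation differential ::
  "'a manifold \<Rightarrow> 'b manifold \<Rightarrow> ('a \<Rightarrow> 'b) \<Rightarrow> 'a \<Rightarrow> 'a tvec \<Rightarrow> 'b tvec" where
  "differential X Y F \<equiv> differential_on X (mpoints X) Y F"

definition submersion :: "'a manifold \<Rightarrow> 'b manifold \<Rightarrow> ('a \<Rightarrow> 'b) \<Rightarrow> bool" where
  "submersion X Y F \<longleftrightarrow>
     dsmooth (mdiff X) (mdiff Y) F \<and>
     (\<forall>x\<in>mpoints X. differential X Y F x ` tangent_space X x = tangent_space Y (F x))"

text \<open>
  In the chart of the tangent bundle induced by \<open>\<phi>\<close>, the fibre coordinates of \<open>v\<close> are the
  values of \<open>v\<close> on the coordinate functions of \<open>\<phi>\<close>.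
\<close>

definition tangent_bundle :: "'a manifold \<Rightarrow> ('a \<times> 'a tvec) diffeology" where
  "tangent_bundle X =
     \<lparr>points = {(x, v). x \<in> mpoints X \<and> v \<in> tangent_space X x},
      plot = (\<lambda>n U q. plot (mdiff X) n U (fst \<circ> q) \<and>
        (\<forall>u\<in>U. snd (q u) \<in> tangent_space X (fst (q u))) \<and>
        (\<forall>(m, D, \<phi>)\<in>atlas X. \<forall>j<m.
           smooth_real n {u \<in> U. fst (q u) \<in> D} (\<lambda>u. snd (q u) (\<lambda>x. \<phi> x j))))\<rparr>"

definition linear_subspace :: "'a tvec set \<Rightarrow> 'a tvec set \<Rightarrow> bool" where
  "linear_subspace L T \<longleftrightarrow>
     L \<subseteq> T \<and> 0 \<in> L \<and> (\<forall>v\<in>L. \<forall>w\<in>L. v + w \<in> L) \<and> (\<forall>c. \<forall>v\<in>L. tscale c v \<in> L)"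

definition smooth_subbundle :: "'a manifold \<Rightarrow> ('a \<Rightarrow> 'a tvec set) \<Rightarrow> bool" where
  "smooth_subbundle X H \<longleftrightarrow>
     (\<forall>x\<in>mpoints X. linear_subspace (H x) (tangent_space X x)) \<and>
     (\<forall>x\<in>mpoints X. \<exists>U (k :: nat) Y. openin (mtop X) U \<and> x \<in> U \<and>
        (\<forall>i<k. dsmooth (subspace_diffeology (mdiff X) U) (tangent_bundle X) (\<lambda>y. (y, Y i y))) \<and>
        (\<forall>y\<in>U. H y = {(\<Sum>i<k. tscale (c i) (Y i y)) |c. True} \<and>
               (\<forall>c. (\<Sum>i<k. tscale (c i) (Y i y)) = 0 \<longrightarrow> (\<forall>i<k. c i = 0))))"

text \<open>
  \<open>cmp G k f\<close> is the composite of \<open>f\<close> followed by \<open>k\<close>, defined when \<open>src G k = tgt G f\<close>.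
\<close>

record ('o, 'a) small_groupoid =
  src :: "'a \<Rightarrow> 'o"
  tgt :: "'a \<Rightarrow> 'o"
  unt :: "'o \<Rightarrow> 'a"
  cmp :: "'a \<Rightarrow> 'a \<Rightarrow> 'a"
  ginv :: "'a \<Rightarrow> 'a"

definition is_groupoid :: "'o set \<Rightarrow> 'a set \<Rightarrow> ('o, 'a, 'z) small_groupoid_scheme \<Rightarrow> bool" where
  "is_groupoid Ob Ar G \<longleftrightarrow>
     (\<forall>f\<in>Ar. src G f \<in> Ob \<and> tgt G f \<in> Ob) \<and>
     (\<forall>x\<in>Ob. unt G x \<in> Ar \<and> src G (unt G x) = x \<and> tgt G (unt G x) = x) \<and>
     (\<forall>k\<in>Ar. \<forall>f\<in>Ar. src G k = tgt G f \<longrightarrow>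
        cmp G k f \<in> Ar \<and> src G (cmp G k f) = src G f \<and> tgt G (cmp G k f) = tgt G k) \<and>
     (\<forall>h\<in>Ar. \<forall>k\<in>Ar. \<forall>f\<in>Ar. src G h = tgt G k \<and> src G k = tgt G f \<longrightarrow>
        cmp G (cmp G h k) f = cmp G h (cmp G k f)) \<and>
     (\<forall>f\<in>Ar. cmp G f (unt G (src G f)) = f \<and> cmp G (unt G (tgt G f)) f = f) \<and>
     (\<forall>f\<in>Ar. ginv G f \<in> Ar \<and> src G (ginv G f) = tgt G f \<and> tgt G (ginv G f) = src G f \<and>
        cmp G (ginv G f) f = unt G (src G f) \<and> cmp G f (ginv G f) = unt G (tgt G f))"

definition smooth_groupoid ::
  "'o diffeology \<Rightarrow> 'a diffeology \<Rightarrow> ('o, 'a, 'z) small_groupoid_scheme \<Rightarrow> bool" where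
  "smooth_groupoid Ob Ar G \<longleftrightarrow>
     is_groupoid (points Ob) (points Ar) G \<and>
     dsmooth Ar Ob (src G) \<and> dsmooth Ar Ob (tgt G) \<and> dsmooth Ob Ar (unt G) \<and>
     dsmooth (fibre_product Ar Ar (src G) (tgt G)) Ar (\<lambda>(k, f). cmp G k f) \<and>
     dsmooth Ar Ar (ginv G)"

record ('o, 'a) diff_groupoid = "('o, 'a) small_groupoid" +
  ob_space :: "'o diffeology"
  ar_space :: "'a diffeology"

definition diffeological_groupoid :: "('o, 'a) diff_groupoid \<Rightarrow> bool" where
  "diffeological_groupoid G \<longleftrightarrow>
     diffeological_space (ob_space G) \<and> diffeological_space (ar_space G) \<and>
     smooth_groupoid (ob_space G) (ar_space G) G"

record ('o, 'a) lie_groupoid = "('o, 'a) small_groupoid" +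
  ob_mfd :: "'o manifold"
  ar_mfd :: "'a manifold"

abbreviation objs :: "('o, 'a) lie_groupoid \<Rightarrow> 'o set" where
  "objs G \<equiv> mpoints (ob_mfd G)"

abbreviation arrs :: "('o, 'a) lie_groupoid \<Rightarrow> 'a set" where
  "arrs G \<equiv> mpoints (ar_mfd G)"

definition is_lie_groupoid :: "('o, 'a) lie_groupoid \<Rightarrow> bool" where
  "is_lie_groupoid G \<longleftrightarrow>
     smooth_manifold (ob_mfd G) \<and> smooth_manifold (ar_mfd G) \<and>
     smooth_groupoid (mdiff (ob_mfd G)) (mdiff (ar_mfd G)) G \<and>
     submersion (ar_mfd G) (ob_mfd G) (src G) \<and> submersion (ar_mfd G) (ob_mfd G) (tgt G)"

definition discrete_groupoid :: "'a diffeology \<Rightarrow> ('a, 'a) diff_groupoid" where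
  "discrete_groupoid D =
     \<lparr>src = (\<lambda>x. x), tgt = (\<lambda>x. x), unt = (\<lambda>x. x), cmp = (\<lambda>y x. x), ginv = (\<lambda>x. x),
      ob_space = D, ar_space = D\<rparr>"

definition smooth_functor ::
  "('o, 'a) diff_groupoid \<Rightarrow> ('p, 'b) diff_groupoid \<Rightarrow> ('o \<Rightarrow> 'p) \<Rightarrow> ('a \<Rightarrow> 'b) \<Rightarrow> bool" where
  "smooth_functor G K F0 F1 \<longleftrightarrow>
     dsmooth (ob_space G) (ob_space K) F0 \<and> dsmooth (ar_space G) (ar_space K) F1 \<and>
     (\<forall>f\<in>points (ar_space G). src K (F1 f) = F0 (src G f) \<and> tgt K (F1 f) = F0 (tgt G f)) \<and>
     (\<forall>x\<in>points (ob_space G). F1 (unt G x) = unt K (F0 x)) \<and>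
     (\<forall>k\<in>points (ar_space G). \<forall>f\<in>points (ar_space G). src G k = tgt G f \<longrightarrow>
        F1 (cmp G k f) = cmp K (F1 k) (F1 f))"

definition conn_class ::
  "'o set \<Rightarrow> 'a set \<Rightarrow> ('o, 'a, 'z) small_groupoid_scheme \<Rightarrow> 'o \<Rightarrow> 'o set" where
  "conn_class Ob Ar G x = {y \<in> Ob. \<exists>f\<in>Ar. src G f = x \<and> tgt G f = y}"

definition conn_components ::
  "'o set \<Rightarrow> 'a set \<Rightarrow> ('o, 'a, 'z) small_groupoid_scheme \<Rightarrow> 'o set set" where
  "conn_components Ob Ar G = conn_class Ob Ar G ` Ob"

record ('p, 'm, 'o, 'a) principal_bundle_data =
  total :: "'p manifold"
  base :: "'m manifold"
  proj :: "'p \<Rightarrow> 'm"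
  anchor :: "'p \<Rightarrow> 'o"
  act :: "'p \<Rightarrow> 'a \<Rightarrow> 'p"

definition principal_bundle ::
  "('o, 'a) lie_groupoid \<Rightarrow> ('p, 'm, 'o, 'a) principal_bundle_data \<Rightarrow> bool" where
  "principal_bundle G B \<longleftrightarrow>
     smooth_manifold (total B) \<and> smooth_manifold (base B) \<and>
     submersion (total B) (base B) (proj B) \<and> proj B ` mpoints (total B) = mpoints (base B) \<and>
     dsmooth (mdiff (total B)) (mdiff (ob_mfd G)) (anchor B) \<and>
     dsmooth (fibre_product (mdiff (total B)) (mdiff (ar_mfd G)) (anchor B) (tgt G))
       (mdiff (total B)) (\<lambda>(p, g). act B p g) \<and>
     (\<forall>p\<in>mpoints (total B). \<forall>g\<in>arrs G. anchor B p = tgt G g \<longrightarrow>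
        anchor B (act B p g) = src G g \<and> proj B (act B p g) = proj B p \<and>
        (\<forall>h\<in>arrs G. src G g = tgt G h \<longrightarrow> act B (act B p g) h = act B p (cmp G g h))) \<and>
     (\<forall>p\<in>mpoints (total B). act B p (unt G (anchor B p)) = p) \<and>
     diffeomorphism
       (fibre_product (mdiff (total B)) (mdiff (ar_mfd G)) (anchor B) (tgt G))
       (fibre_product (mdiff (total B)) (mdiff (total B)) (proj B) (proj B))
       (\<lambda>(p, g). (p, act B p g))"

context
  fixes G :: "('o, 'a) lie_groupoid"
begin

abbreviation dsrc :: "'a \<Rightarrow> 'a tvec \<Rightarrow> 'o tvec" where
  "dsrc \<equiv> differential (ar_mfd G) (ob_mfd G) (src G)"

abbreviation dtgt :: "'a \<Rightarrow> 'a tvec \<Rightarrow> 'o tvec" where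
  "dtgt \<equiv> differential (ar_mfd G) (ob_mfd G) (tgt G)"

definition ker_dsrc :: "'a \<Rightarrow> 'a tvec set" where
  "ker_dsrc g = {v \<in> tangent_space (ar_mfd G) g. dsrc g v = 0}"

definition alg_fibre :: "'o \<Rightarrow> 'a tvec set" where
  "alg_fibre x = ker_dsrc (unt G x)"

text \<open>The total space of the algebroid is a vector subbundle of the pullback of the tangent
  bundle along the units, hence carries the diffeology induced by the latter.\<close>

definition lie_algebroid :: "('o \<times> 'a tvec) diffeology" where
  "lie_algebroid =
     \<lparr>points = {(x, \<alpha>). x \<in> objs G \<and> \<alpha> \<in> alg_fibre x},
      plot = (\<lambda>n U q. plot (mdiff (ob_mfd G)) n U (fst \<circ> q) \<and>
        (\<forall>u\<in>U. snd (q u) \<in> alg_fibre (fst (q u))) \<and>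
        plot (tangent_bundle (ar_mfd G)) n U (\<lambda>u. (unt G (fst (q u)), snd (q u))))\<rparr>"

definition src_fibre :: "'o \<Rightarrow> 'a set" where
  "src_fibre x = {h \<in> arrs G. src G h = x}"

definition rtrans :: "'a \<Rightarrow> 'a tvec \<Rightarrow> 'a tvec" where
  "rtrans g = differential_on (ar_mfd G) (src_fibre (tgt G g)) (ar_mfd G)
     (\<lambda>h. cmp G h g) (unt G (tgt G g))"

definition ltrans :: "'a \<Rightarrow> 'a tvec \<Rightarrow> 'a tvec" where
  "ltrans g = differential_on (ar_mfd G) (src_fibre (src G g)) (ar_mfd G)
     (\<lambda>h. cmp G g (ginv G h)) (unt G (src G g))"

definition ehresmann_connection :: "('a \<Rightarrow> 'a tvec set) \<Rightarrow> bool" where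
  "ehresmann_connection H \<longleftrightarrow>
     smooth_subbundle (ar_mfd G) H \<and>
     (\<forall>g\<in>arrs G. tangent_space (ar_mfd G) g = {v + w |v w. v \<in> H g \<and> w \<in> ker_dsrc g} \<and>
                 H g \<inter> ker_dsrc g = {0}) \<and>
     (\<forall>x\<in>objs G. H (unt G x) =
        differential (ob_mfd G) (ar_mfd G) (unt G) x ` tangent_space (ob_mfd G) x)"

context
  fixes H :: "'a \<Rightarrow> 'a tvec set"
begin

text \<open>\<open>hlift\<close>, \<open>vproj\<close>, \<open>rtrans\<close> and \<open>ltrans\<close> are the maps usually written \<open>\<sigma>\<close>, \<open>\<psi>\<close>, \<open>r\<close> and
  \<open>l\<close>.\<close>

definition hlift :: "'a \<Rightarrow> 'o tvec \<Rightarrow> 'a tvec" where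
  "hlift g = inv_into (H g) (dsrc g)"

definition vproj :: "'a \<Rightarrow> 'a tvec \<Rightarrow> 'a tvec" where
  "vproj g y = (THE \<alpha>. \<alpha> \<in> alg_fibre (tgt G g) \<and> rtrans g \<alpha> + hlift g (dsrc g y) = y)"

definition lam0 :: "'a \<Rightarrow> 'a tvec \<Rightarrow> 'a tvec" where
  "lam0 g \<alpha> = - vproj g (ltrans g \<alpha>)"

definition lam1 :: "'a \<Rightarrow> 'o tvec \<Rightarrow> 'o tvec" where
  "lam1 g v = dtgt g (hlift g v)"

context
  fixes B :: "('p, 'm, 'o, 'a) principal_bundle_data"
begin

text \<open>The pullbacks of the vector bundles along the anchor are embedded in their products with
  the total space of \<open>B\<close>, which gives the plots.\<close>

definition ad_total :: "('p \<times> 'a tvec \<times> 'o tvec) diffeology" where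
  "ad_total =
     \<lparr>points = {(p, \<alpha>, v). p \<in> mpoints (total B) \<and> \<alpha> \<in> alg_fibre (anchor B p) \<and>
                  v \<in> tangent_space (ob_mfd G) (anchor B p)},
      plot = (\<lambda>n U q. plot (mdiff (total B)) n U (\<lambda>u. fst (q u)) \<and>
        plot lie_algebroid n U (\<lambda>u. (anchor B (fst (q u)), fst (snd (q u)))) \<and>
        plot (tangent_bundle (ob_mfd G)) n U (\<lambda>u. (anchor B (fst (q u)), snd (snd (q u)))))\<rparr>"

definition ad_rel :: "(('p \<times> 'a tvec \<times> 'o tvec) \<times> ('p \<times> 'a tvec \<times> 'o tvec)) set" where
  "ad_rel = {((p, \<alpha>, v), (p', \<alpha>', v')).
     (p, \<alpha>, v) \<in> points ad_total \<and> (p', \<alpha>', v') \<in> points ad_total \<and> p = p' \<and>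
     (\<exists>(n :: nat) ps gs hs \<alpha>s vs.
        (\<forall>i\<in>{1..n}. ps i \<in> mpoints (total B) \<and> gs i \<in> arrs G \<and> hs i \<in> arrs G \<and>
           anchor B (ps i) = tgt G (gs i) \<and> src G (gs i) = tgt G (hs i) \<and>
           \<alpha>s i \<in> alg_fibre (anchor B (ps i)) \<and>
           vs i \<in> tangent_space (ob_mfd G) (anchor B (ps i)) \<and>
           p = act B (act B (ps i) (gs i)) (hs i)) \<and>
        \<alpha> - \<alpha>' = (\<Sum>i = 1..n. lam0 (cmp G (ginv G (hs i)) (ginv G (gs i))) (\<alpha>s i)
                             - lam0 (ginv G (hs i)) (lam0 (ginv G (gs i)) (\<alpha>s i))) \<and>
        v - v' = (\<Sum>i = 1..n. lam1 (cmp G (ginv G (hs i)) (ginv G (gs i))) (vs i)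
                             - lam1 (ginv G (hs i)) (lam1 (ginv G (gs i)) (vs i))))}"

definition ad_class :: "'p \<times> 'a tvec \<times> 'o tvec \<Rightarrow> ('p \<times> 'a tvec \<times> 'o tvec) set" where
  "ad_class e = ad_rel `` {e}"

definition ad_objects :: "('p \<times> 'a tvec \<times> 'o tvec) set diffeology" where
  "ad_objects = quotient_diffeology ad_total ad_rel"

definition ad_foot :: "('p \<times> 'a tvec \<times> 'o tvec) set \<Rightarrow> 'p" where
  "ad_foot c = (THE p. \<exists>\<alpha> v. (p, \<alpha>, v) \<in> points ad_total \<and> c = ad_class (p, \<alpha>, v))"

text \<open>The target of the arrow \<open>(c, g)\<close>. The description is meaningful because the class on the
  right does not depend on the representative of \<open>c\<close>.\<close>

definition ad_move ::
  "('p \<times> 'a tvec \<times> 'o tvec) set \<Rightarrow> 'a \<Rightarrow> ('p \<times> 'a tvec \<times> 'o tvec) set" where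
  "ad_move c g = (THE d. \<exists>p \<alpha> v. (p, \<alpha>, v) \<in> points ad_total \<and> c = ad_class (p, \<alpha>, v) \<and>
     d = ad_class (act B p g, lam0 (ginv G g) \<alpha>, lam1 (ginv G g) v))"

definition ad_arrows :: "(('p \<times> 'a tvec \<times> 'o tvec) set \<times> 'a) diffeology" where
  "ad_arrows =
     fibre_product ad_objects (mdiff (ar_mfd G)) (\<lambda>c. anchor B (ad_foot c)) (tgt G)"

definition adjoint_groupoid ::
  "(('p \<times> 'a tvec \<times> 'o tvec) set, ('p \<times> 'a tvec \<times> 'o tvec) set \<times> 'a) diff_groupoid" where
  "adjoint_groupoid =
     \<lparr>src = (\<lambda>(c, g). c),
      tgt = (\<lambda>(c, g). ad_move c g),
      unt = (\<lambda>c. (c, unt G (anchor B (ad_foot c)))),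
      cmp = (\<lambda>(d, h) (c, g). (c, cmp G g h)),
      ginv = (\<lambda>(c, g). (ad_move c g, ginv G g)),
      ob_space = ad_objects,
      ar_space = ad_arrows\<rparr>"

definition ad_proj0 :: "('p \<times> 'a tvec \<times> 'o tvec) set \<Rightarrow> 'm" where
  "ad_proj0 c = proj B (ad_foot c)"

definition ad_proj1 :: "('p \<times> 'a tvec \<times> 'o tvec) set \<times> 'a \<Rightarrow> 'm" where
  "ad_proj1 = (\<lambda>(c, g). proj B (ad_foot c))"

definition fibre_objects :: "'m \<Rightarrow> ('p \<times> 'a tvec \<times> 'o tvec) set set" where
  "fibre_objects m = {c \<in> points ad_objects. ad_proj0 c = m}"

definition fibre_arrows :: "'m \<Rightarrow> (('p \<times> 'a tvec \<times> 'o tvec) set \<times> 'a) set" where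
  "fibre_arrows m = {f \<in> points ad_arrows. ad_proj1 f = m}"

definition ad_conn :: "'m \<Rightarrow> ('p \<times> 'a tvec \<times> 'o tvec) set set set" where
  "ad_conn m = conn_components (fibre_objects m) (fibre_arrows m) adjoint_groupoid"

definition ad_component ::
  "'p \<times> 'a tvec \<times> 'o tvec \<Rightarrow> ('p \<times> 'a tvec \<times> 'o tvec) set set" where
  "ad_component e =
     conn_class (fibre_objects (proj B (fst e))) (fibre_arrows (proj B (fst e)))
       adjoint_groupoid (ad_class e)"

end

end

end

definition real_field :: "real ring" where
  "real_field = \<lparr>carrier = UNIV, mult = (*), one = 1, zero = 0, add = (+)\<rparr>"

definition graded_vector_space ::
  "(real, 'v) module \<Rightarrow> 'i set \<Rightarrow> ('i \<Rightarrow> 'v set) \<Rightarrow> bool" where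
  "graded_vector_space V I W \<longleftrightarrow>
     finite I \<and> Module.module real_field V \<and> (\<forall>i\<in>I. submodule (W i) real_field V) \<and>
     (\<forall>x\<in>carrier V. \<exists>!w. w \<in> Pi\<^sub>E I W \<and> x = finsum V w I)"

end

theory Submission
  imports Defs
begin

text \<open>
Write \<open>E x = A x \<oplus> T x\<close> for the fibre of the coefficient bundle at an object \<open>x\<close> (\<open>fibre\<close> below)
and \<open>\<lambda> g : E (s g) \<rightarrow> E (t g)\<close> for the pair of transports of the connection (\<open>lam\<close>). The
transports are linear, depend smoothly on \<open>g\<close> and are the identity at units, but they are not
multiplicative. The defects \<open>\<lambda> (h\<^sup>-\<^sup>1 g\<^sup>-\<^sup>1) e - \<lambda> (h\<^sup>-\<^sup>1) (\<lambda> (g\<^sup>-\<^sup>1) e)\<close>, for all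
factorisations \<open>p = q g h\<close>, span a subspace of the fibre over \<open>p\<close>, and the equivalence relation
is congruence modulo this subspace. Two purely algebraic facts make the quotient a groupoid. The
defect satisfies a cocycle identity, by which \<open>\<lambda> (k\<^sup>-\<^sup>1)\<close> maps the subspace at \<open>p\<close> into the
subspace at \<open>p k\<close> (\<open>defect_span_move\<close>); so targets of arrows do not depend on representatives.
And \<open>\<lambda> (h\<^sup>-\<^sup>1) (\<lambda> (g\<^sup>-\<^sup>1) e)\<close> differs from \<open>\<lambda> ((g h)\<^sup>-\<^sup>1) e\<close> by a defect, so moving along \<open>g\<close>
and then along \<open>h\<close> is moving along \<open>g h\<close>.

On a principal bundle the action is free and transitive on the fibres of the projection. Hence a
component of the groupoid over \<open>m\<close> contains exactly one class with foot \<open>p\<close>, for every \<open>p\<close> over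
\<open>m\<close>, and the set of components is the quotient of \<open>E (a p)\<close> by the defects (\<open>component_eq_iff\<close>).
The linear structure does not depend on \<open>p\<close> since transports are linear. Setting one component
of \<open>e\<close> to zero does the same to its defect, so the subspace of defects is a direct sum of its
two homogeneous parts (\<open>defect_span_split\<close>) and the quotient is graded.

It remains to show that everything is smooth, which comes down to the transports mapping plots
to plots (\<open>lam0_plot\<close>, \<open>lam1_plot\<close>). There are two obstacles. First, a horizontal lift is only
characterised by being in the connection and having the right image. Relative to a frame its
coefficients solve a linear system with smooth entries and independent columns, and Gauss
elimination shows that they are smooth (\<open>smooth_coefficients\<close>, \<open>hlift_plot\<close>). Second,
translations are only defined on source fibres, and their differentials are defined through
curves in a fibre. A submersion \<open>F\<close> has, near every point, a smooth retraction \<open>\<rho> z y\<close> onto the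
fibre over \<open>y\<close> with \<open>\<rho> z (F z) = z\<close>; this follows from the implicit function theorem. Composing
with \<open>\<rho>\<close> extends a map on a fibre to a neighbourhood, which makes its differential well defined
and linear (\<open>differential_on_fibre\<close>). It also bends a smooth family of curves with vertical
velocities into the fibres without changing the velocities (\<open>vertical_plot_family\<close>), so that the
differentials depend smoothly on parameters (\<open>fibre_differential_plot\<close>).
\<close>

section \<open>Functions of class \<open>C\<^sup>k\<close> on Cartesian spaces\<close>

text \<open>
Boxes rather than balls: membership is a condition on each coordinate separately, as are the
moves along coordinate lines by which differentiability is defined.
\<close>

definition cube :: "nat \<Rightarrow> (nat \<Rightarrow> real) \<Rightarrow> real \<Rightarrow> (nat \<Rightarrow> real) set" where
  "cube n x d = {y \<in> topspace (Euclidean_space n). \<forall>i<n. \<bar>y i - x i\<bar> < d}"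

lemma Euclidean_space_top_of_set:
  "Euclidean_space n = top_of_set {x. \<forall>i\<ge>n. x i = 0}"
  by (simp add: Euclidean_space_def euclidean_product_topology)

lemma openin_cube: "openin (Euclidean_space n) (cube n x d)"
proof -
  have "cube n x d = {x. \<forall>i\<ge>n. x i = 0} \<inter> (\<Inter>i\<in>{..<n}. {y. \<bar>y i - x i\<bar> < d})"
    by (auto simp: cube_def topspace_Euclidean_space)
  moreover have "open (\<Inter>i\<in>{..<n}. {y. \<bar>y i - x i\<bar> < d})"
    by (intro open_INT finite_lessThan ballI open_Collect_less continuous_intros) auto
  ultimately show ?thesis
    unfolding Euclidean_space_top_of_set by (simp add: openin_open_Int)
qed

lemma cube_self: "x \<in> topspace (Euclidean_space n) \<Longrightarrow> d > 0 \<Longrightarrow> x \<in> cube n x d"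
  by (simp add: cube_def)

lemma cube_mono: "d \<le> e \<Longrightarrow> cube n x d \<subseteq> cube n x e"
  by (force simp: cube_def)

lemma openin_Euclidean_iff:
  "openin (Euclidean_space n) U \<longleftrightarrow>
     U \<subseteq> topspace (Euclidean_space n) \<and> (\<forall>x\<in>U. \<exists>d>0. cube n x d \<subseteq> U)" (is "?L \<longleftrightarrow> ?R")
proof
  assume L: ?L
  show ?R
  proof (intro conjI ballI)
    show "U \<subseteq> topspace (Euclidean_space n)" by (rule openin_subset [OF L])
    fix x assume x: "x \<in> U"
    obtain T where T: "openin (powertop_real UNIV) T" "U = T \<inter> {x. \<forall>i\<ge>n. x i = 0}"
      using L by (auto simp: Euclidean_space_def openin_subtopology)
    then obtain B where B: "\<And>i. open (B i)" "x \<in> Pi\<^sub>E UNIV B" "Pi\<^sub>E UNIV B \<subseteq> T"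
        "finite {i. B i \<noteq> UNIV}"
      using x by (force simp: openin_product_topology_alt)
    have "\<exists>d>0. \<forall>i<k. \<forall>t. \<bar>t - x i\<bar> < d \<longrightarrow> t \<in> B i" for k
    proof (induction k)
      case (Suc k)
      then obtain d where d: "d > 0" "\<forall>i<k. \<forall>t. \<bar>t - x i\<bar> < d \<longrightarrow> t \<in> B i" by blast
      have "x k \<in> B k" using B(2) by auto
      then obtain e where e: "e > 0" "\<forall>t. \<bar>t - x k\<bar> < e \<longrightarrow> t \<in> B k"
        using B(1)[of k] by (auto simp: open_dist dist_real_def)
      show ?case
        by (rule exI[of _ "min d e"]) (use d e in \<open>auto simp: less_Suc_eq\<close>)
    qed (auto intro: exI[of _ 1])
    moreover define N where "N = Suc (Max (insert n {i. B i \<noteq> UNIV}))"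
    ultimately obtain d where d: "d > 0" "\<forall>i<N. \<forall>t. \<bar>t - x i\<bar> < d \<longrightarrow> t \<in> B i" by blast
    have "cube n x d \<subseteq> U"
    proof
      fix y assume y: "y \<in> cube n x d"
      have "y i \<in> B i" for i
      proof (cases "B i = UNIV")
        case False
        then have "i < N" unfolding N_def using B(4) by (simp add: less_Suc_eq_le)
        moreover have "\<bar>y i - x i\<bar> < d"
        proof (cases "i < n")
          case False
          then have "y i = 0" "x i = 0" using x y T by (auto simp: cube_def topspace_Euclidean_space)
          then show ?thesis using d by simp
        qed (use y in \<open>auto simp: cube_def\<close>)
        ultimately show ?thesis using d by blast
      qed auto
      then have "y \<in> T" using B(3) by auto
      then show "y \<in> U" using T y by (auto simp: cube_def topspace_Euclidean_space)
    qed
    then show "\<exists>d>0. cube n x d \<subseteq> U" using d(1) by blast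
  qed
next
  assume R: ?R
  show ?L
  proof (subst openin_subopen, intro ballI)
    fix x assume x: "x \<in> U"
    then obtain d where "d > 0" "cube n x d \<subseteq> U" using R by blast
    moreover have "x \<in> cube n x d" using x R \<open>d > 0\<close> by (blast intro: cube_self)
    ultimately show "\<exists>T. openin (Euclidean_space n) T \<and> x \<in> T \<and> T \<subseteq> U"
      using openin_cube by blast
  qed
qed

lemma continuous_map_Euclidean_iff:
  assumes "openin (Euclidean_space n) U"
  shows "continuous_map (subtopology (Euclidean_space n) U) euclideanreal f \<longleftrightarrow>
     (\<forall>x\<in>U. \<forall>e>0. \<exists>d>0. \<forall>y\<in>cube n x d. \<bar>f y - f x\<bar> < e)" (is "?L \<longleftrightarrow> ?R")
proof -
  have U: "U \<subseteq> topspace (Euclidean_space n)" using assms openin_subset by blast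
  have top: "topspace (subtopology (Euclidean_space n) U) = U" using U by auto
  have "?L \<longleftrightarrow> (\<forall>x\<in>U. \<forall>e>0. \<exists>W. openin (Euclidean_space n) W \<and> W \<subseteq> U \<and> x \<in> W \<and>
              (\<forall>y\<in>W. \<bar>f y - f x\<bar> < e))" (is "_ \<longleftrightarrow> ?M")
    unfolding Met_TC.continuous_map_to_metric[unfolded mtopology_is_euclidean mball_eq_ball]
      top openin_open_subtopology[OF assms]
    by (simp add: dist_real_def abs_minus_commute conj_assoc)
  also have "?M \<longleftrightarrow> ?R"
  proof
    assume M: ?M
    show ?R
    proof (intro ballI allI impI)
      fix x e assume "x \<in> U" "(e::real) > 0"
      then obtain W where W: "openin (Euclidean_space n) W" "x \<in> W" "\<forall>y\<in>W. \<bar>f y - f x\<bar> < e"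
        using M by blast
      then obtain d where "d > 0" "cube n x d \<subseteq> W" by (auto simp: openin_Euclidean_iff)
      then show "\<exists>d>0. \<forall>y\<in>cube n x d. \<bar>f y - f x\<bar> < e" using W(3) by (intro exI[of _ d]) auto
    qed
  next
    assume R: ?R
    show ?M
    proof (intro ballI allI impI)
      fix x e assume x: "x \<in> U" "(e::real) > 0"
      then obtain d where d: "d > 0" "\<forall>y\<in>cube n x d. \<bar>f y - f x\<bar> < e" using R by blast
      have "x \<in> cube n x d" using x U d by (auto intro: cube_self)
      then show "\<exists>W. openin (Euclidean_space n) W \<and> W \<subseteq> U \<and> x \<in> W \<and> (\<forall>y\<in>W. \<bar>f y - f x\<bar> < e)"
        using d x by (intro exI[of _ "cube n x d \<inter> U"]) (simp add: openin_cube assms openin_Int)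
    qed
  qed
  finally show ?thesis .
qed

lemma continuous_map_into_Euclidean_iff:
  "continuous_map X (Euclidean_space m) f \<longleftrightarrow>
     f ` topspace X \<subseteq> topspace (Euclidean_space m) \<and>
     (\<forall>j<m. continuous_map X euclideanreal (\<lambda>x. f x j))" (is "?L \<longleftrightarrow> ?R")
proof
  assume ?L
  then have "continuous_map X (powertop_real UNIV) f" "f ` topspace X \<subseteq> topspace (Euclidean_space m)"
    by (auto simp: Euclidean_space_def continuous_map_in_subtopology)
  then show ?R by (auto simp: continuous_map_componentwise_UNIV)
next
  assume R: ?R
  have "continuous_map X euclideanreal (\<lambda>x. f x j)" for j
  proof (cases "j < m")
    case False
    then have "\<And>x. x \<in> topspace X \<Longrightarrow> f x j = 0"
      using R by (auto simp: topspace_Euclidean_space)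
    then show ?thesis by (intro continuous_map_eq[OF continuous_map_const[THEN iffD2], of _ 0]) auto
  qed (use R in auto)
  then show ?L using R
    by (auto simp: Euclidean_space_def continuous_map_in_subtopology continuous_map_componentwise_UNIV)
qed

definition pderiv_at :: "nat \<Rightarrow> ((nat \<Rightarrow> real) \<Rightarrow> real) \<Rightarrow> (nat \<Rightarrow> real) \<Rightarrow> real" where
  "pderiv_at i f x = deriv (\<lambda>t. f (x(i := t))) (x i)"

lemma upd_in_cube:
  assumes "x \<in> topspace (Euclidean_space n)" "i < n" "\<bar>t - x i\<bar> < d"
  shows "x(i := t) \<in> cube n x d"
  using assms by (auto simp: cube_def topspace_Euclidean_space)

lemma eventually_upd_in:
  assumes "openin (Euclidean_space n) U" "x \<in> U" "i < n"
  shows "eventually (\<lambda>t. x(i := t) \<in> U) (nhds (x i))"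
proof -
  obtain d where "d > 0" "cube n x d \<subseteq> U" "x \<in> topspace (Euclidean_space n)"
    using assms openin_Euclidean_iff by blast
  then show ?thesis
    unfolding eventually_nhds_metric dist_real_def using upd_in_cube assms(3) by blast
qed

lemma Ck_on_cong:
  assumes U: "openin (Euclidean_space n) U" and "\<And>x. x \<in> U \<Longrightarrow> f x = g x"
  shows "Ck_on n k U f \<longleftrightarrow> Ck_on n k U g"
proof -
  have *: "Ck_on n k U g" if "Ck_on n k U f" "\<And>x. x \<in> U \<Longrightarrow> f x = g x" for k f g
  proof -
    have c: "continuous_map (subtopology (Euclidean_space n) U) euclideanreal f \<Longrightarrow>
        continuous_map (subtopology (Euclidean_space n) U) euclideanreal g"
      by (erule continuous_map_eq) (use that in auto)
    show ?thesis
    proof (cases k)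
      case (Suc l)
      have "((\<lambda>t. g (x(i := t))) has_real_derivative f') (at (x i))"
        if "i < n" "x \<in> U" "((\<lambda>t. f (x(i := t))) has_real_derivative f') (at (x i))" for i x f'
      proof (rule DERIV_cong_ev[THEN iffD1, OF refl _ refl that(3)])
        show "\<forall>\<^sub>F t in nhds (x i). f (x(i := t)) = g (x(i := t))"
          using eventually_upd_in[OF U that(2,1)] \<open>\<And>x. x \<in> U \<Longrightarrow> f x = g x\<close>
          by (auto elim: eventually_mono)
      qed
      then show ?thesis using \<open>Ck_on n k U f\<close> c Suc by simp blast
    qed (use that c in simp)
  qed
  show ?thesis using *[of k f g] *[of k g f] assms(2) by metis
qed

text \<open>
Derivatives are unique, so the existentially quantified partial derivatives may be replaced by a
canonical choice. Working with a function \<open>pderiv_at i f\<close> avoids carrying witnesses.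
\<close>

lemma Ck_on_Suc_iff:
  assumes U: "openin (Euclidean_space n) U"
  shows "Ck_on n (Suc k) U f \<longleftrightarrow>
     continuous_map (subtopology (Euclidean_space n) U) euclideanreal f \<and>
     (\<forall>i<n. (\<forall>x\<in>U. ((\<lambda>t. f (x(i := t))) has_real_derivative pderiv_at i f x) (at (x i))) \<and>
            Ck_on n k U (pderiv_at i f))" (is "?L \<longleftrightarrow> ?R")
proof
  assume L: ?L
  have "(\<forall>x\<in>U. ((\<lambda>t. f (x(i := t))) has_real_derivative pderiv_at i f x) (at (x i))) \<and>
            Ck_on n k U (pderiv_at i f)" if "i < n" for i
  proof -
    obtain f' where f': "\<forall>x\<in>U. ((\<lambda>t. f (x(i := t))) has_real_derivative f' x) (at (x i))"
      "Ck_on n k U f'" using L \<open>i < n\<close> by auto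
    then have "f' x = pderiv_at i f x" if "x \<in> U" for x
      using that by (auto simp: pderiv_at_def intro!: DERIV_imp_deriv[symmetric])
    then show ?thesis using f' Ck_on_cong[OF U, of f' "pderiv_at i f"] by auto
  qed
  then show ?R using L by auto
qed auto

declare Ck_on.simps(2) [simp del]

lemma Ck_on_continuous:
  "Ck_on n k U f \<Longrightarrow> continuous_map (subtopology (Euclidean_space n) U) euclideanreal f"
  by (cases k) (auto simp: Ck_on.simps)

lemma Ck_on_mono:
  assumes U: "openin (Euclidean_space n) U" and "openin (Euclidean_space n) V" "V \<subseteq> U"
  shows "Ck_on n k U f \<Longrightarrow> Ck_on n k V f"
proof (induction k arbitrary: f)
  case (Suc k)
  then show ?case using assms
    by (auto simp: Ck_on_Suc_iff intro: continuous_map_from_subtopology_mono)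
qed (use assms in \<open>auto intro: continuous_map_from_subtopology_mono\<close>)

lemma Ck_on_lower: 
  assumes U: "openin (Euclidean_space n) U"
  shows "Ck_on n (Suc k) U f \<Longrightarrow> Ck_on n k U f"
proof (induction k arbitrary: f)
  case 0 then show ?case by (simp add: Ck_on_Suc_iff[OF U])
next
  case (Suc k)
  then show ?case by (subst Ck_on_Suc_iff[OF U]) (auto simp: Ck_on_Suc_iff[OF U, of "Suc k"])
qed

lemma Ck_on_local:
  assumes U: "openin (Euclidean_space n) U"
    and "\<And>x. x \<in> U \<Longrightarrow> \<exists>W. openin (Euclidean_space n) W \<and> x \<in> W \<and> W \<subseteq> U \<and> Ck_on n k W f"
  shows "Ck_on n k U f"
  using assms(2)
proof (induction k arbitrary: f)
  case 0
  show ?case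
    unfolding Ck_on.simps continuous_map_Euclidean_iff[OF U]
  proof (intro ballI allI impI)
    fix x e assume "x \<in> U" "(e::real) > 0"
    then obtain W where W: "openin (Euclidean_space n) W" "x \<in> W" "Ck_on n 0 W f" using 0 by blast
    then show "\<exists>d>0. \<forall>y\<in>cube n x d. \<bar>f y - f x\<bar> < e" 
      using \<open>e > 0\<close> by (simp add: continuous_map_Euclidean_iff[OF W(1)])
  qed
next
  case (Suc k)
  have 0: "Ck_on n 0 U f"
    unfolding Ck_on.simps continuous_map_Euclidean_iff[OF U]
  proof (intro ballI allI impI)
    fix x e assume "x \<in> U" "(e::real) > 0"
    obtain W where W: "openin (Euclidean_space n) W" "x \<in> W" "Ck_on n (Suc k) W f"
      using Suc.prems[OF \<open>x \<in> U\<close>] by blast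
    show "\<exists>d>0. \<forall>y\<in>cube n x d. \<bar>f y - f x\<bar> < e" 
      using Ck_on_continuous[OF W(3)] W(2) \<open>e > 0\<close>
      unfolding continuous_map_Euclidean_iff[OF W(1)] by simp
  qed
  show ?case
    unfolding Ck_on_Suc_iff[OF U]
  proof (intro conjI allI impI ballI)
    fix i assume i: "i < n"
    have *: "\<exists>W. openin (Euclidean_space n) W \<and> x \<in> W \<and> W \<subseteq> U \<and> Ck_on n k W (pderiv_at i f) \<and>
        ((\<lambda>t. f (x(i := t))) has_real_derivative pderiv_at i f x) (at (x i))" if x: "x \<in> U" for x
    proof -
      obtain W where W: "openin (Euclidean_space n) W" "x \<in> W" "W \<subseteq> U" "Ck_on n (Suc k) W f"
        using Suc.prems[OF x] by blast
      then show ?thesis using i by (intro exI[of _ W]) (simp add: Ck_on_Suc_iff[OF W(1)])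
    qed
    show "Ck_on n k U (pderiv_at i f)"
      by (rule Suc.IH) (meson *)
    fix x assume "x \<in> U"
    then show "((\<lambda>t. f (x(i := t))) has_real_derivative pderiv_at i f x) (at (x i))"
      using *[of x] by blast
  qed (use 0 in simp)
qed

lemma Ck_on_const:
  assumes U: "openin (Euclidean_space n) U"
  shows "Ck_on n k U (\<lambda>x. c)"
proof (induction k arbitrary: c)
  case (Suc k)
  have "pderiv_at i (\<lambda>x. c) = (\<lambda>x. 0)" for i by (auto simp: pderiv_at_def)
  with Suc show ?case by (simp add: Ck_on_Suc_iff[OF U])
qed auto

lemma Ck_on_SucI:
  assumes U: "openin (Euclidean_space n) U" 
   and "continuous_map (subtopology (Euclidean_space n) U) euclideanreal f"
   and "\<And>i x. i < n \<Longrightarrow> x \<in> U \<Longrightarrow> ((\<lambda>t. f (x(i := t))) has_real_derivative f' i x) (at (x i))"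
   and "\<And>i. i < n \<Longrightarrow> Ck_on n k U (f' i)"
  shows "Ck_on n (Suc k) U f"
  using assms by (auto simp: Ck_on.simps)

lemma Ck_on_coord:
  assumes U: "openin (Euclidean_space n) U" and "j < n"
  shows "Ck_on n k U (\<lambda>x. x j)"
proof -
  have c: "continuous_map (subtopology (Euclidean_space n) U) euclideanreal (\<lambda>x. x j)"
    unfolding continuous_map_Euclidean_iff[OF U] using \<open>j < n\<close> by (auto simp: cube_def)
  show ?thesis
  proof (cases k)
    case (Suc l)
    show ?thesis unfolding Suc
      by (rule Ck_on_SucI[OF U c, where f' = "\<lambda>i x. if i = j then 1 else 0"])
        (auto intro: Ck_on_const[OF U] derivative_eq_intros)
  qed (use c in simp)
qed

lemma Ck_on_pderiv:
  assumes "openin (Euclidean_space n) U" "Ck_on n (Suc k) U f" "i < n"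
  shows "Ck_on n k U (pderiv_at i f)"
  using Ck_on_Suc_iff[OF assms(1), THEN iffD1, OF assms(2)] assms(3) by blast

lemma Ck_on_has_pderiv:
  assumes "openin (Euclidean_space n) U" "Ck_on n (Suc k) U f" "i < n" "x \<in> U"
  shows "((\<lambda>t. f (x(i := t))) has_real_derivative pderiv_at i f x) (at (x i))"
  using Ck_on_Suc_iff[OF assms(1), THEN iffD1, OF assms(2)] assms(3,4) by blast

lemma Ck_on_add:
  assumes U: "openin (Euclidean_space n) U"
  shows "Ck_on n k U f \<Longrightarrow> Ck_on n k U g \<Longrightarrow> Ck_on n k U (\<lambda>x. f x + g x)"
proof (induction k arbitrary: f g)
  case (Suc k)
  show ?case
  proof (rule Ck_on_SucI[OF U, where f' = "\<lambda>i x. pderiv_at i f x + pderiv_at i g x"])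
    show "continuous_map (subtopology (Euclidean_space n) U) euclideanreal (\<lambda>x. f x + g x)"
      using Suc.prems by (intro continuous_map_add Ck_on_continuous)
    fix i x assume "i < n" "x \<in> U"
    then show "((\<lambda>t. f (x(i := t)) + g (x(i := t))) has_real_derivative
        pderiv_at i f x + pderiv_at i g x) (at (x i))"
      using Suc.prems by (intro DERIV_add Ck_on_has_pderiv[OF U])
  next
    fix i assume "i < n"
    then show "Ck_on n k U (\<lambda>x. pderiv_at i f x + pderiv_at i g x)"
      using Suc.prems by (intro Suc.IH Ck_on_pderiv[OF U])
  qed
qed (auto intro: continuous_map_add)

lemma Ck_on_mult:
  assumes U: "openin (Euclidean_space n) U"
  shows "Ck_on n k U f \<Longrightarrow> Ck_on n k U g \<Longrightarrow> Ck_on n k U (\<lambda>x. f x * g x)"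
proof (induction k arbitrary: f g)
  case (Suc k)
  have l: "Ck_on n k U f" "Ck_on n k U g" using Suc.prems Ck_on_lower[OF U] by auto
  show ?case
  proof (rule Ck_on_SucI[OF U, where f' = "\<lambda>i x. pderiv_at i f x * g x + pderiv_at i g x * f x"])
    show "continuous_map (subtopology (Euclidean_space n) U) euclideanreal (\<lambda>x. f x * g x)"
      using Suc.prems by (intro continuous_map_real_mult Ck_on_continuous)
    fix i x assume ix: "i < n" "x \<in> U"
    show "((\<lambda>t. f (x(i := t)) * g (x(i := t))) has_real_derivative
        pderiv_at i f x * g x + pderiv_at i g x * f x) (at (x i))"
      using DERIV_mult[OF Ck_on_has_pderiv[OF U Suc.prems(1) ix] Ck_on_has_pderiv[OF U Suc.prems(2) ix]]
      by (simp only: fun_upd_triv)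
  next
    fix i assume "i < n"
    then show "Ck_on n k U (\<lambda>x. pderiv_at i f x * g x + pderiv_at i g x * f x)"
      using Suc.prems l by (intro Ck_on_add[OF U] Suc.IH Ck_on_pderiv[OF U])
  qed
qed (auto intro: continuous_map_real_mult)

lemma Ck_on_inverse:
  assumes U: "openin (Euclidean_space n) U" and nz: "\<And>x. x \<in> U \<Longrightarrow> f x \<noteq> 0"
  shows "Ck_on n k U f \<Longrightarrow> Ck_on n k U (\<lambda>x. inverse (f x))"
proof (induction k)
  case (Suc k)
  have l: "Ck_on n k U f" using Suc.prems Ck_on_lower[OF U] by auto
  have i: "Ck_on n k U (\<lambda>x. inverse (f x))" by (rule Suc.IH[OF l])
  show ?case
  proof (rule Ck_on_SucI[OF U, where f' = "\<lambda>i x. (- 1) * (inverse (f x) * pderiv_at i f x * inverse (f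
      x))"])
    fix j x assume j: "j < n" "x \<in> U"
    show "((\<lambda>t. inverse (f (x(j := t)))) has_real_derivative 
        (- 1) * (inverse (f x) * pderiv_at j f x * inverse (f x))) (at (x j))"
      using DERIV_inverse'[OF Ck_on_has_pderiv[OF U Suc.prems j]] nz[OF j(2)]
      by (simp only: fun_upd_triv mult_minus1 not_False_eq_True simp_thms)
  next
    fix j assume "j < n"
    from Ck_on_pderiv[OF U Suc.prems this]
    show "Ck_on n k U (\<lambda>x. - 1 * (inverse (f x) * pderiv_at j f x * inverse (f x)))"
      by (rule Ck_on_mult[OF U Ck_on_const[OF U] Ck_on_mult[OF U Ck_on_mult[OF U i _] i]])
  qed (rule Ck_on_continuous[OF i])
qed (use nz in \<open>auto intro!: continuous_map_real_inverse\<close>)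

lemma Ck_on_sum:
  assumes U: "openin (Euclidean_space n) U" 
  shows "(\<And>j. j \<in> A \<Longrightarrow> Ck_on n k U (f j)) \<Longrightarrow> Ck_on n k U (\<lambda>x. \<Sum>j\<in>A. f j x)"
  by (induction A rule: infinite_finite_induct) (auto intro: Ck_on_const[OF U] Ck_on_add[OF U])

section \<open>The mean value theorem and the chain rule\<close>

text \<open>
Walk from \<open>a\<close> to \<open>b\<close> along the edges of a box, one coordinate at a time, and apply the
one-dimensional mean value theorem on each edge. The intermediate points lie on different edges,
but all of them are coordinatewise no further from \<open>a\<close> than \<open>b\<close> is.
\<close>

lemma coordinatewise_mvt:
  assumes der: "\<And>x i. i < n \<Longrightarrow> x \<in> U \<Longrightarrow>
      ((\<lambda>t. f (x(i := t))) has_real_derivative pderiv_at i f x) (at (x i))"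
    and a: "a \<in> topspace (Euclidean_space n)" and b: "b \<in> topspace (Euclidean_space n)"
    and U: "\<And>x. x \<in> topspace (Euclidean_space n) \<Longrightarrow> (\<And>i. \<bar>x i - a i\<bar> \<le> \<bar>b i - a i\<bar>) \<Longrightarrow> x \<in> U"
  obtains \<xi> where "\<And>j. j < n \<Longrightarrow> \<xi> j \<in> topspace (Euclidean_space n)"
    "\<And>j i. j < n \<Longrightarrow> \<bar>\<xi> j i - a i\<bar> \<le> \<bar>b i - a i\<bar>"
    "f b - f a = (\<Sum>j<n. pderiv_at j f (\<xi> j) * (b j - a j))"
proof -
  define z where "z j = (\<lambda>i. if i < j then b i else a i)" for j
  have zU: "(z j)(j := t) \<in> topspace (Euclidean_space n)"
    "\<bar>((z j)(j := t)) i - a i\<bar> \<le> \<bar>b i - a i\<bar>" if "j < n" "\<bar>t - a j\<bar> \<le> \<bar>b j - a j\<bar>" for j t i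
    using that a b by (auto simp: z_def topspace_Euclidean_space)
  have "\<exists>x. x \<in> topspace (Euclidean_space n) \<and> (\<forall>i. \<bar>x i - a i\<bar> \<le> \<bar>b i - a i\<bar>) \<and>
      f (z (Suc j)) - f (z j) = pderiv_at j f x * (b j - a j)" if j: "j < n" for j
  proof -
    have e: "z (Suc j) = (z j)(j := b j)" "z j = (z j)(j := a j)"
      by (auto simp: z_def less_Suc_eq)
    have d: "((\<lambda>t. f ((z j)(j := t))) has_real_derivative pderiv_at j f ((z j)(j := t))) (at t)"
      if "\<bar>t - a j\<bar> \<le> \<bar>b j - a j\<bar>" for t
      using der[of j "(z j)(j := t)"] j U[OF zU[OF j that]] by simp
    consider "a j < b j" | "a j = b j" | "b j < a j" by linarith
    then have "\<exists>t. \<bar>t - a j\<bar> \<le> \<bar>b j - a j\<bar> \<and>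
        f ((z j)(j := b j)) - f ((z j)(j := a j)) = pderiv_at j f ((z j)(j := t)) * (b j - a j)"
    proof cases
      case 1
      obtain t where "a j < t" "t < b j" "f ((z j)(j := b j)) - f ((z j)(j := a j)) =
          (b j - a j) * pderiv_at j f ((z j)(j := t))"
        using MVT2[OF 1, of "\<lambda>t. f ((z j)(j := t))"] d by force
      then show ?thesis by (intro exI[of _ t]) auto
    next
      case 3
      obtain t where "b j < t" "t < a j" "f ((z j)(j := a j)) - f ((z j)(j := b j)) =
          (a j - b j) * pderiv_at j f ((z j)(j := t))"
        using MVT2[OF 3, of "\<lambda>t. f ((z j)(j := t))"] d by force
      then show ?thesis by (intro exI[of _ t]) (auto simp: algebra_simps)
    qed (auto intro: exI[of _ "a j"])
    then obtain t where "\<bar>t - a j\<bar> \<le> \<bar>b j - a j\<bar>"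
        "f ((z j)(j := b j)) - f ((z j)(j := a j)) = pderiv_at j f ((z j)(j := t)) * (b j - a j)"
      by blast
    then show ?thesis using zU[OF j] e by (intro exI[of _ "(z j)(j := t)"]) metis
  qed
  then obtain \<xi> where \<xi>: "\<And>j. j < n \<Longrightarrow> \<xi> j \<in> topspace (Euclidean_space n) \<and>
     (\<forall>i. \<bar>\<xi> j i - a i\<bar> \<le> \<bar>b i - a i\<bar>) \<and> f (z (Suc j)) - f (z j) = pderiv_at j f (\<xi> j) * (b j - a j)"
    by metis
  have "z 0 = a" "z n = b" using a b by (auto simp: z_def topspace_Euclidean_space)
  then have "f b - f a = (\<Sum>j<n. f (z (Suc j)) - f (z j))"
    using sum_lessThan_telescope[of "\<lambda>j. f (z j)" n] by simp
  also have "\<dots> = (\<Sum>j<n. pderiv_at j f (\<xi> j) * (b j - a j))"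
    using \<xi> by (intro sum.cong) auto
  finally have "f b - f a = (\<Sum>j<n. pderiv_at j f (\<xi> j) * (b j - a j))" .
  then show ?thesis by (intro that[of \<xi>]) (use \<xi> in auto)
qed

lemma Ck_on_eps:
  assumes "openin (Euclidean_space n) U" "Ck_on n k U f" "x \<in> U" "e > 0"
  obtains d where "d > 0" "cube n x d \<subseteq> U" "\<And>y. y \<in> cube n x d \<Longrightarrow> \<bar>f y - f x\<bar> < e"
proof -
  obtain d1 where d1: "d1 > 0" "\<forall>y\<in>cube n x d1. \<bar>f y - f x\<bar> < e"
    using Ck_on_continuous[OF assms(2)] assms(3,4) continuous_map_Euclidean_iff[OF assms(1)]
      by simp blast
  obtain d2 where d2: "d2 > 0" "cube n x d2 \<subseteq> U"
    using assms(1,3) by (auto simp: openin_Euclidean_iff)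
  have "cube n x (min d1 d2) \<subseteq> cube n x d1" "cube n x (min d1 d2) \<subseteq> cube n x d2"
    by (rule cube_mono, simp)+
  then show ?thesis by (intro that[of "min d1 d2"]) (use d1 d2 in auto)
qed

lemma eventually_cube:
  assumes "\<And>i. i < n \<Longrightarrow> ((\<lambda>t. \<gamma> t i) \<longlongrightarrow> x i) F" "eventually (\<lambda>t. \<gamma> t \<in> topspace (Euclidean_space n)) F"
    "d > 0"
  shows "eventually (\<lambda>t. \<gamma> t \<in> cube n x d) F"
proof -
  have "eventually (\<lambda>t. \<forall>i\<in>{..<n}. \<bar>\<gamma> t i - x i\<bar> < d) F"
    using assms by (intro eventually_ball_finite) (auto simp: tendsto_iff dist_real_def)
  with assms(2) show ?thesis by eventually_elim (auto simp: cube_def)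
qed

text \<open>
The intermediate points of the mean value theorem are squeezed between the limit and a point
moving towards it, so continuous functions converge along them.
\<close>

lemma tendsto_squeeze_arg:
  assumes U: "openin (Euclidean_space n) U" and f: "Ck_on n k U f" and x: "x \<in> U"
    and \<gamma>: "\<And>i. i < n \<Longrightarrow> ((\<lambda>t. \<gamma> t i) \<longlongrightarrow> x i) F"
    and ev: "eventually (\<lambda>t. \<xi> t \<in> topspace (Euclidean_space n) \<and> (\<forall>i<n. \<bar>\<xi> t i - x i\<bar> \<le> \<bar>\<gamma> t i - x i\<bar>))
        F"
  shows "((\<lambda>t. f (\<xi> t)) \<longlongrightarrow> f x) F"
proof (rule tendstoI)
  fix e :: real assume "e > 0"
  then obtain d where d: "d > 0" "\<And>y. y \<in> cube n x d \<Longrightarrow> \<bar>f y - f x\<bar> < e"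
    using Ck_on_eps[OF U f x] by metis
  have "((\<lambda>t. \<xi> t i) \<longlongrightarrow> x i) F" if "i < n" for i
  proof -
    have "((\<lambda>t. \<gamma> t i - x i) \<longlongrightarrow> 0) F" using \<gamma>[OF that] by (simp add: LIM_zero)
    then have "((\<lambda>t. \<xi> t i - x i) \<longlongrightarrow> 0) F"
      by (rule Lim_null_comparison[rotated, OF tendsto_rabs_zero])
        (use ev that in \<open>auto elim: eventually_mono\<close>)
    then show ?thesis by (simp add: LIM_zero_iff)
  qed
  then have "eventually (\<lambda>t. \<xi> t \<in> cube n x d) F"
    by (rule eventually_cube) (use ev d in \<open>auto elim: eventually_mono\<close>)
  then show "eventually (\<lambda>t. dist (f (\<xi> t)) (f x) < e) F"
    by eventually_elim (use d in \<open>auto simp: dist_real_def\<close>)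
qed

text \<open>
Differentiability in the sense of partial derivatives does not give a chain rule in general;
here it holds because the partial derivatives are continuous. The mean value theorem expresses
the difference quotient of \<open>f \<circ> \<gamma>\<close> through partial derivatives at intermediate points.
\<close>

lemma chain_rule_curve:
  assumes U: "openin (Euclidean_space n) U" and f: "Ck_on n (Suc k) U f"
    and \<gamma>: "eventually (\<lambda>t. \<gamma> t \<in> U) (nhds \<tau>)"
    and d: "\<And>i. i < n \<Longrightarrow> ((\<lambda>t. \<gamma> t i) has_real_derivative \<gamma>' i) (at \<tau>)"
  shows "((\<lambda>t. f (\<gamma> t)) has_real_derivative (\<Sum>i<n. pderiv_at i f (\<gamma> \<tau>) * \<gamma>' i)) (at \<tau>)"
proof -
  have x: "\<gamma> \<tau> \<in> U" by (rule eventually_nhds_x_imp_x[OF \<gamma>])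
  obtain r where r: "r > 0" "cube n (\<gamma> \<tau>) r \<subseteq> U" using U x by (auto simp: openin_Euclidean_iff)
  have UE: "U \<subseteq> topspace (Euclidean_space n)" by (rule openin_subset[OF U])
  have lim: "((\<lambda>t. \<gamma> t i) \<longlongrightarrow> \<gamma> \<tau> i) (at \<tau>)" if "i < n" for i
    using DERIV_isCont[OF d[OF that]] by (simp add: isCont_def)
  have ev1: "eventually (\<lambda>t. \<gamma> t \<in> U) (at \<tau>)" using \<gamma> by (simp add: eventually_nhds_conv_at)
  have ev2: "eventually (\<lambda>t. \<gamma> t \<in> cube n (\<gamma> \<tau>) r) (at \<tau>)"
    by (rule eventually_cube[OF lim eventually_mono[OF ev1] r(1)]) (use UE in auto)
  define P where "P t \<xi> \<longleftrightarrow> (\<forall>j<n. \<xi> j \<in> topspace (Euclidean_space n) \<and>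
        (\<forall>i. \<bar>\<xi> j i - \<gamma> \<tau> i\<bar> \<le> \<bar>\<gamma> t i - \<gamma> \<tau> i\<bar>)) \<and>
        f (\<gamma> t) - f (\<gamma> \<tau>) = (\<Sum>j<n. pderiv_at j f (\<xi> j) * (\<gamma> t j - \<gamma> \<tau> j))" for t \<xi>
  have ex: "\<exists>\<xi>. P t \<xi>" if t: "\<gamma> t \<in> cube n (\<gamma> \<tau>) r" for t
  proof -
    obtain \<xi> where "\<And>j. j < n \<Longrightarrow> \<xi> j \<in> topspace (Euclidean_space n)"
      "\<And>j i. j < n \<Longrightarrow> \<bar>\<xi> j i - \<gamma> \<tau> i\<bar> \<le> \<bar>\<gamma> t i - \<gamma> \<tau> i\<bar>"
      "f (\<gamma> t) - f (\<gamma> \<tau>) = (\<Sum>j<n. pderiv_at j f (\<xi> j) * (\<gamma> t j - \<gamma> \<tau> j))"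
    proof (rule coordinatewise_mvt[of n U f "\<gamma> \<tau>" "\<gamma> t"])
      fix y assume y: "y \<in> topspace (Euclidean_space n)" "\<And>i. \<bar>y i - \<gamma> \<tau> i\<bar> \<le> \<bar>\<gamma> t i - \<gamma> \<tau> i\<bar>"
      then have "y \<in> cube n (\<gamma> \<tau>) r" using t by (auto simp: cube_def intro: le_less_trans)
      then show "y \<in> U" using r by blast
    qed (use x UE t in \<open>auto intro: Ck_on_has_pderiv[OF U f] simp: cube_def\<close>)
    then show ?thesis unfolding P_def by blast
  qed
  define \<xi> where "\<xi> t = (SOME \<xi>. P t \<xi>)" for t
  have ev3: "eventually (\<lambda>t. P t (\<xi> t)) (at \<tau>)"
    by (rule eventually_mono[OF ev2]) (unfold \<xi>_def, rule someI_ex[OF ex])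
  have "((\<lambda>t. \<Sum>j<n. pderiv_at j f (\<xi> t j) * ((\<gamma> t j - \<gamma> \<tau> j) / (t - \<tau>))) \<longlongrightarrow>
         (\<Sum>i<n. pderiv_at i f (\<gamma> \<tau>) * \<gamma>' i)) (at \<tau>)"
  proof (intro tendsto_sum tendsto_mult)
    fix j assume "j \<in> {..<n}"
    then have j: "j < n" by simp
    show "((\<lambda>t. pderiv_at j f (\<xi> t j)) \<longlongrightarrow> pderiv_at j f (\<gamma> \<tau>)) (at \<tau>)"
    proof (rule tendsto_squeeze_arg[OF U _ x lim])
      show "Ck_on n k U (pderiv_at j f)" by (rule Ck_on_pderiv[OF U f j])
      show "\<forall>\<^sub>F t in at \<tau>. \<xi> t j \<in> topspace (Euclidean_space n) \<and>
          (\<forall>i<n. \<bar>\<xi> t j i - \<gamma> \<tau> i\<bar> \<le> \<bar>\<gamma> t i - \<gamma> \<tau> i\<bar>)"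
        by (rule eventually_mono[OF ev3]) (use j in \<open>simp add: P_def\<close>)
    qed auto
    show "((\<lambda>t. (\<gamma> t j - \<gamma> \<tau> j) / (t - \<tau>)) \<longlongrightarrow> \<gamma>' j) (at \<tau>)"
      using d[OF j] by (simp add: has_field_derivative_iff)
  qed
  then have "((\<lambda>t. (f (\<gamma> t) - f (\<gamma> \<tau>)) / (t - \<tau>)) \<longlongrightarrow> (\<Sum>i<n. pderiv_at i f (\<gamma> \<tau>) * \<gamma>' i)) (at \<tau>)"
  proof (rule Lim_transform_eventually)
    show "\<forall>\<^sub>F t in at \<tau>. (\<Sum>j<n. pderiv_at j f (\<xi> t j) * ((\<gamma> t j - \<gamma> \<tau> j) / (t - \<tau>))) =
        (f (\<gamma> t) - f (\<gamma> \<tau>)) / (t - \<tau>)"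
      using ev3 by eventually_elim (simp add: P_def sum_divide_distrib)
  qed
  then show ?thesis by (simp add: has_field_derivative_iff)
qed

lemma continuous_map_compose_Euclidean:
  assumes U: "openin (Euclidean_space n) U" and V: "openin (Euclidean_space m) V"
    and f: "continuous_map (subtopology (Euclidean_space n) U) euclideanreal f"
    and g: "\<And>j. j < n \<Longrightarrow> continuous_map (subtopology (Euclidean_space m) V) euclideanreal (\<lambda>x. g x j)"
    and gU: "g ` V \<subseteq> U"
  shows "continuous_map (subtopology (Euclidean_space m) V) euclideanreal (\<lambda>x. f (g x))"
proof -
  have "continuous_map (subtopology (Euclidean_space m) V) (Euclidean_space n) g"
    unfolding continuous_map_into_Euclidean_iff
    using g gU openin_subset[OF U] by auto
  then have "continuous_map (subtopology (Euclidean_space m) V) (subtopology (Euclidean_space n) U) g"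
    using gU by (auto simp: continuous_map_in_subtopology)
  from continuous_map_compose[OF this f] show ?thesis by (simp add: o_def)
qed

lemma Ck_on_compose:
  assumes U: "openin (Euclidean_space n) U" and V: "openin (Euclidean_space m) V"
    and gU: "g ` V \<subseteq> U"
  shows "Ck_on n k U f \<Longrightarrow> (\<And>j. j < n \<Longrightarrow> Ck_on m k V (\<lambda>x. g x j)) \<Longrightarrow>
     Ck_on m k V (\<lambda>x. f (g x))"
proof (induction k arbitrary: f)
  case 0
  then show ?case by (auto intro: continuous_map_compose_Euclidean[OF U V _ _ gU])
next
  case (Suc k)
  show ?case
  proof (rule Ck_on_SucI[OF V, where f' = "\<lambda>i x. \<Sum>j<n. pderiv_at j f (g x) * pderiv_at i (\<lambda>x. g x j)
      x"])
    show "continuous_map (subtopology (Euclidean_space m) V) euclideanreal (\<lambda>x. f (g x))"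
      by (rule continuous_map_compose_Euclidean[OF U V _ _ gU]) (use Suc.prems Ck_on_continuous in
          blast)+
    fix i x assume ix: "i < m" "x \<in> V"
    have "((\<lambda>t. f (g (x(i := t)))) has_real_derivative
        (\<Sum>j<n. pderiv_at j f (g (x(i := x i))) * pderiv_at i (\<lambda>x. g x j) x)) (at (x i))"
    proof (rule chain_rule_curve[OF U Suc.prems(1)])
      show "\<forall>\<^sub>F t in nhds (x i). g (x(i := t)) \<in> U"
        using eventually_upd_in[OF V ix(2,1)] by eventually_elim (use gU in auto)
    qed (use Suc.prems(2) Ck_on_has_pderiv[OF V _ ix] in blast)
    then show "((\<lambda>t. f (g (x(i := t)))) has_real_derivative
        (\<Sum>j<n. pderiv_at j f (g x) * pderiv_at i (\<lambda>x. g x j) x)) (at (x i))" by simp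
  next
    fix i assume i: "i < m"
    show "Ck_on m k V (\<lambda>x. \<Sum>j<n. pderiv_at j f (g x) * pderiv_at i (\<lambda>x. g x j) x)"
    proof (rule Ck_on_sum[OF V], rule Ck_on_mult[OF V])
      fix j assume "j \<in> {..<n}"
      then have j: "j < n" by simp
      show "Ck_on m k V (\<lambda>x. pderiv_at j f (g x))"
        by (rule Suc.IH[OF Ck_on_pderiv[OF U Suc.prems(1) j] Ck_on_lower[OF V Suc.prems(2)]])
      show "Ck_on m k V (pderiv_at i (\<lambda>x. g x j))"
        by (rule Ck_on_pderiv[OF V Suc.prems(2)[OF j] i])
    qed
  qed
qed

section \<open>Smooth functions and maps between Cartesian spaces\<close>

lemma smooth_realD: 
  assumes "smooth_real n U f"
  shows "openin (Euclidean_space n) U" "Ck_on n k U f"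
  using assms by (auto simp: smooth_real_def)

lemma smooth_real_const: "openin (Euclidean_space n) U \<Longrightarrow> smooth_real n U (\<lambda>x. c)"
  by (simp add: smooth_real_def Ck_on_const)

lemma smooth_real_coord: 
  assumes U: "openin (Euclidean_space n) U"
  shows "smooth_real n U (\<lambda>x. x j)"
proof (cases "j < n")
  case False
  then have "\<And>x. x \<in> U \<Longrightarrow> x j = 0"
    using openin_subset[OF U] by (auto simp: topspace_Euclidean_space)
  then have "Ck_on n k U (\<lambda>x. x j) \<longleftrightarrow> Ck_on n k U (\<lambda>x. 0)" for k by (rule Ck_on_cong[OF U])
  then show ?thesis using Ck_on_const[OF U] U by (simp add: smooth_real_def)
qed (use Ck_on_coord[OF U] U in \<open>simp add: smooth_real_def\<close>)

lemma smooth_real_add: "smooth_real n U f \<Longrightarrow> smooth_real n U g \<Longrightarrow> smooth_real n U (\<lambda>x. f x + g x)"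
  by (simp add: smooth_real_def Ck_on_add)

lemma smooth_real_mult: "smooth_real n U f \<Longrightarrow> smooth_real n U g \<Longrightarrow> smooth_real n U (\<lambda>x. f x * g x)"
  by (simp add: smooth_real_def Ck_on_mult)

lemma smooth_real_uminus: "smooth_real n U f \<Longrightarrow> smooth_real n U (\<lambda>x. - f x)"
  using smooth_real_mult[OF smooth_real_const[of n U "-1"], of f] by (simp add: smooth_real_def)

lemma smooth_real_diff: "smooth_real n U f \<Longrightarrow> smooth_real n U g \<Longrightarrow> smooth_real n U (\<lambda>x. f x - g x)"
  using smooth_real_add[OF _ smooth_real_uminus, of n U f g] by simp

lemma smooth_real_inverse:
  "smooth_real n U f \<Longrightarrow> (\<And>x. x \<in> U \<Longrightarrow> f x \<noteq> 0) \<Longrightarrow> smooth_real n U (\<lambda>x. inverse (f x))"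
  by (simp add: smooth_real_def Ck_on_inverse)

lemma smooth_real_sum:
  "openin (Euclidean_space n) U \<Longrightarrow> (\<And>j. j \<in> A \<Longrightarrow> smooth_real n U (f j)) \<Longrightarrow>
    smooth_real n U (\<lambda>x. \<Sum>j\<in>A. f j x)"
  by (simp add: smooth_real_def Ck_on_sum)

lemma smooth_real_cong:
  "smooth_real n U f \<Longrightarrow> (\<And>x. x \<in> U \<Longrightarrow> g x = f x) \<Longrightarrow> smooth_real n U g"
  unfolding smooth_real_def using Ck_on_cong[of n U g f] by blast

lemma smooth_real_mono:
  "smooth_real n U f \<Longrightarrow> openin (Euclidean_space n) V \<Longrightarrow> V \<subseteq> U \<Longrightarrow> smooth_real n V f"
  unfolding smooth_real_def using Ck_on_mono[of n U V] by blast

lemma smooth_real_local: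
  assumes "\<And>x. x \<in> U \<Longrightarrow> \<exists>W. x \<in> W \<and> W \<subseteq> U \<and> smooth_real n W f"
  shows "smooth_real n U f"
proof -
  have U: "openin (Euclidean_space n) U"
    by (subst openin_subopen) (use assms in \<open>auto simp: smooth_real_def, metis\<close>)
  have "Ck_on n k U f" for k
  proof (rule Ck_on_local[OF U])
    fix x assume "x \<in> U"
    then obtain W where "x \<in> W" "W \<subseteq> U" "smooth_real n W f" using assms by metis
    then show "\<exists>W. openin (Euclidean_space n) W \<and> x \<in> W \<and> W \<subseteq> U \<and> Ck_on n k W f"
      by (intro exI[of _ W]) (simp add: smooth_real_def)
  qed
  with U show ?thesis by (simp add: smooth_real_def)
qed

lemma smooth_real_pderiv:
  assumes "smooth_real n U f" "i < n"
  shows "smooth_real n U (pderiv_at i f)"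
  using Ck_on_pderiv[OF smooth_realD[OF assms(1)] assms(2)] smooth_realD(1)[OF assms(1)]
  by (simp add: smooth_real_def)

lemma smooth_real_has_pderiv:
  assumes "smooth_real n U f" "i < n" "x \<in> U"
  shows "((\<lambda>t. f (x(i := t))) has_real_derivative pderiv_at i f x) (at (x i))"
  using Ck_on_has_pderiv[OF smooth_realD[OF assms(1)] assms(2,3)] .

lemma smooth_real_chain_curve:
  assumes "smooth_real n U f" "eventually (\<lambda>t. \<gamma> t \<in> U) (nhds \<tau>)"
    and "\<And>i. i < n \<Longrightarrow> ((\<lambda>t. \<gamma> t i) has_real_derivative \<gamma>' i) (at \<tau>)"
  shows "((\<lambda>t. f (\<gamma> t)) has_real_derivative (\<Sum>i<n. pderiv_at i f (\<gamma> \<tau>) * \<gamma>' i)) (at \<tau>)"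
  by (rule chain_rule_curve[OF smooth_realD[OF assms(1)] assms(2,3)])

lemma smooth_real_compose:
  assumes f: "smooth_real n U f" and g: "smooth_cartesian m V n g" and gU: "g ` V \<subseteq> U"
  shows "smooth_real m V (\<lambda>x. f (g x))"
proof -
  have V: "openin (Euclidean_space m) V" using g by (simp add: smooth_cartesian_def)
  have "Ck_on m k V (\<lambda>x. f (g x))" for k
    by (rule Ck_on_compose[OF smooth_realD(1)[OF f] V gU smooth_realD(2)[OF f]])
      (use g in \<open>simp add: smooth_cartesian_def smooth_real_def\<close>)
  with V show ?thesis by (simp add: smooth_real_def)
qed

lemma smooth_cartesianI:
  assumes "openin (Euclidean_space n) U" "\<And>x. x \<in> U \<Longrightarrow> f x \<in> topspace (Euclidean_space m)"
    "\<And>j. j < m \<Longrightarrow> smooth_real n U (\<lambda>x. f x j)"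
  shows "smooth_cartesian n U m f"
  using assms by (auto simp: smooth_cartesian_def)

lemma smooth_cartesianD:
  assumes "smooth_cartesian n U m f"
  shows "openin (Euclidean_space n) U" "\<And>x. x \<in> U \<Longrightarrow> f x \<in> topspace (Euclidean_space m)"
    "smooth_real n U (\<lambda>x. f x j)"
proof -
  show U: "openin (Euclidean_space n) U" and t: "\<And>x. x \<in> U \<Longrightarrow> f x \<in> topspace (Euclidean_space m)"
    using assms by (auto simp: smooth_cartesian_def)
  show "smooth_real n U (\<lambda>x. f x j)"
  proof (cases "j < m")
    case False
    show ?thesis
      by (rule smooth_real_cong[OF smooth_real_const[OF U, of 0]])
        (use t False in \<open>auto simp: topspace_Euclidean_space\<close>)
  qed (use assms in \<open>simp add: smooth_cartesian_def\<close>)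
qed

lemma smooth_cartesian_compose:
  assumes f: "smooth_cartesian n U k f" and g: "smooth_cartesian m V n g" and gU: "g ` V \<subseteq> U"
  shows "smooth_cartesian m V k (\<lambda>x. f (g x))"
proof (rule smooth_cartesianI[OF smooth_cartesianD(1)[OF g]])
  show "f (g x) \<in> topspace (Euclidean_space k)" if "x \<in> V" for x
    using smooth_cartesianD(2)[OF f] gU that by auto
  show "smooth_real m V (\<lambda>x. f (g x) j)" for j
    by (rule smooth_real_compose[OF smooth_cartesianD(3)[OF f] g gU])
qed

lemma smooth_cartesian_mono:
  assumes "smooth_cartesian n U m f" "openin (Euclidean_space n) V" "V \<subseteq> U"
  shows "smooth_cartesian n V m f"
  using smooth_cartesianD[OF assms(1)] assms(2,3)
  by (intro smooth_cartesianI) (auto intro: smooth_real_mono)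

lemma smooth_cartesian_cong:
  assumes "smooth_cartesian n U m f" "\<And>x. x \<in> U \<Longrightarrow> g x = f x"
  shows "smooth_cartesian n U m g"
proof (rule smooth_cartesianI[OF smooth_cartesianD(1)[OF assms(1)]])
  show "g x \<in> topspace (Euclidean_space m)" if "x \<in> U" for x
    using smooth_cartesianD(2)[OF assms(1) that] assms(2)[OF that] by simp
  show "smooth_real n U (\<lambda>x. g x j)" for j
    by (rule smooth_real_cong[OF smooth_cartesianD(3)[OF assms(1)]]) (simp add: assms(2))
qed

lemma smooth_cartesian_local:
  assumes "\<And>x. x \<in> U \<Longrightarrow> \<exists>W. x \<in> W \<and> W \<subseteq> U \<and> smooth_cartesian n W m f"
  shows "smooth_cartesian n U m f"
proof (rule smooth_cartesianI)
  show "openin (Euclidean_space n) U"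
    by (subst openin_subopen) (use assms smooth_cartesianD(1) in metis)
  show "f x \<in> topspace (Euclidean_space m)" if x: "x \<in> U" for x
    using assms[OF x] smooth_cartesianD(2) by metis
  show "smooth_real n U (\<lambda>x. f x j)" for j
    by (rule smooth_real_local) (use assms smooth_cartesianD(3) in metis)
qed

lemma smooth_cartesian_continuous:
  assumes "smooth_cartesian n U m f"
  shows "continuous_map (subtopology (Euclidean_space n) U) (Euclidean_space m) f"
  unfolding continuous_map_into_Euclidean_iff
  using smooth_cartesianD[OF assms] openin_subset[OF smooth_cartesianD(1)[OF assms]]
  by (auto intro!: Ck_on_continuous[of n 0] smooth_realD(2))

lemma openin_smooth_preimage:
  assumes "smooth_cartesian n U m f" "openin (Euclidean_space m) W"
  shows "openin (Euclidean_space n) {x \<in> U. f x \<in> W}"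
proof -
  have U: "openin (Euclidean_space n) U" by (rule smooth_cartesianD(1)[OF assms(1)])
  have "openin (subtopology (Euclidean_space n) U) {x \<in> topspace (subtopology (Euclidean_space n) U). f
      x \<in> W}"
    by (rule openin_continuous_map_preimage[OF smooth_cartesian_continuous[OF assms(1)] assms(2)])
  then show ?thesis using openin_subset[OF U]
    by (simp add: openin_open_subtopology[OF U] Int_absorb1 inf.absorb2)
qed

lemma openin_smooth_real_preimage:
  assumes "smooth_real n U f" "open W"
  shows "openin (Euclidean_space n) {x \<in> U. f x \<in> W}"
proof -
  have U: "openin (Euclidean_space n) U" by (rule smooth_realD(1)[OF assms(1)])
  have "openin (subtopology (Euclidean_space n) U) {x \<in> topspace (subtopology (Euclidean_space n) U). f
      x \<in> W}"
    by (rule openin_continuous_map_preimage[OF Ck_on_continuous[OF smooth_realD(2)[OF assms(1), of 0]]])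
      (use assms in simp)
  then show ?thesis using openin_subset[OF U]
    by (simp add: openin_open_subtopology[OF U] Int_absorb1 inf.absorb2)
qed

lemma smooth_cartesian_upd:
  assumes U: "openin (Euclidean_space N) U" and h: "smooth_real N U h"
  shows "smooth_cartesian N U (Suc N) (\<lambda>y. y(N := h y))"
proof (rule smooth_cartesianI[OF U])
  show "x(N := h x) \<in> topspace (Euclidean_space (Suc N))" if "x \<in> U" for x
    using that openin_subset[OF U] by (auto simp: topspace_Euclidean_space)
  show "smooth_real N U (\<lambda>x. (x(N := h x)) j)" for j
    using h smooth_real_coord[OF U] by (cases "j = N") auto
qed

section \<open>Implicit functions\<close>

text \<open>
Since the last partial derivative is positive near \<open>y0\<close>, the function is strictly increasing in
the last coordinate on a box, so that on each vertical line near \<open>y0\<close> it has exactly one zero by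
the intermediate value theorem. The uniqueness is part of the conclusion: it identifies the
implicit function where a solution is already known.
\<close>

lemma implicit_function_pos:
  assumes \<phi>: "smooth_real (Suc N) U \<phi>" and y0: "y0 \<in> topspace (Euclidean_space N)" "y0 \<in> U"
    and z: "\<phi> y0 = 0" and pos: "pderiv_at N \<phi> y0 > 0"
  shows "\<exists>V e \<theta>. y0 \<in> V \<and> 0 < e \<and> smooth_real N V \<theta> \<and>
    (\<forall>y\<in>V. \<bar>\<theta> y\<bar> < e \<and> y(N := \<theta> y) \<in> U \<and> \<phi> (y(N := \<theta> y)) = 0 \<and>
      (\<forall>t. \<bar>t\<bar> < e \<longrightarrow> y(N := t) \<in> U \<and> (\<phi> (y(N := t)) = 0 \<longrightarrow> t = \<theta> y)))"
proof -
  let ?E = "Euclidean_space N" and ?E1 = "Euclidean_space (Suc N)"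
  have U: "openin ?E1 U" by (rule smooth_realD(1)[OF \<phi>])
  define D where "D = pderiv_at N \<phi>"
  have Dsm: "smooth_real (Suc N) U D" unfolding D_def by (rule smooth_real_pderiv[OF \<phi>]) simp
  have y0N: "y0 N = 0" "y0(N := 0) = y0" using y0 by (auto simp: topspace_Euclidean_space)
  obtain d where d: "d > 0" "cube (Suc N) y0 d \<subseteq> U"
      "\<And>y. y \<in> cube (Suc N) y0 d \<Longrightarrow> \<bar>D y - D y0\<bar> < D y0"
    using Ck_on_eps[OF U smooth_realD(2)[OF Dsm, of 0] y0(2), of "D y0"] pos D_def by metis
  have Dpos: "D y > 0" if "y \<in> cube (Suc N) y0 d" for y using d(3)[OF that] by simp
  have up: "y(N := t) \<in> cube (Suc N) y0 d" if "y \<in> cube N y0 d" "\<bar>t\<bar> < d" for y t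
    using that y0N by (auto simp: cube_def topspace_Euclidean_space less_Suc_eq)
  have upU: "y(N := t) \<in> U" if "y \<in> cube N y0 d" "\<bar>t\<bar> < d" for y t
    using up[OF that] d by auto
  have der: "((\<lambda>t. \<phi> (y(N := t))) has_real_derivative D (y(N := t))) (at t)"
    if "y \<in> cube N y0 d" "\<bar>t\<bar> < d" for y t
    using smooth_real_has_pderiv[OF \<phi> _ upU[OF that], of N] by (simp add: D_def)
  have mono: "\<phi> (y(N := s)) < \<phi> (y(N := t))" if y: "y \<in> cube N y0 d" and st: "- d < s" "s < t" "t < d"
      for y s t
  proof (rule DERIV_pos_imp_increasing[OF st(2), of "\<lambda>t. \<phi> (y(N := t))"])
    fix x assume "s \<le> x" "x \<le> t"
    then have x: "\<bar>x\<bar> < d" using st by auto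
    show "\<exists>D. ((\<lambda>t. \<phi> (y(N := t))) has_real_derivative D) (at x) \<and> 0 < D"
      by (intro exI conjI, rule der[OF y x], rule Dpos[OF up[OF y x]])
  qed
  \<comment> \<open>Half the radius of the box, so that the end points of the vertical intervals lie inside
     it.\<close>
  define e where "e = d / 2"
  have e: "e > 0" "e < d" using d by (auto simp: e_def)
  have cub: "openin ?E (cube N y0 d)" by (rule openin_cube)
  have c_sm: "smooth_real N (cube N y0 d) (\<lambda>y. \<phi> (y(N := c)))" if "\<bar>c\<bar> < d" for c
    by (rule smooth_real_compose[OF \<phi> smooth_cartesian_upd[OF cub smooth_real_const[OF cub]]])
      (use upU that in auto)
  have opp: "openin ?E {y \<in> cube N y0 d. \<phi> (y(N := c)) > 0}"
       "openin ?E {y \<in> cube N y0 d. \<phi> (y(N := c)) < 0}" if "\<bar>c\<bar> < d" for c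
    using openin_smooth_real_preimage[OF c_sm[OF that], of "{0<..}"]
      openin_smooth_real_preimage[OF c_sm[OF that], of "{..<0}"] by simp_all
  define V where "V = {y \<in> cube N y0 d. \<phi> (y(N := e)) > 0} \<inter> {y \<in> cube N y0 d. \<phi> (y(N := - e)) < 0}"
  have V: "openin ?E V" unfolding V_def by (intro openin_Int opp) (use e in auto)
  have Vc: "y \<in> cube N y0 d" if "y \<in> V" for y using that by (simp add: V_def)
  have y0V: "y0 \<in> V"
  proof -
    have "y0 \<in> cube N y0 d" using y0 d by (intro cube_self)
    then show ?thesis using mono[of y0 0 e] mono[of y0 "-e" 0] e y0N z by (simp add: V_def)
  qed
  have ivt: "\<exists>t. a \<le> t \<and> t \<le> b \<and> \<phi> (y(N := t)) = 0"
    if y: "y \<in> cube N y0 d" and ab: "\<phi> (y(N := a)) < 0" "\<phi> (y(N := b)) > 0" "a \<le> b" "- d < a" "b < d"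
        for y a b
    by (rule IVT[of "\<lambda>t. \<phi> (y(N := t))"])
      (use ab in \<open>auto intro!: DERIV_isCont[OF der[OF y]]\<close>)
  define \<theta> where "\<theta> y = (THE t. \<bar>t\<bar> < e \<and> \<phi> (y(N := t)) = 0)" for y
  have uniq: "s = t" if "y \<in> V" "\<bar>s\<bar> < d" "\<bar>t\<bar> < d" "\<phi> (y(N := s)) = \<phi> (y(N := t))" for y s t
    using mono[OF Vc[OF that(1)], of s t] mono[OF Vc[OF that(1)], of t s] that by linarith
  have th: "\<bar>\<theta> y\<bar> < e \<and> \<phi> (y(N := \<theta> y)) = 0" if y: "y \<in> V" for y
    unfolding \<theta>_def
  proof (rule theI')
    obtain t where t: "- e \<le> t" "t \<le> e" "\<phi> (y(N := t)) = 0"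
      using ivt[OF Vc[OF y], of "-e" e] y e by (auto simp: V_def)
    have "t \<noteq> e" "t \<noteq> -e" using t y by (auto simp: V_def)
    with t have "\<bar>t\<bar> < e \<and> \<phi> (y(N := t)) = 0" by auto
    then show "\<exists>!t. \<bar>t\<bar> < e \<and> \<phi> (y(N := t)) = 0"
      using uniq[OF y] e by (intro ex1I[of _ t]) auto
  qed
  have thd: "\<bar>\<theta> y\<bar> < d" if "y \<in> V" for y using th[OF that] e by simp
  have thU: "y(N := \<theta> y) \<in> U" if "y \<in> V" for y by (rule upU[OF Vc[OF that] thd[OF that]])
  have cont: "Ck_on N 0 V \<theta>"
    unfolding Ck_on.simps continuous_map_Euclidean_iff[OF V]
  proof (intro ballI allI impI)
    fix y \<eta> assume y: "y \<in> V" and "(\<eta> :: real) > 0"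
    define r where "r = min \<eta> ((e - \<bar>\<theta> y\<bar>) / 2)"
    have r: "r > 0" "r \<le> \<eta>" "\<bar>\<theta> y\<bar> + r < e"
    proof -
      show "r > 0" "r \<le> \<eta>" using \<open>\<eta> > 0\<close> th[OF y] by (auto simp: r_def)
      have "r \<le> (e - \<bar>\<theta> y\<bar>) / 2" unfolding r_def by (rule min.cobounded2)
      moreover have "r < e - \<bar>\<theta> y\<bar>"
        by (rule le_less_trans[OF calculation]) (use th[OF y] in simp)
      ultimately show "\<bar>\<theta> y\<bar> + r < e" by simp
    qed
    have b: "\<bar>\<theta> y + r\<bar> < d" "\<bar>\<theta> y - r\<bar> < d" using r e by auto
    define W where "W = V \<inter> ({x \<in> cube N y0 d. \<phi> (x(N := \<theta> y + r)) > 0} \<inter> {x \<in> cube N y0 d. \<phi> (x(N := \<theta>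
        y - r)) < 0})"
    have W: "openin ?E W" unfolding W_def by (intro openin_Int V opp b)
    have "y \<in> W"
      unfolding W_def using y Vc[OF y] th[OF y] b r thd[OF y]
        mono[OF Vc[OF y], of "\<theta> y" "\<theta> y + r"] mono[OF Vc[OF y], of "\<theta> y - r" "\<theta> y"] by auto
    then obtain c where c: "c > 0" "cube N y c \<subseteq> W" using W by (auto simp: openin_Euclidean_iff)
    have "\<bar>\<theta> x - \<theta> y\<bar> < \<eta>" if "x \<in> W" for x
    proof -
      have x: "x \<in> V" "\<phi> (x(N := \<theta> y + r)) > 0" "\<phi> (x(N := \<theta> y - r)) < 0" using that
        by (auto simp: W_def)
      have bb: "- d < \<theta> y + r" "\<theta> y + r < d" "- d < \<theta> y - r" "\<theta> y - r < d" "- d < \<theta> x" "\<theta> x < d"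
        using b thd[OF x(1)] by linarith+
      have "\<theta> x < \<theta> y + r"
      proof (rule ccontr)
        assume "\<not> \<theta> x < \<theta> y + r"
        then have "\<theta> y + r = \<theta> x \<or> \<theta> y + r < \<theta> x" by auto
        then show False using mono[OF Vc[OF x(1)], of "\<theta> y + r" "\<theta> x"] x th[OF x(1)] bb by auto
      qed
      moreover have "\<theta> y - r < \<theta> x"
      proof (rule ccontr)
        assume "\<not> \<theta> y - r < \<theta> x"
        then have "\<theta> y - r = \<theta> x \<or> \<theta> x < \<theta> y - r" by auto
        then show False using mono[OF Vc[OF x(1)], of "\<theta> x" "\<theta> y - r"] x th[OF x(1)] bb by auto
      qed
      ultimately show ?thesis using r by auto
    qed
    then show "\<exists>c>0. \<forall>x\<in>cube N y c. \<bar>\<theta> x - \<theta> y\<bar> < \<eta>" using c by (intro exI[of _ c]) auto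
  qed
  \<comment> \<open>The derivative that results from differentiating \<open>\<phi> (y(N := \<theta> y)) = 0\<close>.\<close>
  define G where "G i y = - 1 * (pderiv_at i \<phi> (y(N := \<theta> y)) * inverse (D (y(N := \<theta> y))))" for i y
  have dth: "((\<lambda>t. \<theta> (y(i := t))) has_real_derivative G i y) (at (y i))" if i: "i < N" and y: "y \<in> V"
      for i y
  proof -
    define a where "a = y(N := \<theta> y)"
    define b where "b t = y(i := t, N := \<theta> (y(i := t)))" for t
    have ba: "b (y i) = a" by (simp add: a_def b_def)
    have ac: "a \<in> cube (Suc N) y0 d" unfolding a_def by (rule up[OF Vc[OF y] thd[OF y]])
    then have aE: "a \<in> topspace ?E1" by (simp add: cube_def)
    have evV: "eventually (\<lambda>t. y(i := t) \<in> V) (at (y i))"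
      using eventually_upd_in[OF V y i] by (simp add: eventually_nhds_conv_at)
    have thl: "((\<lambda>t. \<theta> (y(i := t))) \<longlongrightarrow> \<theta> y) (at (y i))"
    proof (rule tendsto_squeeze_arg[OF V cont y])
      show "((\<lambda>t. (y(i := t)) l) \<longlongrightarrow> y l) (at (y i))" for l by (cases "l = i") auto
      show "\<forall>\<^sub>F t in at (y i). y(i := t) \<in> topspace ?E \<and> (\<forall>l<N. \<bar>(y(i := t)) l - y l\<bar> \<le> \<bar>(y(i := t)) l -
          y l\<bar>)"
        by (rule eventually_mono[OF evV]) (use openin_subset[OF V] in auto)
    qed
    have bl: "((\<lambda>t. b t j) \<longlongrightarrow> a j) (at (y i))" for j
      using thl i by (cases "j = N"; cases "j = i") (auto simp: a_def b_def)
    obtain r where r: "r > 0" "cube (Suc N) a r \<subseteq> cube (Suc N) y0 d"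
      using openin_cube[of "Suc N" y0 d] ac by (auto simp: openin_Euclidean_iff)
    have evb: "eventually (\<lambda>t. b t \<in> cube (Suc N) a r) (at (y i))"
    proof (rule eventually_cube[OF bl _ r(1)])
      show "\<forall>\<^sub>F t in at (y i). b t \<in> topspace ?E1"
      proof (rule eventually_mono[OF evV])
        fix t assume "y(i := t) \<in> V"
        then have "y(i := t) \<in> topspace ?E" using openin_subset[OF V] by auto
        then show "b t \<in> topspace ?E1" unfolding b_def topspace_Euclidean_space by simp
      qed
    qed
    \<comment> \<open>Between two zeros \<open>a\<close> and \<open>b t\<close> of \<open>\<phi>\<close>, the mean value theorem expresses the increment
       of \<open>\<theta>\<close> by partial derivatives at intermediate points.\<close>
    define P where "P t \<xi> \<longleftrightarrow> (\<forall>j<Suc N. \<xi> j \<in> topspace ?E1 \<and> (\<forall>l. \<bar>\<xi> j l - a l\<bar> \<le> \<bar>b t l - a l\<bar>)) \<and>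
        (\<forall>j<Suc N. \<xi> j \<in> cube (Suc N) y0 d) \<and> 
        \<theta> (y(i := t)) - \<theta> y = - (pderiv_at i \<phi> (\<xi> i) * inverse (D (\<xi> N))) * (t - y i)" for t \<xi>
    have ex: "\<exists>\<xi>. P t \<xi>" if t: "b t \<in> cube (Suc N) a r" "y(i := t) \<in> V" for t
    proof -
      have cu: "x \<in> cube (Suc N) y0 d" if "x \<in> topspace ?E1" "\<And>l. \<bar>x l - a l\<bar> \<le> \<bar>b t l - a l\<bar>" for x
      proof -
        have "x \<in> cube (Suc N) a r"
          using that t(1) by (auto simp: cube_def intro: le_less_trans)
        then show ?thesis using r by auto
      qed
      obtain \<xi> where \<xi>: "\<And>j. j < Suc N \<Longrightarrow> \<xi> j \<in> topspace ?E1"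
        "\<And>j l. j < Suc N \<Longrightarrow> \<bar>\<xi> j l - a l\<bar> \<le> \<bar>b t l - a l\<bar>"
        "\<phi> (b t) - \<phi> a = (\<Sum>j<Suc N. pderiv_at j \<phi> (\<xi> j) * (b t j - a j))"
      proof (rule coordinatewise_mvt[of "Suc N" U \<phi> a "b t"])
        show "x \<in> U" if "x \<in> topspace ?E1" "\<And>l. \<bar>x l - a l\<bar> \<le> \<bar>b t l - a l\<bar>" for x
          using cu[OF that] d by auto
      qed (use aE t in \<open>auto intro: smooth_real_has_pderiv[OF \<phi>] simp: cube_def\<close>)
      have "\<phi> (b t) = 0" "\<phi> a = 0" using th[OF t(2)] th[OF y] by (auto simp: b_def a_def)
      moreover have "(\<Sum>j<Suc N. pderiv_at j \<phi> (\<xi> j) * (b t j - a j)) =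
          pderiv_at i \<phi> (\<xi> i) * (t - y i) + D (\<xi> N) * (\<theta> (y(i := t)) - \<theta> y)"
      proof -
        have "(\<Sum>j<N. pderiv_at j \<phi> (\<xi> j) * (b t j - a j)) =
          (\<Sum>j<N. if j = i then pderiv_at i \<phi> (\<xi> i) * (t - y i) else 0)"
          by (intro sum.cong) (use i in \<open>auto simp: a_def b_def\<close>)
        then show ?thesis using i by (simp add: a_def b_def D_def)
      qed
      ultimately have "D (\<xi> N) * (\<theta> (y(i := t)) - \<theta> y) = - pderiv_at i \<phi> (\<xi> i) * (t - y i)"
        using \<xi>(3) by simp
      moreover have "\<xi> j \<in> cube (Suc N) y0 d" if "j < Suc N" for j using cu \<xi>(1,2) that by blast
      moreover have "D (\<xi> N) > 0" by (rule Dpos, rule cu) (use \<xi>(1,2) in auto)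
      ultimately have "P t \<xi>" unfolding P_def using \<xi>(1,2) by (auto simp: field_simps)
      then show ?thesis by (rule exI[of "P t"])
    qed
    define \<xi> where "\<xi> t = (SOME \<xi>. P t \<xi>)" for t
    have evP: "eventually (\<lambda>t. P t (\<xi> t)) (at (y i))"
      using evb evV by eventually_elim (unfold \<xi>_def, rule someI_ex[OF ex])
    have aU: "a \<in> U" using ac d by auto
    have lim: "((\<lambda>t. h (\<xi> t j)) \<longlongrightarrow> h a) (at (y i))" if "j < Suc N" "smooth_real (Suc N) U h" for j h
    proof (rule tendsto_squeeze_arg[OF U smooth_realD(2)[OF that(2), of 0] aU bl])
      show "\<forall>\<^sub>F t in at (y i). \<xi> t j \<in> topspace ?E1 \<and> (\<forall>l<Suc N. \<bar>\<xi> t j l - a l\<bar> \<le> \<bar>b t l - a l\<bar>)"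
        by (rule eventually_mono[OF evP]) (use that in \<open>simp add: P_def\<close>)
    qed
    have "D a \<noteq> 0" using Dpos[OF ac] by simp
    then have "((\<lambda>t. - (pderiv_at i \<phi> (\<xi> t i) * inverse (D (\<xi> t N)))) \<longlongrightarrow> G i y) (at (y i))"
      using i by (auto intro!: tendsto_eq_intros lim[OF _ smooth_real_pderiv[OF \<phi>]] lim[OF _ Dsm] simp:
          G_def a_def)
    then have "((\<lambda>t. (\<theta> (y(i := t)) - \<theta> y) / (t - y i)) \<longlongrightarrow> G i y) (at (y i))"
    proof (rule Lim_transform_eventually)
      show "\<forall>\<^sub>F t in at (y i). - (pderiv_at i \<phi> (\<xi> t i) * inverse (D (\<xi> t N))) = (\<theta> (y(i := t)) - \<theta> y) /
          (t - y i)"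
        using evP eventually_neq_at_within[of "y i" "y i" UNIV] by eventually_elim (simp add: P_def)
    qed
    then show ?thesis by (simp add: has_field_derivative_iff)
  qed
  \<comment> \<open>The formula for the derivatives contains \<open>\<theta>\<close> but no derivative of it, so each step gains
     one degree of differentiability.\<close>
  have "Ck_on N k V \<theta>" for k
  proof (induction k)
    case (Suc k)
    have *: "Ck_on N k V (\<lambda>y. h (y(N := \<theta> y)))" if h: "smooth_real (Suc N) U h" for h
    proof (rule Ck_on_compose[OF U V _ smooth_realD(2)[OF h]])
      show "Ck_on N k V (\<lambda>y. (y(N := \<theta> y)) j)" if "j < Suc N" for j
        using that Suc Ck_on_coord[OF V] by (cases "j = N") auto
    qed (use thU in auto)
    show ?case
    proof (rule Ck_on_SucI[OF V _ dth])
      fix i assume i: "i < N"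
      show "Ck_on N k V (G i)" unfolding G_def
        using Dpos[OF up[OF Vc thd]] i
        by (intro Ck_on_mult[OF V] Ck_on_inverse[OF V] Ck_on_const[OF V] * Dsm smooth_real_pderiv[OF \<phi>])
          (auto simp: less_imp_neq[THEN not_sym])
    qed (use cont in auto)
  qed (rule cont)
  then have "smooth_real N V \<theta>" using V by (simp add: smooth_real_def)
  moreover have "y(N := t) \<in> U \<and> (\<phi> (y(N := t)) = 0 \<longrightarrow> t = \<theta> y)" if "y \<in> V" "\<bar>t\<bar> < e" for y t
    using upU[OF Vc[OF that(1)], of t] uniq[OF that(1), of t "\<theta> y"] th[OF that(1)] thd[OF that(1)] that
        e by auto
  ultimately show ?thesis
    by (intro exI[of _ V] exI[of _ e] exI[of _ \<theta>]) (use th thU y0V e in auto)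
qed

section \<open>Local retractions onto the fibres of a map\<close>

definition head_coords :: "nat \<Rightarrow> (nat \<Rightarrow> real) \<Rightarrow> nat \<Rightarrow> real" where
  "head_coords n y = (\<lambda>i. if i < n then y i else 0)"

text \<open>
A point of the Cartesian space of dimension \<open>n + k\<close> is a pair: \<open>vjoin n\<close> is the pairing and
\<open>head_coords n\<close> the first projection.
\<close>

definition vjoin :: "nat \<Rightarrow> (nat \<Rightarrow> real) \<Rightarrow> (nat \<Rightarrow> real) \<Rightarrow> nat \<Rightarrow> real" where
  "vjoin n z c = (\<lambda>i. if i < n then z i else c (i - n))"

lemma head_coords_in: "head_coords n y \<in> topspace (Euclidean_space n)"
  by (simp add: head_coords_def topspace_Euclidean_space)

lemma head_coords_id: "y \<in> topspace (Euclidean_space n) \<Longrightarrow> head_coords n y = y"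
  by (auto simp: head_coords_def topspace_Euclidean_space fun_eq_iff)

lemma vjoin_in:
  "c \<in> topspace (Euclidean_space k) \<Longrightarrow> vjoin n z c \<in> topspace (Euclidean_space (n + k))"
  by (auto simp: vjoin_def topspace_Euclidean_space)

lemma head_coords_vjoin: "z \<in> topspace (Euclidean_space n) \<Longrightarrow> head_coords n (vjoin n z c) = z"
  by (auto simp: head_coords_def vjoin_def topspace_Euclidean_space fun_eq_iff)

lemma smooth_cartesian_id:
  "openin (Euclidean_space n) U \<Longrightarrow> smooth_cartesian n U n (\<lambda>x. x)"
  using openin_subset by (intro smooth_cartesianI smooth_real_coord) auto

lemma eventually_curve_in_open:
  assumes U: "openin (Euclidean_space n) U" "\<gamma> \<tau> \<in> U"
    and "\<And>t. \<gamma> t \<in> topspace (Euclidean_space n)"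
    and "\<And>i. i < n \<Longrightarrow> isCont (\<lambda>t. \<gamma> t i) \<tau>"
  shows "eventually (\<lambda>t. \<gamma> t \<in> U) (nhds \<tau>)"
proof -
  obtain d where d: "d > 0" "cube n (\<gamma> \<tau>) d \<subseteq> U" using U by (auto simp: openin_Euclidean_iff)
  have c: "((\<lambda>t. \<gamma> t i) \<longlongrightarrow> \<gamma> \<tau> i) (nhds \<tau>)" if "i < n" for i
    using assms(4)[OF that] tendsto_at_iff_tendsto_nhds[of "\<lambda>t. \<gamma> t i" \<tau>] by (simp add: isCont_def)
  have "eventually (\<lambda>t. \<gamma> t \<in> cube n (\<gamma> \<tau>) d) (nhds \<tau>)"
    by (rule eventually_cube[where x = "\<gamma> \<tau>", OF c]) (use assms(3) d in auto)
  then show ?thesis by (rule eventually_mono) (use d in auto)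
qed

text \<open>
Induction on the number \<open>k\<close> of components of \<open>F\<close> whose values are prescribed. Given a map that
moves points onto the joint fibres of the first \<open>k\<close> components, follow the direction \<open>e\<close> in
which, at \<open>z0\<close>, only component \<open>k\<close> changes, until that component has the prescribed value. The
required amount solves one equation with one unknown, so no matrices occur. The last conjunct
says that points which already lie on the prescribed fibre are not moved.
\<close>

lemma local_fibre_retraction:
  assumes F: "smooth_cartesian n \<Omega> m F" and z0: "z0 \<in> \<Omega>"
    and dir: "\<And>k. k < m \<Longrightarrow> \<exists>e\<in>topspace (Euclidean_space n). \<forall>l<m.
       (\<Sum>i<n. pderiv_at i (\<lambda>x. F x l) z0 * e i) = (if l = k then 1 else 0)"
    and "k \<le> m"
  shows "\<exists>\<Theta> \<rho>. smooth_cartesian (n + k) \<Theta> n \<rho> \<and> vjoin n z0 (head_coords k (F z0)) \<in> \<Theta> \<and>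
    (\<forall>y\<in>\<Theta>. \<rho> y \<in> \<Omega> \<and> (\<forall>l<k. F (\<rho> y) l = y (n + l)) \<and>
      (head_coords n y \<in> \<Omega> \<longrightarrow> (\<forall>l<k. F (head_coords n y) l = y (n + l)) \<longrightarrow> \<rho> y = head_coords n y))"
  using \<open>k \<le> m\<close>
proof (induction k)
  case 0
  have \<Omega>: "openin (Euclidean_space n) \<Omega>" "\<Omega> \<subseteq> topspace (Euclidean_space n)"
    using smooth_cartesianD(1)[OF F] openin_subset by auto
  have "vjoin n z0 (head_coords 0 (F z0)) = z0"
    using z0 \<Omega> by (auto simp: vjoin_def head_coords_def topspace_Euclidean_space fun_eq_iff)
  then show ?case
    by (intro exI[of _ \<Omega>] exI[of _ "\<lambda>x. x"])
      (use smooth_cartesian_id[OF \<Omega>(1)] z0 \<Omega> in \<open>auto simp: head_coords_id subset_iff\<close>)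
next
  case (Suc k)
  then have k: "k < m" by simp
  have \<Omega>: "openin (Euclidean_space n) \<Omega>" "\<Omega> \<subseteq> topspace (Euclidean_space n)"
    using smooth_cartesianD(1)[OF F] openin_subset by auto
  have z0E: "z0 \<in> topspace (Euclidean_space n)" using z0 \<Omega> by auto
  obtain e where e: "e \<in> topspace (Euclidean_space n)"
    "\<And>l. l < m \<Longrightarrow> (\<Sum>i<n. pderiv_at i (\<lambda>x. F x l) z0 * e i) = (if l = k then 1 else 0)"
    using dir[OF k] by auto
  obtain \<Theta> \<rho> where \<rho>: "smooth_cartesian (n + k) \<Theta> n \<rho>" "vjoin n z0 (head_coords k (F z0)) \<in> \<Theta>"
    "\<And>y. y \<in> \<Theta> \<Longrightarrow> \<rho> y \<in> \<Omega>" "\<And>y l. y \<in> \<Theta> \<Longrightarrow> l < k \<Longrightarrow> F (\<rho> y) l = y (n + l)"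
    "\<And>y. y \<in> \<Theta> \<Longrightarrow> head_coords n y \<in> \<Omega> \<Longrightarrow> (\<And>l. l < k \<Longrightarrow> F (head_coords n y) l = y (n + l))
        \<Longrightarrow> \<rho> y = head_coords n y"
    using Suc by auto
  have \<Theta>: "openin (Euclidean_space (n + k)) \<Theta>" by (rule smooth_cartesianD(1)[OF \<rho>(1)])
  define N where "N = Suc (n + k)"
  \<comment> \<open>The coordinate with index \<open>N\<close> is the amount by which the point moves in the direction
     \<open>e\<close>; the coordinates between \<open>n\<close> and \<open>N\<close> are the prescribed values, of which the given
     map uses the first \<open>k\<close>.\<close>
  define A where "A y = (\<lambda>i. if i < n then y i + y N * e i else if i < n + k then y i else 0)" for y
  have A_sm: "smooth_cartesian (Suc N) (topspace (Euclidean_space (Suc N))) (n + k) A"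
  proof (rule smooth_cartesianI)
    fix j
    show "smooth_real (Suc N) (topspace (Euclidean_space (Suc N))) (\<lambda>x. A x j)"
      by (cases "j < n"; cases "j < n + k")
        (auto simp: A_def intro!: smooth_real_add smooth_real_mult smooth_real_coord smooth_real_const)
    show "A x \<in> topspace (Euclidean_space (n + k))" for x
      by (simp add: A_def topspace_Euclidean_space)
  qed (rule openin_topspace)
  define U where "U = {y \<in> topspace (Euclidean_space (Suc N)). A y \<in> \<Theta>}"
  have U: "openin (Euclidean_space (Suc N)) U"
    unfolding U_def by (rule openin_smooth_preimage[OF A_sm \<Theta>])
  have A_smU: "smooth_cartesian (Suc N) U (n + k) A"
    by (rule smooth_cartesian_mono[OF A_sm U]) (simp add: U_def)
  have \<rho>A_sm: "smooth_cartesian (Suc N) U n (\<lambda>y. \<rho> (A y))"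
    by (rule smooth_cartesian_compose[OF \<rho>(1) A_smU]) (auto simp: U_def)
  define g where "g w = F (\<rho> w) k" for w
  have g_sm: "smooth_real (n + k) \<Theta> g"
    unfolding g_def by (rule smooth_real_compose[OF smooth_cartesianD(3)[OF F] \<rho>(1)]) (use \<rho>(3) in auto)
  define \<phi> where "\<phi> y = g (A y) - y (n + k)" for y
  have \<phi>_sm: "smooth_real (Suc N) U \<phi>"
    unfolding \<phi>_def
    by (intro smooth_real_diff smooth_real_coord U smooth_real_compose[OF g_sm A_smU]) (auto simp:
        U_def)
  define y0 where "y0 = vjoin n z0 (head_coords (Suc k) (F z0))"
  have y0E: "y0 \<in> topspace (Euclidean_space N)"
    using vjoin_in[OF head_coords_in, of n z0 "Suc k"] by (simp add: y0_def N_def)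
  then have y0E': "y0 \<in> topspace (Euclidean_space (Suc N))" by (auto simp: topspace_Euclidean_space)
  have A0: "A y0 = vjoin n z0 (head_coords k (F z0))"
    by (auto simp: A_def y0_def vjoin_def head_coords_def N_def fun_eq_iff)
  have y0U: "y0 \<in> U" using \<rho>(2) y0E' A0 by (simp add: U_def)
  have \<rho>0: "\<rho> (A y0) = z0"
    using \<rho>(5)[OF \<rho>(2)] z0 by (simp add: A0 head_coords_vjoin[OF z0E]) (simp add: vjoin_def
        head_coords_def)
  have \<phi>0: "\<phi> y0 = 0" by (simp add: \<phi>_def g_def \<rho>0) (simp add: y0_def vjoin_def head_coords_def)
  have y0N: "y0 N = 0" using y0E by (auto simp: topspace_Euclidean_space)
  define \<alpha>' where "\<alpha>' i = (if i < n then e i else 0)" for i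
  let ?S = "\<Sum>i<n+k. pderiv_at i g (vjoin n z0 (head_coords k (F z0))) * \<alpha>' i"
  define l where "l t = (\<lambda>i. z0 i + t * e i)" for t
  have lE: "l t \<in> topspace (Euclidean_space n)" for t
    using z0E e(1) by (auto simp: l_def topspace_Euclidean_space)
  have l0: "l 0 = z0" by (auto simp: l_def)
  have ldiff: "((\<lambda>t. l t i) has_real_derivative e i) (at t)" for t i
    unfolding l_def by (auto intro!: derivative_eq_intros)
  have lev: "eventually (\<lambda>t. l t \<in> \<Omega>) (nhds 0)"
    by (rule eventually_curve_in_open[OF \<Omega>(1)]) (use lE l0 z0 DERIV_isCont[OF ldiff] in auto)
  have Fl: "((\<lambda>t. F (l t) j) has_real_derivative (if j = k then 1 else 0)) (at 0)" if "j < m" for j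
    using smooth_real_chain_curve[OF smooth_cartesianD(3)[OF F] lev ldiff, of j] e(2)[OF that] l0
      by simp
  \<comment> \<open>Along \<open>\<beta>\<close> the prescribed values are the actual ones, so that \<open>\<rho>\<close> returns the moved point
     \<open>l t\<close>. To first order only component \<open>k\<close> changes along \<open>l\<close>, so \<open>\<beta>\<close> and the line with
     constant prescribed values have the same derivative.\<close>
  have S1: "?S = 1"
  proof -
    define \<beta> where "\<beta> t = vjoin n (l t) (head_coords k (F (l t)))" for t
    have \<beta>0: "\<beta> 0 = vjoin n z0 (head_coords k (F z0))" by (simp add: \<beta>_def l0)
    have d\<beta>: "((\<lambda>t. \<beta> t i) has_real_derivative \<alpha>' i) (at 0)" if "i < n + k" for i
    proof (cases "i < n")
      case False
      then have "i - n < k" "i - n < m" using that k by auto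
      with Fl[OF this(2)] False show ?thesis by (simp add: \<beta>_def vjoin_def head_coords_def \<alpha>'_def)
    qed (use ldiff in \<open>simp add: \<beta>_def vjoin_def \<alpha>'_def\<close>)
    have ev\<beta>: "eventually (\<lambda>t. \<beta> t \<in> \<Theta>) (nhds 0)"
      by (rule eventually_curve_in_open[OF \<Theta>])
        (use \<beta>0 \<rho>(2) DERIV_isCont[OF d\<beta>] in \<open>auto simp: \<beta>_def intro!: vjoin_in head_coords_in\<close>)
    have "((\<lambda>t. g (\<beta> t)) has_real_derivative ?S) (at 0)"
      using smooth_real_chain_curve[OF g_sm ev\<beta> d\<beta>] by (simp add: \<beta>0)
    moreover have "eventually (\<lambda>t. g (\<beta> t) = F (l t) k) (nhds 0)"
      using ev\<beta> lev
    proof eventually_elim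
      case (elim t)
      have c: "head_coords n (\<beta> t) = l t" unfolding \<beta>_def by (rule head_coords_vjoin[OF lE])
      have "\<rho> (\<beta> t) = l t"
        using \<rho>(5)[OF elim(1)] elim(2) unfolding c by (simp add: \<beta>_def vjoin_def head_coords_def)
      then show ?case by (simp add: g_def)
    qed
    ultimately have "((\<lambda>t. F (l t) k) has_real_derivative ?S) (at 0)"
      by (subst (asm) DERIV_cong_ev[OF refl _ refl]) auto
    from DERIV_unique[OF this Fl[OF k]] show ?thesis by simp
  qed
  have pd: "pderiv_at N \<phi> y0 = 1"
  proof -
    define \<gamma> where "\<gamma> t = A (y0(N := t))" for t
    have \<gamma>i: "\<gamma> t i = (if i < n then z0 i + t * e i else if i < n + k then y0 i else 0)" for t i
      by (auto simp: \<gamma>_def A_def y0_def vjoin_def N_def)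
    have \<gamma>0: "\<gamma> 0 = vjoin n z0 (head_coords k (F z0))"
      using y0N A0 by (simp add: \<gamma>_def fun_upd_idem)
    have d\<gamma>: "((\<lambda>t. \<gamma> t i) has_real_derivative \<alpha>' i) (at t)" for t i
      unfolding \<gamma>i \<alpha>'_def by (auto intro!: derivative_eq_intros)
    have ev: "eventually (\<lambda>t. \<gamma> t \<in> \<Theta>) (nhds 0)"
      by (rule eventually_curve_in_open[OF \<Theta>])
        (use \<gamma>0 \<rho>(2) DERIV_isCont[OF d\<gamma>] \<gamma>i in \<open>auto simp: topspace_Euclidean_space\<close>)
    have "((\<lambda>t. g (\<gamma> t)) has_real_derivative ?S) (at 0)"
      using smooth_real_chain_curve[OF g_sm ev d\<gamma>] by (simp add: \<gamma>0)
    then have "((\<lambda>t. g (\<gamma> t) - y0 (n + k)) has_real_derivative 1) (at 0)"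
      using S1 by (auto intro!: derivative_eq_intros)
    moreover have "(\<lambda>t. \<phi> (y0(N := t))) = (\<lambda>t. g (\<gamma> t) - y0 (n + k))"
      by (simp add: \<phi>_def \<gamma>_def N_def fun_eq_iff)
    ultimately show ?thesis unfolding pderiv_at_def y0N by (simp add: DERIV_imp_deriv)
  qed
  have pos: "0 < pderiv_at N \<phi> y0" by (simp add: pd)
  obtain V \<epsilon> \<theta> where *: "y0 \<in> V \<and> 0 < \<epsilon> \<and> smooth_real N V \<theta> \<and>
    (\<forall>y\<in>V. \<bar>\<theta> y\<bar> < \<epsilon> \<and> y(N := \<theta> y) \<in> U \<and> \<phi> (y(N := \<theta> y)) = 0 \<and>
      (\<forall>t. \<bar>t\<bar> < \<epsilon> \<longrightarrow> y(N := t) \<in> U \<and> (\<phi> (y(N := t)) = 0 \<longrightarrow> t = \<theta> y)))"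
    using implicit_function_pos[OF \<phi>_sm y0E y0U \<phi>0 pos] by (elim exE)
  from * have V: "y0 \<in> V" "0 < \<epsilon>" "smooth_real N V \<theta>" by simp_all
  from * have th: "\<And>y. y \<in> V \<Longrightarrow> y(N := \<theta> y) \<in> U \<and> \<phi> (y(N := \<theta> y)) = 0"
      "\<And>y t. y \<in> V \<Longrightarrow> \<bar>t\<bar> < \<epsilon> \<Longrightarrow> y(N := t) \<in> U \<and> (\<phi> (y(N := t)) = 0 \<longrightarrow> t = \<theta> y)"
    by simp_all
  have VE: "openin (Euclidean_space N) V" "V \<subseteq> topspace (Euclidean_space N)"
    using smooth_realD(1)[OF V(3)] openin_subset by auto
  define \<rho>' where "\<rho>' y = \<rho> (A (y(N := \<theta> y)))" for y
  have "smooth_cartesian N V n \<rho>'" unfolding \<rho>'_def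
    by (rule smooth_cartesian_compose[OF \<rho>A_sm smooth_cartesian_upd[OF VE(1) V(3)]]) (use th in auto)
  moreover have "\<rho>' y \<in> \<Omega> \<and> (\<forall>l<Suc k. F (\<rho>' y) l = y (n + l)) \<and>
      (head_coords n y \<in> \<Omega> \<longrightarrow> (\<forall>l<Suc k. F (head_coords n y) l = y (n + l))
          \<longrightarrow> \<rho>' y = head_coords n y)" if y: "y \<in> V" for y
  proof (intro conjI impI allI)
    let ?y = "y(N := \<theta> y)"
    have A\<Theta>: "A ?y \<in> \<Theta>" using th(1)[OF y] by (simp add: U_def)
    then show "\<rho>' y \<in> \<Omega>" unfolding \<rho>'_def by (rule \<rho>(3))
    show "F (\<rho>' y) l = y (n + l)" if "l < Suc k" for l
    proof (cases "l < k")
      case True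
      then show ?thesis using \<rho>(4)[OF A\<Theta> True] by (simp add: \<rho>'_def A_def N_def)
    next
      case False
      then have "l = k" using that by simp
      then show ?thesis using th(1)[OF y] by (simp add: \<phi>_def g_def \<rho>'_def N_def)
    qed
    assume c: "head_coords n y \<in> \<Omega>" "\<forall>l<Suc k. F (head_coords n y) l = y (n + l)"
    have yN: "y N = 0" "y(N := 0) = y" using y VE(2) by (auto simp: topspace_Euclidean_space fun_eq_iff)
    have y\<Theta>: "A y \<in> \<Theta>" using th(2)[OF y, of 0] V(2) yN by (simp add: U_def)
    have cA: "head_coords n (A y) = head_coords n y" by (auto simp: head_coords_def A_def yN)
    have "\<rho> (A y) = head_coords n y"
      using \<rho>(5)[OF y\<Theta>] c unfolding cA by (simp add: A_def)
    moreover from this have "\<phi> (y(N := 0)) = 0" using c(2) yN by (simp add: \<phi>_def g_def)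
    then have "\<theta> y = 0" using th(2)[OF y, of 0] V(2) by simp
    ultimately show "\<rho>' y = head_coords n y" using yN by (simp add: \<rho>'_def)
  qed
  ultimately show ?case using V(1)
    by (intro exI[of _ V] exI[of _ \<rho>']) (simp add: N_def y0_def)
qed

section \<open>Manifolds as diffeological spaces\<close>

lemma continuous_map_openin_iff:
  assumes "openin S U"
  shows "continuous_map (subtopology S U) T p \<longleftrightarrow>
    p ` U \<subseteq> topspace T \<and> (\<forall>W. openin T W \<longrightarrow> openin S {u \<in> U. p u \<in> W})"
proof -
  have "topspace (subtopology S U) = U" using openin_subset[OF assms] by auto
  then show ?thesis
    by (auto simp: continuous_map_def openin_open_subtopology[OF assms] Pi_iff image_subset_iff)
qed

lemma diffeological_spaceD:
  assumes "diffeological_space D"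
  shows "plot D n U p \<Longrightarrow> openin (Euclidean_space n) U"
    "plot D n U p \<Longrightarrow> u \<in> U \<Longrightarrow> p u \<in> points D"
    "plot D n U p \<Longrightarrow> (\<And>u. u \<in> U \<Longrightarrow> p u = q u) \<Longrightarrow> plot D n U q"
    "openin (Euclidean_space n) U \<Longrightarrow> x \<in> points D \<Longrightarrow> plot D n U (\<lambda>_. x)"
    "plot D n U p \<Longrightarrow> smooth_cartesian m V n f \<Longrightarrow> f ` V \<subseteq> U \<Longrightarrow> plot D m V (\<lambda>v. p (f v))"
    "(\<And>u. u \<in> U \<Longrightarrow> \<exists>W. u \<in> W \<and> W \<subseteq> U \<and> plot D n W p) \<Longrightarrow> plot D n U p"
proof -
  note * = assms[unfolded diffeological_space_def]
  note ax1 = *[THEN conjunct1, rule_format]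
  note ax2 = *[THEN conjunct2, THEN conjunct1, rule_format]
  note ax3 = *[THEN conjunct2, THEN conjunct2, THEN conjunct1, rule_format]
  note ax4 = *[THEN conjunct2, THEN conjunct2, THEN conjunct2, THEN conjunct1, rule_format]
  note ax5 = *[THEN conjunct2, THEN conjunct2, THEN conjunct2, THEN conjunct2, rule_format]
  show op: "plot D n U p \<Longrightarrow> openin (Euclidean_space n) U" for n U p by (rule ax1[THEN conjunct1])
  show "plot D n U p \<Longrightarrow> u \<in> U \<Longrightarrow> p u \<in> points D"
    by (rule subsetD[OF ax1[THEN conjunct2]]) auto
  show "plot D n U p \<Longrightarrow> (\<And>u. u \<in> U \<Longrightarrow> p u = q u) \<Longrightarrow> plot D n U q"
    by (rule ax2[of n U p]) simp
  show "openin (Euclidean_space n) U \<Longrightarrow> x \<in> points D \<Longrightarrow> plot D n U (\<lambda>_. x)"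
    by (rule ax3) simp
  show "plot D n U p \<Longrightarrow> smooth_cartesian m V n f \<Longrightarrow> f ` V \<subseteq> U \<Longrightarrow> plot D m V (\<lambda>v. p (f v))"
    using ax4[of n U p m V f] by (simp add: o_def)
  assume l: "\<And>u. u \<in> U \<Longrightarrow> \<exists>W. u \<in> W \<and> W \<subseteq> U \<and> plot D n W p"
  have U: "openin (Euclidean_space n) U"
  proof (subst openin_subopen, intro ballI)
    fix u assume "u \<in> U"
    from l[OF this] obtain W where "u \<in> W" "W \<subseteq> U" "plot D n W p" by (elim exE conjE)
    then show "\<exists>T. openin (Euclidean_space n) T \<and> u \<in> T \<and> T \<subseteq> U" using op by (intro exI[of _ W]) simp
  qed
  show "plot D n U p"
  proof (rule ax5, intro conjI ballI U)
    fix u assume "u \<in> U"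
    from l[OF this] obtain W where "u \<in> W" "W \<subseteq> U" "plot D n W p" by (elim exE conjE)
    then show "\<exists>W. openin (Euclidean_space n) W \<and> u \<in> W \<and> W \<subseteq> U \<and> plot D n W p"
      using op by (intro exI[of _ W]) simp
  qed
qed

lemma diffeological_spaceI:
  assumes op: "\<And>n U p. plot D n U p \<Longrightarrow> openin (Euclidean_space n) U"
    and pt: "\<And>n U p u. plot D n U p \<Longrightarrow> u \<in> U \<Longrightarrow> p u \<in> points D"
    and cong: "\<And>n U p q. plot D n U p \<Longrightarrow> (\<And>u. u \<in> U \<Longrightarrow> p u = q u) \<Longrightarrow> plot D n U q"
    and const: "\<And>n U x. openin (Euclidean_space n) U \<Longrightarrow> x \<in> points D \<Longrightarrow> plot D n U (\<lambda>_. x)"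
    and comp: "\<And>n U p m V f. plot D n U p \<Longrightarrow> smooth_cartesian m V n f \<Longrightarrow> f ` V \<subseteq> U
        \<Longrightarrow> plot D m V (\<lambda>v. p (f v))"
    and loc: "\<And>n U p. openin (Euclidean_space n) U \<Longrightarrow>
       (\<And>u. u \<in> U \<Longrightarrow> \<exists>W. openin (Euclidean_space n) W \<and> u \<in> W \<and> W \<subseteq> U \<and> plot D n W p) \<Longrightarrow> plot D n U p"
  shows "diffeological_space D"
  unfolding diffeological_space_def
proof (intro conjI allI impI)
  fix n U p assume "plot D n U p"
  then show "openin (Euclidean_space n) U" "p ` U \<subseteq> points D" by (auto intro: op pt)
next
  fix n U p q assume "plot D n U p \<and> (\<forall>u\<in>U. p u = q u)"
  then show "plot D n U q" by (intro cong[of n U p q]) auto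
next
  fix n U x assume "openin (Euclidean_space n) U \<and> x \<in> points D"
  then show "plot D n U (\<lambda>_. x)" by (intro const) auto
next
  fix n U p m V f assume "plot D n U p \<and> smooth_cartesian m V n f \<and> f ` V \<subseteq> U"
  then show "plot D m V (p \<circ> f)" unfolding o_def by (intro comp[of n U p m V f]) auto
next
  fix n U p
  assume "openin (Euclidean_space n) U \<and>
        (\<forall>u\<in>U. \<exists>W. openin (Euclidean_space n) W \<and> u \<in> W \<and> W \<subseteq> U \<and> plot D n W p)"
  then show "plot D n U p" by (intro loc) auto
qed

lemma plot_restrict:
  assumes D: "diffeological_space D" "plot D n U p" "openin (Euclidean_space n) W" "W \<subseteq> U"
  shows "plot D n W p"
  using diffeological_spaceD(5)[OF D(1,2) smooth_cartesian_id[OF D(3)]] D(4) by auto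

lemma mdiff_points [simp]: "points (mdiff X) = mpoints X"
  by (simp add: mdiff_def)

lemma mdiff_plot_iff:
  "plot (mdiff X) n U p \<longleftrightarrow> openin (Euclidean_space n) U \<and>
     (\<forall>u\<in>U. p u \<in> mpoints X) \<and>
     (\<forall>W. openin (mtop X) W \<longrightarrow> openin (Euclidean_space n) {u \<in> U. p u \<in> W}) \<and>
     (\<forall>m D \<phi>. (m, D, \<phi>) \<in> atlas X \<longrightarrow> smooth_cartesian n {u \<in> U. p u \<in> D} m (\<lambda>u. \<phi> (p u)))"
  unfolding mdiff_def
  by (auto simp: continuous_map_openin_iff o_def image_subset_iff)

lemma mplot_open: "plot (mdiff X) n U p \<Longrightarrow> openin (Euclidean_space n) U"
  and mplot_point: "plot (mdiff X) n U p \<Longrightarrow> u \<in> U \<Longrightarrow> p u \<in> mpoints X"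
  and mplot_preimage: "plot (mdiff X) n U p \<Longrightarrow> openin (mtop X) W \<Longrightarrow> openin (Euclidean_space n) {u \<in> U. p u
      \<in> W}"
  and mplot_chart: "plot (mdiff X) n U p \<Longrightarrow> (m, D, \<phi>) \<in> atlas X \<Longrightarrow>
     smooth_cartesian n {u \<in> U. p u \<in> D} m (\<lambda>u. \<phi> (p u))"
  by (simp_all add: mdiff_plot_iff)

context
  fixes X :: "'x manifold"
  assumes X: "smooth_manifold X"
begin

lemma chart_facts:
  assumes "(n, D, \<phi>) \<in> atlas X"
  shows "openin (mtop X) D" "D \<subseteq> mpoints X" "openin (Euclidean_space n) (\<phi> ` D)" "inj_on \<phi> D"
    "homeomorphic_map (subtopology (mtop X) D) (subtopology (Euclidean_space n) (\<phi> ` D)) \<phi>"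
    "\<And>x. x \<in> D \<Longrightarrow> \<phi> x \<in> topspace (Euclidean_space n)"
proof -
  show D: "openin (mtop X) D" and o: "openin (Euclidean_space n) (\<phi> ` D)"
    and h: "homeomorphic_map (subtopology (mtop X) D) (subtopology (Euclidean_space n) (\<phi> ` D)) \<phi>"
    using X assms unfolding smooth_manifold_def by fast+
  show "D \<subseteq> mpoints X" by (rule openin_subset[OF D])
  then show "inj_on \<phi> D" using homeomorphic_imp_injective_map[OF h] by (simp add: Int_absorb1)
  show "\<And>x. x \<in> D \<Longrightarrow> \<phi> x \<in> topspace (Euclidean_space n)" using openin_subset[OF o] by auto
qed

lemma chart_at:
  assumes "x \<in> mpoints X"
  obtains n D \<phi> where "(n, D, \<phi>) \<in> atlas X" "x \<in> D"
proof -
  have "mpoints X = (\<Union>(n, D, \<phi>)\<in>atlas X. D)" using X by (simp add: smooth_manifold_def)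
  with assms show ?thesis using that by auto
qed

lemma chart_preimage_open:
  assumes c: "(n, D, \<phi>) \<in> atlas X" and O: "openin (Euclidean_space n) O'"
  shows "openin (mtop X) {x \<in> D. \<phi> x \<in> O'}"
proof -
  have "continuous_map (subtopology (mtop X) D) (Euclidean_space n) \<phi>"
    using homeomorphic_imp_continuous_map[OF chart_facts(5)[OF c]]
    by (simp add: continuous_map_in_subtopology)
  then show ?thesis
    unfolding continuous_map_openin_iff[OF chart_facts(1)[OF c]] using O by blast
qed

lemma chart_image_open:
  assumes c: "(n, D, \<phi>) \<in> atlas X" and W: "openin (mtop X) W"
  shows "openin (Euclidean_space n) {u \<in> \<phi> ` D. inv_into D \<phi> u \<in> W}"
proof -
  have "openin (subtopology (Euclidean_space n) (\<phi> ` D)) (\<phi> ` (D \<inter> W))"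
    by (rule homeomorphic_imp_open_map[OF chart_facts(5)[OF c], unfolded open_map_def, rule_format])
      (use W chart_facts(1)[OF c] in \<open>auto simp: openin_open_subtopology\<close>)
  then have "openin (Euclidean_space n) (\<phi> ` (D \<inter> W))"
    using chart_facts(3)[OF c] by (simp add: openin_open_subtopology)
  moreover have "\<phi> ` (D \<inter> W) = {u \<in> \<phi> ` D. inv_into D \<phi> u \<in> W}"
    using chart_facts(4)[OF c] by (auto simp: inv_into_f_f)
  ultimately show ?thesis by simp
qed

lemma diffeological_space_mdiff: "diffeological_space (mdiff X)"
proof (rule diffeological_spaceI)
  fix n U p
  assume p: "plot (mdiff X) n U p"
  then show "openin (Euclidean_space n) U" by (simp add: mdiff_plot_iff)
  show "p u \<in> points (mdiff X)" if "u \<in> U" for u using p that by (simp add: mdiff_plot_iff)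
  show "plot (mdiff X) n U q" if q: "\<And>u. u \<in> U \<Longrightarrow> p u = q u" for q
  proof -
    have "{u \<in> U. q u \<in> W} = {u \<in> U. p u \<in> W}" for W using q by auto
    moreover have "smooth_cartesian n {u \<in> U. p u \<in> D} m (\<lambda>u. \<phi> (q u))" if "(m, D, \<phi>) \<in> atlas X"
        for m D \<phi>
    proof (rule smooth_cartesian_cong)
      show "smooth_cartesian n {u \<in> U. p u \<in> D} m (\<lambda>u. \<phi> (p u))"
        using p that by (simp add: mdiff_plot_iff)
    qed (simp add: q)
    ultimately show ?thesis using p q unfolding mdiff_plot_iff by simp
  qed
  show "plot (mdiff X) m V (\<lambda>v. p (f v))" if f: "smooth_cartesian m V n f" "f ` V \<subseteq> U" for m V f
  proof -
    have eq: "{v \<in> V. p (f v) \<in> W} = {v \<in> V. f v \<in> {u \<in> U. p u \<in> W}}" for W using f(2) by auto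
    have o: "openin (Euclidean_space m) {v \<in> V. p (f v) \<in> W}" if "openin (mtop X) W" for W
      unfolding eq by (rule openin_smooth_preimage[OF f(1)]) (use p that in \<open>simp add: mdiff_plot_iff\<close>)
    have "smooth_cartesian m {v \<in> V. p (f v) \<in> D} k (\<lambda>v. \<phi> (p (f v)))" if "(k, D, \<phi>) \<in> atlas X"
        for k D \<phi>
    proof (rule smooth_cartesian_compose[of n "{u \<in> U. p u \<in> D}" k "\<lambda>u. \<phi> (p u)" m _ f])
      show "smooth_cartesian n {u \<in> U. p u \<in> D} k (\<lambda>u. \<phi> (p u))" using p that
        by (simp add: mdiff_plot_iff)
      show "smooth_cartesian m {v \<in> V. p (f v) \<in> D} n f"
        by (rule smooth_cartesian_mono[OF f(1) o]) (use chart_facts[OF that] in auto)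
    qed (use f in auto)
    then show ?thesis using o smooth_cartesianD(1)[OF f(1)] p f(2) by (auto simp: mdiff_plot_iff)
  qed
next
  fix n :: nat and U x
  assume U: "openin (Euclidean_space n) U" and x: "x \<in> points (mdiff X)"
  have "openin (Euclidean_space n) {u \<in> U. x \<in> W}" for W using U by (cases "x \<in> W") auto
  moreover have "smooth_cartesian n {u \<in> U. x \<in> D} m (\<lambda>u. \<phi> x)" if "(m, D, \<phi>) \<in> atlas X" for m D \<phi>
    using chart_facts(6)[OF that] calculation by (intro smooth_cartesianI smooth_real_const) auto
  ultimately show "plot (mdiff X) n U (\<lambda>_. x)" using U x by (simp add: mdiff_plot_iff)
next
  fix n :: nat and U p
  assume U: "openin (Euclidean_space n) U"
    and loc: "\<And>u. u \<in> U \<Longrightarrow> \<exists>W. openin (Euclidean_space n) W \<and> u \<in> W \<and> W \<subseteq> U \<and> plot (mdiff X) n W p"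
  have o: "openin (Euclidean_space n) {u \<in> U. p u \<in> V}" if V: "openin (mtop X) V" for V
  proof (subst openin_subopen, intro ballI)
    fix u assume u: "u \<in> {u \<in> U. p u \<in> V}"
    then obtain W where W: "u \<in> W" "W \<subseteq> U" "plot (mdiff X) n W p"
      using loc[of u] by (elim CollectE conjE) (drule (1) meta_mp, elim exE conjE, rule that)
    show "\<exists>T. openin (Euclidean_space n) T \<and> u \<in> T \<and> T \<subseteq> {u \<in> U. p u \<in> V}"
      by (rule exI[of _ "{w \<in> W. p w \<in> V}"]) (use W V u in \<open>auto simp: mdiff_plot_iff\<close>)
  qed
  have "smooth_cartesian n {u \<in> U. p u \<in> D} m (\<lambda>u. \<phi> (p u))" if c: "(m, D, \<phi>) \<in> atlas X" for m D \<phi>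
  proof (rule smooth_cartesian_local)
    fix u assume u: "u \<in> {u \<in> U. p u \<in> D}"
    then obtain W where W: "u \<in> W" "W \<subseteq> U" "plot (mdiff X) n W p"
      using loc[of u] by (elim CollectE conjE) (drule (1) meta_mp, elim exE conjE, rule that)
    show "\<exists>W. u \<in> W \<and> W \<subseteq> {u \<in> U. p u \<in> D} \<and> smooth_cartesian n W m (\<lambda>u. \<phi> (p u))"
      by (rule exI[of _ "{w \<in> W. p w \<in> D}"]) (use W u c in \<open>auto simp: mdiff_plot_iff\<close>)
  qed
  moreover have "p u \<in> mpoints X" if "u \<in> U" for u
  proof -
    from loc[OF that] obtain W where "u \<in> W" "plot (mdiff X) n W p" by (elim exE conjE)
    then show ?thesis by (simp add: mdiff_plot_iff)
  qed
  ultimately show "plot (mdiff X) n U p" using U o by (simp add: mdiff_plot_iff)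
qed

lemmas mplot_cong = diffeological_spaceD(3)[OF diffeological_space_mdiff]
  and mplot_const = diffeological_spaceD(4)[OF diffeological_space_mdiff, unfolded mdiff_points]
  and mplot_compose = diffeological_spaceD(5)[OF diffeological_space_mdiff]
  and mplot_local = diffeological_spaceD(6)[OF diffeological_space_mdiff]
  and mplot_restrict = plot_restrict[OF diffeological_space_mdiff]

lemma chart_inverse_plot:
  assumes c: "(n, D, \<phi>) \<in> atlas X"
  shows "plot (mdiff X) n (\<phi> ` D) (inv_into D \<phi>)"
  unfolding mdiff_plot_iff
proof (intro conjI ballI allI impI)
  show "inv_into D \<phi> u \<in> mpoints X" if "u \<in> \<phi> ` D" for u
    using inv_into_into[OF that] chart_facts(2)[OF c] by auto
  fix m E \<psi> assume d: "(m, E, \<psi>) \<in> atlas X"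
  have "smooth_cartesian n (\<phi> ` (D \<inter> E)) m (\<psi> \<circ> inv_into D \<phi>)"
    using X c d unfolding smooth_manifold_def by fast
  moreover have "\<phi> ` (D \<inter> E) = {u \<in> \<phi> ` D. inv_into D \<phi> u \<in> E}"
    using chart_facts(4)[OF c] by (auto simp: inv_into_f_f)
  ultimately show "smooth_cartesian n {u \<in> \<phi> ` D. inv_into D \<phi> u \<in> E} m (\<lambda>u. \<psi> (inv_into D \<phi> u))"
    by (simp add: o_def)
qed (use chart_image_open[OF c] chart_facts(3)[OF c] in auto)

end

text \<open>
Smoothness on an open set is tested on plots. This makes composition with smooth maps immediate;
\<open>smooth_near_iff\<close> gives the comparison with the description in charts.
\<close>

definition smooth_on :: "'x manifold \<Rightarrow> 'x set \<Rightarrow> ('x \<Rightarrow> real) \<Rightarrow> bool" where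
  "smooth_on X W f \<longleftrightarrow> openin (mtop X) W \<and>
     (\<forall>n U p. plot (mdiff X) n U p \<longrightarrow> p ` U \<subseteq> W \<longrightarrow> smooth_real n U (\<lambda>u. f (p u)))"

lemma smooth_onD:
  assumes "smooth_on X W f"
  shows "openin (mtop X) W" "plot (mdiff X) n U p \<Longrightarrow> p ` U \<subseteq> W \<Longrightarrow> smooth_real n U (\<lambda>u. f (p u))"
  using assms by (auto simp: smooth_on_def)

lemma smooth_on_preimage:
  assumes X: "smooth_manifold X" and f: "smooth_on X W f" and p: "plot (mdiff X) n U p"
  shows "smooth_real n {u \<in> U. p u \<in> W} (\<lambda>u. f (p u))"
  by (rule smooth_onD(2)[OF f mplot_restrict[OF X p mplot_preimage[OF p smooth_onD(1)[OF f]]]]) auto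

text \<open>
Inverse charts are plots, and a plot in the domain of a chart is an inverse chart after a smooth
map.
\<close>

lemma smooth_near_iff:
  assumes X: "smooth_manifold X"
  shows "smooth_near X x f \<longleftrightarrow> (\<exists>W. x \<in> W \<and> smooth_on X W f)"
proof
  assume "smooth_near X x f"
  then obtain W where W: "openin (mtop X) W" "x \<in> W"
    "\<And>n D \<phi>. (n, D, \<phi>) \<in> atlas X \<Longrightarrow> smooth_real n (\<phi> ` (D \<inter> W)) (f \<circ> inv_into D \<phi>)"
    unfolding smooth_near_def by fast
  have "smooth_real n U (\<lambda>u. f (p u))" if p: "plot (mdiff X) n U p" "p ` U \<subseteq> W" for n U p
  proof (rule smooth_real_local)
    fix u assume u: "u \<in> U"
    obtain m D \<phi> where c: "(m, D, \<phi>) \<in> atlas X" "p u \<in> D"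
      using chart_at[OF X mplot_point[OF p(1) u]] .
    have "smooth_real n {u \<in> U. p u \<in> D} (\<lambda>u. (f \<circ> inv_into D \<phi>) (\<phi> (p u)))"
      by (rule smooth_real_compose[OF W(3)[OF c(1)] mplot_chart[OF p(1) c(1)]]) (use p in auto)
    then have "smooth_real n {u \<in> U. p u \<in> D} (\<lambda>u. f (p u))"
      by (rule smooth_real_cong) (simp add: inv_into_f_f[OF chart_facts(4)[OF X c(1)]])
    then show "\<exists>W. u \<in> W \<and> W \<subseteq> U \<and> smooth_real n W (\<lambda>u. f (p u))"
      using u c by (intro exI[of _ "{u \<in> U. p u \<in> D}"]) auto
  qed
  then show "\<exists>W. x \<in> W \<and> smooth_on X W f"
    using W by (intro exI[of _ W]) (simp add: smooth_on_def)
next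
  assume "\<exists>W. x \<in> W \<and> smooth_on X W f"
  then obtain W where W: "x \<in> W" "smooth_on X W f" by auto
  have "smooth_real n (\<phi> ` (D \<inter> W)) (f \<circ> inv_into D \<phi>)" if c: "(n, D, \<phi>) \<in> atlas X" for n D \<phi>
  proof -
    have "\<phi> ` (D \<inter> W) = {u \<in> \<phi> ` D. inv_into D \<phi> u \<in> W}"
      using chart_facts(4)[OF X c] by (auto simp: inv_into_f_f)
    then show ?thesis
      using smooth_on_preimage[OF X W(2) chart_inverse_plot[OF X c]] by (simp add: o_def)
  qed
  then show "smooth_near X x f"
    unfolding smooth_near_def using W smooth_onD(1)[OF W(2)] by (intro exI[of _ W]) auto
qed

lemma smooth_on_coordinate:
  assumes X: "smooth_manifold X" and c: "(n, D, \<phi>) \<in> atlas X"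
  shows "smooth_on X D (\<lambda>x. \<phi> x j)"
  unfolding smooth_on_def
proof (intro conjI allI impI)
  fix m U p assume p: "plot (mdiff X) m U p" "p ` U \<subseteq> D"
  have "{u \<in> U. p u \<in> D} = U" using p by auto
  then show "smooth_real m U (\<lambda>u. \<phi> (p u) j)"
    using smooth_cartesianD(3)[OF mplot_chart[OF p(1) c]] by simp
qed (rule chart_facts(1)[OF X c])

definition smooth_map_on :: "'x manifold \<Rightarrow> 'x set \<Rightarrow> 'y manifold \<Rightarrow> ('x \<Rightarrow> 'y) \<Rightarrow> bool" where
  "smooth_map_on X W Y F \<longleftrightarrow> openin (mtop X) W \<and>
     (\<forall>n U p. plot (mdiff X) n U p \<longrightarrow> p ` U \<subseteq> W \<longrightarrow> plot (mdiff Y) n U (\<lambda>u. F (p u)))"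

lemma smooth_map_onD:
  assumes "smooth_map_on X W Y F"
  shows "openin (mtop X) W" "plot (mdiff X) n U p \<Longrightarrow> p ` U \<subseteq> W \<Longrightarrow> plot (mdiff Y) n U (\<lambda>u. F (p u))"
  using assms by (auto simp: smooth_map_on_def)

lemma dsmoothD:
  assumes "dsmooth D E F"
  shows "x \<in> points D \<Longrightarrow> F x \<in> points E" "plot D n U p \<Longrightarrow> plot E n U (\<lambda>u. F (p u))"
  using assms by (auto simp: dsmooth_def o_def)

lemma dsmooth_smooth_map_on: "dsmooth (mdiff X) (mdiff Y) F \<Longrightarrow> smooth_map_on X (mpoints X) Y F"
  by (auto simp: smooth_map_on_def intro: dsmoothD)

lemma smooth_map_on_preimage:
  assumes X: "smooth_manifold X" and F: "smooth_map_on X W Y F" and V: "openin (mtop Y) V"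
  shows "openin (mtop X) {x \<in> W. F x \<in> V}"
proof (subst openin_subopen, intro ballI)
  fix x assume x: "x \<in> {x \<in> W. F x \<in> V}"
  have "x \<in> mpoints X" using x openin_subset[OF smooth_map_onD(1)[OF F]] by auto
  then obtain n D \<phi> where c: "(n, D, \<phi>) \<in> atlas X" "x \<in> D" by (rule chart_at[OF X])
  define O1 where "O1 = {u \<in> \<phi> ` D. inv_into D \<phi> u \<in> W}"
  have O1: "openin (Euclidean_space n) O1"
    unfolding O1_def by (rule chart_image_open[OF X c(1) smooth_map_onD(1)[OF F]])
  have "plot (mdiff X) n O1 (inv_into D \<phi>)"
    by (rule mplot_restrict[OF X chart_inverse_plot[OF X c(1)] O1]) (auto simp: O1_def)
  then have "plot (mdiff Y) n O1 (\<lambda>u. F (inv_into D \<phi> u))"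
    by (rule smooth_map_onD(2)[OF F]) (auto simp: O1_def)
  then have "openin (Euclidean_space n) {u \<in> O1. F (inv_into D \<phi> u) \<in> V}"
    using V by (simp add: mdiff_plot_iff)
  from chart_preimage_open[OF X c(1) this]
  have "openin (mtop X) {x \<in> D. \<phi> x \<in> {u \<in> O1. F (inv_into D \<phi> u) \<in> V}}" .
  also have "{x \<in> D. \<phi> x \<in> {u \<in> O1. F (inv_into D \<phi> u) \<in> V}} = {x \<in> D. x \<in> W \<and> F x \<in> V}"
    by (rule Collect_cong)
      (simp add: O1_def inv_into_f_f[OF chart_facts(4)[OF X c(1)]] cong: conj_cong)
  finally show "\<exists>T. openin (mtop X) T \<and> x \<in> T \<and> T \<subseteq> {x \<in> W. F x \<in> V}"
    using x c by (intro exI[of _ "{x \<in> D. x \<in> W \<and> F x \<in> V}"]) auto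
qed

lemma smooth_on_compose:
  assumes X: "smooth_manifold X" and F: "smooth_map_on X W Y F" and f: "smooth_on Y V f"
  shows "smooth_on X {x \<in> W. F x \<in> V} (\<lambda>x. f (F x))"
  unfolding smooth_on_def
proof (intro conjI allI impI)
  show "openin (mtop X) {x \<in> W. F x \<in> V}" by (rule smooth_map_on_preimage[OF X F smooth_onD(1)[OF f]])
  fix n U p assume p: "plot (mdiff X) n U p" "p ` U \<subseteq> {x \<in> W. F x \<in> V}"
  have "plot (mdiff Y) n U (\<lambda>u. F (p u))" by (rule smooth_map_onD(2)[OF F p(1)]) (use p in auto)
  then show "smooth_real n U (\<lambda>u. f (F (p u)))" by (rule smooth_onD(2)[OF f]) (use p in auto)
qed

lemma smooth_near_compose:
  assumes X: "smooth_manifold X" and Y: "smooth_manifold Y" and F: "smooth_map_on X W Y F"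
      and x: "x \<in> W"
    and f: "smooth_near Y (F x) f"
  shows "smooth_near X x (\<lambda>x. f (F x))"
proof -
  obtain V where "F x \<in> V" "smooth_on Y V f" using f smooth_near_iff[OF Y] by auto
  then show ?thesis unfolding smooth_near_iff[OF X]
    using smooth_on_compose[OF X F] x by (intro exI[of _ "{x \<in> W. F x \<in> V}"]) auto
qed

section \<open>Curves and tangent vectors\<close>

text \<open>
Points of the one-dimensional Cartesian space are sequences; this predicate speaks of curves
with a real parameter.
\<close>

definition curve_in :: "nat \<Rightarrow> (real \<Rightarrow> nat \<Rightarrow> real) \<Rightarrow> bool" where
  "curve_in m c \<longleftrightarrow> smooth_cartesian 1 (topspace (Euclidean_space 1)) m (\<lambda>u. c (u 0))"

lemma zero_in_Euclidean: "(\<lambda>_. 0) \<in> topspace (Euclidean_space n)"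
  by (simp add: topspace_Euclidean_space)

lemma line_in_Euclidean: "(\<lambda>_. 0)(0 := t) \<in> topspace (Euclidean_space 1)"
  by (simp add: topspace_Euclidean_space)

lemma curve_inD:
  assumes "curve_in m c"
  shows "c t \<in> topspace (Euclidean_space m)" "isCont (\<lambda>t. c t i) \<tau>"
proof -
  show "c t \<in> topspace (Euclidean_space m)"
    using smooth_cartesianD(2)[OF assms[unfolded curve_in_def] line_in_Euclidean[of t]] by simp
  have "((\<lambda>t. c t i) has_real_derivative pderiv_at 0 (\<lambda>u. c (u 0) i) ((\<lambda>_. 0)(0 := \<tau>))) (at \<tau>)"
    using smooth_real_has_pderiv[OF smooth_cartesianD(3)[OF assms[unfolded curve_in_def]] _
        line_in_Euclidean[of \<tau>], of 0 i]
    by simp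
  then show "isCont (\<lambda>t. c t i) \<tau>" by (rule DERIV_isCont)
qed

lemma curve_in_affine:
  assumes "a \<in> topspace (Euclidean_space m)" "b \<in> topspace (Euclidean_space m)"
  shows "curve_in m (\<lambda>t i. a i + t * b i)"
  unfolding curve_in_def
  by (intro smooth_cartesianI smooth_real_add smooth_real_mult smooth_real_const smooth_real_coord
      openin_topspace)
    (use assms in \<open>auto simp: topspace_Euclidean_space\<close>)

lemma curve_in_eventually:
  assumes "curve_in m c" "c \<tau> \<in> V" "openin (Euclidean_space m) V"
  shows "eventually (\<lambda>t. c t \<in> V) (nhds \<tau>)"
  using eventually_curve_in_open[of m V c \<tau>] assms curve_inD[OF assms(1)] by simp

lemma smooth_curveI:
  assumes "\<epsilon> > 0" "plot (mdiff X) 1 (cube 1 (\<lambda>_. 0) \<epsilon>) (\<lambda>u. \<gamma> (u 0))"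
  shows "smooth_curve X \<gamma>"
proof -
  have eq: "cube 1 (\<lambda>_. 0) d = {u \<in> topspace (Euclidean_space 1). \<bar>u 0\<bar> < d}" for d
    by (auto simp: cube_def)
  show ?thesis using assms unfolding smooth_curve_def eq by auto
qed

lemma smooth_curve_of_plot:
  assumes X: "smooth_manifold X" and p: "plot (mdiff X) m V Z" and c: "curve_in m c" and c0: "c 0 \<in> V"
  shows "smooth_curve X (\<lambda>t. Z (c t))"
proof -
  define O1 where "O1 = {u \<in> topspace (Euclidean_space 1). c (u 0) \<in> V}"
  have O1: "openin (Euclidean_space 1) O1" unfolding O1_def
    by (rule openin_smooth_preimage[OF c[unfolded curve_in_def] mplot_open[OF p]])
  have "(\<lambda>_. 0) \<in> O1" using c0 by (simp add: O1_def zero_in_Euclidean)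
  then obtain d where d: "d > 0" "cube 1 (\<lambda>_. 0) d \<subseteq> O1" using O1 by (auto simp: openin_Euclidean_iff)
  have "plot (mdiff X) 1 (cube 1 (\<lambda>_. 0) d) (\<lambda>u. Z (c (u 0)))"
    by (rule mplot_compose[OF X p smooth_cartesian_mono[OF c[unfolded curve_in_def] openin_cube]])
      (use d in \<open>auto simp: O1_def cube_def\<close>)
  with d(1) show ?thesis by (rule smooth_curveI)
qed

lemma smooth_curveD:
  assumes "smooth_curve X \<gamma>"
  obtains \<epsilon> where "\<epsilon> > 0" "plot (mdiff X) 1 (cube 1 (\<lambda>_. 0) \<epsilon>) (\<lambda>u. \<gamma> (u 0))"
proof -
  have eq: "cube 1 (\<lambda>_. 0) d = {u \<in> topspace (Euclidean_space 1). \<bar>u 0\<bar> < d}" for d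
    by (auto simp: cube_def)
  show ?thesis using assms that unfolding smooth_curve_def eq by auto
qed

lemma curve_in_coord:
  assumes "u \<in> topspace (Euclidean_space m)" "j < m" "u j = 0"
  shows "curve_in m (\<lambda>t. u(j := c * t))"
proof -
  have "curve_in m (\<lambda>t i. u i + t * ((\<lambda>_. 0)(j := c)) i)"
    by (rule curve_in_affine) (use assms in \<open>auto simp: topspace_Euclidean_space\<close>)
  also have "(\<lambda>t i. u i + t * ((\<lambda>_. 0)(j := c)) i) = (\<lambda>t. u(j := c * t))"
    using assms by (auto simp: fun_eq_iff)
  finally show ?thesis .
qed

lemma curve_in_line: "curve_in 1 (\<lambda>t. (\<lambda>_. 0)(0 := t))"
  using curve_in_coord[OF zero_in_Euclidean[of 1], of 0 1] by simp

lemma curve_in_diagonal: "curve_in 2 (\<lambda>t. (\<lambda>_. 0)(0 := t, 1 := t))"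
proof -
  have "curve_in 2 (\<lambda>t i. 0 + t * ((\<lambda>_. 0)(0 := 1, 1 := 1)) i)"
    by (rule curve_in_affine) (auto simp: topspace_Euclidean_space)
  also have "(\<lambda>t i. 0 + t * ((\<lambda>_. 0)(0 := 1, 1 := 1)) i) = (\<lambda>t::real. (\<lambda>_. 0)(0 := t, 1 := t))"
    by (auto simp: fun_eq_iff)
  finally show ?thesis .
qed

lemma smooth_curve_point: "smooth_curve X \<gamma> \<Longrightarrow> \<gamma> 0 \<in> mpoints X"
  by (erule smooth_curveD) (use mplot_point cube_self[OF zero_in_Euclidean] in fastforce)

lemma velocity_eqI:
  assumes "eventually (\<lambda>t. \<gamma> t = \<delta> t) (nhds 0)"
  shows "velocity X \<gamma> = velocity X \<delta>"
proof -
  have "\<gamma> 0 = \<delta> 0" by (rule eventually_nhds_x_imp_x[OF assms])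
  moreover have "deriv (\<lambda>t. f (\<gamma> t)) 0 = deriv (\<lambda>t. f (\<delta> t)) 0" for f
    by (rule deriv_cong_ev) (use assms in \<open>auto elim: eventually_mono\<close>)
  ultimately show ?thesis by (simp add: velocity_def fun_eq_iff)
qed

lemma velocity_plot_curve:
  assumes X: "smooth_manifold X" and p: "plot (mdiff X) m V Z" and c: "curve_in m c" and c0: "c 0 \<in> V"
    and d: "\<And>i. i < m \<Longrightarrow> ((\<lambda>t. c t i) has_real_derivative c' i) (at 0)"
    and f: "smooth_near X (Z (c 0)) f"
  shows "((\<lambda>t. f (Z (c t))) has_real_derivative (\<Sum>i<m. pderiv_at i (\<lambda>u. f (Z u)) (c 0) * c' i)) (at 0)"
    "velocity X (\<lambda>t. Z (c t)) f = (\<Sum>i<m. pderiv_at i (\<lambda>u. f (Z u)) (c 0) * c' i)"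
proof -
  obtain W where W: "Z (c 0) \<in> W" "smooth_on X W f" using f smooth_near_iff[OF X] by auto
  have sm: "smooth_real m {u \<in> V. Z u \<in> W} (\<lambda>u. f (Z u))" by (rule smooth_on_preimage[OF X W(2) p])
  show *: "((\<lambda>t. f (Z (c t))) has_real_derivative (\<Sum>i<m. pderiv_at i (\<lambda>u. f (Z u)) (c 0) * c' i)) (at
      0)"
    by (rule smooth_real_chain_curve[OF sm curve_in_eventually[OF c _ smooth_realD(1)[OF sm]] d])
      (use W c0 in auto)
  show "velocity X (\<lambda>t. Z (c t)) f = (\<Sum>i<m. pderiv_at i (\<lambda>u. f (Z u)) (c 0) * c' i)"
    using f DERIV_imp_deriv[OF *] by (simp add: velocity_def)
qed

lemma velocity_deriv:
  assumes X: "smooth_manifold X" and \<gamma>: "smooth_curve X \<gamma>" and f: "smooth_near X (\<gamma> 0) f"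
  shows "((\<lambda>t. f (\<gamma> t)) has_real_derivative velocity X \<gamma> f) (at 0)"
proof -
  obtain \<epsilon> where e: "\<epsilon> > 0" "plot (mdiff X) 1 (cube 1 (\<lambda>_. 0) \<epsilon>) (\<lambda>u. \<gamma> (u 0))"
    using smooth_curveD[OF \<gamma>] .
  have z: "(\<lambda>_::nat. 0::real)(0 := 0) = (\<lambda>_. 0)" by (rule fun_upd_triv)
  note d = velocity_plot_curve(1)[OF X e(2) curve_in_line, where c' = "\<lambda>_. 1" and f = f, unfolded z]
  have "((\<lambda>t. f (\<gamma> t)) has_real_derivative pderiv_at 0 (\<lambda>u. f (\<gamma> (u 0))) (\<lambda>_. 0)) (at 0)"
    using d e(1) f by (simp add: cube_self zero_in_Euclidean)
  moreover from DERIV_imp_deriv[OF this] f have "velocity X \<gamma> f = pderiv_at 0 (\<lambda>u. f (\<gamma> (u 0))) (\<lambda>_. 0)"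
    by (simp add: velocity_def)
  ultimately show ?thesis by simp
qed

lemma velocity_not_near: "\<not> smooth_near X (\<gamma> 0) f \<Longrightarrow> velocity X \<gamma> f = 0"
  by (simp add: velocity_def)

lemma tangent_spaceI: "smooth_curve X \<gamma> \<Longrightarrow> \<gamma> 0 = x \<Longrightarrow> velocity X \<gamma> \<in> tangent_space X x"
  by (auto simp: tangent_space_def)

lemma tangent_spaceE:
  assumes "v \<in> tangent_space X x"
  obtains \<gamma> where "smooth_curve X \<gamma>" "\<gamma> 0 = x" "v = velocity X \<gamma>"
  using assms by (auto simp: tangent_space_def)

lemma tangent_point: "v \<in> tangent_space X x \<Longrightarrow> x \<in> mpoints X"
  by (auto elim!: tangent_spaceE dest: smooth_curve_point)

lemma smooth_near_coordinate:
  assumes X: "smooth_manifold X" and c: "(n, D, \<phi>) \<in> atlas X" and x: "x \<in> D"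
  shows "smooth_near X x (\<lambda>x. \<phi> x j)"
  using smooth_on_coordinate[OF X c] x unfolding smooth_near_iff[OF X] by blast

lemma smooth_curve_eventually_in:
  assumes X: "smooth_manifold X" and \<gamma>: "smooth_curve X \<gamma>" and W: "openin (mtop X) W" "\<gamma> 0 \<in> W"
  shows "eventually (\<lambda>t. \<gamma> t \<in> W) (nhds 0)"
proof -
  obtain \<epsilon> where e: "\<epsilon> > 0" "plot (mdiff X) 1 (cube 1 (\<lambda>_. 0) \<epsilon>) (\<lambda>u. \<gamma> (u 0))"
    using smooth_curveD[OF \<gamma>] .
  have "eventually (\<lambda>t. (\<lambda>_. 0)(0 := t) \<in> {u \<in> cube 1 (\<lambda>_. 0) \<epsilon>. \<gamma> (u 0) \<in> W}) (nhds 0)"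
    by (rule curve_in_eventually[OF curve_in_line _ mplot_preimage[OF e(2) W(1)]])
      (use e W in \<open>auto simp: cube_self zero_in_Euclidean fun_upd_idem\<close>)
  then show ?thesis by (rule eventually_mono) simp
qed

text \<open>
A tangent vector is a derivative along a curve, and by the chain rule in a chart it depends on
the curve only through the derivatives of the coordinates.
\<close>

lemma tangent_coordinates:
  assumes X: "smooth_manifold X" and c: "(n, D, \<phi>) \<in> atlas X" and x: "x \<in> D"
    and v: "v \<in> tangent_space X x" and f: "smooth_near X x f"
  shows "v f = (\<Sum>i<n. pderiv_at i (\<lambda>u. f (inv_into D \<phi> u)) (\<phi> x) * v (\<lambda>y. \<phi> y i))"
proof -
  obtain \<gamma> where \<gamma>: "smooth_curve X \<gamma>" "\<gamma> 0 = x" "v = velocity X \<gamma>" using tangent_spaceE[OF v] .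
  have inv: "inv_into D \<phi> (\<phi> y) = y" if "y \<in> D" for y
    by (rule inv_into_f_f[OF chart_facts(4)[OF X c] that])
  obtain W where W: "x \<in> W" "smooth_on X W f" using f smooth_near_iff[OF X] by auto
  have sm: "smooth_real n {u \<in> \<phi> ` D. inv_into D \<phi> u \<in> W} (\<lambda>u. f (inv_into D \<phi> u))"
    by (rule smooth_on_preimage[OF X W(2) chart_inverse_plot[OF X c]])
  have evD: "eventually (\<lambda>t. \<gamma> t \<in> D) (nhds 0)" "eventually (\<lambda>t. \<gamma> t \<in> W) (nhds 0)"
    using smooth_curve_eventually_in[OF X \<gamma>(1)] chart_facts(1)[OF X c] x W smooth_onD(1)[OF W(2)] \<gamma>(2)
      by auto
  have "((\<lambda>t. f (inv_into D \<phi> (\<phi> (\<gamma> t)))) has_real_derivative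
      (\<Sum>i<n. pderiv_at i (\<lambda>u. f (inv_into D \<phi> u)) (\<phi> (\<gamma> 0)) * v (\<lambda>y. \<phi> y i))) (at 0)"
  proof (rule smooth_real_chain_curve[OF sm])
    show "\<forall>\<^sub>F t in nhds 0. \<phi> (\<gamma> t) \<in> {u \<in> \<phi> ` D. inv_into D \<phi> u \<in> W}"
      using evD by eventually_elim (simp add: inv)
    show "((\<lambda>t. \<phi> (\<gamma> t) i) has_real_derivative v (\<lambda>y. \<phi> y i)) (at 0)" for i
      unfolding \<gamma>(3) by (rule velocity_deriv[OF X \<gamma>(1)]) (use smooth_near_coordinate[OF X c x] \<gamma> in
          simp)
  qed
  then have "((\<lambda>t. f (\<gamma> t)) has_real_derivative
      (\<Sum>i<n. pderiv_at i (\<lambda>u. f (inv_into D \<phi> u)) (\<phi> (\<gamma> 0)) * v (\<lambda>y. \<phi> y i))) (at 0)"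
    by (rule DERIV_cong_ev[OF refl _ refl, THEN iffD1, rotated]) (use evD inv in \<open>auto elim:
        eventually_mono\<close>)
  moreover have "((\<lambda>t. f (\<gamma> t)) has_real_derivative v f) (at 0)"
    unfolding \<gamma>(3) by (rule velocity_deriv[OF X \<gamma>(1)]) (use f \<gamma> in simp)
  ultimately show ?thesis using DERIV_unique \<gamma>(2) by blast
qed

lemma tangent_not_near: "v \<in> tangent_space X x \<Longrightarrow> \<not> smooth_near X x f \<Longrightarrow> v f = 0"
  by (auto elim!: tangent_spaceE simp: velocity_not_near)

lemma tangent_eqI:
  assumes X: "smooth_manifold X" and c: "(n, D, \<phi>) \<in> atlas X" and x: "x \<in> D"
    and v: "v \<in> tangent_space X x" and w: "w \<in> tangent_space X x"
    and eq: "\<And>i. i < n \<Longrightarrow> v (\<lambda>y. \<phi> y i) = w (\<lambda>y. \<phi> y i)"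
  shows "v = w"
proof
  fix f
  show "v f = w f"
  proof (cases "smooth_near X x f")
    case True
    show ?thesis
      unfolding tangent_coordinates[OF X c x v True] tangent_coordinates[OF X c x w True]
      by (rule sum.cong) (use eq in auto)
  qed (use tangent_not_near v w in metis)
qed

text \<open>The chain rule for a map of two parameters, in a form that mentions no chart.\<close>

lemma velocity_diagonal:
  assumes X: "smooth_manifold X" and p: "plot (mdiff X) 2 V Z" and V: "(\<lambda>_. 0) \<in> V"
  shows "velocity X (\<lambda>t. Z ((\<lambda>_. 0)(0 := t, 1 := t))) =
    velocity X (\<lambda>t. Z ((\<lambda>_. 0)(0 := t))) + velocity X (\<lambda>t. Z ((\<lambda>_. 0)(1 := t)))"
proof
  fix f
  let ?z = "\<lambda>_::nat. 0::real"
  have ci: "curve_in 2 (\<lambda>t. ?z(0 := t, 1 := t))" "curve_in 2 (\<lambda>t. ?z(0 := t))"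
      "curve_in 2 (\<lambda>t. ?z(1 := t))"
    using curve_in_diagonal curve_in_coord[OF zero_in_Euclidean[of 2], of 0 1] curve_in_coord[OF
        zero_in_Euclidean[of 2], of 1 1]
    by simp_all
  have z: "?z(0 := 0, 1 := 0) = ?z" "?z(0 := 0) = ?z" "?z(1 := 0) = ?z" by (auto simp: fun_eq_iff)
  show "velocity X (\<lambda>t. Z (?z(0 := t, 1 := t))) f =
    (velocity X (\<lambda>t. Z (?z(0 := t))) + velocity X (\<lambda>t. Z (?z(1 := t)))) f"
  proof (cases "smooth_near X (Z ?z) f")
    case True
    have 1: "velocity X (\<lambda>t. Z (?z(0 := t, 1 := t))) f =
      (\<Sum>i<2. pderiv_at i (\<lambda>u. f (Z u)) (?z(0 := 0, 1 := 0)) * (if i = 0 \<or> i = 1 then 1 else 0))"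
      by (rule velocity_plot_curve(2)[OF X p ci(1)]) (use V True z in auto)
    have 2: "velocity X (\<lambda>t. Z (?z(0 := t))) f =
      (\<Sum>i<2. pderiv_at i (\<lambda>u. f (Z u)) (?z(0 := 0)) * (if i = 0 then 1 else 0))"
      by (rule velocity_plot_curve(2)[OF X p ci(2)]) (use V True z in auto)
    have 3: "velocity X (\<lambda>t. Z (?z(1 := t))) f =
      (\<Sum>i<2. pderiv_at i (\<lambda>u. f (Z u)) (?z(1 := 0)) * (if i = 1 then 1 else 0))"
      by (rule velocity_plot_curve(2)[OF X p ci(3)]) (use V True z in auto)
    show ?thesis unfolding plus_fun_def 1 2 3 z by (simp add: numeral_2_eq_2)
  qed (use z in \<open>auto simp: velocity_not_near\<close>)
qed

lemma velocity_scale: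
  assumes X: "smooth_manifold X" and \<gamma>: "smooth_curve X \<gamma>"
  shows "smooth_curve X (\<lambda>t. \<gamma> (c * t))" "velocity X (\<lambda>t. \<gamma> (c * t)) = tscale c (velocity X \<gamma>)"
proof -
  obtain \<epsilon> where e: "\<epsilon> > 0" "plot (mdiff X) 1 (cube 1 (\<lambda>_. 0) \<epsilon>) (\<lambda>u. \<gamma> (u 0))"
    using smooth_curveD[OF \<gamma>] .
  have ci: "curve_in 1 (\<lambda>t. (\<lambda>_. 0)(0 := c * t))"
    using curve_in_coord[OF zero_in_Euclidean[of 1], of 0 c] by simp
  show "smooth_curve X (\<lambda>t. \<gamma> (c * t))"
    using smooth_curve_of_plot[OF X e(2) ci] e by (simp add: fun_upd_idem cube_self zero_in_Euclidean)
  show "velocity X (\<lambda>t. \<gamma> (c * t)) = tscale c (velocity X \<gamma>)"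
  proof
    fix f
    show "velocity X (\<lambda>t. \<gamma> (c * t)) f = tscale c (velocity X \<gamma>) f"
    proof (cases "smooth_near X (\<gamma> 0) f")
      case True
      have "((\<lambda>t. f (\<gamma> (c * t))) has_real_derivative velocity X \<gamma> f * c) (at 0)"
        by (rule DERIV_chain2[of "\<lambda>t. f (\<gamma> t)"])
          (use velocity_deriv[OF X \<gamma> True] in \<open>auto intro!: derivative_eq_intros\<close>)
      from DERIV_imp_deriv[OF this] True show ?thesis by (simp add: velocity_def tscale_def)
    qed (simp add: velocity_not_near tscale_def)
  qed
qed

lemma velocity_const:
  assumes X: "smooth_manifold X" and x: "x \<in> mpoints X"
  shows "smooth_curve X (\<lambda>_. x)" "velocity X (\<lambda>_. x) = 0"
proof -
  show "smooth_curve X (\<lambda>_. x)"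
    using mplot_const[OF X openin_cube x] by (intro smooth_curveI[of 1]) auto
  show "velocity X (\<lambda>_. x) = 0" by (auto simp: velocity_def fun_eq_iff)
qed

lemma tangent_zero: "smooth_manifold X \<Longrightarrow> x \<in> mpoints X \<Longrightarrow> 0 \<in> tangent_space X x"
  using tangent_spaceI[OF velocity_const(1)] velocity_const(2) by metis

lemma tangent_scale: "smooth_manifold X \<Longrightarrow> v \<in> tangent_space X x \<Longrightarrow> tscale c v \<in> tangent_space X x"
  by (erule tangent_spaceE) (use tangent_spaceI[OF velocity_scale(1)] velocity_scale(2) in force)

text \<open>
In a chart, adding the displacements of the two curves gives a surface of which they are the
axes; the sum is the velocity of its diagonal.
\<close>

lemma tangent_add:
  assumes X: "smooth_manifold X" and v: "v \<in> tangent_space X x" and w: "w \<in> tangent_space X x"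
  shows "v + w \<in> tangent_space X x"
proof -
  obtain \<gamma> where \<gamma>: "smooth_curve X \<gamma>" "\<gamma> 0 = x" "v = velocity X \<gamma>" using tangent_spaceE[OF v] .
  obtain \<delta> where \<delta>: "smooth_curve X \<delta>" "\<delta> 0 = x" "w = velocity X \<delta>" using tangent_spaceE[OF w] .
  obtain n D \<phi> where c: "(n, D, \<phi>) \<in> atlas X" "x \<in> D" by (rule chart_at[OF X tangent_point[OF v]])
  have inv: "inv_into D \<phi> (\<phi> y) = y" if "y \<in> D" for y
    by (rule inv_into_f_f[OF chart_facts(4)[OF X c(1)] that])
  let ?z = "\<lambda>_::nat. 0::real"
  have pl: "\<exists>A. openin (Euclidean_space 2) A \<and> ?z \<in> A \<and> smooth_cartesian 2 A n (\<lambda>u. \<phi> (\<alpha> (u j)))"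
    if \<alpha>: "smooth_curve X \<alpha>" "\<alpha> 0 = x" and j: "j < 2" for \<alpha> j
  proof -
    obtain \<epsilon> where e: "\<epsilon> > 0" "plot (mdiff X) 1 (cube 1 ?z \<epsilon>) (\<lambda>u. \<alpha> (u 0))"
      using smooth_curveD[OF \<alpha>(1)] .
    let ?B = "{u \<in> cube 1 ?z \<epsilon>. \<alpha> (u 0) \<in> D}"
    have s: "smooth_cartesian 1 ?B n (\<lambda>u. \<phi> (\<alpha> (u 0)))" by (rule mplot_chart[OF e(2) c(1)])
    have t: "smooth_cartesian 2 (topspace (Euclidean_space 2)) 1 (\<lambda>u. ?z(0 := u j))"
    proof (rule smooth_cartesianI[OF openin_topspace line_in_Euclidean])
      show "smooth_real 2 (topspace (Euclidean_space 2)) (\<lambda>u. (?z(0 := u j)) i)" for i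
        by (cases "i = 0") (simp_all add: smooth_real_coord smooth_real_const)
    qed
    let ?A = "{u \<in> topspace (Euclidean_space 2). ?z(0 := u j) \<in> ?B}"
    have A: "openin (Euclidean_space 2) ?A"
      by (rule openin_smooth_preimage[OF t smooth_cartesianD(1)[OF s]])
    have "smooth_cartesian 2 ?A n (\<lambda>u. \<phi> (\<alpha> ((?z(0 := u j)) 0)))"
      by (rule smooth_cartesian_compose[OF s smooth_cartesian_mono[OF t A]]) auto
    moreover have "?z \<in> ?A"
      using \<alpha>(2) c(2) e(1) by (simp add: zero_in_Euclidean cube_self fun_upd_idem)
    ultimately show ?thesis using A by (intro exI[of _ ?A]) simp
  qed
  from pl[OF \<gamma>(1,2), of 0] obtain A where A: "openin (Euclidean_space 2) A" "?z \<in> A"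
    "smooth_cartesian 2 A n (\<lambda>u. \<phi> (\<gamma> (u 0)))" by auto
  from pl[OF \<delta>(1,2), of 1] obtain B where B: "openin (Euclidean_space 2) B" "?z \<in> B"
    "smooth_cartesian 2 B n (\<lambda>u. \<phi> (\<delta> (u 1)))" by auto
  have AB: "openin (Euclidean_space 2) (A \<inter> B)" using A B by blast
  have \<phi>x: "\<phi> x \<in> topspace (Euclidean_space n)" by (rule chart_facts(6)[OF X c])
  define Q where "Q u = (\<lambda>i. \<phi> (\<gamma> (u 0)) i + \<phi> (\<delta> (u 1)) i - \<phi> x i)" for u :: "nat \<Rightarrow> real"
  have Q: "smooth_cartesian 2 (A \<inter> B) n Q"
  proof (rule smooth_cartesianI[OF AB])
    show "Q u \<in> topspace (Euclidean_space n)" if "u \<in> A \<inter> B" for u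
      using smooth_cartesianD(2)[OF A(3), of u] smooth_cartesianD(2)[OF B(3), of u] that \<phi>x
      by (simp add: Q_def topspace_Euclidean_space)
    show "smooth_real 2 (A \<inter> B) (\<lambda>u. Q u i)" for i
      unfolding Q_def
      by (intro smooth_real_diff smooth_real_add smooth_real_const AB
          smooth_real_mono[OF smooth_cartesianD(3)[OF A(3)] AB]
          smooth_real_mono[OF smooth_cartesianD(3)[OF B(3)] AB]) auto
  qed
  define V where "V = {u \<in> A \<inter> B. Q u \<in> \<phi> ` D}"
  define Z where "Z u = inv_into D \<phi> (Q u)" for u
  have V: "openin (Euclidean_space 2) V"
    unfolding V_def by (rule openin_smooth_preimage[OF Q chart_facts(3)[OF X c(1)]])
  have p: "plot (mdiff X) 2 V Z" unfolding Z_def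
    by (rule mplot_compose[OF X chart_inverse_plot[OF X c(1)] smooth_cartesian_mono[OF Q V]]) (auto
        simp: V_def)
  have Q0: "Q ?z = \<phi> x" by (simp add: Q_def \<gamma>(2) \<delta>(2))
  have zV: "?z \<in> V" using A B Q0 c by (simp add: V_def)
  have Dx: "openin (mtop X) D" by (rule chart_facts(1)[OF X c(1)])
  have ev: "eventually (\<lambda>t. \<gamma> t \<in> D) (nhds 0)" "eventually (\<lambda>t. \<delta> t \<in> D) (nhds 0)"
    using smooth_curve_eventually_in[OF X \<gamma>(1) Dx] smooth_curve_eventually_in[OF X \<delta>(1) Dx]
      \<gamma>(2) \<delta>(2) c(2) by simp_all
  have ax: "velocity X (\<lambda>t. Z (?z(0 := t))) = v" unfolding \<gamma>(3)
    by (rule velocity_eqI, rule eventually_mono[OF ev(1)]) (simp add: Z_def Q_def \<delta>(2) inv)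
  have ax': "velocity X (\<lambda>t. Z (?z(1 := t))) = w" unfolding \<delta>(3)
    by (rule velocity_eqI, rule eventually_mono[OF ev(2)]) (simp add: Z_def Q_def \<gamma>(2) inv)
  have ci: "curve_in 2 (\<lambda>t. ?z(0 := t, 1 := t))" by (rule curve_in_diagonal)
  have z0: "?z(0 := 0, 1 := 0) = ?z" by (auto simp: fun_eq_iff)
  have "velocity X (\<lambda>t. Z (?z(0 := t, 1 := t))) \<in> tangent_space X x"
    by (rule tangent_spaceI[OF smooth_curve_of_plot[OF X p ci]])
      (use z0 zV Q0 inv c in \<open>auto simp: Z_def\<close>)
  then show ?thesis using velocity_diagonal[OF X p zV] ax ax' by simp
qed

section \<open>Differentials as precomposition\<close>

text \<open>
The velocity of \<open>F \<circ> \<gamma>\<close> acts on \<open>f\<close> as the velocity of \<open>\<gamma>\<close> acts on \<open>f \<circ> F\<close>. Hence the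
differential of \<open>F\<close> is precomposition with \<open>F\<close>, which is visibly linear and needs no choice of a
curve. The case distinction restores the value zero at functions that are not smooth near \<open>F x\<close>.
\<close>

definition push :: "'x manifold \<Rightarrow> 'x \<Rightarrow> 'y manifold \<Rightarrow> ('x \<Rightarrow> 'y) \<Rightarrow> 'x tvec \<Rightarrow> 'y tvec" where
  "push X x Y F v = (\<lambda>f. if smooth_near Y (F x) f then v (\<lambda>x. f (F x)) else 0)"

lemma push_add: "push X x Y F (v + w) = push X x Y F v + push X x Y F w"
  by (auto simp: push_def fun_eq_iff)

lemma push_scale: "push X x Y F (tscale c v) = tscale c (push X x Y F v)"
  by (auto simp: push_def tscale_def fun_eq_iff)

lemma push_zero: "push X x Y F 0 = 0"
  by (auto simp: push_def fun_eq_iff)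

lemma smooth_curve_map:
  assumes X: "smooth_manifold X" and F: "smooth_map_on X W Y F" and \<gamma>: "smooth_curve X \<gamma>" "\<gamma> 0 \<in> W"
  shows "smooth_curve Y (\<lambda>t. F (\<gamma> t))"
proof -
  obtain \<epsilon> where e: "\<epsilon> > 0" "plot (mdiff X) 1 (cube 1 (\<lambda>_. 0) \<epsilon>) (\<lambda>u. \<gamma> (u 0))"
    using smooth_curveD[OF \<gamma>(1)] .
  let ?B = "{u \<in> cube 1 (\<lambda>_. 0) \<epsilon>. \<gamma> (u 0) \<in> W}"
  have B: "openin (Euclidean_space 1) ?B" by (rule mplot_preimage[OF e(2) smooth_map_onD(1)[OF F]])
  have "(\<lambda>_. 0) \<in> ?B" using \<gamma>(2) e(1) by (simp add: cube_self zero_in_Euclidean)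
  then obtain d where d: "d > 0" "cube 1 (\<lambda>_. 0) d \<subseteq> ?B" using B by (auto simp: openin_Euclidean_iff)
  have "plot (mdiff X) 1 (cube 1 (\<lambda>_. 0) d) (\<lambda>u. \<gamma> (u 0))"
    by (rule mplot_restrict[OF X e(2) openin_cube]) (use d in auto)
  then have "plot (mdiff Y) 1 (cube 1 (\<lambda>_. 0) d) (\<lambda>u. F (\<gamma> (u 0)))"
    by (rule smooth_map_onD(2)[OF F]) (use d in auto)
  with d(1) show ?thesis by (rule smooth_curveI)
qed

lemma velocity_map:
  assumes X: "smooth_manifold X" and Y: "smooth_manifold Y" and F: "smooth_map_on X W Y F"
    and \<gamma>: "smooth_curve X \<gamma>" "\<gamma> 0 \<in> W"
  shows "velocity Y (\<lambda>t. F (\<gamma> t)) = push X (\<gamma> 0) Y F (velocity X \<gamma>)"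
proof
  fix f
  show "velocity Y (\<lambda>t. F (\<gamma> t)) f = push X (\<gamma> 0) Y F (velocity X \<gamma>) f"
  proof (cases "smooth_near Y (F (\<gamma> 0)) f")
    case True
    then have "smooth_near X (\<gamma> 0) (\<lambda>x. f (F x))" by (rule smooth_near_compose[OF X Y F \<gamma>(2)])
    then show ?thesis using True by (simp add: velocity_def push_def)
  qed (simp add: velocity_def push_def)
qed

lemma push_tangent:
  assumes X: "smooth_manifold X" and Y: "smooth_manifold Y" and F: "smooth_map_on X W Y F"
    and v: "v \<in> tangent_space X x" and x: "x \<in> W"
  shows "push X x Y F v \<in> tangent_space Y (F x)"
proof -
  obtain \<gamma> where \<gamma>: "smooth_curve X \<gamma>" "\<gamma> 0 = x" "v = velocity X \<gamma>" using tangent_spaceE[OF v] .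
  then show ?thesis
    using velocity_map[OF X Y F \<gamma>(1)] x tangent_spaceI[OF smooth_curve_map[OF X F \<gamma>(1)]] by simp
qed

lemma differential_eq_push:
  assumes X: "smooth_manifold X" and Y: "smooth_manifold Y" and F: "dsmooth (mdiff X) (mdiff Y) F"
    and v: "v \<in> tangent_space X x"
  shows "differential X Y F x v = push X x Y F v"
proof -
  note F' = dsmooth_smooth_map_on[OF F]
  obtain \<gamma> where \<gamma>: "smooth_curve X \<gamma>" "\<gamma> 0 = x" "v = velocity X \<gamma>" using tangent_spaceE[OF v] .
  show ?thesis unfolding differential_on_def
  proof (rule the_equality)
    have "\<forall>\<^sub>F t in nhds 0. \<gamma> t \<in> mpoints X"
      by (rule smooth_curve_eventually_in[OF X \<gamma>(1) openin_topspace smooth_curve_point[OF \<gamma>(1)]])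
    moreover have "push X x Y F v = velocity Y (F \<circ> \<gamma>)"
      using velocity_map[OF X Y F' \<gamma>(1) smooth_curve_point[OF \<gamma>(1)]] \<gamma> by (simp add: o_def)
    ultimately show "\<exists>\<gamma>. smooth_curve X \<gamma> \<and> \<gamma> 0 = x \<and> (\<forall>\<^sub>F t in nhds 0. \<gamma> t \<in> mpoints X) \<and>
        velocity X \<gamma> = v \<and> push X x Y F v = velocity Y (F \<circ> \<gamma>)"
      using \<gamma> by (intro exI[of _ \<gamma>]) simp
  next
    fix w assume "\<exists>\<gamma>. smooth_curve X \<gamma> \<and> \<gamma> 0 = x \<and> (\<forall>\<^sub>F t in nhds 0. \<gamma> t \<in> mpoints X) \<and>
        velocity X \<gamma> = v \<and> w = velocity Y (F \<circ> \<gamma>)"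
    then obtain \<delta> where \<delta>: "smooth_curve X \<delta>" "\<delta> 0 = x" "velocity X \<delta> = v" "w = velocity Y (F \<circ> \<delta>)"
      by auto
    show "w = push X x Y F v"
      using velocity_map[OF X Y F' \<delta>(1) smooth_curve_point[OF \<delta>(1)]] \<delta> by (simp add: o_def)
  qed
qed

section \<open>Plots of the tangent bundle\<close>

lemma smooth_cartesian_head_coords:
  assumes U: "openin (Euclidean_space n) U"
  shows "openin (Euclidean_space (Suc n)) {y \<in> topspace (Euclidean_space (Suc n)). head_coords n y \<in> U}"
    "smooth_cartesian (Suc n) {y \<in> topspace (Euclidean_space (Suc n)). head_coords n y \<in> U} n
        (head_coords n)"
proof -
  have s: "smooth_cartesian (Suc n) (topspace (Euclidean_space (Suc n))) n (head_coords n)"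
  proof (rule smooth_cartesianI[OF openin_topspace head_coords_in])
    show "smooth_real (Suc n) (topspace (Euclidean_space (Suc n))) (\<lambda>x. head_coords n x j)" for j
      by (cases "j < n") (simp_all add: head_coords_def smooth_real_coord smooth_real_const)
  qed
  show o: "openin (Euclidean_space (Suc n)) {y \<in> topspace (Euclidean_space (Suc n)). head_coords n y \<in>
      U}"
    by (rule openin_smooth_preimage[OF s U])
  show "smooth_cartesian (Suc n) {y \<in> topspace (Euclidean_space (Suc n)). head_coords n y \<in> U} n
      (head_coords n)"
    by (rule smooth_cartesian_mono[OF s o]) auto
qed

lemma Euclidean_mono: "x \<in> topspace (Euclidean_space n) \<Longrightarrow> x \<in> topspace (Euclidean_space (Suc n))"
  by (simp add: topspace_Euclidean_space)

lemma Euclidean_last: "x \<in> topspace (Euclidean_space n) \<Longrightarrow> x n = 0"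
  by (simp add: topspace_Euclidean_space)

lemma Euclidean_upd: "x \<in> topspace (Euclidean_space n) \<Longrightarrow> x(n := t) \<in> topspace (Euclidean_space (Suc n))"
  by (simp add: topspace_Euclidean_space)

lemma head_coords_upd: "x \<in> topspace (Euclidean_space n) \<Longrightarrow> head_coords n (x(n := t)) = x"
  by (auto simp: head_coords_def topspace_Euclidean_space fun_eq_iff)

lemma smooth_real_head_coords:
  assumes f: "smooth_real n U f"
  shows "smooth_real (Suc n) {y \<in> topspace (Euclidean_space (Suc n)). head_coords n y \<in> U} (\<lambda>y. f
      (head_coords n y))"
  by (rule smooth_real_compose[OF f smooth_cartesian_head_coords(2)[OF smooth_realD(1)[OF f]]]) auto

lemma curve_in_last: "x \<in> topspace (Euclidean_space n) \<Longrightarrow> curve_in (Suc n) (\<lambda>t. x(n := t))"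
  using curve_in_coord[OF Euclidean_mono[of x n], of n 1] Euclidean_last[of x n] by simp

text \<open>
For a plot with one additional parameter, each point of the original parameter space gives a
curve, and its velocity is a partial derivative.
\<close>

lemma velocity_family:
  assumes X: "smooth_manifold X" and p: "plot (mdiff X) (Suc n) V Z"
      and x: "x \<in> topspace (Euclidean_space n)" "x \<in> V"
  shows "smooth_curve X (\<lambda>t. Z (x(n := t)))"
    "smooth_near X (Z x) f \<Longrightarrow> velocity X (\<lambda>t. Z (x(n := t))) f = pderiv_at n (\<lambda>u. f (Z u)) x"
proof -
  have x0: "x(n := 0) = x" using Euclidean_last[OF x(1)] by (auto simp: fun_eq_iff)
  show "smooth_curve X (\<lambda>t. Z (x(n := t)))"
    by (rule smooth_curve_of_plot[OF X p curve_in_last[OF x(1)]]) (simp add: x0 x)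
  assume f: "smooth_near X (Z x) f"
  note d = velocity_plot_curve(2)[OF X p curve_in_last[OF x(1)], where c' = "\<lambda>i. if i = n then 1 else 0"
      and f = f,
      unfolded x0, OF x(2) _ f]
  have "velocity X (\<lambda>t. Z (x(n := t))) f = (\<Sum>i<Suc n. pderiv_at i (\<lambda>u. f (Z u)) x * (if i = n then 1
      else 0))"
    by (rule d) auto
  then show "velocity X (\<lambda>t. Z (x(n := t))) f = pderiv_at n (\<lambda>u. f (Z u)) x" by simp
qed

lemma tangent_bundle_plot_iff:
  "plot (tangent_bundle X) n U q \<longleftrightarrow> plot (mdiff X) n U (\<lambda>u. fst (q u)) \<and>
     (\<forall>u\<in>U. snd (q u) \<in> tangent_space X (fst (q u))) \<and>
     (\<forall>m D \<phi> j. (m, D, \<phi>) \<in> atlas X \<longrightarrow> j < m \<longrightarrow>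
        smooth_real n {u \<in> U. fst (q u) \<in> D} (\<lambda>u. snd (q u) (\<lambda>x. \<phi> x j)))"
  unfolding tangent_bundle_def by (auto simp: o_def)

lemma smooth_cartesian_self_inclusion:
  assumes "openin (Euclidean_space n) W"
  shows "smooth_cartesian n W (Suc n) (\<lambda>x. x)"
  using openin_subset[OF assms] by (intro smooth_cartesianI assms smooth_real_coord) (auto intro:
      Euclidean_mono)

text \<open>Velocities are partial derivatives of the family, hence smooth.\<close>

lemma tangent_plot_of_family:
  assumes X: "smooth_manifold X"
    and W: "openin (Euclidean_space n) W" "W \<subseteq> V" and p: "plot (mdiff X) (Suc n) V Z"
  shows "plot (tangent_bundle X) n W (\<lambda>w. (Z w, velocity X (\<lambda>t. Z (w(n := t)))))"
  unfolding tangent_bundle_plot_iff fst_conv snd_conv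
proof (intro conjI ballI allI impI)
  note inc = smooth_cartesian_self_inclusion[OF W(1)]
  show Zp: "plot (mdiff X) n W Z" by (rule mplot_compose[OF X p inc]) (use W in auto)
  show "velocity X (\<lambda>t. Z (w(n := t))) \<in> tangent_space X (Z w)" if w: "w \<in> W" for w
  proof -
    have wE: "w \<in> topspace (Euclidean_space n)" using w openin_subset[OF W(1)] by auto
    show ?thesis
      by (rule tangent_spaceI[OF velocity_family(1)[OF X p wE]])
        (use w W Euclidean_last[OF wE] in \<open>auto simp: fun_upd_idem\<close>)
  qed
  fix m D \<phi> j assume c: "(m, D, \<phi>) \<in> atlas X" and "j < m"
  let ?f = "\<lambda>x. \<phi> x j"
  have s: "smooth_real (Suc n) {u \<in> V. Z u \<in> D} (\<lambda>u. ?f (Z u))"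
    by (rule smooth_on_preimage[OF X smooth_on_coordinate[OF X c] p])
  have WD: "openin (Euclidean_space n) {u \<in> W. Z u \<in> D}"
    by (rule mplot_preimage[OF Zp chart_facts(1)[OF X c]])
  have "smooth_real n {u \<in> W. Z u \<in> D} (\<lambda>u. pderiv_at n (\<lambda>u. ?f (Z u)) u)"
    by (rule smooth_real_compose[OF smooth_real_pderiv[OF s, of n] smooth_cartesian_self_inclusion[OF
        WD]])
      (use W in auto)
  then show "smooth_real n {u \<in> W. Z u \<in> D} (\<lambda>u. velocity X (\<lambda>t. Z (u(n := t))) ?f)"
  proof (rule smooth_real_cong)
    fix u assume u: "u \<in> {u \<in> W. Z u \<in> D}"
    have uE: "u \<in> topspace (Euclidean_space n)" using u openin_subset[OF W(1)] by auto
    show "velocity X (\<lambda>t. Z (u(n := t))) ?f = pderiv_at n (\<lambda>u. ?f (Z u)) u"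
      by (rule velocity_family(2)[OF X p uE])
        (use u W smooth_near_coordinate[OF X c] in auto)
  qed
qed

text \<open>
Conversely, every plot of the tangent bundle is locally the velocity field of a plot with one
additional parameter: in a chart, follow straight lines. This reduces statements about smooth
families of tangent vectors to statements about smooth families of curves.
\<close>

lemma tangent_plot_family:
  assumes X: "smooth_manifold X" and q: "plot (tangent_bundle X) n U q" and u: "u \<in> U"
  obtains W V Z where "openin (Euclidean_space n) W" "u \<in> W" "W \<subseteq> U" "W \<subseteq> V"
    "\<forall>y\<in>V. head_coords n y \<in> W"
    "plot (mdiff X) (Suc n) V Z" "\<forall>w\<in>W. Z w = fst (q w)"
    "\<forall>w\<in>W. velocity X (\<lambda>t. Z (w(n := t))) = snd (q w)"
proof -
  define x where "x = (\<lambda>u. fst (q u))"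
  define v where "v = (\<lambda>u. snd (q u))"
  have xp: "plot (mdiff X) n U x" and vt: "\<And>u. u \<in> U \<Longrightarrow> v u \<in> tangent_space X (x u)"
    using q by (auto simp: tangent_bundle_plot_iff x_def v_def)
  obtain m D \<phi> where c: "(m, D, \<phi>) \<in> atlas X" "x u \<in> D" using chart_at[OF X mplot_point[OF xp u]] .
  have vs: "smooth_real n {u \<in> U. x u \<in> D} (\<lambda>u. v u (\<lambda>x. \<phi> x j))" if "j < m" for j
    using q c(1) that by (auto simp: tangent_bundle_plot_iff x_def v_def)
  have inv: "inv_into D \<phi> (\<phi> y) = y" if "y \<in> D" for y
    by (rule inv_into_f_f[OF chart_facts(4)[OF X c(1)] that])
  let ?E1 = "topspace (Euclidean_space (Suc n))"
  define W where "W = {u \<in> U. x u \<in> D}"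
  have W: "openin (Euclidean_space n) W"
    unfolding W_def by (rule mplot_preimage[OF xp chart_facts(1)[OF X c(1)]])
  have WE: "W \<subseteq> topspace (Euclidean_space n)" by (rule openin_subset[OF W])
  have xs: "smooth_cartesian n W m (\<lambda>u. \<phi> (x u))" unfolding W_def by (rule mplot_chart[OF xp c(1)])
  define W1 where "W1 = {y \<in> ?E1. head_coords n y \<in> W}"
  have W1: "openin (Euclidean_space (Suc n)) W1" unfolding W1_def
    by (rule smooth_cartesian_head_coords(1)[OF W])
  \<comment> \<open>The straight line in the chart through the point \<open>x\<close> in the direction \<open>v\<close>; the last
     coordinate is time.\<close>
  define Q where "Q y = (\<lambda>j. if j < m then \<phi> (x (head_coords n y)) j + y n * v (head_coords n y) (\<lambda>x. \<phi>
      x j) else 0)" for y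
  have Q: "smooth_cartesian (Suc n) W1 m Q"
  proof (rule smooth_cartesianI[OF W1])
    show "Q y \<in> topspace (Euclidean_space m)" for y by (simp add: Q_def topspace_Euclidean_space)
    fix j assume j: "j < m"
    have "smooth_real (Suc n) W1 (\<lambda>y. \<phi> (x (head_coords n y)) j)"
        "smooth_real (Suc n) W1 (\<lambda>y. v (head_coords n y) (\<lambda>x. \<phi> x j))"
      unfolding W1_def
      by (rule smooth_real_head_coords[OF smooth_cartesianD(3)[OF xs]], rule smooth_real_head_coords[OF
          vs[OF j, folded W_def]])
    then show "smooth_real (Suc n) W1 (\<lambda>y. Q y j)"
      using j by (simp add: Q_def smooth_real_add smooth_real_mult smooth_real_coord W1)
  qed
  define V where "V = {y \<in> W1. Q y \<in> \<phi> ` D}"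
  have V: "openin (Euclidean_space (Suc n)) V"
    unfolding V_def by (rule openin_smooth_preimage[OF Q chart_facts(3)[OF X c(1)]])
  define Z where "Z y = inv_into D \<phi> (Q y)" for y
  have p: "plot (mdiff X) (Suc n) V Z" unfolding Z_def
    by (rule mplot_compose[OF X chart_inverse_plot[OF X c(1)] smooth_cartesian_mono[OF Q V]]) (auto
        simp: V_def)
  have Qw: "Q (w(n := t)) = (\<lambda>j. if j < m then \<phi> (x w) j + t * v w (\<lambda>x. \<phi> x j) else 0)" if "w \<in> W"
      for w t
    by (simp only: Q_def head_coords_upd[OF subsetD[OF WE that]] fun_upd_same)
  have w0: "w(n := 0) = w" if "w \<in> W" for w
    using Euclidean_last[OF subsetD[OF WE that]] by (simp add: fun_upd_idem)
  have Qw0: "Q w = \<phi> (x w)" if "w \<in> W" for w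
  proof (rule ext)
    fix j
    have "\<phi> (x w) j = 0" if "j \<ge> m"
      using smooth_cartesianD(2)[OF xs \<open>w \<in> W\<close>] that by (simp add: topspace_Euclidean_space)
    then show "Q w j = \<phi> (x w) j" using Qw[OF that, of 0] w0[OF that] by simp
  qed
  have WV: "W \<subseteq> V"
  proof
    fix w assume w: "w \<in> W"
    then have "w \<in> topspace (Euclidean_space n)" using WE by auto
    then have "w \<in> ?E1" "head_coords n w = w" "x w \<in> D" using w
      by (simp_all add: Euclidean_mono head_coords_id W_def)
    then show "w \<in> V" using w Qw0[OF w] by (simp add: V_def W1_def)
  qed
  have Zw: "Z w = x w" if "w \<in> W" for w using Qw0[OF that] that by (simp add: Z_def inv W_def)
  have vel: "velocity X (\<lambda>t. Z (w(n := t))) = v w" if w: "w \<in> W" for w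
  proof -
    have wE: "w \<in> topspace (Euclidean_space n)" and wV: "w \<in> V" and wD: "x w \<in> D" and wU: "w \<in> U"
      using w WE WV by (auto simp: W_def)
    note sc = velocity_family(1)[OF X p wE wV]
    have Z0: "Z (w(n := 0)) = x w" using w0[OF w] Zw[OF w] by simp
    show ?thesis
    proof (rule tangent_eqI[OF X c(1) wD])
      show "velocity X (\<lambda>t. Z (w(n := t))) \<in> tangent_space X (x w)" by (rule tangent_spaceI[OF sc Z0])
      show "v w \<in> tangent_space X (x w)" by (rule vt[OF wU])
      fix j assume j: "j < m"
      have "eventually (\<lambda>t. w(n := t) \<in> V) (nhds 0)"
        by (rule curve_in_eventually[OF curve_in_last[OF wE] _ V]) (simp add: w0[OF w] wV)
      then have ev: "eventually (\<lambda>t. \<phi> (x w) j + t * v w (\<lambda>x. \<phi> x j) = \<phi> (Z (w(n := t))) j) (nhds 0)"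
      proof (rule eventually_mono)
        fix t assume t: "w(n := t) \<in> V"
        then have "\<phi> (Z (w(n := t))) = Q (w(n := t))" unfolding Z_def
          by (intro f_inv_into_f) (simp add: V_def)
        then show "\<phi> (x w) j + t * v w (\<lambda>x. \<phi> x j) = \<phi> (Z (w(n := t))) j"
          using Qw[OF w, of t] j by simp
      qed
      have "((\<lambda>t. \<phi> (x w) j + t * v w (\<lambda>x. \<phi> x j)) has_real_derivative v w (\<lambda>x. \<phi> x j)) (at 0)"
        by (auto intro!: derivative_eq_intros)
      then have "((\<lambda>t. \<phi> (Z (w(n := t))) j) has_real_derivative v w (\<lambda>x. \<phi> x j)) (at 0)"
        using DERIV_cong_ev[OF refl ev refl] by blast
      moreover have "((\<lambda>t. \<phi> (Z (w(n := t))) j) has_real_derivative velocity X (\<lambda>t. Z (w(n := t))) (\<lambda>y.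
          \<phi> y j)) (at 0)"
        by (rule velocity_deriv[OF X sc]) (use smooth_near_coordinate[OF X c(1) wD] Z0 in simp)
      ultimately show "velocity X (\<lambda>t. Z (w(n := t))) (\<lambda>y. \<phi> y j) = v w (\<lambda>y. \<phi> y j)"
        by (rule DERIV_unique[symmetric])
    qed
  qed
  show ?thesis
    by (rule that[of W V Z]) (use W WV p Zw vel u c in \<open>auto simp: W_def V_def W1_def x_def v_def\<close>)
qed

section \<open>Submersions and vertical families\<close>

lemma submersionD:
  assumes "submersion X Y F"
  shows "dsmooth (mdiff X) (mdiff Y) F"
    "x \<in> mpoints X \<Longrightarrow> differential X Y F x ` tangent_space X x = tangent_space Y (F x)"
  using assms by (auto simp: submersion_def)

lemma tangent_vector_with_coordinates:
  assumes X: "smooth_manifold X" and c: "(n, D, \<phi>) \<in> atlas X" "x \<in> D"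
    and a: "a \<in> topspace (Euclidean_space n)"
  obtains v where "v \<in> tangent_space X x" "\<forall>j. v (\<lambda>y. \<phi> y j) = a j"
proof -
  have \<phi>x: "\<phi> x \<in> topspace (Euclidean_space n)" by (rule chart_facts(6)[OF X c])
  define c' where "c' t = (\<lambda>i. \<phi> x i + t * a i)" for t
  have ci: "curve_in n c'" unfolding c'_def by (rule curve_in_affine[OF \<phi>x a])
  have c0: "c' 0 = \<phi> x" by (simp add: c'_def)
  define \<gamma> where "\<gamma> t = inv_into D \<phi> (c' t)" for t
  have \<gamma>: "smooth_curve X \<gamma>" unfolding \<gamma>_def
    by (rule smooth_curve_of_plot[OF X chart_inverse_plot[OF X c(1)] ci]) (use c c0 in auto)
  have \<gamma>0: "\<gamma> 0 = x" using c by (simp add: \<gamma>_def c0 inv_into_f_f[OF chart_facts(4)[OF X c(1)]])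
  have ev: "eventually (\<lambda>t. c' t \<in> \<phi> ` D) (nhds 0)"
    by (rule curve_in_eventually[OF ci _ chart_facts(3)[OF X c(1)]]) (use c c0 in auto)
  have "velocity X \<gamma> (\<lambda>y. \<phi> y j) = a j" for j
  proof -
    have ev': "eventually (\<lambda>t. \<phi> x j + t * a j = \<phi> (\<gamma> t) j) (nhds 0)"
      using ev by (rule eventually_mono) (simp add: \<gamma>_def f_inv_into_f, simp add: c'_def)
    have "((\<lambda>t. \<phi> x j + t * a j) has_real_derivative a j) (at 0)"
      by (auto intro!: derivative_eq_intros)
    then have "((\<lambda>t. \<phi> (\<gamma> t) j) has_real_derivative a j) (at 0)"
      using DERIV_cong_ev[OF refl ev' refl] by blast
    moreover have "((\<lambda>t. \<phi> (\<gamma> t) j) has_real_derivative velocity X \<gamma> (\<lambda>y. \<phi> y j)) (at 0)"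
      by (rule velocity_deriv[OF X \<gamma>]) (use smooth_near_coordinate[OF X c] \<gamma>0 in simp)
    ultimately show ?thesis by (rule DERIV_unique[symmetric])
  qed
  then show ?thesis using that[OF tangent_spaceI[OF \<gamma> \<gamma>0]] by blast
qed

lemma smooth_cartesian_vjoin:
  assumes f: "smooth_cartesian k U n f" and g: "smooth_cartesian k U m g"
  shows "smooth_cartesian k U (n + m) (\<lambda>u. vjoin n (f u) (g u))"
proof (rule smooth_cartesianI[OF smooth_cartesianD(1)[OF f]])
  show "vjoin n (f u) (g u) \<in> topspace (Euclidean_space (n + m))" if "u \<in> U" for u
    by (rule vjoin_in[OF smooth_cartesianD(2)[OF g that]])
  show "smooth_real k U (\<lambda>u. vjoin n (f u) (g u) j)" for j
    by (cases "j < n") (simp_all add: vjoin_def smooth_cartesianD(3)[OF f] smooth_cartesianD(3)[OF g])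
qed

lemma vjoin_in_cube:
  assumes "z \<in> cube n z0 d" "y \<in> cube m y0 d"
  shows "vjoin n z y \<in> cube (n + m) (vjoin n z0 y0) d"
  using assms vjoin_in[of y m n z] by (auto simp: cube_def vjoin_def)

text \<open>
In charts this is \<open>local_fibre_retraction\<close> for all components of \<open>F\<close>; the directions that it
needs are provided by the surjectivity of the differential. The retraction \<open>\<rho> z y\<close> is the point
into which \<open>z\<close> is moved on the fibre over \<open>y\<close>.
\<close>

lemma submersion_local_retraction:
  assumes X: "smooth_manifold X" and Y: "smooth_manifold Y" and F: "submersion X Y F"
      and x: "x \<in> mpoints X"
  obtains W W' \<rho> where "openin (mtop X) W" "x \<in> W" "openin (mtop Y) W'"
    "\<forall>z\<in>W. F z \<in> W'" "\<forall>z\<in>W. \<rho> z (F z) = z" "\<forall>z\<in>W. \<forall>y\<in>W'. F (\<rho> z y) = y"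
    "\<forall>n U p q. plot (mdiff X) n U p \<longrightarrow> plot (mdiff Y) n U q \<longrightarrow> p ` U \<subseteq> W \<longrightarrow> q ` U \<subseteq> W' \<longrightarrow>
       plot (mdiff X) n U (\<lambda>u. \<rho> (p u) (q u))"
proof -
  note Fs = submersionD(1)[OF F]
  note Fm = dsmooth_smooth_map_on[OF Fs]
  have Fx: "F x \<in> mpoints Y" using dsmoothD(1)[OF Fs] x by simp
  obtain n D \<phi> where c: "(n, D, \<phi>) \<in> atlas X" "x \<in> D" by (rule chart_at[OF X x])
  obtain m E \<psi> where d: "(m, E, \<psi>) \<in> atlas Y" "F x \<in> E" by (rule chart_at[OF Y Fx])
  have inv: "inv_into D \<phi> (\<phi> y) = y" if "y \<in> D" for y
    by (rule inv_into_f_f[OF chart_facts(4)[OF X c(1)] that])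
  define \<Omega> where "\<Omega> = {u \<in> \<phi> ` D. F (inv_into D \<phi> u) \<in> E}"
  define Fc where "Fc u = \<psi> (F (inv_into D \<phi> u))" for u
  have "plot (mdiff Y) n (\<phi> ` D) (\<lambda>u. F (inv_into D \<phi> u))"
    by (rule dsmoothD(2)[OF Fs chart_inverse_plot[OF X c(1)]])
  from mplot_chart[OF this d(1)] have Fcs: "smooth_cartesian n \<Omega> m Fc"
    unfolding \<Omega>_def Fc_def .
  have z0: "\<phi> x \<in> \<Omega>" using c d by (simp add: \<Omega>_def inv)
  have \<psi>E: "\<And>y. y \<in> E \<Longrightarrow> \<psi> y \<in> topspace (Euclidean_space m)" by (rule chart_facts(6)[OF Y d(1)])
  have dir: "\<exists>e\<in>topspace (Euclidean_space n). \<forall>l<m.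
       (\<Sum>i<n. pderiv_at i (\<lambda>u. Fc u l) (\<phi> x) * e i) = (if l = k then 1 else 0)" if k: "k < m" for k
  proof -
    have "(\<lambda>i. if i = k then 1 else 0) \<in> topspace (Euclidean_space m)"
      using k by (simp add: topspace_Euclidean_space)
    from tangent_vector_with_coordinates[OF Y d this]
    obtain w where w: "w \<in> tangent_space Y (F x)" "\<forall>j. w (\<lambda>y. \<psi> y j) = (if j = k then 1 else 0)" .
    have "w \<in> differential X Y F x ` tangent_space X x" using w(1) submersionD(2)[OF F x] by simp
    then obtain v where v: "v \<in> tangent_space X x" "w = differential X Y F x v" by (elim imageE)
    have v2: "w = push X x Y F v" using v(2) differential_eq_push[OF X Y Fs v(1)] by simp
    define e where "e i = (if i < n then v (\<lambda>y. \<phi> y i) else 0)" for i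
    have "(\<Sum>i<n. pderiv_at i (\<lambda>u. Fc u l) (\<phi> x) * e i) = (if l = k then 1 else 0)" for l
    proof -
      have ny: "smooth_near Y (F x) (\<lambda>y. \<psi> y l)" by (rule smooth_near_coordinate[OF Y d])
      have nx: "smooth_near X x (\<lambda>y. \<psi> (F y) l)" by (rule smooth_near_compose[OF X Y Fm x ny])
      have "v (\<lambda>y. \<psi> (F y) l) = (\<Sum>i<n. pderiv_at i (\<lambda>u. Fc u l) (\<phi> x) * v (\<lambda>y. \<phi> y i))"
        unfolding Fc_def by (rule tangent_coordinates[OF X c v(1) nx])
      moreover have "v (\<lambda>y. \<psi> (F y) l) = w (\<lambda>y. \<psi> y l)" using ny by (simp add: v2 push_def)
      ultimately show ?thesis using w(2) by (simp add: e_def)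
    qed
    moreover have "e \<in> topspace (Euclidean_space n)" by (simp add: e_def topspace_Euclidean_space)
    ultimately show ?thesis by blast
  qed
  obtain \<Theta> \<rho> where \<rho>: "smooth_cartesian (n + m) \<Theta> n \<rho>" "vjoin n (\<phi> x) (head_coords m (Fc (\<phi> x))) \<in> \<Theta>"
    and \<rho>': "\<forall>y\<in>\<Theta>. \<rho> y \<in> \<Omega> \<and> (\<forall>l<m. Fc (\<rho> y) l = y (n + l)) \<and>
      (head_coords n y \<in> \<Omega> \<longrightarrow> (\<forall>l<m. Fc (head_coords n y) l = y (n + l)) \<longrightarrow> \<rho> y = head_coords n y)"
    using local_fibre_retraction[OF Fcs z0 dir, of m] by auto
  let ?y0 = "\<psi> (F x)"
  have "head_coords m (Fc (\<phi> x)) = ?y0" using c d \<psi>E by (simp add: Fc_def inv head_coords_id)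
  then have "vjoin n (\<phi> x) ?y0 \<in> \<Theta>" using \<rho>(2) by simp
  then obtain r where r: "r > 0" "cube (n + m) (vjoin n (\<phi> x) ?y0) r \<subseteq> \<Theta>"
    using smooth_cartesianD(1)[OF \<rho>(1)] by (auto simp: openin_Euclidean_iff)
  define W' where "W' = {y \<in> E. \<psi> y \<in> cube m ?y0 r}"
  have W': "openin (mtop Y) W'" unfolding W'_def by (rule chart_preimage_open[OF Y d(1) openin_cube])
  define W where "W = {z \<in> D. \<phi> z \<in> cube n (\<phi> x) r} \<inter> {z \<in> mpoints X. F z \<in> W'}"
  have W: "openin (mtop X) W" unfolding W_def
    by (intro openin_Int chart_preimage_open[OF X c(1) openin_cube] smooth_map_on_preimage[OF X Fm W'])
  have \<phi>x: "\<phi> x \<in> topspace (Euclidean_space n)" by (rule chart_facts(6)[OF X c])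
  have xW: "x \<in> W" using c d x r \<psi>E \<phi>x by (simp add: W_def W'_def cube_self)
  define J where "J z y = vjoin n (\<phi> z) (\<psi> y)" for z y
  have J: "J z y \<in> \<Theta>" if "z \<in> W" "y \<in> W'" for z y
    unfolding J_def using vjoin_in_cube[of "\<phi> z" n "\<phi> x" r "\<psi> y" m ?y0] that r
    by (auto simp: W_def W'_def)
  define R where "R z y = inv_into D \<phi> (\<rho> (J z y))" for z y
  show ?thesis
  proof (rule that[OF W xW W', of R]; (intro ballI allI impI)?)
    show "F z \<in> W'" if "z \<in> W" for z using that by (simp add: W_def)
    show "F (R z y) = y" if zy: "z \<in> W" "y \<in> W'" for z y
    proof -
      have 1: "\<rho> (J z y) \<in> \<Omega>" "\<forall>l<m. Fc (\<rho> (J z y)) l = J z y (n + l)" using \<rho>' J[OF zy] by auto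
      have E1: "F (R z y) \<in> E" using 1(1) by (simp add: \<Omega>_def R_def)
      have E2: "y \<in> E" using zy by (simp add: W'_def)
      have "\<psi> (F (R z y)) l = \<psi> y l" for l
      proof (cases "l < m")
        case True
        then show ?thesis using 1(2) by (simp add: Fc_def R_def J_def vjoin_def)
      next
        case False
        then show ?thesis using \<psi>E[OF E1] \<psi>E[OF E2] by (simp add: topspace_Euclidean_space)
      qed
      then have "\<psi> (F (R z y)) = \<psi> y" by (rule ext)
      then show ?thesis using inj_onD[OF chart_facts(4)[OF Y d(1)] _ E1 E2] by blast
    qed
    show "R z (F z) = z" if z: "z \<in> W" for z
    proof -
      have zD: "z \<in> D" and FzW: "F z \<in> W'" using z by (auto simp: W_def)
      then have FzE: "F z \<in> E" by (simp add: W'_def)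
      have ct: "head_coords n (J z (F z)) = \<phi> z" unfolding J_def
        by (rule head_coords_vjoin[OF chart_facts(6)[OF X c(1) zD]])
      have "\<phi> z \<in> \<Omega>" using zD FzE by (simp add: \<Omega>_def inv)
      moreover have "\<forall>l<m. Fc (\<phi> z) l = J z (F z) (n + l)" by (simp add: Fc_def J_def vjoin_def inv zD)
      ultimately have "\<rho> (J z (F z)) = \<phi> z" using \<rho>'[rule_format, OF J[OF z FzW]] ct by simp
      then show ?thesis by (simp add: R_def inv zD)
    qed
    fix k U p q
    assume p: "plot (mdiff X) k U p" "p ` U \<subseteq> W" and q: "plot (mdiff Y) k U q" "q ` U \<subseteq> W'"
    have "{u \<in> U. p u \<in> D} = U" "{u \<in> U. q u \<in> E} = U" using p q by (auto simp: W_def W'_def)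
    then have s: "smooth_cartesian k U n (\<lambda>u. \<phi> (p u))" "smooth_cartesian k U m (\<lambda>u. \<psi> (q u))"
      using mplot_chart[OF p(1) c(1)] mplot_chart[OF q(1) d(1)] by simp_all
    have Jm: "J (p u) (q u) \<in> \<Theta>" if "u \<in> U" for u
      using J subsetD[OF p(2) imageI[OF that]] subsetD[OF q(2) imageI[OF that]] by simp
    have "smooth_cartesian k U (n + m) (\<lambda>u. J (p u) (q u))"
      unfolding J_def by (rule smooth_cartesian_vjoin[OF s])
    then have "smooth_cartesian k U n (\<lambda>u. \<rho> (J (p u) (q u)))"
      by (rule smooth_cartesian_compose[OF \<rho>(1)]) (use Jm in auto)
    moreover have "\<rho> (J (p u) (q u)) \<in> \<phi> ` D" if "u \<in> U" for u
      using \<rho>'[rule_format, OF Jm[OF that]] by (simp add: \<Omega>_def)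
    ultimately show "plot (mdiff X) k U (\<lambda>u. R (p u) (q u))"
      unfolding R_def by (intro mplot_compose[OF X chart_inverse_plot[OF X c(1)]]) auto
  qed
qed

text \<open>
Follow straight lines as in \<open>tangent_plot_family\<close> and retract the result onto the fibres. The
velocities before and after differ by the image, under the differential of the retraction, of
the velocity of the projection to \<open>Y\<close>, and this velocity vanishes because the given vectors are
vertical.
\<close>

lemma vertical_plot_family:
  assumes X: "smooth_manifold X" and Y: "smooth_manifold Y" and F: "submersion X Y F"
    and q: "plot (tangent_bundle X) n U q" and u: "u \<in> U"
    and ver: "\<And>u. u \<in> U \<Longrightarrow> push X (fst (q u)) Y F (snd (q u)) = 0"
  obtains W V Z where "openin (Euclidean_space n) W" "u \<in> W" "W \<subseteq> U" "W \<subseteq> V"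
    "\<forall>y\<in>V. head_coords n y \<in> W"
    "plot (mdiff X) (Suc n) V Z" "\<forall>w\<in>W. Z w = fst (q w)"
    "\<forall>w\<in>W. velocity X (\<lambda>t. Z (w(n := t))) = snd (q w)"
    "\<forall>y\<in>V. F (Z y) = F (fst (q (head_coords n y)))"
proof -
  obtain W0 V0 Z0 where W0: "openin (Euclidean_space n) W0" "u \<in> W0" "W0 \<subseteq> U" "W0 \<subseteq> V0"
    and cut0: "\<forall>y\<in>V0. head_coords n y \<in> W0"
    and Z00: "plot (mdiff X) (Suc n) V0 Z0" "\<forall>w\<in>W0. Z0 w = fst (q w)"
    "\<forall>w\<in>W0. velocity X (\<lambda>t. Z0 (w(n := t))) = snd (q w)"
    using tangent_plot_family[OF X q u] .
  note Z0 = Z00[rule_format]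
  define x where "x = (\<lambda>u. fst (q u))"
  have xp: "plot (mdiff X) n U x" using q by (simp add: tangent_bundle_plot_iff x_def)
  note Fs = submersionD(1)[OF F]
  note Fm = dsmooth_smooth_map_on[OF Fs]
  obtain Wx Wy \<rho> where Wx: "openin (mtop X) Wx" "x u \<in> Wx" and Wy: "openin (mtop Y) Wy"
    "\<forall>z\<in>Wx. F z \<in> Wy" and \<rho>0: "\<forall>z\<in>Wx. \<rho> z (F z) = z" "\<forall>z\<in>Wx. \<forall>y\<in>Wy. F (\<rho> z y) = y"
    "\<forall>n U p q. plot (mdiff X) n U p \<longrightarrow> plot (mdiff Y) n U q \<longrightarrow> p ` U \<subseteq> Wx \<longrightarrow> q ` U \<subseteq> Wy \<longrightarrow>
       plot (mdiff X) n U (\<lambda>u. \<rho> (p u) (q u))"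
    using submersion_local_retraction[OF X Y F mplot_point[OF xp u]] .
  note \<rho> = \<rho>0[rule_format]
  have xW0: "plot (mdiff X) n W0 x" by (rule mplot_restrict[OF X xp W0(1,3)])
  define W where "W = {w \<in> W0. x w \<in> Wx}"
  have W: "openin (Euclidean_space n) W" unfolding W_def by (rule mplot_preimage[OF xW0 Wx(1)])
  have WE: "W \<subseteq> topspace (Euclidean_space n)" by (rule openin_subset[OF W])
  define C where "C = {y \<in> topspace (Euclidean_space (Suc n)). head_coords n y \<in> W}"
  have C: "openin (Euclidean_space (Suc n)) C" "smooth_cartesian (Suc n) C n (head_coords n)"
    unfolding C_def by (rule smooth_cartesian_head_coords[OF W])+
  define V where "V = {y \<in> V0. Z0 y \<in> Wx} \<inter> C"
  have V: "openin (Euclidean_space (Suc n)) V" unfolding V_def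
    by (intro openin_Int mplot_preimage[OF Z0(1) Wx(1)] C)
  have cutV: "head_coords n y \<in> W" if "y \<in> V" for y using that by (simp add: V_def C_def)
  \<comment> \<open>The curves of the family \<open>Z0\<close> are moved onto the fibres of their starting points.\<close>
  define Z where "Z y = \<rho> (Z0 y) (F (x (head_coords n y)))" for y
  have Z0V: "plot (mdiff X) (Suc n) V Z0" by (rule mplot_restrict[OF X Z0(1) V]) (auto simp: V_def)
  have "plot (mdiff X) (Suc n) V (\<lambda>y. x (head_coords n y))"
    by (rule mplot_compose[OF X xW0 smooth_cartesian_mono[OF C(2) V]]) (auto simp: V_def C_def W_def)
  from dsmoothD(2)[OF Fs this] have Fxp: "plot (mdiff Y) (Suc n) V (\<lambda>y. F (x (head_coords n y)))" .
  have Zp: "plot (mdiff X) (Suc n) V Z" unfolding Z_def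
    by (rule \<rho>(3)[OF Z0V Fxp]) (use cutV Wy(2) in \<open>auto simp: V_def W_def\<close>)
  have WV: "W \<subseteq> V"
  proof
    fix w assume w: "w \<in> W"
    then have "w \<in> topspace (Euclidean_space n)" using WE by auto
    then show "w \<in> V" using w W0(4) Z0(2)[of w]
      by (auto simp: V_def C_def W_def Euclidean_mono head_coords_id x_def)
  qed
  have wW: "w \<in> topspace (Euclidean_space n)" "w \<in> W0" "w \<in> V" "x w \<in> Wx" "head_coords n w = w"
      "Z0 w = x w"
    "w \<in> U" "w(n := 0) = w" if "w \<in> W" for w
  proof -
    show wE: "w \<in> topspace (Euclidean_space n)" using that WE by auto
    show "w \<in> W0" "w \<in> V" "x w \<in> Wx" "Z0 w = x w" "w \<in> U" using that WV Z0(2)[of w] W0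
      by (auto simp: W_def x_def)
    show "head_coords n w = w" by (rule head_coords_id[OF wE])
    show "w(n := 0) = w" using Euclidean_last[OF wE] by (simp add: fun_upd_idem)
  qed
  have Zw: "Z w = x w" if "w \<in> W" for w using wW[OF that] \<rho>(1) by (simp add: Z_def)
  have FZ: "F (Z y) = F (x (head_coords n y))" if y: "y \<in> V" for y
    unfolding Z_def by (rule \<rho>(2)) (use cutV[OF y] y Wy(2) in \<open>auto simp: V_def W_def\<close>)
  have vel: "velocity X (\<lambda>t. Z (w(n := t))) = snd (q w)" if w: "w \<in> W" for w
  proof -
    let ?z = "\<lambda>_::nat. 0::real"
    have up: "smooth_cartesian 2 (topspace (Euclidean_space 2)) (Suc n) (\<lambda>s. w(n := s j))" for j
    proof (rule smooth_cartesianI[OF openin_topspace Euclidean_upd[OF wW(1)[OF w]]])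
      show "smooth_real 2 (topspace (Euclidean_space 2)) (\<lambda>s. (w(n := s j)) i)" for i
        by (cases "i = n") (simp_all add: smooth_real_coord smooth_real_const)
    qed
    define A where "A = {s \<in> topspace (Euclidean_space 2). w(n := s 0) \<in> V} \<inter> {s \<in> topspace
        (Euclidean_space 2). w(n := s 1) \<in> V}"
    have A: "openin (Euclidean_space 2) A"
      unfolding A_def by (intro openin_Int openin_smooth_preimage[OF up V])
    have pj: "plot (mdiff X) 2 A (\<lambda>s. Z0 (w(n := s j)))" if "j = 0 \<or> j = 1" for j
      by (rule mplot_compose[OF X Z0V smooth_cartesian_mono[OF up A]]) (use that in \<open>auto simp: A_def\<close>)
    \<comment> \<open>On this surface the diagonal is \<open>Z0\<close> and the first axis is \<open>Z\<close>, and on the second axis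
       only the projection of \<open>Z0\<close> to \<open>Y\<close> varies.\<close>
    define K where "K s = \<rho> (Z0 (w(n := s 0))) (F (Z0 (w(n := s 1))))" for s :: "nat \<Rightarrow> real"
    have K: "plot (mdiff X) 2 A K" unfolding K_def
      by (rule \<rho>(3)[OF pj dsmoothD(2)[OF Fs pj]]) (auto simp: A_def V_def Wy(2))
    have zA: "?z \<in> A" using wW[OF w] by (simp add: A_def zero_in_Euclidean)
    have ev: "eventually (\<lambda>t. w(n := t) \<in> V) (nhds 0)"
      by (rule curve_in_eventually[OF curve_in_last[OF wW(1)[OF w]] _ V]) (use wW[OF w] in simp)
    have "velocity X (\<lambda>t. K (?z(0 := t, 1 := t))) = velocity X (\<lambda>t. Z0 (w(n := t)))"
      by (rule velocity_eqI, rule eventually_mono[OF ev]) (simp add: K_def \<rho>(1) V_def)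
    moreover have "velocity X (\<lambda>t. K (?z(0 := t))) = velocity X (\<lambda>t. Z (w(n := t)))"
      by (simp add: K_def Z_def wW[OF w] head_coords_upd[OF wW(1)[OF w]])
    moreover have "velocity X (\<lambda>t. K (?z(1 := t))) = 0"
    proof -
      have h: "smooth_map_on Y Wy X (\<rho> (x w))"
        unfolding smooth_map_on_def
      proof (intro conjI allI impI Wy(1))
        fix k U p assume p: "plot (mdiff Y) k U p" "p ` U \<subseteq> Wy"
        have "x w \<in> mpoints X" using wW(4)[OF w] openin_subset[OF Wx(1)] by auto
        from \<rho>(3)[OF mplot_const[OF X mplot_open[OF p(1)] this] p(1) _ p(2)] wW(4)[OF w]
        show "plot (mdiff X) k U (\<lambda>u. \<rho> (x w) (p u))" by auto
      qed
      define \<delta> where "\<delta> = (\<lambda>t. Z0 (w(n := t)))"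
      have \<delta>0: "\<delta> 0 = x w" using wW(6,8)[OF w] by (simp add: \<delta>_def)
      have sc: "smooth_curve X \<delta>" unfolding \<delta>_def
        by (rule velocity_family(1)[OF X Z0V wW(1,3)[OF w]])
      have v\<delta>: "velocity X \<delta> = snd (q w)" unfolding \<delta>_def by (rule Z0(3)[OF wW(2)[OF w]])
      have scY: "smooth_curve Y (\<lambda>t. F (\<delta> t))"
        by (rule smooth_curve_map[OF X Fm sc]) (rule smooth_curve_point[OF sc])
      have vY: "velocity Y (\<lambda>t. F (\<delta> t)) = 0"
        using velocity_map[OF X Y Fm sc smooth_curve_point[OF sc]] ver[OF wW(7)[OF w]]
        by (simp add: x_def \<delta>0 v\<delta>)
      have "F (\<delta> 0) \<in> Wy" using Wy(2) wW(4)[OF w] by (simp add: \<delta>0)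
      then have "velocity X (\<lambda>t. \<rho> (x w) (F (\<delta> t))) = 0"
        using velocity_map[OF Y X h scY] by (simp add: vY push_zero)
      then show ?thesis by (simp add: K_def \<delta>_def wW[OF w])
    qed
    ultimately show ?thesis
      using velocity_diagonal[OF X K zA] Z0(3)[OF wW(2)[OF w]] by simp
  qed
  show ?thesis
    by (rule that[of W V Z]) (use W WV Zp Zw FZ vel cutV u W0 Wx in \<open>auto simp: W_def x_def\<close>)
qed

text \<open>A single vector is a plot on the zero-dimensional space.\<close>

lemma vertical_curve:
  assumes X: "smooth_manifold X" and Y: "smooth_manifold Y" and F: "submersion X Y F"
    and v: "v \<in> tangent_space X x" "push X x Y F v = 0"
  obtains \<gamma> where "smooth_curve X \<gamma>" "\<gamma> 0 = x" "velocity X \<gamma> = v" "eventually (\<lambda>t. F (\<gamma> t) = F x) (nhds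
      0)"
proof -
  let ?E = "topspace (Euclidean_space 0)" and ?z = "\<lambda>_::nat. 0::real"
  have x: "x \<in> mpoints X" by (rule tangent_point[OF v(1)])
  have "plot (tangent_bundle X) 0 ?E (\<lambda>_. (x, v))"
    unfolding tangent_bundle_plot_iff fst_conv snd_conv
  proof (intro conjI ballI allI impI)
    show "plot (mdiff X) 0 ?E (\<lambda>u. x)" by (rule mplot_const[OF X openin_topspace x])
    show "smooth_real 0 {u \<in> ?E. x \<in> D} (\<lambda>u. v (\<lambda>x. \<phi> x j))" for D \<phi> and j :: nat
      by (rule smooth_real_const, cases "x \<in> D") auto
  qed (rule v(1))
  note fam = vertical_plot_family[OF X Y F this zero_in_Euclidean, unfolded fst_conv snd_conv, OF v(2)]
  obtain W V Z where W: "openin (Euclidean_space 0) W" "?z \<in> W" "W \<subseteq> ?E" "W \<subseteq> V"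
    and ct: "\<forall>y\<in>V. head_coords 0 y \<in> W"
    and Z0: "plot (mdiff X) (Suc 0) V Z" "\<forall>w\<in>W. Z w = x" "\<forall>w\<in>W. velocity X (\<lambda>t. Z (w(0 := t))) = v"
    and FZ: "\<forall>y\<in>V. F (Z y) = F x"
    using fam .
  note Z = Z0[rule_format]
  have zV: "?z \<in> V" using W by auto
  have z0: "?z(0 := 0) = ?z" by (rule fun_upd_triv)
  have ev: "eventually (\<lambda>t. ?z(0 := t) \<in> V) (nhds 0)"
    by (rule curve_in_eventually[OF curve_in_last[OF zero_in_Euclidean] _ mplot_open[OF Z(1)]]) (use zV
        z0 in simp)
  show ?thesis
    by (rule that[OF velocity_family(1)[OF X Z(1) zero_in_Euclidean zV] _ Z(3)[OF W(2)]
        eventually_mono[OF ev]])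
      (use Z(2)[OF W(2)] z0 FZ in auto)
qed

section \<open>Differentials along fibres\<close>

text \<open>
Precomposition with the retraction onto the fibre through \<open>x\<close> extends \<open>\<Phi>\<close> smoothly to a
neighbourhood of \<open>x\<close>. The required linear map is the differential of the extension, and it does
not depend on the curve.
\<close>

lemma fibre_velocity:
  assumes X: "smooth_manifold X" and Y: "smooth_manifold Y" and Z: "smooth_manifold Z"
    and F: "submersion X Y F" and x: "x \<in> mpoints X"
    and \<Phi>: "dsmooth (subspace_diffeology (mdiff X) {h \<in> mpoints X. F h = F x}) (mdiff Z) \<Phi>"
  obtains L where "\<forall>v w. L (v + w) = L v + L w" "\<forall>c v. L (tscale c v) = tscale c (L v)"
    "\<forall>\<gamma>. smooth_curve X \<gamma> \<longrightarrow> \<gamma> 0 = x \<longrightarrow> (\<forall>\<^sub>F t in nhds 0. F (\<gamma> t) = F x) \<longrightarrow>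
       velocity Z (\<lambda>t. \<Phi> (\<gamma> t)) = L (velocity X \<gamma>)"
proof -
  obtain W W' \<rho> where W: "openin (mtop X) W" "x \<in> W" and W': "openin (mtop Y) W'"
    "\<forall>z\<in>W. F z \<in> W'" and \<rho>0: "\<forall>z\<in>W. \<rho> z (F z) = z" "\<forall>z\<in>W. \<forall>y\<in>W'. F (\<rho> z y) = y"
    "\<forall>n U p q. plot (mdiff X) n U p \<longrightarrow> plot (mdiff Y) n U q \<longrightarrow> p ` U \<subseteq> W \<longrightarrow> q ` U \<subseteq> W' \<longrightarrow>
       plot (mdiff X) n U (\<lambda>u. \<rho> (p u) (q u))"
    using submersion_local_retraction[OF X Y F x] .
  note \<rho> = \<rho>0[rule_format]
  have Fx: "F x \<in> W'" using W W' by blast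
  define r where "r z = \<Phi> (\<rho> z (F x))" for z
  have r: "smooth_map_on X W Z r"
    unfolding smooth_map_on_def
  proof (intro conjI allI impI W)
    fix n U p assume p: "plot (mdiff X) n U p" "p ` U \<subseteq> W"
    have FxY: "F x \<in> mpoints Y" using Fx openin_subset[OF W'(1)] by auto
    have pl: "plot (mdiff X) n U (\<lambda>u. \<rho> (p u) (F x))"
      by (rule \<rho>(3)[OF p(1) mplot_const[OF Y mplot_open[OF p(1)] FxY] p(2)]) (use Fx in auto)
    have "plot (subspace_diffeology (mdiff X) {h \<in> mpoints X. F h = F x}) n U (\<lambda>u. \<rho> (p u) (F x))"
      using pl mplot_point[OF pl] \<rho>(2) Fx p(2) by (auto simp: subspace_diffeology_def)
    from dsmoothD(2)[OF \<Phi> this] show "plot (mdiff Z) n U (\<lambda>u. r (p u))" by (simp add: r_def)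
  qed
  have "velocity Z (\<lambda>t. \<Phi> (\<gamma> t)) = push X x Z r (velocity X \<gamma>)"
    if \<gamma>: "smooth_curve X \<gamma>" "\<gamma> 0 = x" "\<forall>\<^sub>F t in nhds 0. F (\<gamma> t) = F x" for \<gamma>
  proof -
    have evW: "\<forall>\<^sub>F t in nhds 0. \<gamma> t \<in> W"
      by (rule smooth_curve_eventually_in[OF X \<gamma>(1) W(1)]) (simp add: \<gamma> W)
    have "velocity Z (\<lambda>t. \<Phi> (\<gamma> t)) = velocity Z (\<lambda>t. r (\<gamma> t))"
    proof (rule velocity_eqI)
      show "\<forall>\<^sub>F t in nhds 0. \<Phi> (\<gamma> t) = r (\<gamma> t)"
        using evW \<gamma>(3)
      proof eventually_elim
        case (elim t)
        then show ?case using \<rho>(1)[of "\<gamma> t"] by (simp add: r_def)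
      qed
    qed
    then show ?thesis using velocity_map[OF X Z r \<gamma>(1)] W \<gamma>(2) by simp
  qed
  then show ?thesis using that[of "push X x Z r"] by (simp add: push_add push_scale)
qed

text \<open>
Two curves in the fibre with the same velocity have images with the same velocity by
\<open>fibre_velocity\<close>, so the description that defines the differential has a unique solution; every
vertical vector is the velocity of a curve in the fibre by \<open>vertical_curve\<close>.
\<close>

lemma differential_on_fibre:
  assumes X: "smooth_manifold X" and Y: "smooth_manifold Y" and Z: "smooth_manifold Z"
    and F: "submersion X Y F" and x: "x \<in> mpoints X"
    and S: "S = {h \<in> mpoints X. F h = F x}"
    and \<Phi>: "dsmooth (subspace_diffeology (mdiff X) S) (mdiff Z) \<Phi>"
  shows "smooth_curve X \<gamma> \<Longrightarrow> \<gamma> 0 = x \<Longrightarrow> \<forall>\<^sub>F t in nhds 0. F (\<gamma> t) = F x \<Longrightarrow>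
       differential_on X S Z \<Phi> x (velocity X \<gamma>) = velocity Z (\<lambda>t. \<Phi> (\<gamma> t))"
    and "v \<in> tangent_space X x \<Longrightarrow> push X x Y F v = 0 \<Longrightarrow> w \<in> tangent_space X x \<Longrightarrow> push X x Y F w = 0 \<Longrightarrow>
       differential_on X S Z \<Phi> x (v + w) = differential_on X S Z \<Phi> x v + differential_on X S Z \<Phi> x w"
    and "v \<in> tangent_space X x \<Longrightarrow> push X x Y F v = 0 \<Longrightarrow>
       differential_on X S Z \<Phi> x (tscale c v) = tscale c (differential_on X S Z \<Phi> x v)"
proof -
  obtain L where L: "\<forall>v w. L (v + w) = L v + L w" "\<forall>c v. L (tscale c v) = tscale c (L v)"
    and L3: "\<forall>\<gamma>. smooth_curve X \<gamma> \<longrightarrow> \<gamma> 0 = x \<longrightarrow> (\<forall>\<^sub>F t in nhds 0. F (\<gamma> t) = F x) \<longrightarrow>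
       velocity Z (\<lambda>t. \<Phi> (\<gamma> t)) = L (velocity X \<gamma>)"
    using fibre_velocity[OF X Y Z F x \<Phi>[unfolded S]] .
  have d: "differential_on X S Z \<Phi> x (velocity X \<gamma>) = L (velocity X \<gamma>)"
    if \<gamma>: "smooth_curve X \<gamma>" "\<gamma> 0 = x" "\<forall>\<^sub>F t in nhds 0. F (\<gamma> t) = F x" for \<gamma>
    unfolding differential_on_def
  proof (rule the_equality)
    have "\<forall>\<^sub>F t in nhds 0. \<gamma> t \<in> mpoints X"
      by (rule smooth_curve_eventually_in[OF X \<gamma>(1) openin_topspace smooth_curve_point[OF \<gamma>(1)]])
    with \<gamma>(3) have "\<forall>\<^sub>F t in nhds 0. \<gamma> t \<in> S" by eventually_elim (simp add: S)
    then show "\<exists>\<gamma>'. smooth_curve X \<gamma>' \<and> \<gamma>' 0 = x \<and> (\<forall>\<^sub>F t in nhds 0. \<gamma>' t \<in> S) \<and>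
        velocity X \<gamma>' = velocity X \<gamma> \<and> L (velocity X \<gamma>) = velocity Z (\<Phi> \<circ> \<gamma>')"
      using \<gamma> L3 by (intro exI[of _ \<gamma>]) (simp add: o_def)
  next
    fix w assume "\<exists>\<gamma>'. smooth_curve X \<gamma>' \<and> \<gamma>' 0 = x \<and> (\<forall>\<^sub>F t in nhds 0. \<gamma>' t \<in> S) \<and>
        velocity X \<gamma>' = velocity X \<gamma> \<and> w = velocity Z (\<Phi> \<circ> \<gamma>')"
    then obtain \<delta> where \<delta>: "smooth_curve X \<delta>" "\<delta> 0 = x" "\<forall>\<^sub>F t in nhds 0. \<delta> t \<in> S"
       "velocity X \<delta> = velocity X \<gamma>" "w = velocity Z (\<Phi> \<circ> \<delta>)" by auto
    have "\<forall>\<^sub>F t in nhds 0. F (\<delta> t) = F x" using \<delta>(3) by (rule eventually_mono) (simp add: S)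
    then show "w = L (velocity X \<gamma>)" using L3 \<delta> by (simp add: o_def)
  qed
  show "smooth_curve X \<gamma> \<Longrightarrow> \<gamma> 0 = x \<Longrightarrow> \<forall>\<^sub>F t in nhds 0. F (\<gamma> t) = F x \<Longrightarrow>
       differential_on X S Z \<Phi> x (velocity X \<gamma>) = velocity Z (\<lambda>t. \<Phi> (\<gamma> t))"
    using d L3 by simp
  have dv: "differential_on X S Z \<Phi> x v = L v" if v: "v \<in> tangent_space X x" "push X x Y F v = 0" for v
  proof -
    obtain \<gamma> where "smooth_curve X \<gamma>" "\<gamma> 0 = x" "velocity X \<gamma> = v" "\<forall>\<^sub>F t in nhds 0. F (\<gamma> t) = F x"
      using vertical_curve[OF X Y F v] .
    then show ?thesis using d[of \<gamma>] by simp
  qed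
  show "differential_on X S Z \<Phi> x (v + w) = differential_on X S Z \<Phi> x v + differential_on X S Z \<Phi> x w"
    if "v \<in> tangent_space X x" "push X x Y F v = 0" "w \<in> tangent_space X x" "push X x Y F w = 0"
    using dv[OF that(1,2)] dv[OF that(3,4)] dv[OF tangent_add[OF X that(1,3)]] that L
      by (simp add: push_add)
  show "differential_on X S Z \<Phi> x (tscale c v) = tscale c (differential_on X S Z \<Phi> x v)"
    if "v \<in> tangent_space X x" "push X x Y F v = 0"
    using dv[OF that] dv[OF tangent_scale[OF X that(1), of c]] that L
    by (simp add: push_scale) (simp add: tscale_def zero_fun_def)
qed

section \<open>Linear systems with smooth coefficients\<close>

text \<open>
Gauss elimination. Some entry of the last vector is nonzero at \<open>u0\<close>, hence on a neighbourhood;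
subtracting multiples of that vector from the others eliminates its coefficient, and the
remaining vectors are still independent.
\<close>

lemma smooth_coefficients:
  fixes k N :: nat and w :: "nat \<Rightarrow> (nat \<Rightarrow> real) \<Rightarrow> nat \<Rightarrow> real"
  assumes "u0 \<in> U" "openin (Euclidean_space n) U"
    and "\<And>i j. i < k \<Longrightarrow> j < N \<Longrightarrow> smooth_real n U (\<lambda>u. w i u j)"
    and "\<And>j. j < N \<Longrightarrow> smooth_real n U (\<lambda>u. v u j)"
    and "\<And>u c. u \<in> U \<Longrightarrow> (\<And>j. j < N \<Longrightarrow> (\<Sum>i<k. c i * w i u j) = 0) \<Longrightarrow> (\<forall>i<k. c i = 0)"
    and "\<And>u j. u \<in> U \<Longrightarrow> j < N \<Longrightarrow> v u j = (\<Sum>i<k. a i u * w i u j)"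
  shows "\<exists>W. u0 \<in> W \<and> W \<subseteq> U \<and> openin (Euclidean_space n) W \<and> (\<forall>i<k. smooth_real n W (a i))"
  using assms
proof (induction k arbitrary: U v w)
  case 0
  then show ?case by (intro exI[of _ U]) auto
next
  case (Suc k)
  have "\<exists>j0<N. w k u0 j0 \<noteq> (0::real)"
  proof (rule ccontr)
    assume "\<not> (\<exists>j0<N. w k u0 j0 \<noteq> 0)"
    then have "\<And>j. j < N \<Longrightarrow> (\<Sum>i<Suc k. (if i = k then 1 else 0) * w i u0 j) = 0" by simp
    then have "\<forall>i<Suc k. (if i = k then 1 else 0) = (0::real)" by (rule Suc.prems(5)[OF Suc.prems(1)])
    from this[rule_format, of k] show False by simp
  qed
  then obtain j0 where j0: "j0 < N" "w k u0 j0 \<noteq> 0" by (elim exE conjE)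
  have wk: "smooth_real n U (\<lambda>u. w k u j0)" by (rule Suc.prems(3)[OF lessI j0(1)])
  define U' where "U' = {u \<in> U. w k u j0 \<in> - {0}}"
  have U': "openin (Euclidean_space n) U'" "U' \<subseteq> U" "u0 \<in> U'"
    unfolding U'_def using openin_smooth_real_preimage[OF wk, of "- {0}"] j0(2) Suc.prems(1)
    by (simp_all add: open_Compl)
  have nz: "w k u j0 \<noteq> 0" if "u \<in> U'" for u using that by (simp add: U'_def)
  define I where "I u = inverse (w k u j0)" for u
  have I: "smooth_real n U' I" unfolding I_def
    by (rule smooth_real_inverse[OF smooth_real_mono[OF wk U'(1,2)] nz])
  \<comment> \<open>With coefficient \<open>I u\<close> the reciprocal of the pivot, component \<open>j0\<close> of every new vector
     vanishes, and so does the new last vector.\<close>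
  define w' where "w' i u j = w i u j - w i u j0 * I u * w k u j" for i u j
  define v' where "v' u j = v u j - v u j0 * I u * w k u j" for u j
  have ws: "smooth_real n U' (\<lambda>u. w i u j)" if "i < Suc k" "j < N" for i j
    by (rule smooth_real_mono[OF Suc.prems(3)[OF that] U'(1,2)])
  have vs: "smooth_real n U' (\<lambda>u. v u j)" if "j < N" for j
    by (rule smooth_real_mono[OF Suc.prems(4)[OF that] U'(1,2)])
  have "\<exists>W. u0 \<in> W \<and> W \<subseteq> U' \<and> openin (Euclidean_space n) W \<and> (\<forall>i<k. smooth_real n W (a i))"
  proof (rule Suc.IH[of U' w' v'])
    show "smooth_real n U' (\<lambda>u. w' i u j)" if "i < k" "j < N" for i j
      unfolding w'_def using that j0 by (intro smooth_real_diff smooth_real_mult ws I) auto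
    show "smooth_real n U' (\<lambda>u. v' u j)" if "j < N" for j
      unfolding v'_def using that j0 by (intro smooth_real_diff smooth_real_mult ws vs I) auto
    show "\<forall>i<k. c i = 0" if u: "u \<in> U'" and c: "\<And>j. j < N \<Longrightarrow> (\<Sum>i<k. c i * w' i u j) = 0" for u c
    proof -
      \<comment> \<open>A relation among the new vectors is a relation among the old ones; the last
         coefficient collects the subtracted multiples.\<close>
      define c' where "c' i = (if i < k then c i else - (\<Sum>l<k. c l * w l u j0 * I u))" for i
      have "(\<Sum>i<Suc k. c' i * w i u j) = 0" if "j < N" for j
      proof -
        have "(\<Sum>i<Suc k. c' i * w i u j) = (\<Sum>i<k. c i * w i u j) - (\<Sum>l<k. c l * w l u j0 * I u) * w k u
            j"
          by (simp add: c'_def)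
        also have "\<dots> = (\<Sum>i<k. c i * w' i u j)"
          by (simp add: w'_def algebra_simps sum_subtractf sum_distrib_left sum_distrib_right)
        finally show ?thesis using c[OF that] by simp
      qed
      then have "\<forall>i<Suc k. c' i = 0" by (rule Suc.prems(5)[OF subsetD[OF U'(2) u]])
      then have "c' i = 0" if "i < k" for i using that by simp
      then show ?thesis by (simp add: c'_def)
    qed
    show "v' u j = (\<Sum>i<k. a i u * w' i u j)" if u: "u \<in> U'" and j: "j < N" for u j
    proof -
      have uU: "u \<in> U" using u U' by auto
      have "v' u j = (\<Sum>i<Suc k. a i u * w i u j) - (\<Sum>i<Suc k. a i u * w i u j0) * I u * w k u j"
        unfolding v'_def Suc.prems(6)[OF uU j] Suc.prems(6)[OF uU j0(1)] by simp
      also have "\<dots> = (\<Sum>i<Suc k. a i u * w' i u j)"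
        by (simp only: w'_def right_diff_distrib sum_subtractf sum_distrib_right mult.assoc)
      also have "w' k u j = 0" using nz[OF u] by (simp add: w'_def I_def)
      then have "(\<Sum>i<Suc k. a i u * w' i u j) = (\<Sum>i<k. a i u * w' i u j)" by simp
      finally show ?thesis .
    qed
  qed (use U' in auto)
  then obtain W where W: "u0 \<in> W" "W \<subseteq> U'" "openin (Euclidean_space n) W" "\<forall>i<k. smooth_real n W (a i)"
    by (elim exE conjE)
  have "smooth_real n W (\<lambda>u. (v u j0 - (\<Sum>i<k. a i u * w i u j0)) * I u)"
    by (intro smooth_real_mult smooth_real_diff smooth_real_sum W(3)
        smooth_real_mono[OF vs W(3,2)] smooth_real_mono[OF ws W(3,2)] smooth_real_mono[OF I W(3,2)])
      (use W(4) j0 in auto)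
  then have "smooth_real n W (a k)"
  proof (rule smooth_real_cong)
    fix u assume "u \<in> W"
    then have u: "u \<in> U'" "u \<in> U" using W U' by auto
    show "a k u = (v u j0 - (\<Sum>i<k. a i u * w i u j0)) * I u"
      using Suc.prems(6)[OF u(2) j0(1)] nz[OF u(1)] by (simp add: I_def field_simps)
  qed
  then show ?case using W U' by (intro exI[of _ W]) (auto simp: less_Suc_eq)
qed

section \<open>The tangent bundle as a diffeological space\<close>

lemma diffeological_space_tangent_bundle:
  assumes X: "smooth_manifold X"
  shows "diffeological_space (tangent_bundle X)"
proof (rule diffeological_spaceI)
  fix n U q
  assume q: "plot (tangent_bundle X) n U q"
  then have p: "plot (mdiff X) n U (\<lambda>u. fst (q u))" by (simp add: tangent_bundle_plot_iff)
  show U: "openin (Euclidean_space n) U" by (rule mplot_open[OF p])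
  show "q u \<in> points (tangent_bundle X)" if "u \<in> U" for u
    using q mplot_point[OF p that] that
    by (simp add: tangent_bundle_plot_iff) (simp add: tangent_bundle_def case_prod_beta)
  show "plot (tangent_bundle X) n U q'" if e: "\<And>u. u \<in> U \<Longrightarrow> q u = q' u" for q'
    unfolding tangent_bundle_plot_iff
  proof (intro conjI ballI allI impI)
    show "plot (mdiff X) n U (\<lambda>u. fst (q' u))" by (rule mplot_cong[OF X p]) (simp add: e)
    show "snd (q' u) \<in> tangent_space X (fst (q' u))" if "u \<in> U" for u
      using q that by (simp add: tangent_bundle_plot_iff e[symmetric])
    fix m D \<phi> j assume "(m, D, \<phi>) \<in> atlas X" "j < m"
    then have "smooth_real n {u \<in> U. fst (q u) \<in> D} (\<lambda>u. snd (q u) (\<lambda>x. \<phi> x j))"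
      using q by (simp add: tangent_bundle_plot_iff)
    moreover have "{u \<in> U. fst (q u) \<in> D} = {u \<in> U. fst (q' u) \<in> D}" using e by auto
    ultimately show "smooth_real n {u \<in> U. fst (q' u) \<in> D} (\<lambda>u. snd (q' u) (\<lambda>x. \<phi> x j))"
      by (auto intro: smooth_real_cong simp: e)
  qed
  show "plot (tangent_bundle X) m V (\<lambda>v. q (f v))" if f: "smooth_cartesian m V n f" "f ` V \<subseteq> U"
      for m V f
    unfolding tangent_bundle_plot_iff
  proof (intro conjI ballI allI impI)
    show p': "plot (mdiff X) m V (\<lambda>v. fst (q (f v)))" by (rule mplot_compose[OF X p f])
    show "snd (q (f v)) \<in> tangent_space X (fst (q (f v)))" if "v \<in> V" for v
      using q that f(2) by (auto simp: tangent_bundle_plot_iff)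
    fix k D \<phi> j assume c: "(k, D, \<phi>) \<in> atlas X" "j < k"
    have s: "smooth_real n {u \<in> U. fst (q u) \<in> D} (\<lambda>u. snd (q u) (\<lambda>x. \<phi> x j))"
      using q c by (simp add: tangent_bundle_plot_iff)
    show "smooth_real m {v \<in> V. fst (q (f v)) \<in> D} (\<lambda>v. snd (q (f v)) (\<lambda>x. \<phi> x j))"
      by (rule smooth_real_compose[OF s smooth_cartesian_mono[OF f(1) mplot_preimage[OF p'
          chart_facts(1)[OF X c(1)]]]])
        (use f(2) in auto)
  qed
next
  fix n U z assume U: "openin (Euclidean_space n) U" and z: "z \<in> points (tangent_bundle X)"
  then have zz: "fst z \<in> mpoints X" "snd z \<in> tangent_space X (fst z)"
    by (auto simp: tangent_bundle_def)
  show "plot (tangent_bundle X) n U (\<lambda>_. z)"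
    unfolding tangent_bundle_plot_iff
  proof (intro conjI ballI allI impI)
    show "plot (mdiff X) n U (\<lambda>u. fst z)" by (rule mplot_const[OF X U zz(1)])
    show "smooth_real n {u \<in> U. fst z \<in> D} (\<lambda>u. snd z (\<lambda>x. \<phi> x j))" for D \<phi> and j :: nat
      by (rule smooth_real_const, cases "fst z \<in> D") (use U in auto)
  qed (rule zz(2))
next
  fix n U q
  assume U: "openin (Euclidean_space n) U"
    and loc: "\<And>u. u \<in> U \<Longrightarrow> \<exists>W. openin (Euclidean_space n) W \<and> u \<in> W \<and> W \<subseteq> U
        \<and> plot (tangent_bundle X) n W q"
  show "plot (tangent_bundle X) n U q"
    unfolding tangent_bundle_plot_iff
  proof (intro conjI ballI allI impI)
    show "plot (mdiff X) n U (\<lambda>u. fst (q u))"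
    proof (rule mplot_local[OF X])
      fix u assume "u \<in> U"
      from loc[OF this] obtain W where "u \<in> W" "W \<subseteq> U" "plot (tangent_bundle X) n W q"
        by (elim exE conjE)
      then show "\<exists>W. u \<in> W \<and> W \<subseteq> U \<and> plot (mdiff X) n W (\<lambda>u. fst (q u))"
        by (intro exI[of _ W]) (simp add: tangent_bundle_plot_iff)
    qed
    show "snd (q u) \<in> tangent_space X (fst (q u))" if "u \<in> U" for u
    proof -
      from loc[OF that] obtain W where "u \<in> W" "plot (tangent_bundle X) n W q" by (elim exE conjE)
      then show ?thesis by (simp add: tangent_bundle_plot_iff)
    qed
    fix m D \<phi> j assume c: "(m, D, \<phi>) \<in> atlas X" "j < m"
    show "smooth_real n {u \<in> U. fst (q u) \<in> D} (\<lambda>u. snd (q u) (\<lambda>x. \<phi> x j))"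
    proof (rule smooth_real_local)
      fix u assume u: "u \<in> {u \<in> U. fst (q u) \<in> D}"
      then have "u \<in> U" by simp
      from loc[OF this] obtain W where W: "u \<in> W" "W \<subseteq> U" "plot (tangent_bundle X) n W q"
        by (elim exE conjE)
      have s: "smooth_real n {u \<in> W. fst (q u) \<in> D} (\<lambda>u. snd (q u) (\<lambda>x. \<phi> x j))"
        using W(3) c by (simp add: tangent_bundle_plot_iff)
      show "\<exists>W. u \<in> W \<and> W \<subseteq> {u \<in> U. fst (q u) \<in> D} \<and> smooth_real n W (\<lambda>u. snd (q u) (\<lambda>x. \<phi> x j))"
        by (rule exI[of _ "{u \<in> W. fst (q u) \<in> D}"]) (use W u s in auto)
    qed
  qed
qed

lemma tangent_plotD:
  assumes "plot (tangent_bundle X) n U (\<lambda>u. (x u, v u))"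
  shows "plot (mdiff X) n U x" "u \<in> U \<Longrightarrow> v u \<in> tangent_space X (x u)"
    "(m, D, \<phi>) \<in> atlas X \<Longrightarrow> j < m \<Longrightarrow> smooth_real n {u \<in> U. x u \<in> D} (\<lambda>u. v u (\<lambda>x. \<phi> x j))"
  using assms unfolding tangent_bundle_plot_iff by simp_all

lemma tangent_plotI:
  assumes "plot (mdiff X) n U x" "\<And>u. u \<in> U \<Longrightarrow> v u \<in> tangent_space X (x u)"
    "\<And>m D \<phi> j. (m, D, \<phi>) \<in> atlas X \<Longrightarrow> j < m \<Longrightarrow> smooth_real n {u \<in> U. x u \<in> D} (\<lambda>u. v u (\<lambda>x. \<phi> x j))"
  shows "plot (tangent_bundle X) n U (\<lambda>u. (x u, v u))"
  using assms unfolding tangent_bundle_plot_iff by simp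

lemma tscale_minus_one: "tscale (- 1) v = - v"
  by (auto simp: tscale_def fun_eq_iff)

lemma tangent_uminus: "smooth_manifold X \<Longrightarrow> v \<in> tangent_space X x \<Longrightarrow> - v \<in> tangent_space X x"
  using tangent_scale[of X v x "- 1"] by (simp add: tscale_minus_one)

lemma tangent_diff:
  "smooth_manifold X \<Longrightarrow> v \<in> tangent_space X x \<Longrightarrow> w \<in> tangent_space X x \<Longrightarrow> v - w \<in> tangent_space X x"
  using tangent_add[OF _ _ tangent_uminus, of X v x w] by simp

lemma push_diff: "push X x Y F (v - w) = push X x Y F v - push X x Y F w"
  by (auto simp: push_def fun_eq_iff)

lemma tscale_uminus: "tscale c (- v) = - tscale c v"
  by (auto simp: tscale_def fun_eq_iff)

lemma push_combination:
  "push X x Y F (\<Sum>i\<in>I. tscale (c i) (v i)) = (\<Sum>i\<in>I. tscale (c i) (push X x Y F (v i)))"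
  by (induction I rule: infinite_finite_induct)
    (simp_all only: sum.infinite sum.empty sum.insert push_zero push_add push_scale not_False_eq_True)

lemma combination_apply: "(\<Sum>i\<in>I. tscale (c i) (v i)) f = (\<Sum>i\<in>I. c i * v i f)"
proof (induction I rule: infinite_finite_induct)
  case (insert i I)
  show ?case
    unfolding sum.insert[OF insert.hyps] plus_fun_apply insert.IH by (simp add: tscale_def)
qed simp_all

lemma tangent_plot_diff:
  assumes X: "smooth_manifold X" and v: "plot (tangent_bundle X) n U (\<lambda>u. (x u, v u))"
    and w: "plot (tangent_bundle X) n U (\<lambda>u. (x u, w u))"
  shows "plot (tangent_bundle X) n U (\<lambda>u. (x u, v u - w u))"
  by (rule tangent_plotI)
    (use tangent_plotD[OF v] tangent_plotD[OF w] in \<open>auto intro: tangent_diff[OF X] smooth_real_diff\<close>)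

lemma tangent_plot_uminus:
  assumes X: "smooth_manifold X" and v: "plot (tangent_bundle X) n U (\<lambda>u. (x u, v u))"
  shows "plot (tangent_bundle X) n U (\<lambda>u. (x u, - v u))"
  by (rule tangent_plotI)
    (use tangent_plotD[OF v] in \<open>auto intro: tangent_uminus[OF X] smooth_real_uminus\<close>)

text \<open>Represent the plot by a family of curves and compose the family with \<open>F\<close>.\<close>

lemma push_plot:
  assumes X: "smooth_manifold X" and Y: "smooth_manifold Y" and F: "dsmooth (mdiff X) (mdiff Y) F"
    and q: "plot (tangent_bundle X) n U (\<lambda>u. (x u, v u))"
  shows "plot (tangent_bundle Y) n U (\<lambda>u. (F (x u), push X (x u) Y F (v u)))"
proof (rule diffeological_spaceD(6)[OF diffeological_space_tangent_bundle[OF Y]])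
  note Fm = dsmooth_smooth_map_on[OF F]
  fix u assume u: "u \<in> U"
  obtain W V Z where W: "openin (Euclidean_space n) W" "u \<in> W" "W \<subseteq> U" "W \<subseteq> V"
    and ct: "\<forall>y\<in>V. head_coords n y \<in> W"
    and Z: "plot (mdiff X) (Suc n) V Z" "\<forall>w\<in>W. Z w = x w"
    "\<forall>w\<in>W. velocity X (\<lambda>t. Z (w(n := t))) = v w"
    using tangent_plot_family[OF X q u, unfolded fst_conv snd_conv] .
  have "plot (tangent_bundle Y) n W (\<lambda>w. (F (Z w), velocity Y (\<lambda>t. F (Z (w(n := t))))))"
    by (rule tangent_plot_of_family[OF Y W(1,4) dsmoothD(2)[OF F Z(1)]])
  then have "plot (tangent_bundle Y) n W (\<lambda>u. (F (x u), push X (x u) Y F (v u)))"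
  proof (rule diffeological_spaceD(3)[OF diffeological_space_tangent_bundle[OF Y]])
    fix w assume w: "w \<in> W"
    have wE: "w \<in> topspace (Euclidean_space n)" using w openin_subset[OF W(1)] by auto
    have w0: "w(n := 0) = w" using Euclidean_last[OF wE] by (simp add: fun_upd_idem)
    define \<gamma> where "\<gamma> = (\<lambda>t. Z (w(n := t)))"
    have \<gamma>: "smooth_curve X \<gamma>" "\<gamma> 0 = x w" "velocity X \<gamma> = v w"
      using velocity_family(1)[OF X Z(1) wE] w W(4) Z(2,3) w0 by (auto simp: \<gamma>_def)
    have "velocity Y (\<lambda>t. F (\<gamma> t)) = push X (x w) Y F (v w)"
      using velocity_map[OF X Y Fm \<gamma>(1) smooth_curve_point[OF \<gamma>(1)]] by (simp add: \<gamma>(2,3))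
    then show "(F (Z w), velocity Y (\<lambda>t. F (Z (w(n := t))))) = (F (x w), push X (x w) Y F (v w))"
      using Z(2) w by (simp add: \<gamma>_def)
  qed
  then show "\<exists>W. u \<in> W \<and> W \<subseteq> U \<and> plot (tangent_bundle Y) n W (\<lambda>u. (F (x u), push X (x u) Y F (v u)))"
    using W by (intro exI[of _ W]) simp
qed

lemma smooth_curve_fibre:
  assumes X: "smooth_manifold X" and \<gamma>: "smooth_curve X \<gamma>" "\<forall>\<^sub>F t in nhds 0. \<gamma> t \<in> S"
    and \<Phi>: "dsmooth (subspace_diffeology (mdiff X) S) (mdiff Z) \<Phi>"
  shows "smooth_curve Z (\<lambda>t. \<Phi> (\<gamma> t))"
proof -
  obtain \<epsilon> where e: "\<epsilon> > 0" "plot (mdiff X) 1 (cube 1 (\<lambda>_. 0) \<epsilon>) (\<lambda>u. \<gamma> (u 0))"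
    using smooth_curveD[OF \<gamma>(1)] .
  obtain d where d: "d > 0" "\<forall>t. dist t 0 < d \<longrightarrow> \<gamma> t \<in> S" using \<gamma>(2)
    by (auto simp: eventually_nhds_metric)
  have c: "cube 1 (\<lambda>_. 0) (min \<epsilon> d) \<subseteq> cube 1 (\<lambda>_. 0) \<epsilon>" by (rule cube_mono) simp
  have "plot (mdiff X) 1 (cube 1 (\<lambda>_. 0) (min \<epsilon> d)) (\<lambda>u. \<gamma> (u 0))"
    by (rule mplot_restrict[OF X e(2) openin_cube c])
  moreover have "\<gamma> (u 0) \<in> S" if "u \<in> cube 1 (\<lambda>_. 0) (min \<epsilon> d)" for u
    using that d(2) by (auto simp: cube_def dist_real_def)
  ultimately have "plot (subspace_diffeology (mdiff X) S) 1 (cube 1 (\<lambda>_. 0) (min \<epsilon> d)) (\<lambda>u. \<gamma> (u 0))"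
    by (auto simp: subspace_diffeology_def)
  from dsmoothD(2)[OF \<Phi> this] show ?thesis by (rule smooth_curveI[rotated]) (use e d in auto)
qed

text \<open>
A family of maps \<open>\<Psi> u\<close>, each defined on one fibre of \<open>F\<close>, with \<open>\<Psi> u z\<close> smooth in both arguments
as far as it is defined: plots \<open>z\<close> over a reparametrisation \<open>p\<close> that stay in the right fibres
are mapped to plots. Vectors along the fibres are velocities of curves inside the fibres that
depend smoothly on the parameters, and the maps can be applied to these curves.
\<close>

lemma fibre_differential_plot:
  assumes X: "smooth_manifold X" and Y: "smooth_manifold Y" and Z: "smooth_manifold Z"
    and F: "submersion X Y F"
    and q: "plot (tangent_bundle X) n U (\<lambda>u. (x u, v u))"
    and ver: "\<And>u. u \<in> U \<Longrightarrow> push X (x u) Y F (v u) = 0"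
    and \<Psi>: "\<And>m V p z. smooth_cartesian m V n p \<Longrightarrow> p ` V \<subseteq> U \<Longrightarrow> plot (mdiff X) m V z \<Longrightarrow>
      (\<And>y. y \<in> V \<Longrightarrow> F (z y) = F (x (p y))) \<Longrightarrow> plot (mdiff Z) m V (\<lambda>y. \<Psi> (p y) (z y))"
    and S: "\<And>u. u \<in> U \<Longrightarrow> S u = {h \<in> mpoints X. F h = F (x u)}"
  shows "u \<in> U \<Longrightarrow> dsmooth (subspace_diffeology (mdiff X) (S u)) (mdiff Z) (\<Psi> u)"
    "plot (tangent_bundle Z) n U (\<lambda>u. (\<Psi> u (x u), differential_on X (S u) Z (\<Psi> u) (x u) (v u)))"
proof -
  note xp = tangent_plotD(1)[OF q]
  have U: "openin (Euclidean_space n) U" by (rule mplot_open[OF xp])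
  show ds: "dsmooth (subspace_diffeology (mdiff X) (S u)) (mdiff Z) (\<Psi> u)" if u: "u \<in> U" for u
  proof -
    have uE: "u \<in> topspace (Euclidean_space n)" using u openin_subset[OF U] by auto
    have pl: "plot (mdiff Z) m V (\<lambda>y. \<Psi> u (z y))"
      if z: "plot (mdiff X) m V z" "z ` V \<subseteq> S u" for m V z
    proof (rule \<Psi>[where p = "\<lambda>_. u"])
      show "smooth_cartesian m V n (\<lambda>_. u)"
        by (rule smooth_cartesianI[OF mplot_open[OF z(1)] uE smooth_real_const[OF mplot_open[OF z(1)]]])
    qed (use z u S[OF u] in auto)
    have "\<Psi> u h \<in> mpoints Z" if h: "h \<in> S u" for h
    proof -
      have "plot (mdiff Z) 0 (topspace (Euclidean_space 0)) (\<lambda>y. \<Psi> u h)"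
        by (rule pl[OF mplot_const[OF X openin_topspace]]) (use h S[OF u] in auto)
      from mplot_point[OF this zero_in_Euclidean] show ?thesis .
    qed
    then show ?thesis using pl by (auto simp: dsmooth_def subspace_diffeology_def o_def)
  qed
  show "plot (tangent_bundle Z) n U (\<lambda>u. (\<Psi> u (x u), differential_on X (S u) Z (\<Psi> u) (x u) (v u)))"
  proof (rule diffeological_spaceD(6)[OF diffeological_space_tangent_bundle[OF Z]])
    fix u assume u: "u \<in> U"
    obtain W V K where W: "openin (Euclidean_space n) W" "u \<in> W" "W \<subseteq> U" "W \<subseteq> V"
      and ct: "\<forall>y\<in>V. head_coords n y \<in> W"
      and K: "plot (mdiff X) (Suc n) V K" "\<forall>w\<in>W. K w = x w"
      "\<forall>w\<in>W. velocity X (\<lambda>t. K (w(n := t))) = v w" "\<forall>y\<in>V. F (K y) = F (x (head_coords n y))"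
      using vertical_plot_family[OF X Y F q u, unfolded fst_conv snd_conv, OF ver] .
    have V: "openin (Euclidean_space (Suc n)) V" by (rule mplot_open[OF K(1)])
    have cs: "smooth_cartesian (Suc n) V n (head_coords n)"
      by (rule smooth_cartesian_mono[OF smooth_cartesian_head_coords(2)[OF U] V])
        (use ct W(3) openin_subset[OF V] in auto)
    have "plot (mdiff Z) (Suc n) V (\<lambda>y. \<Psi> (head_coords n y) (K y))"
      by (rule \<Psi>[OF cs _ K(1)]) (use ct W(3) K(4) in auto)
    from tangent_plot_of_family[OF Z W(1,4) this]
    have "plot (tangent_bundle Z) n W (\<lambda>u. (\<Psi> u (x u), differential_on X (S u) Z (\<Psi> u) (x u) (v u)))"
    proof (rule diffeological_spaceD(3)[OF diffeological_space_tangent_bundle[OF Z]])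
      fix w assume w: "w \<in> W"
      have wE: "w \<in> topspace (Euclidean_space n)" using w openin_subset[OF W(1)] by auto
      have w0: "w(n := 0) = w" using Euclidean_last[OF wE] by (simp add: fun_upd_idem)
      have wU: "w \<in> U" and wV: "w \<in> V" using w W by auto
      define \<gamma> where "\<gamma> = (\<lambda>t. K (w(n := t)))"
      have \<gamma>: "smooth_curve X \<gamma>" "\<gamma> 0 = x w" "velocity X \<gamma> = v w"
        using velocity_family(1)[OF X K(1) wE wV] w K(2,3) w0 by (auto simp: \<gamma>_def)
      have "eventually (\<lambda>t. w(n := t) \<in> V) (nhds 0)"
        by (rule curve_in_eventually[OF curve_in_last[OF wE] _ V]) (simp add: w0 wV)
      then have ev: "eventually (\<lambda>t. F (\<gamma> t) = F (x w)) (nhds 0)"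
        by (rule eventually_mono) (use K(4) in \<open>simp add: \<gamma>_def head_coords_upd[OF wE]\<close>)
      have "differential_on X (S w) Z (\<Psi> w) (x w) (velocity X \<gamma>) = velocity Z (\<lambda>t. \<Psi> w (\<gamma> t))"
        by (rule differential_on_fibre(1)[OF X Y Z F mplot_point[OF xp wU] S[OF wU] ds[OF wU] \<gamma>(1,2)
            ev])
      then show "(\<Psi> (head_coords n w) (K w), velocity Z (\<lambda>t. \<Psi> (head_coords n (w(n := t))) (K (w(n :=
          t))))) =
          (\<Psi> w (x w), differential_on X (S w) Z (\<Psi> w) (x w) (v w))"
        using K(2) w \<gamma>(3) by (simp add: head_coords_upd[OF wE] head_coords_id[OF wE] \<gamma>_def)
    qed
    then show "\<exists>W. u \<in> W \<and> W \<subseteq> U \<and> plot (tangent_bundle Z) n W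
        (\<lambda>u. (\<Psi> u (x u), differential_on X (S u) Z (\<Psi> u) (x u) (v u)))"
      using W by (intro exI[of _ W]) simp
  qed
qed

section \<open>Lie groupoids with a connection\<close>

locale groupoid_with_connection =
  fixes G :: "('o, 'a) lie_groupoid" and H :: "'a \<Rightarrow> 'a tvec set"
  assumes lie: "is_lie_groupoid G" and conn: "ehresmann_connection G H"
begin

abbreviation M where "M \<equiv> ob_mfd G"
abbreviation A where "A \<equiv> ar_mfd G"

abbreviation Sc where "Sc \<equiv> src G"
abbreviation Tg where "Tg \<equiv> tgt G"

abbreviation One where "One \<equiv> unt G"
abbreviation Mu where "Mu \<equiv> cmp G"

abbreviation Inv where "Inv \<equiv> ginv G"
abbreviation TM where "TM \<equiv> tangent_space M"

abbreviation TA where "TA \<equiv> tangent_space A"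

lemma M: "smooth_manifold M" and A: "smooth_manifold A"
  and sg: "smooth_groupoid (mdiff M) (mdiff A) G"
  and s_sub: "submersion A M Sc" and t_sub: "submersion A M Tg"
  using lie by (simp_all add: is_lie_groupoid_def)

lemma is_grpd: "is_groupoid (objs G) (arrs G) G"
  using sg by (simp add: smooth_groupoid_def)

lemma s_smooth: "dsmooth (mdiff A) (mdiff M) Sc" and t_smooth: "dsmooth (mdiff A) (mdiff M) Tg"
  and unit_smooth: "dsmooth (mdiff M) (mdiff A) One"
  and cmp_smooth: "dsmooth (fibre_product (mdiff A) (mdiff A) Sc Tg) (mdiff A) (\<lambda>(k, f). Mu k f)"
  and inv_smooth: "dsmooth (mdiff A) (mdiff A) Inv"
  using sg by (simp_all add: smooth_groupoid_def)

lemmas groupoid_ends = is_grpd[unfolded is_groupoid_def, THEN conjunct1, rule_format]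

lemmas groupoid_unit = is_grpd[unfolded is_groupoid_def, THEN conjunct2, THEN conjunct1, rule_format]

lemmas groupoid_cmp = is_grpd[unfolded is_groupoid_def, THEN conjunct2, THEN conjunct2, THEN conjunct1,
    rule_format]

lemmas groupoid_assoc = is_grpd[unfolded is_groupoid_def, THEN conjunct2, THEN conjunct2, THEN
    conjunct2, THEN conjunct1, rule_format]

lemmas groupoid_unit_laws = is_grpd[unfolded is_groupoid_def, THEN conjunct2, THEN conjunct2, THEN
    conjunct2, THEN conjunct2, THEN conjunct1, rule_format]

lemmas groupoid_inverse = is_grpd[unfolded is_groupoid_def, THEN conjunct2, THEN conjunct2, THEN
    conjunct2, THEN conjunct2, THEN conjunct2, rule_format]

lemma gr_simps [simp]:
  "f \<in> arrs G \<Longrightarrow> Sc f \<in> objs G" "f \<in> arrs G \<Longrightarrow> Tg f \<in> objs G"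
  "x \<in> objs G \<Longrightarrow> One x \<in> arrs G" "x \<in> objs G \<Longrightarrow> Sc (One x) = x" "x \<in> objs G \<Longrightarrow> Tg (One x) = x"
  "k \<in> arrs G \<Longrightarrow> f \<in> arrs G \<Longrightarrow> Sc k = Tg f \<Longrightarrow> Mu k f \<in> arrs G"
  "k \<in> arrs G \<Longrightarrow> f \<in> arrs G \<Longrightarrow> Sc k = Tg f \<Longrightarrow> Sc (Mu k f) = Sc f"
  "k \<in> arrs G \<Longrightarrow> f \<in> arrs G \<Longrightarrow> Sc k = Tg f \<Longrightarrow> Tg (Mu k f) = Tg k"
  "f \<in> arrs G \<Longrightarrow> Mu f (One (Sc f)) = f" "f \<in> arrs G \<Longrightarrow> Mu (One (Tg f)) f = f"
  "f \<in> arrs G \<Longrightarrow> Inv f \<in> arrs G" "f \<in> arrs G \<Longrightarrow> Sc (Inv f) = Tg f" "f \<in> arrs G \<Longrightarrow> Tg (Inv f) = Sc f"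
  "f \<in> arrs G \<Longrightarrow> Mu (Inv f) f = One (Sc f)" "f \<in> arrs G \<Longrightarrow> Mu f (Inv f) = One (Tg f)"
  using groupoid_ends groupoid_unit groupoid_cmp groupoid_unit_laws groupoid_inverse by simp_all

lemma gr_assoc:
  "h \<in> arrs G \<Longrightarrow> k \<in> arrs G \<Longrightarrow> f \<in> arrs G \<Longrightarrow> Sc h = Tg k \<Longrightarrow> Sc k = Tg f \<Longrightarrow>
     Mu (Mu h k) f = Mu h (Mu k f)"
  using groupoid_assoc by simp

lemma cmp_unit [simp]:
  "f \<in> arrs G \<Longrightarrow> Sc f = x \<Longrightarrow> Mu f (One x) = f"
  "f \<in> arrs G \<Longrightarrow> Tg f = x \<Longrightarrow> Mu (One x) f = f"
  using gr_simps(9,10) by blast+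

lemma inv_cancel [simp]:
  assumes "g \<in> arrs G" "h \<in> arrs G" "Sc g = Tg h"
  shows "Mu (Inv g) (Mu g h) = h"
  using gr_assoc[of "Inv g" g h] assms by simp

lemma inv_unique:
  assumes "f \<in> arrs G" "k \<in> arrs G" "Sc k = Tg f" "Mu k f = One (Sc f)"
  shows "k = Inv f"
proof -
  have "k = Mu k (One (Sc k))" by (rule gr_simps(9)[OF assms(2), symmetric])
  also have "\<dots> = Mu k (Mu f (Inv f))" using assms by simp
  also have "\<dots> = Mu (Mu k f) (Inv f)" by (rule gr_assoc[symmetric]) (use assms in simp_all)
  also have "\<dots> = Mu (One (Tg (Inv f))) (Inv f)" using assms by simp
  also have "\<dots> = Inv f" by (rule gr_simps(10)) (use assms in simp)
  finally show ?thesis .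
qed

lemma inv_inv [simp]: "f \<in> arrs G \<Longrightarrow> Inv (Inv f) = f"
  using inv_unique[of "Inv f" f] by simp

lemma inv_cmp:
  assumes "g \<in> arrs G" "h \<in> arrs G" "Sc g = Tg h"
  shows "Inv (Mu g h) = Mu (Inv h) (Inv g)"
proof (rule inv_unique[symmetric])
  have "Mu (Mu (Inv h) (Inv g)) (Mu g h) = Mu (Inv h) (Mu (Inv g) (Mu g h))"
    by (rule gr_assoc) (use assms in simp_all)
  then show "Mu (Mu (Inv h) (Inv g)) (Mu g h) = One (Sc (Mu g h))" using assms by simp
qed (use assms in auto)

lemma inv_unit [simp]: "x \<in> objs G \<Longrightarrow> Inv (One x) = One x"
  using inv_unique[of "One x" "One x"] gr_simps(9)[of "One x"] by simp

lemma cmp_plot: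
  assumes "plot (mdiff A) n U k" "plot (mdiff A) n U f" "\<And>u. u \<in> U \<Longrightarrow> Sc (k u) = Tg (f u)"
  shows "plot (mdiff A) n U (\<lambda>u. Mu (k u) (f u))"
  using dsmoothD(2)[OF cmp_smooth, of n U "\<lambda>u. (k u, f u)"] assms
  by (simp add: fibre_product_def o_def)

lemmas inv_plot = dsmoothD(2)[OF inv_smooth]

lemmas s_plot = dsmoothD(2)[OF s_smooth]

lemmas t_plot = dsmoothD(2)[OF t_smooth]

lemmas unit_plot = dsmoothD(2)[OF unit_smooth]

section \<open>Source-vertical vectors and translations\<close>

lemma ker_dsrc_iff: "v \<in> ker_dsrc G g \<longleftrightarrow> v \<in> TA g \<and> push A g M Sc v = 0"
  using differential_eq_push[OF A M s_smooth] by (auto simp: ker_dsrc_def)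

lemma ker_dsrcD: "v \<in> ker_dsrc G g \<Longrightarrow> v \<in> TA g" "v \<in> ker_dsrc G g \<Longrightarrow> push A g M Sc v = 0"
  by (simp_all add: ker_dsrc_iff)

lemma ker_dsrc_linear:
  "g \<in> arrs G \<Longrightarrow> 0 \<in> ker_dsrc G g"
  "v \<in> ker_dsrc G g \<Longrightarrow> w \<in> ker_dsrc G g \<Longrightarrow> v + w \<in> ker_dsrc G g"
  "v \<in> ker_dsrc G g \<Longrightarrow> tscale c v \<in> ker_dsrc G g"
  "v \<in> ker_dsrc G g \<Longrightarrow> - v \<in> ker_dsrc G g"
proof -
  show "g \<in> arrs G \<Longrightarrow> 0 \<in> ker_dsrc G g" by (simp add: ker_dsrc_iff tangent_zero[OF A] push_zero)
  show "v \<in> ker_dsrc G g \<Longrightarrow> w \<in> ker_dsrc G g \<Longrightarrow> v + w \<in> ker_dsrc G g"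
    by (simp add: ker_dsrc_iff tangent_add[OF A] push_add)
  show *: "v \<in> ker_dsrc G g \<Longrightarrow> tscale c v \<in> ker_dsrc G g" for c
    by (simp add: ker_dsrc_iff tangent_scale[OF A] push_scale) (simp add: tscale_def zero_fun_def)
  show "v \<in> ker_dsrc G g \<Longrightarrow> - v \<in> ker_dsrc G g" using *[of "-1"] by (simp add: tscale_minus_one)
qed

lemma ker_curve:
  assumes "v \<in> ker_dsrc G g"
  obtains \<gamma> where "smooth_curve A \<gamma>" "\<gamma> 0 = g" "velocity A \<gamma> = v" "\<forall>\<^sub>F t in nhds 0. Sc (\<gamma> t) = Sc g"
  using vertical_curve[OF A M s_sub ker_dsrcD[OF assms]] .

lemma velocity_in_ker:
  assumes \<gamma>: "smooth_curve A \<gamma>" "\<gamma> 0 = g" "\<forall>\<^sub>F t in nhds 0. Sc (\<gamma> t) = Sc g"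
  shows "velocity A \<gamma> \<in> ker_dsrc G g"
  unfolding ker_dsrc_iff
proof
  show "velocity A \<gamma> \<in> TA g" by (rule tangent_spaceI[OF \<gamma>(1,2)])
  have g: "g \<in> arrs G" using smooth_curve_point[OF \<gamma>(1)] \<gamma>(2) by simp
  have "push A g M Sc (velocity A \<gamma>) = velocity M (\<lambda>t. Sc (\<gamma> t))"
    using velocity_map[OF A M dsmooth_smooth_map_on[OF s_smooth] \<gamma>(1)] \<gamma>(2) g by simp
  also have "\<dots> = velocity M (\<lambda>t. Sc g)" by (rule velocity_eqI[OF \<gamma>(3)])
  also have "\<dots> = 0" using velocity_const(2)[OF M] g by simp
  finally show "push A g M Sc (velocity A \<gamma>) = 0" .
qed

text \<open>The inverse of the right translation \<open>r g\<close>, as the differential of a right translation.\<close>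

definition rinv :: "'a \<Rightarrow> 'a tvec \<Rightarrow> 'a tvec" where
  "rinv g = differential_on A (src_fibre G (Sc g)) A (\<lambda>h. Mu h (Inv g)) g"

lemma src_fibre_eq: "src_fibre G x = {h \<in> arrs G. Sc h = x}"
  by (simp add: src_fibre_def)

lemma right_translation_smooth:
  assumes k: "k \<in> arrs G"
  shows "dsmooth (subspace_diffeology (mdiff A) {h \<in> arrs G. Sc h = Tg k}) (mdiff A) (\<lambda>h. Mu h k)"
  unfolding dsmooth_def
proof (intro conjI allI impI)
  show "(\<lambda>h. Mu h k) ` points (subspace_diffeology (mdiff A) {h \<in> arrs G. Sc h = Tg k}) \<subseteq> points (mdiff
      A)"
    using k by (auto simp: subspace_diffeology_def)
  fix n U p assume "plot (subspace_diffeology (mdiff A) {h \<in> arrs G. Sc h = Tg k}) n U p"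
  then have p: "plot (mdiff A) n U p" "\<And>u. u \<in> U \<Longrightarrow> Sc (p u) = Tg k"
    by (auto simp: subspace_diffeology_def)
  show "plot (mdiff A) n U ((\<lambda>h. Mu h k) \<circ> p)"
    unfolding o_def by (rule cmp_plot[OF p(1) mplot_const[OF A mplot_open[OF p(1)] k] p(2)])
qed

lemma left_translation_smooth:
  assumes k: "k \<in> arrs G"
  shows "dsmooth (subspace_diffeology (mdiff A) {h \<in> arrs G. Sc h = Sc k}) (mdiff A) (\<lambda>h. Mu k (Inv h))"
  unfolding dsmooth_def
proof (intro conjI allI impI)
  show "(\<lambda>h. Mu k (Inv h)) ` points (subspace_diffeology (mdiff A) {h \<in> arrs G. Sc h = Sc k}) \<subseteq> points
      (mdiff A)"
    using k by (auto simp: subspace_diffeology_def)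
  fix n U p assume "plot (subspace_diffeology (mdiff A) {h \<in> arrs G. Sc h = Sc k}) n U p"
  then have p: "plot (mdiff A) n U p" "\<And>u. u \<in> U \<Longrightarrow> Sc (p u) = Sc k"
    by (auto simp: subspace_diffeology_def)
  show "plot (mdiff A) n U ((\<lambda>h. Mu k (Inv h)) \<circ> p)"
    unfolding o_def
    by (rule cmp_plot[OF mplot_const[OF A mplot_open[OF p(1)] k] inv_plot[OF p(1)]])
      (use p mplot_point[OF p(1)] in simp)
qed

lemma eventually_in_fibre:
  assumes "smooth_curve A \<gamma>" "\<forall>\<^sub>F t in nhds 0. Sc (\<gamma> t) = x"
  shows "\<forall>\<^sub>F t in nhds 0. \<gamma> t \<in> {h \<in> arrs G. Sc h = x}"
  using smooth_curve_eventually_in[OF A assms(1) openin_topspace smooth_curve_point[OF assms(1)]]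
      assms(2)
  by eventually_elim simp

lemma right_translation_curve:
  assumes k: "k \<in> arrs G" and h: "h \<in> arrs G" "Sc h = Tg k"
    and \<gamma>: "smooth_curve A \<gamma>" "\<gamma> 0 = h" "\<forall>\<^sub>F t in nhds 0. Sc (\<gamma> t) = Sc h"
  shows "smooth_curve A (\<lambda>t. Mu (\<gamma> t) k)" "\<forall>\<^sub>F t in nhds 0. Sc (Mu (\<gamma> t) k) = Sc (Mu h k)"
    "differential_on A (src_fibre G (Tg k)) A (\<lambda>h. Mu h k) h (velocity A \<gamma>) = velocity A (\<lambda>t. Mu (\<gamma> t)
        k)"
proof -
  note ev = eventually_in_fibre[OF \<gamma>(1) \<gamma>(3)[unfolded h(2)]]
  show "smooth_curve A (\<lambda>t. Mu (\<gamma> t) k)"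
    by (rule smooth_curve_fibre[OF A \<gamma>(1) ev right_translation_smooth[OF k]])
  show "\<forall>\<^sub>F t in nhds 0. Sc (Mu (\<gamma> t) k) = Sc (Mu h k)"
    using ev by (rule eventually_mono) (use h k in auto)
  show "differential_on A (src_fibre G (Tg k)) A (\<lambda>h. Mu h k) h (velocity A \<gamma>) = velocity A (\<lambda>t. Mu (\<gamma>
      t) k)"
    by (rule differential_on_fibre(1)[OF A M A s_sub h(1) _ _ \<gamma>])
      (use right_translation_smooth[OF k] h in \<open>auto simp: src_fibre_eq\<close>)
qed

lemma rtrans_curve:
  assumes g: "g \<in> arrs G"
    and \<gamma>: "smooth_curve A \<gamma>" "\<gamma> 0 = One (Tg g)" "\<forall>\<^sub>F t in nhds 0. Sc (\<gamma> t) = Tg g"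
  shows "smooth_curve A (\<lambda>t. Mu (\<gamma> t) g)" "\<forall>\<^sub>F t in nhds 0. Sc (Mu (\<gamma> t) g) = Sc g"
    "rtrans G g (velocity A \<gamma>) = velocity A (\<lambda>t. Mu (\<gamma> t) g)"
  using right_translation_curve[OF g, of "One (Tg g)" \<gamma>] g \<gamma> by (simp_all add: rtrans_def)

lemma rinv_curve:
  assumes g: "g \<in> arrs G"
    and \<gamma>: "smooth_curve A \<gamma>" "\<gamma> 0 = g" "\<forall>\<^sub>F t in nhds 0. Sc (\<gamma> t) = Sc g"
  shows "smooth_curve A (\<lambda>t. Mu (\<gamma> t) (Inv g))" "\<forall>\<^sub>F t in nhds 0. Sc (Mu (\<gamma> t) (Inv g)) = Tg g"
    "rinv g (velocity A \<gamma>) = velocity A (\<lambda>t. Mu (\<gamma> t) (Inv g))"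
  using right_translation_curve[of "Inv g" g \<gamma>] g \<gamma> by (simp_all add: rinv_def)

text \<open>
Right translations by \<open>g\<close> and by its inverse are inverse to each other on source fibres, hence
so are their differentials.
\<close>

lemma rtrans_rinv:
  assumes g: "g \<in> arrs G"
  shows "\<alpha> \<in> alg_fibre G (Tg g) \<Longrightarrow> rtrans G g \<alpha> \<in> ker_dsrc G g"
    "\<alpha> \<in> alg_fibre G (Tg g) \<Longrightarrow> rinv g (rtrans G g \<alpha>) = \<alpha>"
    "y \<in> ker_dsrc G g \<Longrightarrow> rinv g y \<in> alg_fibre G (Tg g)"
    "y \<in> ker_dsrc G g \<Longrightarrow> rtrans G g (rinv g y) = y"
proof -
  assume "\<alpha> \<in> alg_fibre G (Tg g)"
  then obtain \<gamma> where \<gamma>: "smooth_curve A \<gamma>" "\<gamma> 0 = One (Tg g)" "velocity A \<gamma> = \<alpha>"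
    "\<forall>\<^sub>F t in nhds 0. Sc (\<gamma> t) = Sc (One (Tg g))" unfolding alg_fibre_def by (rule ker_curve)
  then have \<gamma>4: "\<forall>\<^sub>F t in nhds 0. Sc (\<gamma> t) = Tg g" using g by simp
  note r = rtrans_curve[OF g \<gamma>(1,2) \<gamma>4, unfolded \<gamma>(3)]
  have z: "Mu (\<gamma> 0) g = g" using g \<gamma>(2) by simp
  show "rtrans G g \<alpha> \<in> ker_dsrc G g" unfolding r(3) by (rule velocity_in_ker[OF r(1) z r(2)])
  have "rinv g (rtrans G g \<alpha>) = velocity A (\<lambda>t. Mu (Mu (\<gamma> t) g) (Inv g))"
    unfolding r(3) by (rule rinv_curve(3)[OF g r(1) z r(2)])
  also have "\<dots> = velocity A \<gamma>"
  proof (rule velocity_eqI, rule eventually_mono[OF eventually_in_fibre[OF \<gamma>(1) \<gamma>4]])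
    fix t assume t: "\<gamma> t \<in> {h \<in> arrs G. Sc h = Tg g}"
    then have "Mu (Mu (\<gamma> t) g) (Inv g) = Mu (\<gamma> t) (One (Sc (\<gamma> t)))" using g by (simp add: gr_assoc)
    then show "Mu (Mu (\<gamma> t) g) (Inv g) = \<gamma> t" using t by simp
  qed
  finally show "rinv g (rtrans G g \<alpha>) = \<alpha>" using \<gamma>(3) by simp
next
  assume "y \<in> ker_dsrc G g"
  then obtain \<gamma> where \<gamma>: "smooth_curve A \<gamma>" "\<gamma> 0 = g" "velocity A \<gamma> = y"
    "\<forall>\<^sub>F t in nhds 0. Sc (\<gamma> t) = Sc g" by (rule ker_curve)
  note r = rinv_curve[OF g \<gamma>(1,2,4), unfolded \<gamma>(3)]
  have z: "Mu (\<gamma> 0) (Inv g) = One (Tg g)" using g \<gamma>(2) by simp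
  have r2: "\<forall>\<^sub>F t in nhds 0. Sc (Mu (\<gamma> t) (Inv g)) = Sc (One (Tg g))" using r(2) g by simp
  show "rinv g y \<in> alg_fibre G (Tg g)" unfolding r(3) alg_fibre_def
    by (rule velocity_in_ker[OF r(1) z r2])
  have "rtrans G g (rinv g y) = velocity A (\<lambda>t. Mu (Mu (\<gamma> t) (Inv g)) g)"
    unfolding r(3) by (rule rtrans_curve(3)[OF g r(1) z r(2)])
  also have "\<dots> = velocity A \<gamma>"
  proof (rule velocity_eqI, rule eventually_mono[OF eventually_in_fibre[OF \<gamma>(1) \<gamma>(4)]])
    fix t assume t: "\<gamma> t \<in> {h \<in> arrs G. Sc h = Sc g}"
    then have "Mu (Mu (\<gamma> t) (Inv g)) g = Mu (\<gamma> t) (One (Sc (\<gamma> t)))" using g by (simp add: gr_assoc)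
    then show "Mu (Mu (\<gamma> t) (Inv g)) g = \<gamma> t" using t by simp
  qed
  finally show "rtrans G g (rinv g y) = y" using \<gamma>(3) by simp
qed

lemma rinv_linear:
  assumes g: "g \<in> arrs G"
  shows "y \<in> ker_dsrc G g \<Longrightarrow> z \<in> ker_dsrc G g \<Longrightarrow> rinv g (y + z) = rinv g y + rinv g z"
    "y \<in> ker_dsrc G g \<Longrightarrow> rinv g (tscale c y) = tscale c (rinv g y)"
proof -
  have S: "src_fibre G (Sc g) = {h \<in> arrs G. Sc h = Sc g}" by (simp add: src_fibre_eq)
  have sm: "dsmooth (subspace_diffeology (mdiff A) (src_fibre G (Sc g))) (mdiff A) (\<lambda>h. Mu h (Inv g))"
    using right_translation_smooth[of "Inv g"] g by (simp add: src_fibre_eq)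
  note d = differential_on_fibre[OF A M A s_sub g S sm]
  show "y \<in> ker_dsrc G g \<Longrightarrow> z \<in> ker_dsrc G g \<Longrightarrow> rinv g (y + z) = rinv g y + rinv g z"
    unfolding rinv_def by (intro d(2)) (simp_all add: ker_dsrc_iff)
  show "y \<in> ker_dsrc G g \<Longrightarrow> rinv g (tscale c y) = tscale c (rinv g y)"
    unfolding rinv_def by (intro d(3)) (simp_all add: ker_dsrc_iff)
qed

lemma ltrans_facts:
  assumes g: "g \<in> arrs G"
  shows "\<alpha> \<in> alg_fibre G (Sc g) \<Longrightarrow> \<beta> \<in> alg_fibre G (Sc g) \<Longrightarrow> ltrans G g (\<alpha> + \<beta>) = ltrans G g \<alpha> + ltrans G
      g \<beta>"
    "\<alpha> \<in> alg_fibre G (Sc g) \<Longrightarrow> ltrans G g (tscale c \<alpha>) = tscale c (ltrans G g \<alpha>)"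
    "smooth_curve A \<gamma> \<Longrightarrow> \<gamma> 0 = One (Sc g) \<Longrightarrow> \<forall>\<^sub>F t in nhds 0. Sc (\<gamma> t) = Sc g \<Longrightarrow>
       ltrans G g (velocity A \<gamma>) = velocity A (\<lambda>t. Mu g (Inv (\<gamma> t)))"
    "\<alpha> \<in> alg_fibre G (Sc g) \<Longrightarrow> ltrans G g \<alpha> \<in> TA g"
proof -
  have o: "One (Sc g) \<in> arrs G" using g by simp
  have S: "src_fibre G (Sc g) = {h \<in> arrs G. Sc h = Sc (One (Sc g))}" using g
    by (simp add: src_fibre_eq)
  have sm: "dsmooth (subspace_diffeology (mdiff A) (src_fibre G (Sc g))) (mdiff A) (\<lambda>h. Mu g (Inv h))"
    using left_translation_smooth[OF g] by (simp add: src_fibre_eq)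
  note d = differential_on_fibre[OF A M A s_sub o S sm]
  show "\<alpha> \<in> alg_fibre G (Sc g) \<Longrightarrow> \<beta> \<in> alg_fibre G (Sc g) \<Longrightarrow> ltrans G g (\<alpha> + \<beta>) = ltrans G g \<alpha> + ltrans G g
      \<beta>"
    unfolding ltrans_def alg_fibre_def by (intro d(2)) (simp_all add: ker_dsrc_iff)
  show "\<alpha> \<in> alg_fibre G (Sc g) \<Longrightarrow> ltrans G g (tscale c \<alpha>) = tscale c (ltrans G g \<alpha>)"
    unfolding ltrans_def alg_fibre_def by (intro d(3)) (simp_all add: ker_dsrc_iff)
  show c: "smooth_curve A \<gamma> \<Longrightarrow> \<gamma> 0 = One (Sc g) \<Longrightarrow> \<forall>\<^sub>F t in nhds 0. Sc (\<gamma> t) = Sc g \<Longrightarrow>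
       ltrans G g (velocity A \<gamma>) = velocity A (\<lambda>t. Mu g (Inv (\<gamma> t)))" for \<gamma>
    unfolding ltrans_def using g by (intro d(1)) simp_all
  assume "\<alpha> \<in> alg_fibre G (Sc g)"
  then obtain \<gamma> where \<gamma>: "smooth_curve A \<gamma>" "\<gamma> 0 = One (Sc g)" "velocity A \<gamma> = \<alpha>"
    "\<forall>\<^sub>F t in nhds 0. Sc (\<gamma> t) = Sc (One (Sc g))" unfolding alg_fibre_def by (rule ker_curve)
  then have \<gamma>4: "\<forall>\<^sub>F t in nhds 0. Sc (\<gamma> t) = Sc g" using g by simp
  have "smooth_curve A (\<lambda>t. Mu g (Inv (\<gamma> t)))"
    by (rule smooth_curve_fibre[OF A \<gamma>(1) eventually_in_fibre[OF \<gamma>(1) \<gamma>4] left_translation_smooth[OF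
        g]])
  then have "velocity A (\<lambda>t. Mu g (Inv (\<gamma> t))) \<in> TA g"
    by (rule tangent_spaceI) (use g \<gamma>(2) gr_simps(9)[OF g] in simp)
  then show "ltrans G g \<alpha> \<in> TA g" using c[OF \<gamma>(1,2) \<gamma>4] \<gamma>(3) by simp
qed

section \<open>Horizontal lifts and transports\<close>

lemma H_subbundle: "smooth_subbundle A H"
  and H_split: "g \<in> arrs G \<Longrightarrow> TA g = {v + w |v w. v \<in> H g \<and> w \<in> ker_dsrc G g}"
  and H_ker: "g \<in> arrs G \<Longrightarrow> H g \<inter> ker_dsrc G g = {0}"
  and H_unit: "x \<in> objs G \<Longrightarrow> H (One x) = differential M A One x ` TM x"
  using conn by (simp_all add: ehresmann_connection_def)

lemma H_linear:
  assumes g: "g \<in> arrs G"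
  shows "H g \<subseteq> TA g" "v \<in> H g \<Longrightarrow> w \<in> H g \<Longrightarrow> v + w \<in> H g" "v \<in> H g \<Longrightarrow> tscale c v \<in> H g"
    "v \<in> H g \<Longrightarrow> - v \<in> H g"
proof -
  have l: "linear_subspace (H g) (TA g)"
    using H_subbundle g by (simp add: smooth_subbundle_def)
  then show "H g \<subseteq> TA g" "v \<in> H g \<Longrightarrow> w \<in> H g \<Longrightarrow> v + w \<in> H g" "v \<in> H g \<Longrightarrow> tscale c v \<in> H g"
    by (simp_all add: linear_subspace_def)
  show "v \<in> H g \<Longrightarrow> - v \<in> H g" using l tscale_minus_one[of v] unfolding linear_subspace_def by metis
qed

lemma dsrc_push: "v \<in> TA g \<Longrightarrow> dsrc G g v = push A g M Sc v"
  by (rule differential_eq_push[OF A M s_smooth])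

lemma dtgt_push: "v \<in> TA g \<Longrightarrow> dtgt G g v = push A g M Tg v"
  by (rule differential_eq_push[OF A M t_smooth])

lemma dsrc_inj_H: 
  assumes g: "g \<in> arrs G" and v: "v \<in> H g" "w \<in> H g" "push A g M Sc v = push A g M Sc w"
  shows "v = w"
proof -
  have "v + - w \<in> H g" by (intro H_linear[OF g] v)
  moreover have "v + - w \<in> ker_dsrc G g"
    using calculation H_linear(1)[OF g] v(3) by (auto simp: ker_dsrc_iff push_diff)
  ultimately have "v + - w \<in> H g \<inter> ker_dsrc G g" by blast
  then have "v + - w = 0" unfolding H_ker[OF g] by simp
  then show ?thesis by simp
qed

text \<open>
The complement of the kernel is mapped isomorphically onto the image, which is the whole tangent
space since the source map is a submersion.
\<close>

lemma hlift:
  assumes g: "g \<in> arrs G" and v: "v \<in> TM (Sc g)"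
  shows "hlift G H g v \<in> H g" "push A g M Sc (hlift G H g v) = v"
proof -
  have "v \<in> dsrc G g ` TA g" using submersionD(2)[OF s_sub] g v by simp
  then obtain y where y: "y \<in> TA g" "v = dsrc G g y" by (elim imageE)
  obtain h k where hk: "y = h + k" "h \<in> H g" "k \<in> ker_dsrc G g" using y(1) H_split[OF g] by auto
  have hT: "h \<in> TA g" using hk H_linear(1)[OF g] by auto
  have "v = push A g M Sc h"
    using y hk by (simp add: dsrc_push push_add ker_dsrc_iff)
  then have "v = dsrc G g h" using dsrc_push[OF hT] by simp
  then have vi: "v \<in> dsrc G g ` H g" using hk(2) by (rule image_eqI)
  show 1: "hlift G H g v \<in> H g" unfolding hlift_def by (rule inv_into_into[OF vi])
  have "dsrc G g (hlift G H g v) = v" unfolding hlift_def by (rule f_inv_into_f[OF vi])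
  then show "push A g M Sc (hlift G H g v) = v" using 1 H_linear(1)[OF g] dsrc_push by auto
qed

lemma hlift_eqI:
  assumes g: "g \<in> arrs G" and h: "h \<in> H g"
  shows "hlift G H g (push A g M Sc h) = h"
proof -
  have "push A g M Sc h \<in> TM (Sc g)"
    by (rule push_tangent[OF A M dsmooth_smooth_map_on[OF s_smooth]]) (use g h H_linear(1)[OF g] in
        auto)
  from hlift[OF g this] show ?thesis by (intro dsrc_inj_H[OF g] h)
qed

lemma hlift_linear:
  assumes g: "g \<in> arrs G"
  shows "v \<in> TM (Sc g) \<Longrightarrow> w \<in> TM (Sc g) \<Longrightarrow> hlift G H g (v + w) = hlift G H g v + hlift G H g w"
    "v \<in> TM (Sc g) \<Longrightarrow> hlift G H g (tscale c v) = tscale c (hlift G H g v)"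
proof -
  show "v \<in> TM (Sc g) \<Longrightarrow> w \<in> TM (Sc g) \<Longrightarrow> hlift G H g (v + w) = hlift G H g v + hlift G H g w"
    using hlift_eqI[OF g H_linear(2)[OF g hlift(1)[OF g] hlift(1)[OF g]], of v w]
    by (simp add: push_add hlift(2)[OF g])
  show "v \<in> TM (Sc g) \<Longrightarrow> hlift G H g (tscale c v) = tscale c (hlift G H g v)"
    using hlift_eqI[OF g H_linear(3)[OF g hlift(1)[OF g]], of v c]
    by (simp add: push_scale hlift(2)[OF g])
qed

text \<open>
The projection onto the kernel of the differential of the source map along the connection.
\<close>

definition vertical_part :: "'a \<Rightarrow> 'a tvec \<Rightarrow> 'a tvec" where
  "vertical_part g y = y - hlift G H g (push A g M Sc y)"

lemma push_src_tangent: "y \<in> TA g \<Longrightarrow> push A g M Sc y \<in> TM (Sc g)"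
  by (rule push_tangent[OF A M dsmooth_smooth_map_on[OF s_smooth]]) (use tangent_point in auto)

lemma vertical_part:
  assumes g: "g \<in> arrs G"
  shows "y \<in> TA g \<Longrightarrow> vertical_part g y \<in> ker_dsrc G g"
    "y \<in> TA g \<Longrightarrow> z \<in> TA g \<Longrightarrow> vertical_part g (y + z) = vertical_part g y + vertical_part g z"
    "y \<in> TA g \<Longrightarrow> vertical_part g (tscale c y) = tscale c (vertical_part g y)"
proof -
  show "vertical_part g y \<in> ker_dsrc G g" if y: "y \<in> TA g"
    using hlift[OF g push_src_tangent[OF y]] H_linear(1)[OF g] y
    by (auto simp: vertical_part_def ker_dsrc_iff push_diff intro!: tangent_diff[OF A])
  show "y \<in> TA g \<Longrightarrow> z \<in> TA g \<Longrightarrow> vertical_part g (y + z) = vertical_part g y + vertical_part g z"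
    by (simp add: vertical_part_def push_add hlift_linear[OF g] push_src_tangent)
  show "y \<in> TA g \<Longrightarrow> vertical_part g (tscale c y) = tscale c (vertical_part g y)"
    by (simp add: vertical_part_def push_scale hlift_linear[OF g] push_src_tangent)
      (simp add: tscale_def fun_eq_iff right_diff_distrib)
qed

text \<open>
The decomposition of \<open>y\<close> into a horizontal and a vertical part is unique, and right translation
identifies the vertical vectors with the algebroid fibre.
\<close>

lemma vproj_eq:
  assumes g: "g \<in> arrs G" and y: "y \<in> TA g"
  shows "vproj G H g y = rinv g (vertical_part g y)"
  unfolding vproj_def
proof (rule the_equality)
  note k = vertical_part(1)[OF g y]
  show "rinv g (vertical_part g y) \<in> alg_fibre G (Tg g) \<and>
     rtrans G g (rinv g (vertical_part g y)) + hlift G H g (dsrc G g y) = y"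
    using rtrans_rinv(3,4)[OF g k] by (simp add: dsrc_push[OF y]) (simp add: vertical_part_def)
  fix \<alpha> assume a: "\<alpha> \<in> alg_fibre G (Tg g) \<and> rtrans G g \<alpha> + hlift G H g (dsrc G g y) = y"
  then have "rtrans G g \<alpha> = vertical_part g y"
    by (simp add: dsrc_push[OF y] vertical_part_def eq_diff_eq)
  then show "\<alpha> = rinv g (vertical_part g y)" using rtrans_rinv(2)[OF g] a by metis
qed

lemma lam0_eq:
  assumes g: "g \<in> arrs G" and \<alpha>: "\<alpha> \<in> alg_fibre G (Sc g)"
  shows "lam0 G H g \<alpha> = - rinv g (vertical_part g (ltrans G g \<alpha>))"
  unfolding lam0_def using vproj_eq[OF g ltrans_facts(4)[OF g \<alpha>]] by simp

lemma lam0_linear: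
  assumes g: "g \<in> arrs G"
  shows "\<alpha> \<in> alg_fibre G (Sc g) \<Longrightarrow> lam0 G H g \<alpha> \<in> alg_fibre G (Tg g)"
    "\<alpha> \<in> alg_fibre G (Sc g) \<Longrightarrow> \<beta> \<in> alg_fibre G (Sc g) \<Longrightarrow> lam0 G H g (\<alpha> + \<beta>) = lam0 G H g \<alpha> + lam0 G H g \<beta>"
    "\<alpha> \<in> alg_fibre G (Sc g) \<Longrightarrow> lam0 G H g (tscale c \<alpha>) = tscale c (lam0 G H g \<alpha>)"
proof -
  note l = ltrans_facts[OF g] and v = vertical_part[OF g] and r = rinv_linear[OF g]
  show "lam0 G H g \<alpha> \<in> alg_fibre G (Tg g)" if a: "\<alpha> \<in> alg_fibre G (Sc g)"
    using rtrans_rinv(3)[OF g v(1)[OF l(4)[OF a]]] unfolding lam0_eq[OF g a] alg_fibre_def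
    by (rule ker_dsrc_linear(4))
  show "lam0 G H g (\<alpha> + \<beta>) = lam0 G H g \<alpha> + lam0 G H g \<beta>"
    if a: "\<alpha> \<in> alg_fibre G (Sc g)" "\<beta> \<in> alg_fibre G (Sc g)"
  proof -
    have ab: "\<alpha> + \<beta> \<in> alg_fibre G (Sc g)" using a unfolding alg_fibre_def by (rule ker_dsrc_linear(2))
    show ?thesis
      unfolding lam0_eq[OF g ab] lam0_eq[OF g a(1)] lam0_eq[OF g a(2)]
      using l(1)[OF a] v(2)[OF l(4)[OF a(1)] l(4)[OF a(2)]] r(1)[OF v(1)[OF l(4)[OF a(1)]] v(1)[OF
          l(4)[OF a(2)]]]
      by simp
  qed
  show "lam0 G H g (tscale c \<alpha>) = tscale c (lam0 G H g \<alpha>)" if a: "\<alpha> \<in> alg_fibre G (Sc g)"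
  proof -
    have ab: "tscale c \<alpha> \<in> alg_fibre G (Sc g)" using a unfolding alg_fibre_def
      by (rule ker_dsrc_linear(3))
    show ?thesis
      unfolding lam0_eq[OF g ab] lam0_eq[OF g a]
      by (simp only: l(2)[OF a] v(3)[OF l(4)[OF a]] r(2)[OF v(1)[OF l(4)[OF a]]] tscale_uminus)
  qed
qed

lemma lam1_eq:
  assumes g: "g \<in> arrs G" and v: "v \<in> TM (Sc g)"
  shows "lam1 G H g v = push A g M Tg (hlift G H g v)"
  unfolding lam1_def using dtgt_push hlift(1)[OF g v] H_linear(1)[OF g] by auto

lemma lam1_linear:
  assumes g: "g \<in> arrs G"
  shows "v \<in> TM (Sc g) \<Longrightarrow> lam1 G H g v \<in> TM (Tg g)"
    "v \<in> TM (Sc g) \<Longrightarrow> w \<in> TM (Sc g) \<Longrightarrow> lam1 G H g (v + w) = lam1 G H g v + lam1 G H g w"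
    "v \<in> TM (Sc g) \<Longrightarrow> lam1 G H g (tscale c v) = tscale c (lam1 G H g v)"
proof -
  show "lam1 G H g v \<in> TM (Tg g)" if v: "v \<in> TM (Sc g)"
    unfolding lam1_eq[OF g v]
    by (rule push_tangent[OF A M dsmooth_smooth_map_on[OF t_smooth]])
      (use g hlift(1)[OF g v] H_linear(1)[OF g] in auto)
  show "v \<in> TM (Sc g) \<Longrightarrow> w \<in> TM (Sc g) \<Longrightarrow> lam1 G H g (v + w) = lam1 G H g v + lam1 G H g w"
    by (simp add: lam1_eq[OF g] tangent_add[OF M] hlift_linear[OF g] push_add)
  show "v \<in> TM (Sc g) \<Longrightarrow> lam1 G H g (tscale c v) = tscale c (lam1 G H g v)"
    by (simp add: lam1_eq[OF g] tangent_scale[OF M] hlift_linear[OF g] push_scale)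
qed

section \<open>Transports along units\<close>

text \<open>
The connection contains the tangent vectors of units, so curves of units are horizontal.
\<close>

lemma unit_curve:
  assumes \<gamma>: "smooth_curve M \<gamma>"
  shows "smooth_curve A (\<lambda>t. One (\<gamma> t))" "velocity A (\<lambda>t. One (\<gamma> t)) \<in> H (One (\<gamma> 0))"
    "push A (One (\<gamma> 0)) M Sc (velocity A (\<lambda>t. One (\<gamma> t))) = velocity M \<gamma>"
    "push A (One (\<gamma> 0)) M Tg (velocity A (\<lambda>t. One (\<gamma> t))) = velocity M \<gamma>"
proof -
  note p = smooth_curve_point[OF \<gamma>]
  show c: "smooth_curve A (\<lambda>t. One (\<gamma> t))"
    by (rule smooth_curve_map[OF M dsmooth_smooth_map_on[OF unit_smooth] \<gamma> p])
  have "velocity A (\<lambda>t. One (\<gamma> t)) = push M (\<gamma> 0) A One (velocity M \<gamma>)"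
    by (rule velocity_map[OF M A dsmooth_smooth_map_on[OF unit_smooth] \<gamma> p])
  also have "\<dots> = differential M A One (\<gamma> 0) (velocity M \<gamma>)"
    using differential_eq_push[OF M A unit_smooth tangent_spaceI[OF \<gamma> refl]] by simp
  finally show "velocity A (\<lambda>t. One (\<gamma> t)) \<in> H (One (\<gamma> 0))"
    unfolding H_unit[OF p] using tangent_spaceI[OF \<gamma> refl] by simp
  have ev: "\<forall>\<^sub>F t in nhds 0. \<gamma> t \<in> objs G"
    by (rule smooth_curve_eventually_in[OF M \<gamma> openin_topspace p])
  have "velocity M (\<lambda>t. Sc (One (\<gamma> t))) = velocity M \<gamma>"
    by (rule velocity_eqI, rule eventually_mono[OF ev]) simp
  then show "push A (One (\<gamma> 0)) M Sc (velocity A (\<lambda>t. One (\<gamma> t))) = velocity M \<gamma>"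
    using velocity_map[OF A M dsmooth_smooth_map_on[OF s_smooth] c] p by simp
  have "velocity M (\<lambda>t. Tg (One (\<gamma> t))) = velocity M \<gamma>"
    by (rule velocity_eqI, rule eventually_mono[OF ev]) simp
  then show "push A (One (\<gamma> 0)) M Tg (velocity A (\<lambda>t. One (\<gamma> t))) = velocity M \<gamma>"
    using velocity_map[OF A M dsmooth_smooth_map_on[OF t_smooth] c] p by simp
qed

lemma lam1_unit:
  assumes x: "x \<in> objs G" and v: "v \<in> TM x"
  shows "lam1 G H (One x) v = v"
proof -
  obtain \<gamma> where \<gamma>: "smooth_curve M \<gamma>" "\<gamma> 0 = x" "v = velocity M \<gamma>" using tangent_spaceE[OF v] .
  note u = unit_curve[OF \<gamma>(1), unfolded \<gamma>(2)]
  have o: "One x \<in> arrs G" using x by simp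
  have "hlift G H (One x) v = velocity A (\<lambda>t. One (\<gamma> t))"
    using hlift_eqI[OF o u(2)] by (simp add: u(3) \<gamma>(3))
  then show ?thesis using lam1_eq[OF o] v x u(4) \<gamma>(3) by simp
qed

text \<open>
For a curve \<open>\<gamma>\<close> of arrows with source \<open>x\<close> that starts at the unit, consider the surface \<open>\<gamma> t (\<gamma>
s)\<^sup>-\<^sup>1\<close>. Its diagonal consists of units, so it is horizontal; its axes have the velocities \<open>\<alpha>\<close>
and \<open>ltrans (One x) \<alpha>\<close>. Hence left translation along a unit is \<open>- \<alpha>\<close> modulo horizontal vectors.
The sign in the definition of \<open>lam0\<close> compensates for this.
\<close>

lemma lam0_unit:
  assumes x: "x \<in> objs G" and \<alpha>: "\<alpha> \<in> alg_fibre G x"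
  shows "lam0 G H (One x) \<alpha> = \<alpha>"
proof -
  have o: "One x \<in> arrs G" using x by simp
  obtain \<gamma> where \<gamma>: "smooth_curve A \<gamma>" "\<gamma> 0 = One x" "velocity A \<gamma> = \<alpha>"
    "\<forall>\<^sub>F t in nhds 0. Sc (\<gamma> t) = Sc (One x)" using \<alpha> unfolding alg_fibre_def by (rule ker_curve)
  have \<gamma>4: "\<forall>\<^sub>F t in nhds 0. Sc (\<gamma> t) = x" using \<gamma>(4) x by simp
  note ev = eventually_in_fibre[OF \<gamma>(1) \<gamma>4]
  have sT: "smooth_curve M (\<lambda>t. Tg (\<gamma> t))"
    by (rule smooth_curve_map[OF A dsmooth_smooth_map_on[OF t_smooth] \<gamma>(1) smooth_curve_point[OF \<gamma>(1)]])
  have T0: "Tg (\<gamma> 0) = x" using \<gamma>(2) x by simp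
  define h where "h = velocity A (\<lambda>t. One (Tg (\<gamma> t)))"
  have h: "h \<in> H (One x)" using unit_curve(2)[OF sT] unfolding h_def T0 .
  obtain \<epsilon> where e: "\<epsilon> > 0" "plot (mdiff A) 1 (cube 1 (\<lambda>_. 0) \<epsilon>) (\<lambda>u. \<gamma> (u 0))"
    using smooth_curveD[OF \<gamma>(1)] .
  obtain d where d: "d > 0" "\<forall>t. dist t 0 < d \<longrightarrow> \<gamma> t \<in> {h \<in> arrs G. Sc h = x}"
    using ev by (auto simp: eventually_nhds_metric)
  let ?z = "\<lambda>_::nat. 0::real"
  let ?Q = "cube 2 ?z (min \<epsilon> d)"
  have zQ: "?z \<in> ?Q" using e d by (simp add: cube_self zero_in_Euclidean)
  have pj: "plot (mdiff A) 2 ?Q (\<lambda>u. \<gamma> (u j))" if j: "j < 2" for j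
  proof -
    have s: "smooth_cartesian 2 ?Q 1 (\<lambda>u. ?z(0 := u j))"
    proof (rule smooth_cartesianI[OF openin_cube line_in_Euclidean])
      show "smooth_real 2 ?Q (\<lambda>u. (?z(0 := u j)) i)" for i
        by (cases "i = 0") (simp_all add: smooth_real_coord smooth_real_const openin_cube)
    qed
    have "plot (mdiff A) 2 ?Q (\<lambda>u. \<gamma> ((?z(0 := u j)) 0))"
      by (rule mplot_compose[OF A e(2) s]) (use j in \<open>auto simp: cube_def topspace_Euclidean_space\<close>)
    then show ?thesis by simp
  qed
  have fib: "\<gamma> (u j) \<in> arrs G" "Sc (\<gamma> (u j)) = x" if "u \<in> ?Q" "j < 2" for u j
    using that d(2)[rule_format, of "u j"] by (auto simp: cube_def dist_real_def)
  define K where "K u = Mu (\<gamma> (u 0)) (Inv (\<gamma> (u 1)))" for u :: "nat \<Rightarrow> real"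
  have K: "plot (mdiff A) 2 ?Q K"
    unfolding K_def by (rule cmp_plot[OF pj inv_plot[OF pj]]) (use fib in auto)
  have "velocity A (\<lambda>t. K (?z(0 := t, 1 := t))) = h"
    unfolding h_def by (rule velocity_eqI, rule eventually_mono[OF ev]) (simp add: K_def)
  moreover have "velocity A (\<lambda>t. K (?z(0 := t))) = \<alpha>"
    unfolding \<gamma>(3)[symmetric]
    by (rule velocity_eqI, rule eventually_mono[OF ev]) (use x in \<open>auto simp: K_def \<gamma>(2)\<close>)
  moreover have "velocity A (\<lambda>t. K (?z(1 := t))) = ltrans G (One x) \<alpha>"
    using ltrans_facts(3)[OF o \<gamma>(1)] \<gamma>(2) \<gamma>4 x by (simp add: K_def \<gamma>(3))
  ultimately have sum: "h = \<alpha> + ltrans G (One x) \<alpha>" using velocity_diagonal[OF A K zQ] by simp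
  have \<alpha>s: "\<alpha> \<in> alg_fibre G (Sc (One x))" using \<alpha> x by simp
  have l: "ltrans G (One x) \<alpha> = h - \<alpha>" using sum by (simp add: algebra_simps)
  have "push A (One x) M Sc (h - \<alpha>) = push A (One x) M Sc h"
    using \<alpha> by (simp add: push_diff alg_fibre_def ker_dsrc_iff)
  then have vp: "vertical_part (One x) (ltrans G (One x) \<alpha>) = - \<alpha>"
    unfolding vertical_part_def l using hlift_eqI[OF o h] by simp
  have \<alpha>k: "- \<alpha> \<in> ker_dsrc G (One x)" using \<alpha> unfolding alg_fibre_def by (rule ker_dsrc_linear(4))
  have "rinv (One x) (- \<alpha>) = - \<alpha>"
  proof -
    obtain \<delta> where \<delta>: "smooth_curve A \<delta>" "\<delta> 0 = One x" "velocity A \<delta> = - \<alpha>"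
      "\<forall>\<^sub>F t in nhds 0. Sc (\<delta> t) = Sc (One x)" using \<alpha>k by (rule ker_curve)
    have "rinv (One x) (velocity A \<delta>) = velocity A (\<lambda>t. Mu (\<delta> t) (Inv (One x)))"
      by (rule rinv_curve(3)[OF o \<delta>(1,2,4)])
    also have "\<dots> = velocity A \<delta>"
      by (rule velocity_eqI, rule eventually_mono[OF eventually_in_fibre[OF \<delta>(1,4)]]) (use x in auto)
    finally show ?thesis using \<delta>(3) by simp
  qed
  then show ?thesis using lam0_eq[OF o \<alpha>s] vp by simp
qed

section \<open>Smoothness of the transports\<close>

text \<open>
Expand the lift in a local frame of the connection. The source map is injective on horizontal
vectors, so the images of the frame are linearly independent and the coefficients are the
solution of a linear system with smooth entries.
\<close>

lemma hlift_plot: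
  assumes g: "plot (mdiff A) n U g" and v: "plot (tangent_bundle M) n U (\<lambda>u. (Sc (g u), v u))"
  shows "plot (tangent_bundle A) n U (\<lambda>u. (g u, hlift G H (g u) (v u)))"
proof (rule diffeological_spaceD(6)[OF diffeological_space_tangent_bundle[OF A]])
  fix u0 assume u0: "u0 \<in> U"
  have gu: "g u \<in> arrs G" if "u \<in> U" for u by (rule mplot_point[OF g that])
  obtain O1 and k :: nat and Y where O1: "openin (mtop A) O1" "g u0 \<in> O1"
    and Y: "\<forall>i<k. dsmooth (subspace_diffeology (mdiff A) O1) (tangent_bundle A) (\<lambda>y. (y, Y i y))"
    and fr: "\<forall>y\<in>O1. H y = {(\<Sum>i<k. tscale (c i) (Y i y)) |c. True} \<and>
               (\<forall>c. (\<Sum>i<k. tscale (c i) (Y i y)) = 0 \<longrightarrow> (\<forall>i<k. c i = 0))"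
    using H_subbundle[unfolded smooth_subbundle_def, THEN conjunct2, rule_format, OF gu[OF u0]]
      by (elim exE conjE)
  have Sg0: "Sc (g u0) \<in> objs G" using gu[OF u0] by simp
  obtain m E \<psi> where c: "(m, E, \<psi>) \<in> atlas M" "Sc (g u0) \<in> E" by (rule chart_at[OF M Sg0])
  define U1 where "U1 = {u \<in> U. g u \<in> O1} \<inter> {u \<in> U. Sc (g u) \<in> E}"
  have U1: "openin (Euclidean_space n) U1" unfolding U1_def
    by (intro openin_Int mplot_preimage[OF g O1(1)] mplot_preimage[OF s_plot[OF g] chart_facts(1)[OF M
        c(1)]])
  have U1U: "U1 \<subseteq> U" and u01: "u0 \<in> U1" using u0 O1 c by (auto simp: U1_def)
  have g1: "plot (mdiff A) n U1 g" by (rule mplot_restrict[OF A g U1 U1U])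
  have gO: "g u \<in> O1" "Sc (g u) \<in> E" "g u \<in> arrs G" "u \<in> U" if "u \<in> U1" for u
    using that gu by (auto simp: U1_def)
  have Yp: "plot (tangent_bundle A) n U1 (\<lambda>u. (g u, Y i (g u)))" if "i < k" for i
  proof -
    have "plot (subspace_diffeology (mdiff A) O1) n U1 g"
      using g1 gO by (auto simp: subspace_diffeology_def)
    from dsmoothD(2)[OF Y[rule_format, OF that] this] show ?thesis .
  qed
  have YT: "Y i (g u) \<in> TA (g u)" if "i < k" "u \<in> U1" for i u
    by (rule tangent_plotD(2)[OF Yp[OF that(1)] that(2)])
  \<comment> \<open>The coordinates of the images of the frame under the differential of the source map.\<close>
  define w where "w i u j = push A (g u) M Sc (Y i (g u)) (\<lambda>y. \<psi> y j)" for i u j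
  have ws: "smooth_real n U1 (\<lambda>u. w i u j)" if "i < k" "j < m" for i j
  proof -
    have "{u \<in> U1. Sc (g u) \<in> E} = U1" using gO by auto
    then show ?thesis
      using tangent_plotD(3)[OF push_plot[OF A M s_smooth Yp[OF that(1)]] c(1) that(2)]
        by (simp add: w_def)
  qed
  have vs: "smooth_real n U1 (\<lambda>u. v u (\<lambda>y. \<psi> y j))" if "j < m" for j
    by (rule smooth_real_mono[OF tangent_plotD(3)[OF v c(1) that] U1]) (auto simp: U1_def)
  have vT: "v u \<in> TM (Sc (g u))" if "u \<in> U" for u by (rule tangent_plotD(2)[OF v that])
  define comb where "comb c u = (\<Sum>i<k. tscale (c i) (Y i (g u)))" for c u
  have comb_push: "push A (g u) M Sc (comb c u) (\<lambda>y. \<psi> y j) = (\<Sum>i<k. c i * w i u j)" for c u j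
    unfolding comb_def w_def push_combination combination_apply ..
  have combH: "H (g u) = {comb c u |c. True}" if "u \<in> U1" for u
    using fr gO[OF that] by (simp add: comb_def)
  have "\<forall>u\<in>U1. \<exists>c. hlift G H (g u) (v u) = comb c u"
    using hlift(1)[OF gO(3) vT[OF gO(4)]] combH by auto
  from bchoice[OF this] obtain cf where cf: "\<forall>u\<in>U1. hlift G H (g u) (v u) = comb (cf u) u" by (elim exE)
  define a where "a i u = cf u i" for i u
  have "\<exists>W. u0 \<in> W \<and> W \<subseteq> U1 \<and> openin (Euclidean_space n) W \<and> (\<forall>i<k. smooth_real n W (a i))"
  proof (rule smooth_coefficients[where w = w and v = "\<lambda>u j. v u (\<lambda>y. \<psi> y j)", OF u01 U1 ws vs])
    fix u c assume u: "u \<in> U1" and z: "\<And>j. j < m \<Longrightarrow> (\<Sum>i<k. c i * w i u j) = 0"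
    have cH: "comb c u \<in> H (g u)" using combH[OF u] by auto
    have cT: "comb c u \<in> TA (g u)" using cH H_linear(1)[OF gO(3)[OF u]] by auto
    have "push A (g u) M Sc (comb c u) = 0"
    proof (rule tangent_eqI[OF M c(1) gO(2)[OF u] push_src_tangent[OF cT] tangent_zero[OF M]])
      show "Sc (g u) \<in> objs G" using gO(3)[OF u] by simp
      show "push A (g u) M Sc (comb c u) (\<lambda>y. \<psi> y j) = 0 (\<lambda>y. \<psi> y j)" if "j < m" for j
        using z[OF that] by (simp add: comb_push)
    qed
    then have "comb c u \<in> H (g u) \<inter> ker_dsrc G (g u)" using cH cT by (simp add: ker_dsrc_iff)
    then have "comb c u = 0" unfolding H_ker[OF gO(3)[OF u]] by simp
    then show "\<forall>i<k. c i = 0" using fr gO(1)[OF u] by (simp add: comb_def)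
  next
    fix u j assume u: "u \<in> U1" "j < m"
    show "v u (\<lambda>y. \<psi> y j) = (\<Sum>i<k. a i u * w i u j)"
      using comb_push[of u "cf u" j] cf[rule_format, OF u(1)] hlift(2)[OF gO(3)[OF u(1)] vT[OF gO(4)[OF
          u(1)]]]
      by (simp add: a_def)
  qed auto
  then obtain W where W: "u0 \<in> W" "W \<subseteq> U1" "openin (Euclidean_space n) W" "\<forall>i<k. smooth_real n W (a i)"
    by (elim exE conjE)
  have "plot (tangent_bundle A) n W (\<lambda>u. (g u, hlift G H (g u) (v u)))"
  proof (rule tangent_plotI)
    show gW: "plot (mdiff A) n W g" by (rule mplot_restrict[OF A g1 W(3,2)])
    show "hlift G H (g u) (v u) \<in> TA (g u)" if "u \<in> W" for u
      using hlift(1)[OF gO(3) vT[OF gO(4)], of u] H_linear(1)[OF gO(3), of u] that W(2) by auto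
    fix l D \<phi> j assume ch: "(l, D, \<phi>) \<in> atlas A" "j < l"
    have WD: "openin (Euclidean_space n) {u \<in> W. g u \<in> D}"
      by (rule mplot_preimage[OF gW chart_facts(1)[OF A ch(1)]])
    have ai: "smooth_real n {u \<in> W. g u \<in> D} (a i)" if "i < k" for i
      by (rule smooth_real_mono[OF W(4)[rule_format, OF that] WD]) auto
    have yi: "smooth_real n {u \<in> W. g u \<in> D} (\<lambda>u. Y i (g u) (\<lambda>x. \<phi> x j))" if "i < k" for i
      by (rule smooth_real_mono[OF tangent_plotD(3)[OF Yp[OF that] ch] WD]) (use W(2) in auto)
    have "smooth_real n {u \<in> W. g u \<in> D} (\<lambda>u. \<Sum>i<k. a i u * Y i (g u) (\<lambda>x. \<phi> x j))"
      by (intro smooth_real_sum WD smooth_real_mult ai yi) auto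
    then show "smooth_real n {u \<in> W. g u \<in> D} (\<lambda>u. hlift G H (g u) (v u) (\<lambda>x. \<phi> x j))"
    proof (rule smooth_real_cong)
      fix u assume "u \<in> {u \<in> W. g u \<in> D}"
      then have "u \<in> U1" using W(2) by auto
      then have "hlift G H (g u) (v u) = (\<Sum>i<k. tscale (a i u) (Y i (g u)))"
        using cf by (simp add: comb_def a_def)
      then show "hlift G H (g u) (v u) (\<lambda>x. \<phi> x j) = (\<Sum>i<k. a i u * Y i (g u) (\<lambda>x. \<phi> x j))"
        by (simp only: combination_apply)
    qed
  qed
  then show "\<exists>W. u0 \<in> W \<and> W \<subseteq> U \<and> plot (tangent_bundle A) n W (\<lambda>u. (g u, hlift G H (g u) (v u)))"
    using W U1U by (intro exI[of _ W]) auto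
qed

lemma lam1_plot:
  assumes g: "plot (mdiff A) n U g" and v: "plot (tangent_bundle M) n U (\<lambda>u. (Sc (g u), v u))"
  shows "plot (tangent_bundle M) n U (\<lambda>u. (Tg (g u), lam1 G H (g u) (v u)))"
proof (rule diffeological_spaceD(3)[OF diffeological_space_tangent_bundle[OF M]
      push_plot[OF A M t_smooth hlift_plot[OF g v]]])
  fix u assume "u \<in> U"
  then show "(Tg (g u), push A (g u) M Tg (hlift G H (g u) (v u))) = (Tg (g u), lam1 G H (g u) (v u))"
    using lam1_eq[OF mplot_point[OF g] tangent_plotD(2)[OF v]] by simp
qed

lemma lie_algebroid_plot_iff:
  "plot (lie_algebroid G) n U (\<lambda>u. (x u, \<alpha> u)) \<longleftrightarrow> plot (mdiff M) n U x \<and>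
     (\<forall>u\<in>U. \<alpha> u \<in> alg_fibre G (x u)) \<and> plot (tangent_bundle A) n U (\<lambda>u. (One (x u), \<alpha> u))"
  by (simp add: lie_algebroid_def o_def)

text \<open>
The transport is a composite of three maps that send plots to plots: the left translation, the
projection along the connection, and the inverse right translation. The first and the last are
families of differentials along source fibres.
\<close>

lemma lam0_plot:
  assumes g: "plot (mdiff A) n U g" and a: "plot (lie_algebroid G) n U (\<lambda>u. (Sc (g u), \<alpha> u))"
  shows "plot (lie_algebroid G) n U (\<lambda>u. (Tg (g u), lam0 G H (g u) (\<alpha> u)))"
proof -
  have gu: "g u \<in> arrs G" if "u \<in> U" for u by (rule mplot_point[OF g that])
  have \<alpha>: "\<alpha> u \<in> alg_fibre G (Sc (g u))" if "u \<in> U" for u using a that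
    by (simp add: lie_algebroid_plot_iff)
  have q: "plot (tangent_bundle A) n U (\<lambda>u. (One (Sc (g u)), \<alpha> u))" using a
    by (simp add: lie_algebroid_plot_iff)
  have l: "plot (tangent_bundle A) n U (\<lambda>u. (Mu (g u) (Inv (One (Sc (g u)))),
      differential_on A (src_fibre G (Sc (g u))) A (\<lambda>h. Mu (g u) (Inv h)) (One (Sc (g u))) (\<alpha> u)))"
  proof (rule fibre_differential_plot(2)[OF A M A s_sub q])
    show "push A (One (Sc (g u))) M Sc (\<alpha> u) = 0" if "u \<in> U" for u
      using \<alpha>[OF that] by (simp add: alg_fibre_def ker_dsrc_iff)
    show "src_fibre G (Sc (g u)) = {h \<in> arrs G. Sc h = Sc (One (Sc (g u)))}" if "u \<in> U" for u
      using gu[OF that] by (simp add: src_fibre_eq)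
    fix m V p z
    assume p: "smooth_cartesian m V n p" "p ` V \<subseteq> U" and z: "plot (mdiff A) m V z"
      and eq: "\<And>y. y \<in> V \<Longrightarrow> Sc (z y) = Sc (One (Sc (g (p y))))"
    show "plot (mdiff A) m V (\<lambda>y. Mu (g (p y)) (Inv (z y)))"
      by (rule cmp_plot[OF mplot_compose[OF A g p] inv_plot[OF z]])
        (use eq p(2) gu mplot_point[OF z] in auto)
  qed
  have l': "plot (tangent_bundle A) n U (\<lambda>u. (g u, ltrans G (g u) (\<alpha> u)))"
    by (rule diffeological_spaceD(3)[OF diffeological_space_tangent_bundle[OF A] l])
      (use gu in \<open>simp add: ltrans_def\<close>)
  have y: "plot (tangent_bundle A) n U (\<lambda>u. (g u, vertical_part (g u) (ltrans G (g u) (\<alpha> u))))"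
    unfolding vertical_part_def
    by (rule tangent_plot_diff[OF A l' hlift_plot[OF g push_plot[OF A M s_smooth l']]])
  have k: "vertical_part (g u) (ltrans G (g u) (\<alpha> u)) \<in> ker_dsrc G (g u)" if "u \<in> U" for u
    by (rule vertical_part(1)[OF gu[OF that] ltrans_facts(4)[OF gu[OF that] \<alpha>[OF that]]])
  have r: "plot (tangent_bundle A) n U (\<lambda>u. (Mu (g u) (Inv (g u)),
      differential_on A (src_fibre G (Sc (g u))) A (\<lambda>h. Mu h (Inv (g u))) (g u)
        (vertical_part (g u) (ltrans G (g u) (\<alpha> u)))))"
  proof (rule fibre_differential_plot(2)[OF A M A s_sub y])
    show "push A (g u) M Sc (vertical_part (g u) (ltrans G (g u) (\<alpha> u))) = 0" if "u \<in> U" for u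
      using k[OF that] by (simp add: ker_dsrc_iff)
    show "src_fibre G (Sc (g u)) = {h \<in> arrs G. Sc h = Sc (g u)}" for u by (simp add: src_fibre_eq)
    fix m V p z
    assume p: "smooth_cartesian m V n p" "p ` V \<subseteq> U" and z: "plot (mdiff A) m V z"
      and eq: "\<And>y. y \<in> V \<Longrightarrow> Sc (z y) = Sc (g (p y))"
    show "plot (mdiff A) m V (\<lambda>y. Mu (z y) (Inv (g (p y))))"
      by (rule cmp_plot[OF z inv_plot[OF mplot_compose[OF A g p]]]) (use eq p(2) gu in auto)
  qed
  have "plot (tangent_bundle A) n U (\<lambda>u. (One (Tg (g u)), lam0 G H (g u) (\<alpha> u)))"
    by (rule diffeological_spaceD(3)[OF diffeological_space_tangent_bundle[OF A] tangent_plot_uminus[OF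
        A r]])
      (use gu lam0_eq[OF gu \<alpha>] in \<open>simp add: rinv_def\<close>)
  then show ?thesis
    unfolding lie_algebroid_plot_iff using t_plot[OF g] lam0_linear(1)[OF gu \<alpha>] by simp
qed

end

section \<open>Initial, fibre product and quotient diffeologies\<close>

text \<open>
Three maps suffice for all spaces needed below: the total space of the coefficient bundle has
its base point and two vectors. Fewer maps are obtained by repetition.
\<close>

lemma diffeological_space_initial:
  assumes D1: "diffeological_space D1" and D2: "diffeological_space D2" and D3: "diffeological_space D3"
    and f: "\<And>x. x \<in> points D \<Longrightarrow> f1 x \<in> points D1 \<and> f2 x \<in> points D2 \<and> f3 x \<in> points D3"
    and iff: "\<And>n U p. plot D n U p \<longleftrightarrow> (\<forall>u\<in>U. p u \<in> points D) \<and> plot D1 n U (\<lambda>u. f1 (p u)) \<and>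
       plot D2 n U (\<lambda>u. f2 (p u)) \<and> plot D3 n U (\<lambda>u. f3 (p u))"
  shows "diffeological_space D"
proof (rule diffeological_spaceI)
  fix n U p assume p: "plot D n U p"
  then have q: "\<forall>u\<in>U. p u \<in> points D" "plot D1 n U (\<lambda>u. f1 (p u))" "plot D2 n U (\<lambda>u. f2 (p u))"
    "plot D3 n U (\<lambda>u. f3 (p u))" by (simp_all add: iff)
  show "openin (Euclidean_space n) U" by (rule diffeological_spaceD(1)[OF D1 q(2)])
  show "p u \<in> points D" if "u \<in> U" for u using q(1) that by blast
  show "plot D n U q" if e: "\<And>u. u \<in> U \<Longrightarrow> p u = q u" for q
    unfolding iff
    by (intro conjI diffeological_spaceD(3)[OF D1 q(2)] diffeological_spaceD(3)[OF D2 q(3)]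
        diffeological_spaceD(3)[OF D3 q(4)])
      (use q(1) e in auto)
  show "plot D m V (\<lambda>v. p (f v))" if s: "smooth_cartesian m V n f" "f ` V \<subseteq> U" for m V f
    unfolding iff
    by (intro conjI diffeological_spaceD(5)[OF D1 q(2) s] diffeological_spaceD(5)[OF D2 q(3) s]
        diffeological_spaceD(5)[OF D3 q(4) s]) (use q(1) s(2) in auto)
next
  fix n U x assume U: "openin (Euclidean_space n) U" and x: "x \<in> points D"
  show "plot D n U (\<lambda>_. x)"
    unfolding iff using f[OF x] x
    by (intro conjI diffeological_spaceD(4)[OF D1 U] diffeological_spaceD(4)[OF D2 U]
        diffeological_spaceD(4)[OF D3 U]) auto
next
  fix n U p assume U: "openin (Euclidean_space n) U"
    and loc: "\<And>u. u \<in> U \<Longrightarrow> \<exists>W. openin (Euclidean_space n) W \<and> u \<in> W \<and> W \<subseteq> U \<and> plot D n W p"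
  have l: "\<exists>W. u \<in> W \<and> W \<subseteq> U \<and> (\<forall>u\<in>W. p u \<in> points D) \<and> plot D1 n W (\<lambda>u. f1 (p u)) \<and>
       plot D2 n W (\<lambda>u. f2 (p u)) \<and> plot D3 n W (\<lambda>u. f3 (p u))" if u: "u \<in> U" for u
  proof -
    from loc[OF u] obtain W where "u \<in> W" "W \<subseteq> U" "plot D n W p" by (elim exE conjE)
    then show ?thesis by (intro exI[of _ W]) (simp add: iff)
  qed
  show "plot D n U p" unfolding iff
  proof (intro conjI ballI)
    show "p u \<in> points D" if u: "u \<in> U" for u
    proof -
      from l[OF u] obtain W where "u \<in> W" "\<forall>u\<in>W. p u \<in> points D" by (elim exE conjE)
      then show ?thesis by blast
    qed
    show "plot D1 n U (\<lambda>u. f1 (p u))"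
    proof (rule diffeological_spaceD(6)[OF D1])
      fix u assume "u \<in> U"
      from l[OF this] show "\<exists>W. u \<in> W \<and> W \<subseteq> U \<and> plot D1 n W (\<lambda>u. f1 (p u))"
        by (elim exE conjE) (intro exI conjI)
    qed
    show "plot D2 n U (\<lambda>u. f2 (p u))"
    proof (rule diffeological_spaceD(6)[OF D2])
      fix u assume "u \<in> U"
      from l[OF this] show "\<exists>W. u \<in> W \<and> W \<subseteq> U \<and> plot D2 n W (\<lambda>u. f2 (p u))"
        by (elim exE conjE) (intro exI conjI)
    qed
    show "plot D3 n U (\<lambda>u. f3 (p u))"
    proof (rule diffeological_spaceD(6)[OF D3])
      fix u assume "u \<in> U"
      from l[OF this] show "\<exists>W. u \<in> W \<and> W \<subseteq> U \<and> plot D3 n W (\<lambda>u. f3 (p u))"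
        by (elim exE conjE) (intro exI conjI)
    qed
  qed
qed

lemma fibre_product_plot_iff:
  "plot (fibre_product D E f g) n U p \<longleftrightarrow> plot D n U (\<lambda>u. fst (p u)) \<and> plot E n U (\<lambda>u. snd (p u)) \<and>
     (\<forall>u\<in>U. f (fst (p u)) = g (snd (p u)))"
  by (simp add: fibre_product_def o_def)

lemma fibre_product_points:
  "z \<in> points (fibre_product D E f g) \<longleftrightarrow> fst z \<in> points D \<and> snd z \<in> points E \<and> f (fst z) = g (snd z)"
  by (auto simp: fibre_product_def)

lemma diffeological_space_fibre_product:
  assumes D: "diffeological_space D" and E: "diffeological_space E"
  shows "diffeological_space (fibre_product D E f g)"
proof (rule diffeological_space_initial[OF D E E, where ?f1.0 = fst and ?f2.0 = snd and ?f3.0 = snd])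
  show "plot (fibre_product D E f g) n U p \<longleftrightarrow> (\<forall>u\<in>U. p u \<in> points (fibre_product D E f g)) \<and>
      plot D n U (\<lambda>u. fst (p u)) \<and> plot E n U (\<lambda>u. snd (p u)) \<and> plot E n U (\<lambda>u. snd (p u))" for n U p
    using diffeological_spaceD(2)[OF D, of n U "\<lambda>u. fst (p u)"] diffeological_spaceD(2)[OF E, of n U
        "\<lambda>u. snd (p u)"]
    unfolding fibre_product_plot_iff fibre_product_points by auto
qed (simp add: fibre_product_points)

lemma quotient_plot_iff:
  "plot (quotient_diffeology D R) n U q \<longleftrightarrow> openin (Euclidean_space n) U \<and>
        (\<forall>u\<in>U. \<exists>W p. openin (Euclidean_space n) W \<and> u \<in> W \<and> W \<subseteq> U \<and>
           plot D n W p \<and> (\<forall>w\<in>W. q w = R `` {p w}))"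
  by (simp add: quotient_diffeology_def)

lemma quotient_points [simp]: "points (quotient_diffeology D R) = points D // R"
  by (simp add: quotient_diffeology_def)

lemma quotient_lift:
  assumes "plot (quotient_diffeology D R) n U q" "u \<in> U"
  obtains W p where "openin (Euclidean_space n) W" "u \<in> W" "W \<subseteq> U" "plot D n W p"
      "\<forall>w\<in>W. q w = R `` {p w}"
proof -
  have "\<exists>W p. openin (Euclidean_space n) W \<and> u \<in> W \<and> W \<subseteq> U \<and> plot D n W p \<and> (\<forall>w\<in>W. q w = R `` {p w})"
    using assms(1)[unfolded quotient_plot_iff, THEN conjunct2] assms(2) by (rule bspec)
  then show ?thesis using that by (elim exE conjE)
qed

lemma quotient_plotI:
  assumes "openin (Euclidean_space n) U"
    "\<And>u. u \<in> U \<Longrightarrow> \<exists>W p. openin (Euclidean_space n) W \<and> u \<in> W \<and> W \<subseteq> U \<and> plot D n W p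
        \<and> (\<forall>w\<in>W. q w = R `` {p w})"
  shows "plot (quotient_diffeology D R) n U q"
  unfolding quotient_plot_iff using assms by simp

lemma diffeological_space_quotient:
  assumes D: "diffeological_space D"
  shows "diffeological_space (quotient_diffeology D R)"
proof (rule diffeological_spaceI)
  fix n U q assume q: "plot (quotient_diffeology D R) n U q"
  show U: "openin (Euclidean_space n) U" using q by (simp add: quotient_plot_iff)
  show "q u \<in> points (quotient_diffeology D R)" if uU: "u \<in> U" for u
  proof -
    obtain W p where W: "openin (Euclidean_space n) W" "u \<in> W" "W \<subseteq> U" "plot D n W p"
        "\<forall>w\<in>W. q w = R `` {p w}"
      using quotient_lift[OF q uU] .
    then show ?thesis using diffeological_spaceD(2)[OF D W(4,2)] by (simp add: quotientI)
  qed
  show "plot (quotient_diffeology D R) n U q'" if e: "\<And>u. u \<in> U \<Longrightarrow> q u = q' u" for q'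
  proof (rule quotient_plotI[OF U])
    fix u assume u: "u \<in> U"
    obtain W p where W: "openin (Euclidean_space n) W" "u \<in> W" "W \<subseteq> U" "plot D n W p"
        "\<forall>w\<in>W. q w = R `` {p w}"
      using quotient_lift[OF q u] .
    then show "\<exists>W p. openin (Euclidean_space n) W \<and> u \<in> W \<and> W \<subseteq> U \<and> plot D n W p
        \<and> (\<forall>w\<in>W. q' w = R `` {p w})"
      using e by (intro exI[of _ W] exI[of _ p]) (auto simp: subset_iff)
  qed
  show "plot (quotient_diffeology D R) m V (\<lambda>v. q (f v))" if s: "smooth_cartesian m V n f" "f ` V \<subseteq> U"
      for m V f
  proof (rule quotient_plotI[OF smooth_cartesianD(1)[OF s(1)]])
    fix v assume v: "v \<in> V"
    then have "f v \<in> U" using s(2) by auto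
    obtain W p where W: "openin (Euclidean_space n) W" "f v \<in> W" "W \<subseteq> U" "plot D n W p"
        "\<forall>w\<in>W. q w = R `` {p w}"
      using quotient_lift[OF q \<open>f v \<in> U\<close>] .
    have W': "openin (Euclidean_space m) {v \<in> V. f v \<in> W}"
      by (rule openin_smooth_preimage[OF s(1) W(1)])
    have "plot D m {v \<in> V. f v \<in> W} (\<lambda>v. p (f v))"
      by (rule diffeological_spaceD(5)[OF D W(4) smooth_cartesian_mono[OF s(1) W']]) auto
    then show "\<exists>W p. openin (Euclidean_space m) W \<and> v \<in> W \<and> W \<subseteq> V \<and> plot D m W p
        \<and> (\<forall>w\<in>W. q (f w) = R `` {p w})"
      using W W' v by (intro exI[of _ "{v \<in> V. f v \<in> W}"] exI[of _ "\<lambda>v. p (f v)"]) simp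
  qed
next
  fix n U c assume U: "openin (Euclidean_space n) U" and c: "c \<in> points (quotient_diffeology D R)"
  then obtain x where x: "x \<in> points D" "c = R `` {x}" by (auto elim: quotientE)
  show "plot (quotient_diffeology D R) n U (\<lambda>_. c)"
    by (rule quotient_plotI[OF U])
      (intro exI[of _ U] exI[of _ "\<lambda>_. x"], use U x diffeological_spaceD(4)[OF D U x(1)] in simp)
next
  fix n U q assume U: "openin (Euclidean_space n) U"
    and loc: "\<And>u. u \<in> U \<Longrightarrow> \<exists>W. openin (Euclidean_space n) W \<and> u \<in> W \<and> W \<subseteq> U
        \<and> plot (quotient_diffeology D R) n W q"
  show "plot (quotient_diffeology D R) n U q"
  proof (rule quotient_plotI[OF U])
    fix u assume "u \<in> U"
    from loc[OF this] obtain V where V: "u \<in> V" "V \<subseteq> U" "plot (quotient_diffeology D R) n V q"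
      by (elim exE conjE)
    obtain W p where "openin (Euclidean_space n) W" "u \<in> W" "W \<subseteq> V" "plot D n W p"
        "\<forall>w\<in>W. q w = R `` {p w}"
      using quotient_lift[OF V(3,1)] .
    then show "\<exists>W p. openin (Euclidean_space n) W \<and> u \<in> W \<and> W \<subseteq> U \<and> plot D n W p
        \<and> (\<forall>w\<in>W. q w = R `` {p w})"
      using V(2) by (intro exI[of _ W] exI[of _ p]) simp
  qed
qed

section \<open>The defect of multiplicativity\<close>

definition pscale :: "real \<Rightarrow> 'x tvec \<times> 'y tvec \<Rightarrow> 'x tvec \<times> 'y tvec" where
  "pscale c e = (tscale c (fst e), tscale c (snd e))"

lemma pscale_simps:
  "pscale c (d + e) = pscale c d + pscale c e" "pscale (a + b) e = pscale a e + pscale b e"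
  "pscale a (pscale b e) = pscale (a * b) e" "pscale 1 e = e" "pscale (- 1) e = - e" "pscale c 0 = 0"
  by (auto simp: pscale_def tscale_def fun_eq_iff prod_eq_iff algebra_simps)

locale adjoint_setting = groupoid_with_connection G H
  for G :: "('o, 'a) lie_groupoid" and H +
  fixes B :: "('p, 'm, 'o, 'a) principal_bundle_data"
  assumes principal: "principal_bundle G B"
begin

abbreviation P where "P \<equiv> mpoints (total B)"
abbreviation An where "An \<equiv> anchor B"

abbreviation Ac where "Ac \<equiv> act B"
abbreviation pr where "pr \<equiv> proj B"

lemma TB: "smooth_manifold (total B)" and BB: "smooth_manifold (base B)"
  and pr_sub: "submersion (total B) (base B) pr" and pr_surj: "pr ` P = mpoints (base B)"
  and An_smooth: "dsmooth (mdiff (total B)) (mdiff M) An"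
  and Ac_smooth: "dsmooth (fibre_product (mdiff (total B)) (mdiff A) An Tg) (mdiff (total B)) (\<lambda>(p, g).
      Ac p g)"
  and Ac_ax: "\<forall>p\<in>P. \<forall>g\<in>arrs G. An p = Tg g \<longrightarrow>
        An (Ac p g) = Sc g \<and> pr (Ac p g) = pr p \<and>
        (\<forall>h\<in>arrs G. Sc g = Tg h \<longrightarrow> Ac (Ac p g) h = Ac p (Mu g h))"
  and Ac_one_ax: "\<forall>p\<in>P. Ac p (One (An p)) = p"
  and Ac_diff: "diffeomorphism (fibre_product (mdiff (total B)) (mdiff A) An Tg)
       (fibre_product (mdiff (total B)) (mdiff (total B)) pr pr) (\<lambda>(p, g). (p, Ac p g))"
  using principal by (simp_all add: principal_bundle_def)

lemma pr_smooth: "dsmooth (mdiff (total B)) (mdiff (base B)) pr" by (rule submersionD(1)[OF pr_sub])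

lemma act_simps [simp]:
  "p \<in> P \<Longrightarrow> An p \<in> objs G" "p \<in> P \<Longrightarrow> pr p \<in> mpoints (base B)" "p \<in> P \<Longrightarrow> An p = x \<Longrightarrow> Ac p (One x) = p"
  "p \<in> P \<Longrightarrow> g \<in> arrs G \<Longrightarrow> An p = Tg g \<Longrightarrow> Ac p g \<in> P"
  "p \<in> P \<Longrightarrow> g \<in> arrs G \<Longrightarrow> An p = Tg g \<Longrightarrow> An (Ac p g) = Sc g"
  "p \<in> P \<Longrightarrow> g \<in> arrs G \<Longrightarrow> An p = Tg g \<Longrightarrow> pr (Ac p g) = pr p"
  "p \<in> P \<Longrightarrow> g \<in> arrs G \<Longrightarrow> An p = Tg g \<Longrightarrow> h \<in> arrs G \<Longrightarrow> Sc g = Tg h \<Longrightarrow> Ac (Ac p g) h = Ac p (Mu g h)"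
proof -
  show "p \<in> P \<Longrightarrow> An p \<in> objs G" using dsmoothD(1)[OF An_smooth] by simp
  show "p \<in> P \<Longrightarrow> pr p \<in> mpoints (base B)" using pr_surj by blast
  show "p \<in> P \<Longrightarrow> An p = x \<Longrightarrow> Ac p (One x) = p" using Ac_one_ax by blast
  show "p \<in> P \<Longrightarrow> g \<in> arrs G \<Longrightarrow> An p = Tg g \<Longrightarrow> Ac p g \<in> P"
    using dsmoothD(1)[OF Ac_smooth, of "(p, g)"] by (simp add: fibre_product_points)
qed (use Ac_ax in simp_all)

text \<open>Bijectivity of \<open>(p, g) \<mapsto> (p, p g)\<close>.\<close>

lemma translation_unique:
  assumes "p \<in> P" "q \<in> P" "pr p = pr q"
  shows "\<exists>!g. g \<in> arrs G \<and> An p = Tg g \<and> q = Ac p g"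
proof -
  have b: "bij_betw (\<lambda>(p, g). (p, Ac p g)) (points (fibre_product (mdiff (total B)) (mdiff A) An Tg))
       (points (fibre_product (mdiff (total B)) (mdiff (total B)) pr pr))"
    using Ac_diff by (simp add: diffeomorphism_def)
  have "(p, q) \<in> points (fibre_product (mdiff (total B)) (mdiff (total B)) pr pr)"
    using assms by (simp add: fibre_product_points)
  then have "(p, q) \<in> (\<lambda>(p, g). (p, Ac p g)) ` points (fibre_product (mdiff (total B)) (mdiff A) An Tg)"
    using b by (simp add: bij_betw_def)
  then obtain g where g: "g \<in> arrs G" "An p = Tg g" "q = Ac p g"
    by (auto simp: fibre_product_points)
  show ?thesis
  proof (rule ex1I[of _ g])
    fix h assume h: "h \<in> arrs G \<and> An p = Tg h \<and> q = Ac p h"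
    have "(p, h) = (p, g)"
      by (rule inj_onD[OF bij_betw_imp_inj_on[OF b]]) (use g h assms in \<open>auto simp:
          fibre_product_points\<close>)
    then show "h = g" by simp
  qed (use g in simp)
qed

lemma free: "p \<in> P \<Longrightarrow> g \<in> arrs G \<Longrightarrow> An p = Tg g \<Longrightarrow> Ac p g = p \<Longrightarrow> g = One (An p)"
  using translation_unique[of p p] by (metis act_simps(1,3) gr_simps(3,5))

definition fibre :: "'o \<Rightarrow> ('a tvec \<times> 'o tvec) set" where
  "fibre x = alg_fibre G x \<times> TM x"

definition lam :: "'a \<Rightarrow> 'a tvec \<times> 'o tvec \<Rightarrow> 'a tvec \<times> 'o tvec" where
  "lam g e = (lam0 G H g (fst e), lam1 G H g (snd e))"

lemma fibre_linear:
  "x \<in> objs G \<Longrightarrow> 0 \<in> fibre x" "d \<in> fibre x \<Longrightarrow> e \<in> fibre x \<Longrightarrow> d + e \<in> fibre x" "e \<in> fibre x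
      \<Longrightarrow> pscale c e \<in> fibre x"
  "e \<in> fibre x \<Longrightarrow> - e \<in> fibre x" "d \<in> fibre x \<Longrightarrow> e \<in> fibre x \<Longrightarrow> d - e \<in> fibre x"
proof -
  show "x \<in> objs G \<Longrightarrow> 0 \<in> fibre x"
    by (simp add: fibre_def alg_fibre_def ker_dsrc_linear(1) tangent_zero[OF M] mem_Times_iff)
  show a: "d \<in> fibre x \<Longrightarrow> e \<in> fibre x \<Longrightarrow> d + e \<in> fibre x" for d e
    by (simp add: fibre_def alg_fibre_def ker_dsrc_linear(2) tangent_add[OF M] mem_Times_iff)
  show s: "e \<in> fibre x \<Longrightarrow> pscale c e \<in> fibre x" for c e
    by (simp add: fibre_def pscale_def alg_fibre_def ker_dsrc_linear(3) tangent_scale[OF M]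
        mem_Times_iff)
  show u: "e \<in> fibre x \<Longrightarrow> - e \<in> fibre x" for e using s[of e "-1"] by (simp add: pscale_simps)
  show "d \<in> fibre x \<Longrightarrow> e \<in> fibre x \<Longrightarrow> d - e \<in> fibre x" using a[of d "- e"] u by simp
qed

lemma lam_linear:
  assumes g: "g \<in> arrs G"
  shows "e \<in> fibre (Sc g) \<Longrightarrow> lam g e \<in> fibre (Tg g)"
    "d \<in> fibre (Sc g) \<Longrightarrow> e \<in> fibre (Sc g) \<Longrightarrow> lam g (d + e) = lam g d + lam g e"
    "e \<in> fibre (Sc g) \<Longrightarrow> lam g (pscale c e) = pscale c (lam g e)"
    "e \<in> fibre (Sc g) \<Longrightarrow> lam g (- e) = - lam g e"
    "d \<in> fibre (Sc g) \<Longrightarrow> e \<in> fibre (Sc g) \<Longrightarrow> lam g (d - e) = lam g d - lam g e"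
    "lam g 0 = 0"
proof -
  show "e \<in> fibre (Sc g) \<Longrightarrow> lam g e \<in> fibre (Tg g)"
    by (simp add: fibre_def lam_def mem_Times_iff lam0_linear[OF g] lam1_linear[OF g])
  show a: "d \<in> fibre (Sc g) \<Longrightarrow> e \<in> fibre (Sc g) \<Longrightarrow> lam g (d + e) = lam g d + lam g e" for d e
    by (simp add: fibre_def lam_def mem_Times_iff lam0_linear[OF g] lam1_linear[OF g])
  show s: "e \<in> fibre (Sc g) \<Longrightarrow> lam g (pscale c e) = pscale c (lam g e)" for c e
    by (simp add: fibre_def lam_def pscale_def mem_Times_iff lam0_linear[OF g] lam1_linear[OF g])
  show u: "e \<in> fibre (Sc g) \<Longrightarrow> lam g (- e) = - lam g e" for e using s[of e "-1"]
    by (simp add: pscale_simps)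
  show "d \<in> fibre (Sc g) \<Longrightarrow> e \<in> fibre (Sc g) \<Longrightarrow> lam g (d - e) = lam g d - lam g e"
    using a[of d "- e"] u fibre_linear(4) by simp
  have "(0 :: 'a tvec \<times> 'o tvec) = pscale 0 0" by (simp add: pscale_simps)
  moreover have "pscale 0 e = 0" for e :: "'a tvec \<times> 'o tvec"
    by (auto simp: pscale_def tscale_def prod_eq_iff fun_eq_iff)
  ultimately show "lam g 0 = 0" using s[OF fibre_linear(1), of 0] g by (simp del: zero_prod_def) 
qed

lemma lam_unit: "x \<in> objs G \<Longrightarrow> e \<in> fibre x \<Longrightarrow> lam (One x) e = e"
  by (simp add: lam_def fibre_def mem_Times_iff lam0_unit lam1_unit)

definition defect :: "'a \<Rightarrow> 'a \<Rightarrow> 'a tvec \<times> 'o tvec \<Rightarrow> 'a tvec \<times> 'o tvec" where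
  "defect g h e = lam (Mu (Inv h) (Inv g)) e - lam (Inv h) (lam (Inv g) e)"

text \<open>
Finite sums of defects at \<open>p\<close>. They form a subspace because a multiple of a defect is again a
defect.
\<close>

inductive_set defect_span :: "'p \<Rightarrow> ('a tvec \<times> 'o tvec) set" for p where
  zero: "0 \<in> defect_span p"
| step: "d \<in> defect_span p \<Longrightarrow> q \<in> P \<Longrightarrow> g \<in> arrs G \<Longrightarrow> h \<in> arrs G \<Longrightarrow> An q = Tg g \<Longrightarrow> Sc g = Tg h \<Longrightarrow>
     e \<in> fibre (An q) \<Longrightarrow> p = Ac (Ac q g) h \<Longrightarrow> d + defect g h e \<in> defect_span p"

lemma defect_in_span:
  "q \<in> P \<Longrightarrow> g \<in> arrs G \<Longrightarrow> h \<in> arrs G \<Longrightarrow> An q = Tg g \<Longrightarrow> Sc g = Tg h \<Longrightarrow>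
     e \<in> fibre (An q) \<Longrightarrow> p = Ac (Ac q g) h \<Longrightarrow> defect g h e \<in> defect_span p"
  using defect_span.step[OF defect_span.zero] by simp

lemma defect_fibre:
  assumes "g \<in> arrs G" "h \<in> arrs G" "Sc g = Tg h" "e \<in> fibre (Tg g)"
  shows "defect g h e \<in> fibre (Sc h)"
  unfolding defect_def
  by (rule fibre_linear(5))
    (use assms lam_linear(1)[of "Mu (Inv h) (Inv g)" e] lam_linear(1)[of "Inv h" "lam (Inv g) e"]
      lam_linear(1)[of "Inv g" e] in simp_all)

lemma defect_scale:
  assumes "g \<in> arrs G" "h \<in> arrs G" "Sc g = Tg h" "e \<in> fibre (Tg g)"
  shows "pscale c (defect g h e) = defect g h (pscale c e)"
proof -
  have "pscale c (x - y) = pscale c x - pscale c y" for x y :: "'a tvec \<times> 'o tvec"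
    by (auto simp: pscale_def tscale_def prod_eq_iff fun_eq_iff right_diff_distrib)
  then show ?thesis
    unfolding defect_def
    using assms lam_linear(3)[of "Mu (Inv h) (Inv g)" e c] lam_linear(3)[of "Inv h" "lam (Inv g) e" c]
      lam_linear(1,3)[of "Inv g" e] by simp
qed

lemma defect_span_add: "d' \<in> defect_span p \<Longrightarrow> d \<in> defect_span p \<Longrightarrow> d + d' \<in> defect_span p"
proof (induction rule: defect_span.induct)
  case (step d' q g h e)
  then show ?case using defect_span.step[of "d + d'" p q g h e] by (simp add: add.assoc)
qed simp

lemma defect_span_scale: "d \<in> defect_span p \<Longrightarrow> pscale c d \<in> defect_span p"
proof (induction rule: defect_span.induct)
  case (step d q g h e)
  then show ?case using defect_span.step[of "pscale c d" p q g h "pscale c e"]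
    by (simp add: pscale_simps(1) defect_scale fibre_linear(3))
qed (simp only: pscale_simps defect_span.zero)

lemma defect_span_uminus: "d \<in> defect_span p \<Longrightarrow> - d \<in> defect_span p"
  using defect_span_scale[of d p "-1"] by (simp only: pscale_simps)

lemma defect_span_diff: "d \<in> defect_span p \<Longrightarrow> d' \<in> defect_span p \<Longrightarrow> d - d' \<in> defect_span p"
  using defect_span_add[OF defect_span_uminus, of d' p d] by simp

lemma defect_span_fibre: "d \<in> defect_span p \<Longrightarrow> p \<in> P \<Longrightarrow> d \<in> fibre (An p)"
proof (induction rule: defect_span.induct)
  case (step d q g h e)
  then show ?case using defect_fibre[of g h e] by (simp add: fibre_linear(2))
qed (simp add: fibre_linear(1))

text \<open>
The vector with one component replaced by zero has the defect with that component replaced by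
zero.
\<close>

lemma defect_span_split: "d \<in> defect_span p \<Longrightarrow> (fst d, 0) \<in> defect_span p"
proof (induction rule: defect_span.induct)
  case (step d q g h e)
  have l0: "lam1 G H k 0 = 0" if "k \<in> arrs G" for k using lam_linear(6)[OF that]
    by (simp add: lam_def prod_eq_iff)
  have "(fst e, 0) \<in> fibre (An q)" using step fibre_linear(1)[of "An q"]
    by (simp add: fibre_def mem_Times_iff)
  moreover have "defect g h (fst e, 0) = (fst (defect g h e), 0)"
    using step l0[of "Mu (Inv h) (Inv g)"] l0[of "Inv h"] l0[of "Inv g"]
      by (simp add: defect_def lam_def)
  moreover have "(fst (d + defect g h e), 0 :: 'o tvec) = (fst d, 0) + (fst (defect g h e), 0)"
    by (simp add: prod_eq_iff)
  ultimately show ?case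
    using defect_span.step[OF step.IH step.hyps(2-6) _ step.hyps(8), of "(fst e, 0)"] by (simp only:)
qed (use defect_span.zero in \<open>simp only: fst_zero zero_prod_def[symmetric]\<close>)

text \<open>
For \<open>p = q g h\<close> and \<open>c (g, h) e\<close> the defect, the cocycle identity is \<open>\<lambda> (k\<^sup>-\<^sup>1) (c (g, h) e) = c
(g, h k) e - c (g h, k) e + c (h, k) (\<lambda> (g\<^sup>-\<^sup>1) e)\<close>. All defects on the right belong to
factorisations of \<open>p k\<close>.
\<close>

lemma defect_span_move: "d \<in> defect_span p \<Longrightarrow> p \<in> P \<Longrightarrow> k \<in> arrs G \<Longrightarrow> An p = Tg k
    \<Longrightarrow> lam (Inv k) d \<in> defect_span (Ac p k)"
proof (induction rule: defect_span.induct)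
  case (step d q g h e)
  have gh: "Sc h = Tg k" using step by simp
  note s = step.hyps and k = step.prems
  have e: "e \<in> fibre (Tg g)" using s by simp
  have i: "Inv (Mu g h) = Mu (Inv h) (Inv g)" "Inv (Mu h k) = Mu (Inv k) (Inv h)"
    "Mu (Inv k) (Mu (Inv h) (Inv g)) = Mu (Mu (Inv k) (Inv h)) (Inv g)"
    using s k gh by (simp_all add: inv_cmp gr_assoc)
  have le: "lam (Inv g) e \<in> fibre (Sc g)" using lam_linear(1)[of "Inv g" e] s e by simp
  have l1: "lam (Mu (Inv h) (Inv g)) e \<in> fibre (Sc h)"
    using lam_linear(1)[of "Mu (Inv h) (Inv g)" e] s e by simp
  have l2: "lam (Inv h) (lam (Inv g) e) \<in> fibre (Sc h)" using lam_linear(1)[of "Inv h"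
      "lam (Inv g) e"] s le by simp
  have "lam (Inv k) (defect g h e) = lam (Inv k) (lam (Mu (Inv h) (Inv g)) e) - lam (Inv k) (lam (Inv h)
      (lam (Inv g) e))"
    unfolding defect_def using lam_linear(5)[of "Inv k"] k gh l1 l2 by simp
  also have "\<dots> = - defect (Mu g h) k e + defect g (Mu h k) e + defect h k (lam (Inv g) e)"
    unfolding defect_def i by simp
  finally have eq: "lam (Inv k) (defect g h e) = - defect (Mu g h) k e + defect g (Mu h k) e + defect h
      k (lam (Inv g) e)" .
  have pk: "Ac p k = Ac (Ac q (Mu g h)) k" "Ac p k = Ac (Ac q g) (Mu h k)"
      "Ac p k = Ac (Ac (Ac q g) h) k"
    using s k gh by (simp_all add: gr_assoc)
  have "defect (Mu g h) k e \<in> defect_span (Ac p k)"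
    by (rule defect_in_span[OF s(2) _ k(2) _ _ _ pk(1)]) (use s gh in simp_all)
  moreover have "defect g (Mu h k) e \<in> defect_span (Ac p k)"
    by (rule defect_in_span[OF s(2) _ _ _ _ _ pk(2)]) (use s gh k in simp_all)
  moreover have "defect h k (lam (Inv g) e) \<in> defect_span (Ac p k)"
    by (rule defect_in_span[OF _ _ _ _ _ _ pk(3)]) (use s gh k le in simp_all)
  ultimately have "lam (Inv k) (defect g h e) \<in> defect_span (Ac p k)" unfolding eq
    by (intro defect_span_add defect_span_uminus)
  moreover have "lam (Inv k) (d + defect g h e) = lam (Inv k) d + lam (Inv k) (defect g h e)"
    using lam_linear(2)[of "Inv k" d "defect g h e"] defect_span_fibre[OF s(1) k(1)] defect_fibre[OF
        s(3,4,6) e] k gh by simp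
  ultimately show ?case using step.IH[OF k] by (simp add: defect_span_add)
qed (simp add: lam_linear(6) defect_span.zero del: zero_prod_def)

section \<open>The adjoint groupoid\<close>

abbreviation T where "T \<equiv> ad_total G B"
abbreviation cls where "cls \<equiv> ad_class G H B"

lemma T_points: "(p, e) \<in> points T \<longleftrightarrow> p \<in> P \<and> e \<in> fibre (An p)"
  by (cases e) (auto simp: ad_total_def fibre_def)

text \<open>
The data over which \<open>ad_rel\<close> quantifies. Both of its sums run over the same arrows, so that the
pair of them is one sum of defects.
\<close>

definition representation :: "'p \<Rightarrow> nat \<Rightarrow> (nat \<Rightarrow> 'p) \<Rightarrow> (nat \<Rightarrow> 'a) \<Rightarrow> (nat \<Rightarrow> 'a) \<Rightarrow>
    (nat \<Rightarrow> 'a tvec) \<Rightarrow> (nat \<Rightarrow> 'o tvec) \<Rightarrow> bool" where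
  "representation p n ps gs hs as vs \<longleftrightarrow>
     (\<forall>i\<in>{1..n}. ps i \<in> P \<and> gs i \<in> arrs G \<and> hs i \<in> arrs G \<and>
           An (ps i) = Tg (gs i) \<and> Sc (gs i) = Tg (hs i) \<and>
           as i \<in> alg_fibre G (An (ps i)) \<and> vs i \<in> TM (An (ps i)) \<and>
           p = Ac (Ac (ps i) (gs i)) (hs i))"

lemma defect_span_representation:
  "d \<in> defect_span p \<longleftrightarrow> (\<exists>(n :: nat) ps gs hs as vs. representation p n ps gs hs as vs \<and>
     d = (\<Sum>i = 1..n. defect (gs i) (hs i) (as i, vs i)))"
proof
  show "d \<in> defect_span p \<Longrightarrow> \<exists>(n :: nat) ps gs hs as vs. representation p n ps gs hs as vs \<and>
     d = (\<Sum>i = 1..n. defect (gs i) (hs i) (as i, vs i))"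
  proof (induction rule: defect_span.induct)
    case zero
    have r: "representation p 0 ps gs hs as vs" for ps gs hs as vs by (simp add: representation_def)
    show ?case by (rule exI[of _ "0 :: nat"], intro exI conjI, rule r) simp
  next
    case (step d q g h e)
    then obtain n :: nat and ps gs hs as vs where r: "representation p n ps gs hs as vs"
      "d = (\<Sum>i = 1..n. defect (gs i) (hs i) (as i, vs i))" by (elim exE conjE)
    let ?n = "Suc n"
    have "representation p ?n (ps(?n := q)) (gs(?n := g)) (hs(?n := h)) (as(?n := fst e)) (vs(?n := snd
        e))"
      unfolding representation_def
    proof
      fix i assume i: "i \<in> {1..?n}"
      show "(ps(?n := q)) i \<in> P \<and> (gs(?n := g)) i \<in> arrs G \<and> (hs(?n := h)) i \<in> arrs G \<and>
           An ((ps(?n := q)) i) = Tg ((gs(?n := g)) i) \<and> Sc ((gs(?n := g)) i) = Tg ((hs(?n := h)) i) \<and>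
           (as(?n := fst e)) i \<in> alg_fibre G (An ((ps(?n := q)) i)) \<and>
           (vs(?n := snd e)) i \<in> TM (An ((ps(?n := q)) i)) \<and>
           p = Ac (Ac ((ps(?n := q)) i) ((gs(?n := g)) i)) ((hs(?n := h)) i)"
      proof (cases "i = ?n")
        case True
        then show ?thesis using step.hyps by (simp add: fibre_def mem_Times_iff)
      next
        case False
        then have "i \<in> {1..n}" using i by simp
        then show ?thesis
          unfolding fun_upd_other[OF False] by (rule r(1)[unfolded representation_def, rule_format])
      qed
    qed
    moreover have "d + defect g h e = (\<Sum>i = 1..?n. defect ((gs(?n := g)) i) ((hs(?n := h)) i)
        ((as(?n := fst e)) i, (vs(?n := snd e)) i))"
      by (simp add: r(2))
    ultimately show ?case by (intro exI conjI)
  qed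
next
  assume "\<exists>(n :: nat) ps gs hs as vs. representation p n ps gs hs as vs \<and>
     d = (\<Sum>i = 1..n. defect (gs i) (hs i) (as i, vs i))"
  then obtain n :: nat and ps gs hs as vs where r: "representation p n ps gs hs as vs"
      "d = (\<Sum>i = 1..n. defect (gs i) (hs i) (as i, vs i))" by (elim exE conjE)
  have "(\<Sum>i = 1..k. defect (gs i) (hs i) (as i, vs i)) \<in> defect_span p" if "k \<le> n" for k
    using that
  proof (induction k)
    case 0
    then show ?case using defect_span.zero by simp
  next
    case (Suc k)
    have i: "Suc k \<in> {1..n}" using Suc by simp
    have "(\<Sum>i = 1..k. defect (gs i) (hs i) (as i, vs i)) + defect (gs (Suc k)) (hs (Suc k)) (as (Suc k),
        vs (Suc k)) \<in> defect_span p"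
      by (rule defect_span.step[where q = "ps (Suc k)"])
        (use Suc r(1)[unfolded representation_def, rule_format, OF i] in \<open>auto simp: fibre_def\<close>)
    then show ?case by simp
  qed
  then show "d \<in> defect_span p" using r(2) by simp
qed

lemma fst_sum: "fst (\<Sum>i\<in>I. f i) = (\<Sum>i\<in>I. fst (f i))" and snd_sum: "snd (\<Sum>i\<in>I. f i) = (\<Sum>i\<in>I. snd (f i))"
  by (induction I rule: infinite_finite_induct) auto

lemma ad_rel_iff:
  "((p, e), (p', e')) \<in> ad_rel G H B \<longleftrightarrow> p \<in> P \<and> e \<in> fibre (An p) \<and> e' \<in> fibre (An p) \<and> p' = p
      \<and> e - e' \<in> defect_span p"
proof -
  obtain \<alpha> v where e: "e = (\<alpha>, v)" by (cases e)
  obtain \<alpha>' v' where e': "e' = (\<alpha>', v')" by (cases e')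
  have 1: "e - e' \<in> defect_span p \<longleftrightarrow> (\<exists>(n :: nat) ps gs hs as vs. representation p n ps gs hs as vs \<and>
     \<alpha> - \<alpha>' = (\<Sum>i = 1..n. lam0 G H (Mu (Inv (hs i)) (Inv (gs i))) (as i)
                             - lam0 G H (Inv (hs i)) (lam0 G H (Inv (gs i)) (as i))) \<and>
     v - v' = (\<Sum>i = 1..n. lam1 G H (Mu (Inv (hs i)) (Inv (gs i))) (vs i)
                             - lam1 G H (Inv (hs i)) (lam1 G H (Inv (gs i)) (vs i))))"
    unfolding defect_span_representation
    by (simp add: prod_eq_iff e e' fst_sum snd_sum defect_def lam_def)
  have 2: "((p, e), (p', e')) \<in> ad_rel G H B \<longleftrightarrow> (p, e) \<in> points T \<and> (p', e') \<in> points T \<and> p = p'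
      \<and> e - e' \<in> defect_span p"
    unfolding 1 representation_def unfolding e e' ad_rel_def by simp
  show ?thesis unfolding 2 T_points by auto
qed

lemma equiv_ad_rel: "equiv (points T) (ad_rel G H B)"
proof (rule equivI)
  show "ad_rel G H B \<subseteq> points T \<times> points T"
    by (auto simp: ad_rel_def)
  show "refl_on (points T) (ad_rel G H B)"
    by (rule refl_onI) (auto simp: ad_rel_iff T_points defect_span.zero)
  show "sym (ad_rel G H B)"
  proof (rule symI)
    fix x y assume "(x, y) \<in> ad_rel G H B"
    then show "(y, x) \<in> ad_rel G H B"
      using defect_span_uminus[of "snd x - snd y" "fst x"] by (cases x; cases y) (auto simp: ad_rel_iff)
  qed
  show "trans (ad_rel G H B)"
  proof (rule transI)
    fix x y z assume "(x, y) \<in> ad_rel G H B" "(y, z) \<in> ad_rel G H B"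
    then show "(x, z) \<in> ad_rel G H B"
      using defect_span_add[of "snd y - snd z" "fst x" "snd x - snd y"]
        by (cases x; cases y; cases z) (auto simp: ad_rel_iff)
  qed
qed

lemma cls_eq_iff:
  assumes "p \<in> P" "e \<in> fibre (An p)" "p' \<in> P" "e' \<in> fibre (An p')"
  shows "cls (p, e) = cls (p', e') \<longleftrightarrow> p' = p \<and> e - e' \<in> defect_span p"
  unfolding ad_class_def
  using eq_equiv_class_iff[OF equiv_ad_rel, of "(p, e)" "(p', e')"] assms
    by (auto simp: T_points ad_rel_iff)

lemma cls_obj: "p \<in> P \<Longrightarrow> e \<in> fibre (An p) \<Longrightarrow> cls (p, e) \<in> points (ad_objects G H B)"
  by (simp add: ad_objects_def ad_class_def quotientI T_points)

lemma objE:
  assumes "c \<in> points (ad_objects G H B)"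
  obtains p e where "p \<in> P" "e \<in> fibre (An p)" "c = cls (p, e)"
proof -
  have "c \<in> points T // ad_rel G H B" using assms by (simp add: ad_objects_def)
  then obtain x where "x \<in> points T" "c = ad_rel G H B `` {x}" by (rule quotientE)
  then show ?thesis using that[of "fst x" "snd x"] T_points[of "fst x" "snd x"]
    by (simp add: ad_class_def)
qed

abbreviation foot where "foot \<equiv> ad_foot G H B"
abbreviation move where "move \<equiv> ad_move G H B"

lemma foot_cls [simp]:
  assumes "p \<in> P" "e \<in> fibre (An p)"
  shows "foot (cls (p, e)) = p"
  unfolding ad_foot_def
proof (rule the_equality)
  show "\<exists>\<alpha> v. (p, \<alpha>, v) \<in> points T \<and> cls (p, e) = cls (p, \<alpha>, v)"
    using assms by (intro exI[of _ "fst e"] exI[of _ "snd e"]) (simp add: T_points)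
  fix q assume "\<exists>\<alpha> v. (q, \<alpha>, v) \<in> points T \<and> cls (p, e) = cls (q, \<alpha>, v)"
  then show "q = p" using cls_eq_iff[OF assms] by (auto simp: T_points)
qed

lemma lam_fibre:
  assumes "g \<in> arrs G" "e \<in> fibre (Tg g)"
  shows "lam (Inv g) e \<in> fibre (Sc g)"
  using lam_linear(1)[of "Inv g" e] assms by simp

text \<open>
The definite description is meaningful by \<open>defect_span_move\<close> and the linearity of the transport.
\<close>

lemma move_cls:
  assumes p: "p \<in> P" "e \<in> fibre (An p)" and g: "g \<in> arrs G" "An p = Tg g"
  shows "move (cls (p, e)) g = cls (Ac p g, lam (Inv g) e)"
  unfolding ad_move_def
proof (rule the_equality)
  show "\<exists>q \<alpha> v. (q, \<alpha>, v) \<in> points T \<and> cls (p, e) = cls (q, \<alpha>, v) \<and>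
     cls (Ac p g, lam (Inv g) e) = cls (Ac q g, lam0 G H (Inv g) \<alpha>, lam1 G H (Inv g) v)"
    using p by (intro exI[of _ p] exI[of _ "fst e"] exI[of _ "snd e"]) (simp add: T_points lam_def)
  fix d assume "\<exists>q \<alpha> v. (q, \<alpha>, v) \<in> points T \<and> cls (p, e) = cls (q, \<alpha>, v) \<and>
     d = cls (Ac q g, lam0 G H (Inv g) \<alpha>, lam1 G H (Inv g) v)"
  then obtain q e' where q: "q \<in> P" "e' \<in> fibre (An q)" "cls (p, e) = cls (q, e')"
      "d = cls (Ac q g, lam (Inv g) e')"
    by (auto simp: T_points lam_def)
  have qp: "q = p" "e - e' \<in> defect_span p" using cls_eq_iff[OF p q(1,2)] q(3) by auto
  have e: "e \<in> fibre (Tg g)" "e' \<in> fibre (Tg g)" using p q qp g by auto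
  have "lam (Inv g) e - lam (Inv g) e' \<in> defect_span (Ac p g)"
    using defect_span_move[OF qp(2) p(1) g] lam_linear(5)[of "Inv g" e e'] g e by simp
  then have "cls (Ac p g, lam (Inv g) e) = cls (Ac p g, lam (Inv g) e')"
    using cls_eq_iff[of "Ac p g" "lam (Inv g) e" "Ac p g" "lam (Inv g) e'"] p g lam_fibre[OF g(1)] e
      by simp
  then show "d = cls (Ac p g, lam (Inv g) e)" using q qp by simp
qed

lemma move_obj:
  assumes "c \<in> points (ad_objects G H B)" "g \<in> arrs G" "An (foot c) = Tg g"
  shows "move c g \<in> points (ad_objects G H B)" "foot (move c g) = Ac (foot c) g"
proof -
  obtain p e where c: "p \<in> P" "e \<in> fibre (An p)" "c = cls (p, e)" using objE[OF assms(1)] .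
  then have g: "An p = Tg g" using assms(3) by simp
  then have "Ac p g \<in> P" "lam (Inv g) e \<in> fibre (An (Ac p g))" using c assms lam_fibre[OF assms(2)]
    by auto
  then show "move c g \<in> points (ad_objects G H B)" "foot (move c g) = Ac (foot c) g"
    using move_cls[OF c(1,2) assms(2) g] c cls_obj by auto
qed

lemma foot_in: "c \<in> points (ad_objects G H B) \<Longrightarrow> foot c \<in> P"
  by (erule objE) simp

text \<open>The two sides differ by the defect of \<open>(g, h)\<close>.\<close>

lemma move_move:
  assumes "c \<in> points (ad_objects G H B)" "g \<in> arrs G" "An (foot c) = Tg g" "h \<in> arrs G" "Sc g = Tg h"
  shows "move (move c g) h = move c (Mu g h)"
proof -
  obtain p e where c: "p \<in> P" "e \<in> fibre (An p)" "c = cls (p, e)" using objE[OF assms(1)] .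
  then have g: "An p = Tg g" using assms(3) by simp
  have e: "e \<in> fibre (Tg g)" using c g by simp
  have lg: "lam (Inv g) e \<in> fibre (Sc g)" by (rule lam_fibre[OF assms(2) e])
  have lh: "lam (Inv h) (lam (Inv g) e) \<in> fibre (Sc h)" using lam_fibre[OF assms(4)] lg assms(5) by simp
  have lgh: "lam (Inv (Mu g h)) e \<in> fibre (Sc h)" using lam_fibre[of "Mu g h" e] assms e by simp
  have "lam (Inv (Mu g h)) e - lam (Inv h) (lam (Inv g) e) \<in> defect_span (Ac p (Mu g h))"
    using defect_in_span[OF c(1) assms(2,4) g assms(5) c(2) refl] assms c g
      by (simp add: defect_def inv_cmp)
  then have "cls (Ac p (Mu g h), lam (Inv (Mu g h)) e) = cls (Ac p (Mu g h), lam (Inv h) (lam (Inv g)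
      e))"
    using cls_eq_iff[of "Ac p (Mu g h)" "lam (Inv (Mu g h)) e" "Ac p (Mu g h)"
        "lam (Inv h) (lam (Inv g) e)"]
      c g assms lh lgh by simp
  moreover have "move c g = cls (Ac p g, lam (Inv g) e)" using move_cls[OF c(1,2) assms(2) g] c by simp
  moreover have "move (cls (Ac p g, lam (Inv g) e)) h = cls (Ac (Ac p g) h, lam (Inv h) (lam (Inv g)
      e))"
    by (rule move_cls) (use c g assms lg in simp_all)
  moreover have "move c (Mu g h) = cls (Ac p (Mu g h), lam (Inv (Mu g h)) e)"
    unfolding c(3) by (rule move_cls) (use c g assms in simp_all)
  ultimately show ?thesis using c g assms by simp
qed

lemma move_unit:
  assumes "c \<in> points (ad_objects G H B)"
  shows "move c (One (An (foot c))) = c"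
proof -
  obtain p e where c: "p \<in> P" "e \<in> fibre (An p)" "c = cls (p, e)" using objE[OF assms] .
  have "move (cls (p, e)) (One (An p)) = cls (Ac p (One (An p)), lam (Inv (One (An p))) e)"
    by (rule move_cls) (use c in simp_all)
  then show ?thesis using c lam_unit[of "An p" e] by simp
qed

lemma arrows_iff:
  "(c, g) \<in> points (ad_arrows G H B) \<longleftrightarrow> c \<in> points (ad_objects G H B) \<and> g \<in> arrs G \<and> An (foot c) = Tg g"
  by (simp add: ad_arrows_def fibre_product_points)

abbreviation AG where "AG \<equiv> adjoint_groupoid G H B"

lemma AG_simps [simp]:
  "src AG (c, g) = c" "tgt AG (c, g) = move c g" "unt AG c = (c, One (An (foot c)))"
  "cmp AG (d, h) (c, g) = (c, Mu g h)" "ginv AG (c, g) = (move c g, Inv g)"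
  "ob_space AG = ad_objects G H B" "ar_space AG = ad_arrows G H B"
  by (simp_all add: adjoint_groupoid_def)

lemma adjoint_is_groupoid: "is_groupoid (points (ad_objects G H B)) (points (ad_arrows G H B)) AG"
  unfolding is_groupoid_def
proof (intro conjI ballI impI)
  fix f assume f: "f \<in> points (ad_arrows G H B)"
  obtain c g where fc: "f = (c, g)" by (cases f)
  have c: "c \<in> points (ad_objects G H B)" "g \<in> arrs G" "An (foot c) = Tg g" using f
    by (simp_all add: fc arrows_iff)
  note m = move_obj[OF c]
  note pin = foot_in[OF c(1)]
  show "src AG f \<in> points (ad_objects G H B)" "tgt AG f \<in> points (ad_objects G H B)" using c m
    by (simp_all add: fc)
  show "cmp AG f (unt AG (src AG f)) = f" "cmp AG (unt AG (tgt AG f)) f = f"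
    using c m pin by (simp_all add: fc)
  show "ginv AG f \<in> points (ad_arrows G H B)" "src AG (ginv AG f) = tgt AG f"
    using c m pin by (simp_all add: fc arrows_iff)
  show "tgt AG (ginv AG f) = src AG f"
    using move_move[OF c, of "Inv g"] move_unit[OF c(1)] c by (simp add: fc)
  show "cmp AG (ginv AG f) f = unt AG (src AG f)" "cmp AG f (ginv AG f) = unt AG (tgt AG f)"
    using c m pin by (simp_all add: fc)
next
  fix x assume x: "x \<in> points (ad_objects G H B)"
  then show "unt AG x \<in> points (ad_arrows G H B)" "src AG (unt AG x) = x" "tgt AG (unt AG x) = x"
    using foot_in[OF x] move_unit[OF x] by (simp_all add: arrows_iff)
next
  fix k f assume kf: "k \<in> points (ad_arrows G H B)" "f \<in> points (ad_arrows G H B)" "src AG k = tgt AG f"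
  obtain c g where fc: "f = (c, g)" by (cases f)
  obtain d h where kd: "k = (d, h)" by (cases k)
  have c: "c \<in> points (ad_objects G H B)" "g \<in> arrs G" "An (foot c) = Tg g" using kf
    by (simp_all add: fc arrows_iff)
  have d: "d = move c g" "h \<in> arrs G" "An (foot d) = Tg h" using kf by (simp_all add: fc kd arrows_iff)
  have gh: "Sc g = Tg h" using d move_obj[OF c] foot_in[OF c(1)] c by simp
  show "cmp AG k f \<in> points (ad_arrows G H B)" "src AG (cmp AG k f) = src AG f"
      "tgt AG (cmp AG k f) = tgt AG k"
    using c d gh move_move[OF c d(2) gh] by (simp_all add: fc kd arrows_iff)
next
  fix l k f assume kf: "l \<in> points (ad_arrows G H B)" "k \<in> points (ad_arrows G H B)"
      "f \<in> points (ad_arrows G H B)"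
    "src AG l = tgt AG k \<and> src AG k = tgt AG f"
  obtain c g where fc: "f = (c, g)" by (cases f)
  obtain d h where kd: "k = (d, h)" by (cases k)
  obtain b i where lb: "l = (b, i)" by (cases l)
  have c: "c \<in> points (ad_objects G H B)" "g \<in> arrs G" "An (foot c) = Tg g" using kf
    by (simp_all add: fc arrows_iff)
  have d: "d \<in> points (ad_objects G H B)" "h \<in> arrs G" "An (foot d) = Tg h" "d = move c g" using kf
    by (simp_all add: fc kd arrows_iff)
  have b: "b = move d h" "i \<in> arrs G" "An (foot b) = Tg i" using kf by (simp_all add: lb kd arrows_iff)
  have gh: "Sc g = Tg h" using d move_obj[OF c] foot_in[OF c(1)] c by simp
  have hi: "Sc h = Tg i" using b move_obj[OF d(1-3)] foot_in[OF d(1)] d by simp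
  show "cmp AG (cmp AG l k) f = cmp AG l (cmp AG k f)"
    using c d b gh hi by (simp add: fc kd lb gr_assoc)
qed

section \<open>The diffeology of the adjoint groupoid\<close>

text \<open>
The plots are those of the three factors; the conditions on the base points in the algebroid and
the tangent bundle follow from the smoothness of the anchor.
\<close>

lemma T_plot_iff:
  "plot T n U q \<longleftrightarrow> (\<forall>u\<in>U. q u \<in> points T) \<and> plot (mdiff (total B)) n U (\<lambda>u. fst (q u)) \<and>
     plot (tangent_bundle A) n U (\<lambda>u. (One (An (fst (q u))), fst (snd (q u)))) \<and>
     plot (tangent_bundle M) n U (\<lambda>u. (An (fst (q u)), snd (snd (q u))))"
proof -
  have pt: "q u \<in> points T \<longleftrightarrow> fst (q u) \<in> P \<and> fst (snd (q u)) \<in> alg_fibre G (An (fst (q u))) \<and>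
      snd (snd (q u)) \<in> TM (An (fst (q u)))" for u
    using T_points[of "fst (q u)" "snd (q u)"] by (simp add: fibre_def mem_Times_iff)
  have 1: "plot T n U q \<longleftrightarrow> plot (mdiff (total B)) n U (\<lambda>u. fst (q u)) \<and>
     plot (lie_algebroid G) n U (\<lambda>u. (An (fst (q u)), fst (snd (q u)))) \<and>
     plot (tangent_bundle M) n U (\<lambda>u. (An (fst (q u)), snd (snd (q u))))"
    by (simp add: ad_total_def)
  show ?thesis
  proof
    assume L: "plot T n U q"
    then show "(\<forall>u\<in>U. q u \<in> points T) \<and> plot (mdiff (total B)) n U (\<lambda>u. fst (q u)) \<and>
     plot (tangent_bundle A) n U (\<lambda>u. (One (An (fst (q u))), fst (snd (q u)))) \<and>
     plot (tangent_bundle M) n U (\<lambda>u. (An (fst (q u)), snd (snd (q u))))"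
      unfolding 1 lie_algebroid_plot_iff pt
      using mplot_point[of "total B" n U "\<lambda>u. fst (q u)"]
        tangent_plotD(2)[of M n U "\<lambda>u. An (fst (q u))" "\<lambda>u. snd (snd (q u))"] by auto
  next
    assume R: "(\<forall>u\<in>U. q u \<in> points T) \<and> plot (mdiff (total B)) n U (\<lambda>u. fst (q u)) \<and>
     plot (tangent_bundle A) n U (\<lambda>u. (One (An (fst (q u))), fst (snd (q u)))) \<and>
     plot (tangent_bundle M) n U (\<lambda>u. (An (fst (q u)), snd (snd (q u))))"
    then show "plot T n U q"
      unfolding 1 lie_algebroid_plot_iff pt
      using dsmoothD(2)[OF An_smooth, of n U "\<lambda>u. fst (q u)"] by auto
  qed
qed

lemma diffeological_space_T: "diffeological_space T"
proof (rule diffeological_space_initial[OF diffeological_space_mdiff[OF TB]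
      diffeological_space_tangent_bundle[OF A] diffeological_space_tangent_bundle[OF M] _ T_plot_iff])
  fix x assume "x \<in> points T"
  then have "fst x \<in> P" "fst (snd x) \<in> alg_fibre G (An (fst x))" "snd (snd x) \<in> TM (An (fst x))"
    using T_points[of "fst x" "snd x"] by (simp_all add: fibre_def mem_Times_iff)
  then show "fst x \<in> points (mdiff (total B)) \<and> (One (An (fst x)), fst (snd x)) \<in> points (tangent_bundle
      A) \<and>
        (An (fst x), snd (snd x)) \<in> points (tangent_bundle M)"
    by (simp add: tangent_bundle_def alg_fibre_def ker_dsrc_iff)
qed

lemma diffeological_space_objects: "diffeological_space (ad_objects G H B)"
  unfolding ad_objects_def by (rule diffeological_space_quotient[OF diffeological_space_T])

lemma diffeological_space_arrows: "diffeological_space (ad_arrows G H B)"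
  unfolding ad_arrows_def
  by (rule diffeological_space_fibre_product[OF diffeological_space_objects diffeological_space_mdiff[OF
      A]])

lemma object_plot_lift:
  assumes "plot (ad_objects G H B) n U q" "u \<in> U"
  obtains W p where "openin (Euclidean_space n) W" "u \<in> W" "W \<subseteq> U" "plot T n W p"
      "\<forall>w\<in>W. q w = cls (p w)"
  using quotient_lift[OF assms[unfolded ad_objects_def], folded ad_class_def] .

lemma object_plotI:
  assumes "openin (Euclidean_space n) U"
    "\<And>u. u \<in> U \<Longrightarrow> \<exists>W p. openin (Euclidean_space n) W \<and> u \<in> W \<and> W \<subseteq> U \<and> plot T n W p
        \<and> (\<forall>w\<in>W. q w = cls (p w))"
  shows "plot (ad_objects G H B) n U q"
  unfolding ad_objects_def by (rule quotient_plotI[OF assms(1) assms(2)[unfolded ad_class_def]])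

lemma foot_plot:
  assumes q: "plot (ad_objects G H B) n U q"
  shows "plot (mdiff (total B)) n U (\<lambda>u. foot (q u))"
proof (rule mplot_local[OF TB])
  fix u assume u: "u \<in> U"
  obtain W p where W: "openin (Euclidean_space n) W" "u \<in> W" "W \<subseteq> U" "plot T n W p"
      "\<forall>w\<in>W. q w = cls (p w)"
    using object_plot_lift[OF q u] .
  have t: "plot (mdiff (total B)) n W (\<lambda>u. fst (p u))" and pt: "\<forall>w\<in>W. p w \<in> points T"
    using W(4) by (simp_all add: T_plot_iff)
  have "plot (mdiff (total B)) n W (\<lambda>u. foot (q u))"
  proof (rule mplot_cong[OF TB t])
    fix w assume w: "w \<in> W"
    then show "fst (p w) = foot (q w)"
      using W(5) pt T_points[of "fst (p w)" "snd (p w)"] foot_cls[of "fst (p w)" "snd (p w)"] by simp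
  qed
  then show "\<exists>W. u \<in> W \<and> W \<subseteq> U \<and> plot (mdiff (total B)) n W (\<lambda>u. foot (q u))" using W
    by (intro exI[of _ W]) simp
qed

lemma act_plot:
  assumes "plot (mdiff (total B)) n U p" "plot (mdiff A) n U g" "\<And>u. u \<in> U \<Longrightarrow> An (p u) = Tg (g u)"
  shows "plot (mdiff (total B)) n U (\<lambda>u. Ac (p u) (g u))"
  using dsmoothD(2)[OF Ac_smooth, of n U "\<lambda>u. (p u, g u)"] assms by (simp add: fibre_product_plot_iff)

text \<open>
Lift the plot of classes to a plot of representatives and transport the representatives.
\<close>

lemma move_plot:
  assumes q: "plot (ad_objects G H B) n U c" and g: "plot (mdiff A) n U g"
    and eq: "\<And>u. u \<in> U \<Longrightarrow> An (foot (c u)) = Tg (g u)"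
  shows "plot (ad_objects G H B) n U (\<lambda>u. move (c u) (g u))"
proof (rule object_plotI[OF mplot_open[OF g]])
  fix u assume u: "u \<in> U"
  obtain W p where W: "openin (Euclidean_space n) W" "u \<in> W" "W \<subseteq> U" "plot T n W p"
      "\<forall>w\<in>W. c w = cls (p w)"
    using object_plot_lift[OF q u] .
  define x where "x = (\<lambda>u. fst (p u))"
  define e where "e = (\<lambda>u. snd (p u))"
  have pxe: "p w = (x w, e w)" for w by (simp add: x_def e_def)
  have pt: "x w \<in> P" "e w \<in> fibre (An (x w))" if "w \<in> W" for w
    using W(4) that T_points[of "x w" "e w"] by (simp_all add: T_plot_iff pxe)
  have xp: "plot (mdiff (total B)) n W x"
    and ap: "plot (tangent_bundle A) n W (\<lambda>u. (One (An (x u)), fst (e u)))"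
    and vp: "plot (tangent_bundle M) n W (\<lambda>u. (An (x u), snd (e u)))"
    using W(4) by (simp_all add: T_plot_iff x_def e_def)
  have gW: "plot (mdiff A) n W g" by (rule mplot_restrict[OF A g W(1,3)])
  have gw: "g w \<in> arrs G" "An (x w) = Tg (g w)" if "w \<in> W" for w
    using mplot_point[OF gW that] eq[of w] W(3,5) that pt[OF that] by (auto simp: pxe)
  have iW: "plot (mdiff A) n W (\<lambda>u. Inv (g u))" by (rule inv_plot[OF gW])
  have sI: "Sc (Inv (g w)) = An (x w)" "Tg (Inv (g w)) = Sc (g w)" if "w \<in> W" for w using gw[OF that]
    by simp_all
  have "plot (lie_algebroid G) n W (\<lambda>u. (Sc (Inv (g u)), fst (e u)))"
    unfolding lie_algebroid_plot_iff
  proof (intro conjI ballI)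
    show "plot (mdiff M) n W (\<lambda>u. Sc (Inv (g u)))" by (rule s_plot[OF iW])
    show "fst (e w) \<in> alg_fibre G (Sc (Inv (g w)))" if "w \<in> W" for w
      using pt(2)[OF that] sI[OF that] by (simp add: fibre_def mem_Times_iff)
    show "plot (tangent_bundle A) n W (\<lambda>u. (One (Sc (Inv (g u))), fst (e u)))"
      by (rule diffeological_spaceD(3)[OF diffeological_space_tangent_bundle[OF A] ap]) (simp add: sI)
  qed
  from lam0_plot[OF iW this]
  have l0: "plot (tangent_bundle A) n W (\<lambda>u. (One (Tg (Inv (g u))), lam0 G H (Inv (g u)) (fst (e u))))"
    by (simp add: lie_algebroid_plot_iff)
  have "plot (tangent_bundle M) n W (\<lambda>u. (Sc (Inv (g u)), snd (e u)))"
    by (rule diffeological_spaceD(3)[OF diffeological_space_tangent_bundle[OF M] vp]) (simp add: sI)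
  from lam1_plot[OF iW this]
  have l1: "plot (tangent_bundle M) n W (\<lambda>u. (Tg (Inv (g u)), lam1 G H (Inv (g u)) (snd (e u))))" .
  define p' where "p' u = (Ac (x u) (g u), lam (Inv (g u)) (e u))" for u
  have "plot T n W p'"
    unfolding T_plot_iff
  proof (intro conjI ballI)
    show "p' w \<in> points T" if "w \<in> W" for w
      unfolding p'_def T_points using gw[OF that] pt[OF that] lam_fibre[of "g w" "e w"] by simp
    show "plot (mdiff (total B)) n W (\<lambda>u. fst (p' u))"
      unfolding p'_def fst_conv by (rule act_plot[OF xp gW gw(2)])
    show "plot (tangent_bundle A) n W (\<lambda>u. (One (An (fst (p' u))), fst (snd (p' u))))"
      by (rule diffeological_spaceD(3)[OF diffeological_space_tangent_bundle[OF A] l0])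
        (use gw pt in \<open>simp add: p'_def lam_def\<close>)
    show "plot (tangent_bundle M) n W (\<lambda>u. (An (fst (p' u)), snd (snd (p' u))))"
      by (rule diffeological_spaceD(3)[OF diffeological_space_tangent_bundle[OF M] l1])
        (use gw pt in \<open>simp add: p'_def lam_def\<close>)
  qed
  moreover have "\<forall>w\<in>W. move (c w) (g w) = cls (p' w)"
    using W(5) move_cls[OF pt gw] by (simp add: pxe p'_def)
  ultimately show "\<exists>W p. openin (Euclidean_space n) W \<and> u \<in> W \<and> W \<subseteq> U \<and> plot T n W p
      \<and> (\<forall>w\<in>W. move (c w) (g w) = cls (p w))"
    using W by (intro exI[of _ W] exI[of _ p']) simp
qed

lemma arrow_plot_iff:
  "plot (ad_arrows G H B) n U f \<longleftrightarrow> plot (ad_objects G H B) n U (\<lambda>u. fst (f u)) \<and>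
     plot (mdiff A) n U (\<lambda>u. snd (f u)) \<and> (\<forall>u\<in>U. An (foot (fst (f u))) = Tg (snd (f u)))"
  by (simp add: ad_arrows_def fibre_product_plot_iff)

lemma dsmoothI:
  assumes "\<And>x. x \<in> points D \<Longrightarrow> F x \<in> points C" "\<And>n U p. plot D n U p \<Longrightarrow> plot C n U (\<lambda>u. F (p u))"
  shows "dsmooth D C F"
  using assms by (auto simp: dsmooth_def o_def)

lemma adjoint_diffeological_groupoid: "diffeological_groupoid AG"
  unfolding diffeological_groupoid_def smooth_groupoid_def AG_simps(6,7)
proof (intro conjI diffeological_space_objects diffeological_space_arrows adjoint_is_groupoid)
  have ag: "src AG f = fst f" "tgt AG f = move (fst f) (snd f)" "ginv AG f = (move (fst f) (snd f), Inv
      (snd f))" for f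
    by (cases f; simp)+
  note gr = adjoint_is_groupoid[unfolded is_groupoid_def]
  show s: "dsmooth (ad_arrows G H B) (ad_objects G H B) (src AG)"
    by (rule dsmoothI) (use gr arrow_plot_iff ag in auto)
  show t: "dsmooth (ad_arrows G H B) (ad_objects G H B) (tgt AG)"
  proof (rule dsmoothI)
    fix n U f assume "plot (ad_arrows G H B) n U f"
    then show "plot (ad_objects G H B) n U (\<lambda>u. tgt AG (f u))"
      unfolding ag arrow_plot_iff by (intro move_plot) auto
  qed (use gr in auto)
  show "dsmooth (ad_objects G H B) (ad_arrows G H B) (unt AG)"
  proof (rule dsmoothI)
    fix n U c assume c: "plot (ad_objects G H B) n U c"
    have "An (foot (c u)) \<in> objs G" if "u \<in> U" for u
      using foot_in[OF diffeological_spaceD(2)[OF diffeological_space_objects c that]] by simp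
    then show "plot (ad_arrows G H B) n U (\<lambda>u. unt AG (c u))"
      using c unit_plot[OF dsmoothD(2)[OF An_smooth foot_plot[OF c]]] by (simp add: arrow_plot_iff)
  qed (use gr in auto)
  show "dsmooth (ad_arrows G H B) (ad_arrows G H B) (ginv AG)"
  proof (rule dsmoothI)
    fix n U f assume f: "plot (ad_arrows G H B) n U f"
    have "An (foot (move (fst (f u)) (snd (f u)))) = Tg (Inv (snd (f u)))" if "u \<in> U" for u
    proof -
      have 1: "(fst (f u), snd (f u)) \<in> points (ad_arrows G H B)"
        using diffeological_spaceD(2)[OF diffeological_space_arrows f that] by simp
      then have "fst (f u) \<in> points (ad_objects G H B)" "snd (f u) \<in> arrs G"
          "An (foot (fst (f u))) = Tg (snd (f u))"
        unfolding arrows_iff by auto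
      then show ?thesis using move_obj(2) foot_in by simp
    qed
    then show "plot (ad_arrows G H B) n U (\<lambda>u. ginv AG (f u))"
      using f unfolding ag arrow_plot_iff fst_conv snd_conv by (auto intro!: move_plot inv_plot)
  qed (use gr in auto)
  show "dsmooth (fibre_product (ad_arrows G H B) (ad_arrows G H B) (src AG) (tgt AG)) (ad_arrows G H B)
      (\<lambda>(k, f). cmp AG k f)"
  proof (rule dsmoothI)
    fix z assume "z \<in> points (fibre_product (ad_arrows G H B) (ad_arrows G H B) (src AG) (tgt AG))"
    then show "(case z of (k, f) \<Rightarrow> cmp AG k f) \<in> points (ad_arrows G H B)"
      using gr[THEN conjunct2, THEN conjunct2, THEN conjunct1]
        by (cases z) (simp add: fibre_product_points)
  next
    fix n U z assume z: "plot (fibre_product (ad_arrows G H B) (ad_arrows G H B) (src AG) (tgt AG)) n U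
        z"
    define k f where "k = (\<lambda>u. fst (z u))" and "f = (\<lambda>u. snd (z u))"
    have k: "plot (ad_arrows G H B) n U k" and f: "plot (ad_arrows G H B) n U f"
      and kf: "\<And>u. u \<in> U \<Longrightarrow> fst (k u) = move (fst (f u)) (snd (f u))"
      using z by (simp_all add: fibre_product_plot_iff k_def f_def ag)
    have c: "cmp AG (k u) (f u) = (fst (f u), Mu (snd (f u)) (snd (k u)))" for u
      by (cases "k u"; cases "f u") simp
    have in_ar: "fst (f u) \<in> points (ad_objects G H B)" "snd (f u) \<in> arrs G"
        "An (foot (fst (f u))) = Tg (snd (f u))"
      "snd (k u) \<in> arrs G" "An (foot (fst (k u))) = Tg (snd (k u))" if "u \<in> U" for u
      using diffeological_spaceD(2)[OF diffeological_space_arrows f that]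
        diffeological_spaceD(2)[OF diffeological_space_arrows k that]
        arrows_iff[of "fst (f u)" "snd (f u)"] arrows_iff[of "fst (k u)" "snd (k u)"] by simp_all
    have st: "Sc (snd (f u)) = Tg (snd (k u))" if u: "u \<in> U" for u
      using in_ar[OF u] kf[OF u] move_obj(2)[OF in_ar(1-3)[OF u]] foot_in[OF in_ar(1)[OF u]] by simp
    have "plot (ad_arrows G H B) n U (\<lambda>u. (fst (f u), Mu (snd (f u)) (snd (k u))))"
      unfolding arrow_plot_iff fst_conv snd_conv
    proof (intro conjI ballI)
      show "plot (ad_objects G H B) n U (\<lambda>u. fst (f u))" using f by (simp add: arrow_plot_iff)
      show "plot (mdiff A) n U (\<lambda>u. Mu (snd (f u)) (snd (k u)))"
        by (rule cmp_plot[OF _ _ st]) (use f k in \<open>simp_all add: arrow_plot_iff\<close>)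
      show "An (foot (fst (f u))) = Tg (Mu (snd (f u)) (snd (k u)))" if "u \<in> U" for u
        using in_ar[OF that] st[OF that] by simp
    qed
    moreover have "(\<lambda>u. case z u of (k, f) \<Rightarrow> cmp AG k f) = (\<lambda>u. (fst (f u), Mu (snd (f u)) (snd (k
        u))))"
      by (simp only: c[symmetric] case_prod_beta) (simp only: k_def f_def)
    ultimately show "plot (ad_arrows G H B) n U (\<lambda>u. case z u of (k, f) \<Rightarrow> cmp AG k f)" by (simp only:)
  qed
qed

end

section \<open>Connected components of the fibres\<close>

lemma cring_real_field: "cring real_field"
proof (rule cringI)
  show "abelian_group real_field"
    by (rule abelian_groupI) (auto simp: real_field_def intro: exI[of _ "- x" for x])
  show "comm_monoid real_field"
    by (rule comm_monoidI) (auto simp: real_field_def)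
qed (auto simp: real_field_def distrib_right)

text \<open>
A subspace of pairs of tangent vectors modulo another one. The quotient map \<open>\<kappa>\<close> is given, so
that the elements of the vector space can be the components of a groupoid.
\<close>

lemma quotient_module:
  fixes \<kappa> :: "'x tvec \<times> 'y tvec \<Rightarrow> 'v"
  assumes E0: "0 \<in> E0" "\<And>a b. a \<in> E0 \<Longrightarrow> b \<in> E0 \<Longrightarrow> a + b \<in> E0" "\<And>c a. a \<in> E0 \<Longrightarrow> pscale c a \<in> E0"
    and N0: "\<And>a b. a \<in> N0 \<Longrightarrow> b \<in> N0 \<Longrightarrow> a + b \<in> N0" "\<And>c a. a \<in> N0 \<Longrightarrow> pscale c a \<in> N0"
    and eq: "\<And>a b. a \<in> E0 \<Longrightarrow> b \<in> E0 \<Longrightarrow> \<kappa> a = \<kappa> b \<longleftrightarrow> a - b \<in> N0"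
  shows "\<exists>V :: (real, 'v) module. carrier V = \<kappa> ` E0 \<and> Module.module real_field V \<and> \<zero>\<^bsub>V\<^esub> = \<kappa> 0 \<and>
    (\<forall>a\<in>E0. \<forall>b\<in>E0. \<kappa> a \<oplus>\<^bsub>V\<^esub> \<kappa> b = \<kappa> (a + b)) \<and> (\<forall>c. \<forall>a\<in>E0. c \<odot>\<^bsub>V\<^esub> \<kappa> a = \<kappa> (pscale c a)) \<and>
    (\<forall>a\<in>E0. \<ominus>\<^bsub>V\<^esub> \<kappa> a = \<kappa> (- a))"
proof -
  define r where "r = inv_into E0 \<kappa>"
  have r: "r (\<kappa> a) \<in> E0" "r (\<kappa> a) - a \<in> N0" if a: "a \<in> E0" for a
  proof -
    show 1: "r (\<kappa> a) \<in> E0" unfolding r_def by (rule inv_into_into) (use a in simp)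
    have "\<kappa> (r (\<kappa> a)) = \<kappa> a" unfolding r_def by (rule f_inv_into_f) (use a in simp)
    then show "r (\<kappa> a) - a \<in> N0" using eq[OF 1 a] by simp
  qed
  define V :: "(real, 'v) module" where "V = \<lparr>carrier = \<kappa> ` E0, mult = (\<lambda>x y. \<kappa> 0), one = \<kappa> 0, zero = \<kappa>
      0,
     add = (\<lambda>x y. \<kappa> (r x + r y)), smult = (\<lambda>c x. \<kappa> (pscale c (r x)))\<rparr>"
  have psd: "pscale c (a - b) = pscale c a - pscale c b" for c and a b :: "'x tvec \<times> 'y tvec"
    by (auto simp: pscale_def tscale_def prod_eq_iff fun_eq_iff right_diff_distrib)
  have add: "\<kappa> a \<oplus>\<^bsub>V\<^esub> \<kappa> b = \<kappa> (a + b)" if a: "a \<in> E0" and b: "b \<in> E0" for a b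
  proof -
    have e: "(r (\<kappa> a) + r (\<kappa> b)) - (a + b) = (r (\<kappa> a) - a) + (r (\<kappa> b) - b)" by (rule add_diff_add)
    have "(r (\<kappa> a) + r (\<kappa> b)) - (a + b) \<in> N0" unfolding e by (rule N0(1)[OF r(2)[OF a] r(2)[OF b]])
    then show ?thesis using eq[OF E0(2)[OF r(1)[OF a] r(1)[OF b]] E0(2)[OF a b]] by (simp add: V_def)
  qed
  have sm: "c \<odot>\<^bsub>V\<^esub> \<kappa> a = \<kappa> (pscale c a)" if a: "a \<in> E0" for c a
  proof -
    have "pscale c (r (\<kappa> a)) - pscale c a \<in> N0" unfolding psd[symmetric] by (rule N0(2)[OF r(2)[OF a]])
    then show ?thesis using eq[OF E0(3)[OF r(1)[OF a]] E0(3)[OF a]] by (simp add: V_def)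
  qed
  have car: "carrier V = \<kappa> ` E0" and z: "\<zero>\<^bsub>V\<^esub> = \<kappa> 0" by (simp_all add: V_def)
  have um: "- a \<in> E0" if "a \<in> E0" for a using E0(3)[OF that, of "-1"] by (simp add: pscale_simps)
  have ab: "abelian_group V"
  proof (rule abelian_groupI)
    fix x assume "x \<in> carrier V"
    then obtain a where a: "a \<in> E0" "x = \<kappa> a" by (auto simp: car)
    then have "\<kappa> (- a) \<oplus>\<^bsub>V\<^esub> x = \<zero>\<^bsub>V\<^esub>" using add[OF um[OF a(1)] a(1)] z by simp
    then show "\<exists>y\<in>carrier V. y \<oplus>\<^bsub>V\<^esub> x = \<zero>\<^bsub>V\<^esub>" using um[OF a(1)] by (auto simp: car)
  qed (use E0 in \<open>auto simp: car z add ac_simps\<close>)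
  have md: "Module.module real_field V"
    by (rule moduleI[OF cring_real_field ab])
      (simp_all add: car real_field_def, (elim imageE, simp add: E0 sm add pscale_simps)+)
  have "\<ominus>\<^bsub>V\<^esub> \<kappa> a = \<kappa> (- a)" if a: "a \<in> E0" for a
  proof (rule abelian_group.minus_equality[OF ab])
    show "\<kappa> (- a) \<oplus>\<^bsub>V\<^esub> \<kappa> a = \<zero>\<^bsub>V\<^esub>" using add[OF um[OF a] a] z by simp
  qed (use a um[OF a] in \<open>simp_all add: car\<close>)
  then show ?thesis using car md z add sm by (intro exI[of _ V]) simp
qed

context adjoint_setting
begin

abbreviation component where "component \<equiv> ad_component G H B"

lemma proj0: "ad_proj0 G H B c = pr (foot c)" and proj1: "ad_proj1 G H B (c, g) = pr (foot c)"
  by (simp_all add: ad_proj0_def ad_proj1_def)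

text \<open>
An arrow with source \<open>c\<close> is determined by its component in \<open>G\<close>, which can be any arrow that ends
at the anchor of the foot of \<open>c\<close>. Its target lies over the same point since the action preserves
the fibres of the projection.
\<close>

lemma component_eq_image:
  assumes p: "p \<in> P" "e \<in> fibre (An p)"
  shows "component (p, e) = {move (cls (p, e)) g |g. g \<in> arrs G \<and> An p = Tg g}"
proof -
  have c: "cls (p, e) \<in> points (ad_objects G H B)" "foot (cls (p, e)) = p" using p cls_obj by simp_all
  show ?thesis
    unfolding ad_component_def conn_class_def fst_conv
  proof (intro equalityI subsetI)
    fix y assume "y \<in> {y \<in> fibre_objects G H B (pr p). \<exists>f\<in>fibre_arrows G H B (pr p). src AG f = cls (p,
        e) \<and> tgt AG f = y}"
    then obtain f where "f \<in> points (ad_arrows G H B)" "src AG f = cls (p, e)" "tgt AG f = y"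
      by (auto simp: fibre_arrows_def)
    then show "y \<in> {move (cls (p, e)) g |g. g \<in> arrs G \<and> An p = Tg g}"
      using c by (cases f) (auto simp: arrows_iff)
  next
    fix y assume "y \<in> {move (cls (p, e)) g |g. g \<in> arrs G \<and> An p = Tg g}"
    then obtain g where g: "g \<in> arrs G" "An p = Tg g" "y = move (cls (p, e)) g" by auto
    have "y \<in> fibre_objects G H B (pr p)"
      using move_obj[OF c(1) g(1)] c g p by (simp add: fibre_objects_def proj0)
    moreover have "(cls (p, e), g) \<in> fibre_arrows G H B (pr p)"
      using c g by (simp add: fibre_arrows_def arrows_iff proj1)
    moreover have "src AG (cls (p, e), g) = cls (p, e)" "tgt AG (cls (p, e), g) = y" using g by simp_all
    ultimately show "y \<in> {y \<in> fibre_objects G H B (pr p). \<exists>f\<in>fibre_arrows G H B (pr p). src AG f = cls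
        (p, e) \<and> tgt AG f = y}"
      by blast
  qed
qed

lemma component_move:
  assumes p: "p \<in> P" "e \<in> fibre (An p)" and g: "g \<in> arrs G" "An p = Tg g"
  shows "component (Ac p g, lam (Inv g) e) = component (p, e)"
proof -
  have c: "cls (p, e) \<in> points (ad_objects G H B)" "foot (cls (p, e)) = p" using p cls_obj by simp_all
  have q: "Ac p g \<in> P" "lam (Inv g) e \<in> fibre (An (Ac p g))" using p g lam_fibre[of g e] by simp_all
  have mm: "move (cls (Ac p g, lam (Inv g) e)) h = move (cls (p, e)) (Mu g h)"
      if "h \<in> arrs G" "Sc g = Tg h" for h
    using move_move[OF c(1) g(1) _ that] move_cls[OF p g] c g by simp
  show ?thesis unfolding component_eq_image[OF p] component_eq_image[OF q]
  proof (intro equalityI subsetI)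
    fix y assume "y \<in> {move (cls (Ac p g, lam (Inv g) e)) h |h. h \<in> arrs G \<and> An (Ac p g) = Tg h}"
    then obtain h where h: "h \<in> arrs G" "Sc g = Tg h" "y = move (cls (Ac p g, lam (Inv g) e)) h"
      using p g by auto
    then show "y \<in> {move (cls (p, e)) g |g. g \<in> arrs G \<and> An p = Tg g}"
      using mm[OF h(1,2)] g by (intro CollectI exI[of _ "Mu g h"]) simp
  next
    fix y assume "y \<in> {move (cls (p, e)) g |g. g \<in> arrs G \<and> An p = Tg g}"
    then obtain k where k: "k \<in> arrs G" "An p = Tg k" "y = move (cls (p, e)) k" by auto
    define h where "h = Mu (Inv g) k"
    have h: "h \<in> arrs G" "Sc g = Tg h" using k g by (simp_all add: h_def)
    have "Mu g h = Mu (Mu g (Inv g)) k" unfolding h_def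
      by (rule gr_assoc[symmetric]) (use k g in simp_all)
    then have "Mu g h = k" using k g by simp
    then show "y \<in> {move (cls (Ac p g, lam (Inv g) e)) h |h. h \<in> arrs G \<and> An (Ac p g) = Tg h}"
      using mm[OF h] h k p g by (intro CollectI exI[of _ h]) simp
  qed
qed

text \<open>
An arrow between two classes with the same foot \<open>p\<close> has a component \<open>g\<close> with \<open>p g = p\<close>, so \<open>g\<close>
is a unit by freeness and the classes agree.
\<close>

lemma component_eq_iff:
  assumes p: "p \<in> P" and e: "e \<in> fibre (An p)" "e' \<in> fibre (An p)"
  shows "component (p, e) = component (p, e') \<longleftrightarrow> e - e' \<in> defect_span p"
proof
  assume "e - e' \<in> defect_span p"
  then have "cls (p, e) = cls (p, e')" using cls_eq_iff[OF p e(1) p e(2)] by simp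
  then show "component (p, e) = component (p, e')"
    unfolding component_eq_image[OF p e(1)] component_eq_image[OF p e(2)] by simp
next
  assume eq: "component (p, e) = component (p, e')"
  have c: "cls (p, e') \<in> points (ad_objects G H B)" "foot (cls (p, e')) = p" using p e cls_obj
    by simp_all
  have "move (cls (p, e')) (One (An p)) = cls (p, e')" using move_unit[OF c(1)] c by simp
  then have "cls (p, e') \<in> component (p, e')"
    unfolding component_eq_image[OF p e(2)] using p by (intro CollectI exI[of _ "One (An p)"]) simp
  then have "cls (p, e') \<in> component (p, e)" using eq by simp
  then obtain g where g: "g \<in> arrs G" "An p = Tg g" "cls (p, e') = move (cls (p, e)) g"
    unfolding component_eq_image[OF p e(1)] by auto
  have gm: "cls (p, e') = cls (Ac p g, lam (Inv g) e)" using move_cls[OF p e(1) g(1,2)] g by simp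
  have le: "lam (Inv g) e \<in> fibre (An (Ac p g))" using lam_fibre[of g e] e g p by simp
  have "Ac p g = p" using gm foot_cls[of "Ac p g" "lam (Inv g) e"] c p g le by simp
  then have "g = One (An p)" using free p g by simp
  then have "lam (Inv g) e = e" using p e lam_unit by simp
  then have "cls (p, e') = cls (p, e)" using gm \<open>Ac p g = p\<close> by simp
  then have "cls (p, e) = cls (p, e')" by simp
  then show "e - e' \<in> defect_span p" using cls_eq_iff[OF p e(1) p e(2)] by simp
qed

text \<open>
Transport along the arrow from \<open>q\<close> to \<open>p0\<close>. Linearity and homogeneity of this map are what makes
the operations on components independent of the foot.
\<close>

lemma based_component:
  assumes p0: "p0 \<in> P" and q: "q \<in> P" "pr q = pr p0"
  obtains L where "\<forall>e\<in>fibre (An q). L e \<in> fibre (An p0) \<and> component (q, e) = component (p0, L e)"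
    "\<forall>d\<in>fibre (An q). \<forall>e\<in>fibre (An q). L (d + e) = L d + L e" "\<forall>c. \<forall>e\<in>fibre (An q). L (pscale c e) =
        pscale c (L e)"
    "L 0 = 0" "\<forall>e\<in>fibre (An q). L (- e) = - L e"
    "\<forall>e\<in>fibre (An q). (snd e = 0 \<longrightarrow> snd (L e) = 0) \<and> (fst e = 0 \<longrightarrow> fst (L e) = 0)"
proof -
  obtain g where g: "g \<in> arrs G" "An q = Tg g" "p0 = Ac q g"
    using translation_unique[OF q(1) p0 q(2)] by auto
  have i: "Inv g \<in> arrs G" "Sc (Inv g) = An q" "Tg (Inv g) = An p0" using g q by simp_all
  note ll = lam_linear[OF i(1), unfolded i(2,3)]
  have l0: "lam0 G H (Inv g) 0 = 0" "lam1 G H (Inv g) 0 = 0"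
    using ll(6) by (simp_all add: lam_def prod_eq_iff)
  show ?thesis
  proof (rule that[of "lam (Inv g)"])
    show "\<forall>e\<in>fibre (An q). lam (Inv g) e \<in> fibre (An p0) \<and> component (q, e) = component (p0, lam (Inv g)
        e)"
      using ll(1) component_move[OF q(1) _ g(1,2)] g(3) by simp
    show "\<forall>e\<in>fibre (An q). (snd e = 0 \<longrightarrow> snd (lam (Inv g) e) = 0) \<and> (fst e = 0
        \<longrightarrow> fst (lam (Inv g) e) = 0)"
      using l0 by (simp add: lam_def)
  qed (use ll in simp_all)
qed

text \<open>Fix \<open>p0\<close> over \<open>m\<close>. Components are the classes of vectors at \<open>p0\<close> modulo defects.\<close>

lemma component_vector_space:
  assumes m: "m \<in> mpoints (base B)"
  shows "\<exists>V :: (real, ('p \<times> 'a tvec \<times> 'o tvec) set set) module.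
           carrier V = ad_conn G H B m \<and>
           graded_vector_space V {0, 1 :: nat}
             (\<lambda>i. {component (p, \<alpha>, v) |p \<alpha> v. (p, \<alpha>, v) \<in> points T \<and> pr p = m \<and>
                     (if i = 0 then v = 0 else \<alpha> = 0)}) \<and>
           (\<forall>p\<in>P. \<forall>a\<in>fibre (An p). \<forall>b\<in>fibre (An p). pr p = m \<longrightarrow>
              component (p, a) \<oplus>\<^bsub>V\<^esub> component (p, b) = component (p, a + b)) \<and>
           (\<forall>p\<in>P. \<forall>a\<in>fibre (An p). pr p = m \<longrightarrow>
              \<zero>\<^bsub>V\<^esub> = component (p, 0) \<and> \<ominus>\<^bsub>V\<^esub> component (p, a) = component (p, - a) \<and>
              (\<forall>c. c \<odot>\<^bsub>V\<^esub> component (p, a) = component (p, pscale c a)))"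
proof -
  obtain p0 where p0: "p0 \<in> P" "pr p0 = m" using m unfolding pr_surj[symmetric]
    by (elim imageE) (rule that, simp_all)
  define E0 where "E0 = fibre (An p0)"
  define \<kappa> where "\<kappa> e = component (p0, e)" for e
  have o: "An p0 \<in> objs G" using p0 by simp
  have keq: "\<kappa> a = \<kappa> b \<longleftrightarrow> a - b \<in> defect_span p0" if "a \<in> E0" "b \<in> E0" for a b
    using component_eq_iff[OF p0(1)] that by (simp add: \<kappa>_def E0_def)
  have E00: "0 \<in> E0" "\<And>a b. a \<in> E0 \<Longrightarrow> b \<in> E0 \<Longrightarrow> a + b \<in> E0" "\<And>c a. a \<in> E0 \<Longrightarrow> pscale c a \<in> E0" "\<And>a. a \<in> E0
      \<Longrightarrow> - a \<in> E0"
    unfolding E0_def by (rule fibre_linear(1)[OF o], rule fibre_linear(2), assumption+, rule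
        fibre_linear(3), assumption, rule fibre_linear(4))
  have "\<exists>V :: (real, ('p \<times> 'a tvec \<times> 'o tvec) set set) module. carrier V = \<kappa> ` E0 \<and>
    Module.module real_field V \<and> \<zero>\<^bsub>V\<^esub> = \<kappa> 0 \<and>
    (\<forall>a\<in>E0. \<forall>b\<in>E0. \<kappa> a \<oplus>\<^bsub>V\<^esub> \<kappa> b = \<kappa> (a + b)) \<and> (\<forall>c. \<forall>a\<in>E0. c \<odot>\<^bsub>V\<^esub> \<kappa> a = \<kappa> (pscale c a)) \<and>
    (\<forall>a\<in>E0. \<ominus>\<^bsub>V\<^esub> \<kappa> a = \<kappa> (- a))"
    by (rule quotient_module[where ?N0.0 = "defect_span p0"]) (rule E00(1), rule E00(2), assumption+,
        rule E00(3), assumption,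
        erule (1) defect_span_add, erule defect_span_scale, erule (1) keq)
  then obtain V :: "(real, ('p \<times> 'a tvec \<times> 'o tvec) set set) module"
    where V: "carrier V = \<kappa> ` E0" "Module.module real_field V" "\<zero>\<^bsub>V\<^esub> = \<kappa> 0"
    "\<forall>a\<in>E0. \<forall>b\<in>E0. \<kappa> a \<oplus>\<^bsub>V\<^esub> \<kappa> b = \<kappa> (a + b)" "\<forall>c. \<forall>a\<in>E0. c \<odot>\<^bsub>V\<^esub> \<kappa> a = \<kappa> (pscale c a)"
    "\<forall>a\<in>E0. \<ominus>\<^bsub>V\<^esub> \<kappa> a = \<kappa> (- a)"
    by (elim exE conjE)
  interpret Module.module real_field V by (rule V(2))
  define W where "W i = {e \<in> E0. if i = 0 then snd e = 0 else fst e = 0}" for i :: nat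
  have Weq: "{component (p, \<alpha>, v) |p \<alpha> v. (p, \<alpha>, v) \<in> points T \<and> pr p = m
      \<and> (if i = 0 then v = 0 else \<alpha> = 0)} = \<kappa> ` W i" for i
  proof (intro equalityI subsetI)
    fix x assume "x \<in> {component (p, \<alpha>, v) |p \<alpha> v. (p, \<alpha>, v) \<in> points T \<and> pr p = m
        \<and> (if i = 0 then v = 0 else \<alpha> = 0)}"
    then obtain q \<alpha> v where qv: "x = component (q, \<alpha>, v)" "(q, \<alpha>, v) \<in> points T" "pr q = m"
        "if i = 0 then v = 0 else \<alpha> = 0"
      by (elim CollectE exE conjE)
    define e where "e = (\<alpha>, v)"
    have q: "q \<in> P" "e \<in> fibre (An q)" "pr q = m" "x = component (q, e)"
        "if i = 0 then snd e = 0 else fst e = 0"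
      using qv by (simp_all add: T_points e_def)
    have qp: "pr q = pr p0" using q p0 by simp
    obtain L where L: "\<forall>e\<in>fibre (An q). L e \<in> fibre (An p0) \<and> component (q, e) = component (p0, L e)"
    "\<forall>d\<in>fibre (An q). \<forall>e\<in>fibre (An q). L (d + e) = L d + L e" "\<forall>c. \<forall>e\<in>fibre (An q). L (pscale c e) =
        pscale c (L e)"
    "L 0 = 0" "\<forall>e\<in>fibre (An q). L (- e) = - L e"
    "\<forall>e\<in>fibre (An q). (snd e = 0 \<longrightarrow> snd (L e) = 0) \<and> (fst e = 0 \<longrightarrow> fst (L e) = 0)"
      using based_component[OF p0(1) q(1) qp] .
    have "L e \<in> W i" using L(1,6) q(2,5) by (auto simp: W_def E0_def split: if_splits)
    moreover have "x = \<kappa> (L e)" using L(1) q(2,4) by (simp add: \<kappa>_def)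
    ultimately show "x \<in> \<kappa> ` W i" by (rule image_eqI[rotated])
  next
    fix x assume "x \<in> \<kappa> ` W i"
    then obtain e where "e \<in> E0" "if i = 0 then snd e = 0 else fst e = 0" "x = \<kappa> e"
      by (auto simp: W_def)
    then show "x \<in> {component (p, \<alpha>, v) |p \<alpha> v. (p, \<alpha>, v) \<in> points T \<and> pr p = m
        \<and> (if i = 0 then v = 0 else \<alpha> = 0)}"
      using p0 by (intro CollectI exI[of _ p0] exI[of _ "fst e"] exI[of _
          "snd e"]) (simp add: T_points E0_def \<kappa>_def)
  qed
  have car: "carrier V = ad_conn G H B m"
  proof -
    have "ad_conn G H B m = {component (p, e) |p e. p \<in> P \<and> e \<in> fibre (An p) \<and> pr p = m}"
      unfolding ad_conn_def conn_components_def
    proof (intro equalityI subsetI)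
      fix x assume "x \<in> conn_class (fibre_objects G H B m) (fibre_arrows G H B m) AG ` fibre_objects G H
          B m"
      then obtain c where c: "c \<in> points (ad_objects G H B)" "pr (foot c) = m"
        "x = conn_class (fibre_objects G H B m) (fibre_arrows G H B m) AG c"
        by (auto simp: fibre_objects_def proj0)
      obtain p e where "p \<in> P" "e \<in> fibre (An p)" "c = cls (p, e)" using objE[OF c(1)] .
      then show "x \<in> {component (p, e) |p e. p \<in> P \<and> e \<in> fibre (An p) \<and> pr p = m}"
        using c by (intro CollectI exI[of _ p] exI[of _ e]) (simp add: ad_component_def)
    next
      fix x assume "x \<in> {component (p, e) |p e. p \<in> P \<and> e \<in> fibre (An p) \<and> pr p = m}"
      then obtain p e where pe: "p \<in> P" "e \<in> fibre (An p)" "pr p = m" "x = component (p, e)" by auto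
      then have "cls (p, e) \<in> fibre_objects G H B m" using cls_obj
        by (simp add: fibre_objects_def proj0)
      then show "x \<in> conn_class (fibre_objects G H B m) (fibre_arrows G H B m) AG ` fibre_objects G H B
          m"
        using pe by (simp add: ad_component_def)
    qed
    also have "\<dots> = \<kappa> ` E0"
    proof (intro equalityI subsetI)
      fix x assume "x \<in> {component (p, e) |p e. p \<in> P \<and> e \<in> fibre (An p) \<and> pr p = m}"
      then obtain q e where q: "q \<in> P" "e \<in> fibre (An q)" "pr q = m" "x = component (q, e)" by auto
      have qp: "pr q = pr p0" using q p0 by simp
      obtain L where L: "\<forall>e\<in>fibre (An q). L e \<in> fibre (An p0) \<and> component (q, e) = component (p0, L e)"
      "\<forall>d\<in>fibre (An q). \<forall>e\<in>fibre (An q). L (d + e) = L d + L e" "\<forall>c. \<forall>e\<in>fibre (An q). L (pscale c e) =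
          pscale c (L e)"
      "L 0 = 0" "\<forall>e\<in>fibre (An q). L (- e) = - L e"
      "\<forall>e\<in>fibre (An q). (snd e = 0 \<longrightarrow> snd (L e) = 0) \<and> (fst e = 0 \<longrightarrow> fst (L e) = 0)"
        using based_component[OF p0(1) q(1) qp] .
      have "L e \<in> E0" "x = \<kappa> (L e)" using L(1) q(2,4) by (simp_all add: \<kappa>_def E0_def)
      then show "x \<in> \<kappa> ` E0" by (rule image_eqI[rotated])
    next
      fix x assume "x \<in> \<kappa> ` E0"
      then show "x \<in> {component (p, e) |p e. p \<in> P \<and> e \<in> fibre (An p) \<and> pr p = m}"
        using p0 by (auto simp: \<kappa>_def E0_def)
    qed
    finally show ?thesis using V(1) by simp
  qed
  have WE: "W i \<subseteq> E0" for i by (auto simp: W_def)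
  have sub: "submodule (\<kappa> ` W i) real_field V" for i
  proof (rule submoduleI)
    show "\<kappa> ` W i \<subseteq> carrier V" using WE V(1) by auto
    show "\<zero>\<^bsub>V\<^esub> \<in> \<kappa> ` W i" unfolding V(3) using E00(1) by (auto simp: W_def)
    fix x assume "x \<in> \<kappa> ` W i"
    then obtain a where a: "a \<in> W i" "x = \<kappa> a" by auto
    have aE: "a \<in> E0" using a WE by auto
    have "- a \<in> W i" using a(1) E00(4) by (auto simp: W_def split: if_splits)
    then show "\<ominus>\<^bsub>V\<^esub> x \<in> \<kappa> ` W i" using V(6) aE a(2) by auto
    show "c \<odot>\<^bsub>V\<^esub> x \<in> \<kappa> ` W i" for c
    proof -
      have "pscale c a \<in> W i" using a(1) E00(3)
        by (auto simp: W_def pscale_def tscale_def zero_fun_def split: if_splits)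
      then show ?thesis using V(5) aE a(2) by auto
    qed
    fix y assume "y \<in> \<kappa> ` W i"
    then obtain b where b: "b \<in> W i" "y = \<kappa> b" by auto
    have bE: "b \<in> E0" using b WE by auto
    have "a + b \<in> W i" using a(1) b(1) E00(2) by (auto simp: W_def split: if_splits)
    then show "x \<oplus>\<^bsub>V\<^esub> y \<in> \<kappa> ` W i" using V(4) aE bE a(2) b(2) by auto
  qed
  have fs: "finsum V w {0, 1 :: nat} = w 0 \<oplus>\<^bsub>V\<^esub> w 1" if "w 0 \<in> carrier V" "w 1 \<in> carrier V" for w
    using that by simp
  have graded: "graded_vector_space V {0, 1 :: nat} (\<lambda>i. \<kappa> ` W i)"
    unfolding graded_vector_space_def
  proof (intro conjI ballI V(2) sub)
    show "finite {0, 1 :: nat}" by simp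
    fix x assume "x \<in> carrier V"
    then obtain e where e: "e \<in> E0" "x = \<kappa> e" using V(1) by auto
    have eW: "(fst e, 0) \<in> W 0" "(0, snd e) \<in> W 1"
      using e(1) E00(1) by (simp_all add: W_def E0_def fibre_def mem_Times_iff)
    have ee: "(fst e, 0) + (0, snd e) = e" by (simp add: prod_eq_iff)
    define w where "w = (\<lambda>i\<in>{0, 1 :: nat}. if i = 0 then \<kappa> (fst e, 0) else \<kappa> (0, snd e))"
    have w01: "w 0 = \<kappa> (fst e, 0)" "w 1 = \<kappa> (0, snd e)" by (simp_all add: w_def)
    have wP: "w \<in> Pi\<^sub>E {0, 1} (\<lambda>i. \<kappa> ` W i)" using eW by (auto simp: w_def)
    have eE: "(fst e, 0) \<in> E0" "(0, snd e) \<in> E0"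
      by (rule subsetD[OF WE eW(1)], rule subsetD[OF WE eW(2)])
    have wV: "w 0 \<in> carrier V" "w 1 \<in> carrier V" unfolding w01 V(1)
      by (rule imageI[OF eE(1)], rule imageI[OF eE(2)])
    have "\<kappa> (fst e, 0) \<oplus>\<^bsub>V\<^esub> \<kappa> (0, snd e) = \<kappa> e"
      using V(4)[rule_format, OF eE] unfolding ee .
    then have wx: "x = finsum V w {0, 1}" unfolding fs[OF wV] w01 e(2) by (rule sym)
    show "\<exists>!w. w \<in> Pi\<^sub>E {0, 1} (\<lambda>i. \<kappa> ` W i) \<and> x = finsum V w {0, 1}"
    proof (rule ex1I[of _ w])
      show "w \<in> Pi\<^sub>E {0, 1} (\<lambda>i. \<kappa> ` W i) \<and> x = finsum V w {0, 1}" using wP wx by simp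
      fix w' assume w': "w' \<in> Pi\<^sub>E {0, 1} (\<lambda>i. \<kappa> ` W i) \<and> x = finsum V w' {0, 1}"
      then have "w' 0 \<in> \<kappa> ` W 0" "w' 1 \<in> \<kappa> ` W 1" by (auto simp: PiE_iff)
      then obtain a b where ab: "a \<in> W 0" "w' 0 = \<kappa> a" "b \<in> W 1" "w' 1 = \<kappa> b" by auto
      have abE: "a \<in> E0" "b \<in> E0" using ab WE by auto
      have wV': "w' 0 \<in> carrier V" "w' 1 \<in> carrier V"
        unfolding ab(2,4) V(1) by (rule imageI[OF abE(1)], rule imageI[OF abE(2)])
      have "x = \<kappa> (a + b)"
        using w'[THEN conjunct2] unfolding fs[OF wV'] ab(2,4) V(4)[rule_format, OF abE] .
      then have d: "e - (a + b) \<in> defect_span p0" using keq[OF e(1) E00(2)[OF abE]] e(2) by simp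
      have sa: "snd a = 0" "fst b = 0" using ab by (simp_all add: W_def)
      have d1: "(fst e, 0) - a = (fst (e - (a + b)), 0)" using sa by (simp add: prod_eq_iff)
      have n1: "(fst e, 0) - a \<in> defect_span p0" unfolding d1 by (rule defect_span_split[OF d])
      have d2: "(0, snd e) - b = (e - (a + b)) - ((fst e, 0) - a)" using sa by (simp add: prod_eq_iff)
      have n2: "(0, snd e) - b \<in> defect_span p0" unfolding d2 by (rule defect_span_diff[OF d n1])
      have "w' 0 = w 0" "w' 1 = w 1"
        unfolding w01 ab(2,4) using keq[OF eE(1) abE(1)] keq[OF eE(2) abE(2)] n1 n2 by simp_all
      then show "w' = w" using w' wP by (intro PiE_ext[of w' "{0,1}" "\<lambda>i. \<kappa> ` W i" w]) auto
    qed
  qed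
  have comps: "component (p, a) \<oplus>\<^bsub>V\<^esub> component (p, b) = component (p, a + b) \<and> \<zero>\<^bsub>V\<^esub> = component (p, 0) \<and>
      \<ominus>\<^bsub>V\<^esub> component (p, a) = component (p, - a) \<and> (\<forall>c. c \<odot>\<^bsub>V\<^esub> component (p, a) = component (p, pscale c
          a))"
    if p: "p \<in> P" "pr p = m" and a: "a \<in> fibre (An p)" and b: "b \<in> fibre (An p)" for p a b
  proof -
    have pp: "pr p = pr p0" using p p0 by simp
    obtain L where L: "\<forall>e\<in>fibre (An p). L e \<in> fibre (An p0) \<and> component (p, e) = component (p0, L e)"
    "\<forall>d\<in>fibre (An p). \<forall>e\<in>fibre (An p). L (d + e) = L d + L e" "\<forall>c. \<forall>e\<in>fibre (An p). L (pscale c e) =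
        pscale c (L e)"
    "L 0 = 0" "\<forall>e\<in>fibre (An p). L (- e) = - L e"
    "\<forall>e\<in>fibre (An p). (snd e = 0 \<longrightarrow> snd (L e) = 0) \<and> (fst e = 0 \<longrightarrow> fst (L e) = 0)"
      using based_component[OF p0(1) p(1) pp] .
    have k: "component (p, e) = \<kappa> (L e)" "L e \<in> E0" if "e \<in> fibre (An p)" for e
      using L(1) that by (simp_all add: \<kappa>_def E0_def)
    have op: "An p \<in> objs G" using p by simp
    show ?thesis
      using k[OF a] k[OF b] k[OF fibre_linear(2)[OF a b]] k[OF fibre_linear(1)[OF op]] k[OF
          fibre_linear(4)[OF a]]
        k[OF fibre_linear(3)[OF a]] V(3-6) L(2-5) a b by simp
  qed
  have Wf: "(\<lambda>i. {component (p, \<alpha>, v) |p \<alpha> v. (p, \<alpha>, v) \<in> points T \<and> pr p = m \<and>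
      (if i = 0 then v = 0 else \<alpha> = 0)}) = (\<lambda>i. \<kappa> ` W i)"
    by (rule ext) (rule Weq)
  show ?thesis
    unfolding Wf
  proof (intro exI[of _ V] conjI car graded ballI impI allI)
    fix p a b assume "p \<in> P" "a \<in> fibre (An p)" "b \<in> fibre (An p)" "pr p = m"
    then show "component (p, a) \<oplus>\<^bsub>V\<^esub> component (p, b) = component (p, a + b)" using comps by blast
  next
    fix p a assume *: "p \<in> P" "a \<in> fibre (An p)" "pr p = m"
    then show "\<zero>\<^bsub>V\<^esub> = component (p, 0)" "\<ominus>\<^bsub>V\<^esub> component (p, a) = component (p, - a)"
      using comps[OF *(1,3,2,2)] by blast+
    show "c \<odot>\<^bsub>V\<^esub> component (p, a) = component (p, pscale c a)" for c
      using comps[OF *(1,3,2,2)] by blast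
  qed
qed

section \<open>The projection to the base\<close>

lemma proj_functor:
  "smooth_functor AG (discrete_groupoid (mdiff (base B))) (ad_proj0 G H B) (ad_proj1 G H B)"
  unfolding smooth_functor_def AG_simps(6,7)
proof (intro conjI ballI impI)
  have p1: "ad_proj1 G H B f = pr (foot (fst f))" for f by (cases f) (simp add: proj1)
  show "dsmooth (ad_objects G H B) (ob_space (discrete_groupoid (mdiff (base B)))) (ad_proj0 G H B)"
    by (rule dsmoothI)
      (use foot_in dsmoothD(2)[OF pr_smooth foot_plot] in \<open>auto simp: discrete_groupoid_def proj0\<close>)
  show "dsmooth (ad_arrows G H B) (ar_space (discrete_groupoid (mdiff (base B)))) (ad_proj1 G H B)"
    by (rule dsmoothI)
      (use foot_in dsmoothD(2)[OF pr_smooth foot_plot] in \<open>auto simp: discrete_groupoid_def p1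
          arrow_plot_iff arrows_iff\<close>)
  fix f assume f: "f \<in> points (ad_arrows G H B)"
  obtain c g where fc: "f = (c, g)" by (cases f)
  have c: "c \<in> points (ad_objects G H B)" "g \<in> arrs G" "An (foot c) = Tg g" using f
    by (simp_all add: fc arrows_iff)
  show "src (discrete_groupoid (mdiff (base B))) (ad_proj1 G H B f) = ad_proj0 G H B (src AG f)"
    by (simp add: fc discrete_groupoid_def proj0 proj1)
  show "tgt (discrete_groupoid (mdiff (base B))) (ad_proj1 G H B f) = ad_proj0 G H B (tgt AG f)"
    using move_obj(2)[OF c] foot_in[OF c(1)] c by (simp add: fc discrete_groupoid_def proj0 proj1)
next
  fix x show "ad_proj1 G H B (unt AG x) = unt (discrete_groupoid (mdiff (base B))) (ad_proj0 G H B x)"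
    by (simp add: discrete_groupoid_def proj0 proj1)
next
  fix k f
  show "ad_proj1 G H B (cmp AG k f) = cmp (discrete_groupoid (mdiff (base B))) (ad_proj1 G H B k)
      (ad_proj1 G H B f)"
    by (cases k; cases f) (simp add: discrete_groupoid_def proj1)
qed

lemma proj_surjective:
  "ad_proj0 G H B ` points (ad_objects G H B) = mpoints (base B)"
  "ad_proj1 G H B ` points (ad_arrows G H B) = mpoints (base B)"
proof -
  have sub: "ad_proj0 G H B ` points (ad_objects G H B) \<subseteq> mpoints (base B)"
    "ad_proj1 G H B ` points (ad_arrows G H B) \<subseteq> mpoints (base B)"
    using foot_in by (auto simp: proj0 proj1 arrows_iff)
  have "m \<in> ad_proj0 G H B ` points (ad_objects G H B) \<and> m \<in> ad_proj1 G H B ` points (ad_arrows G H B)"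
    if m: "m \<in> mpoints (base B)" for m
  proof -
    obtain p where p: "p \<in> P" "m = pr p" using m unfolding pr_surj[symmetric] by (elim imageE)
    have z: "0 \<in> fibre (An p)" using fibre_linear(1) p by simp
    have c: "cls (p, 0) \<in> points (ad_objects G H B)" "foot (cls (p, 0)) = p"
      using cls_obj[OF p(1) z] foot_cls[OF p(1) z] by simp_all
    have "(cls (p, 0), One (An p)) \<in> points (ad_arrows G H B)" unfolding arrows_iff using c p by simp
    moreover have "m = ad_proj1 G H B (cls (p, 0), One (An p))" "m = ad_proj0 G H B (cls (p, 0))"
      using c p by (simp_all add: proj0 proj1)
    ultimately show ?thesis using c(1) by blast
  qed
  then show "ad_proj0 G H B ` points (ad_objects G H B) = mpoints (base B)"
    "ad_proj1 G H B ` points (ad_arrows G H B) = mpoints (base B)"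
    using sub by blast+
qed

end

section \<open>The adjoint groupoid of a principal bundle\<close>

theorem proposition8:
  fixes G :: "('o, 'a) lie_groupoid"
    and H :: "'a \<Rightarrow> 'a tvec set"
    and B :: "('p, 'm, 'o, 'a) principal_bundle_data"
  assumes "is_lie_groupoid G"
    and "ehresmann_connection G H"
    and "principal_bundle G B"
  shows "equiv (points (ad_total G B)) (ad_rel G H B) \<and>
    (\<forall>(p, \<alpha>, v)\<in>points (ad_total G B). ad_foot G H B (ad_class G H B (p, \<alpha>, v)) = p) \<and>
    (\<forall>(p, \<alpha>, v)\<in>points (ad_total G B). \<forall>g\<in>arrs G. anchor B p = tgt G g \<longrightarrow>
           tgt (adjoint_groupoid G H B) (ad_class G H B (p, \<alpha>, v), g) =
           ad_class G H B (act B p g, lam0 G H (ginv G g) \<alpha>, lam1 G H (ginv G g) v)) \<and>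
    diffeological_groupoid (adjoint_groupoid G H B) \<and>
    smooth_functor (adjoint_groupoid G H B) (discrete_groupoid (mdiff (base B)))
           (ad_proj0 G H B) (ad_proj1 G H B) \<and>
    (\<forall>(p, \<alpha>, v)\<in>points (ad_total G B).
           ad_proj0 G H B (ad_class G H B (p, \<alpha>, v)) = proj B p \<and>
           (\<forall>g\<in>arrs G. anchor B p = tgt G g \<longrightarrow>
              ad_proj1 G H B (ad_class G H B (p, \<alpha>, v), g) = proj B p)) \<and>
    ad_proj0 G H B ` points (ob_space (adjoint_groupoid G H B)) = mpoints (base B) \<and>
    ad_proj1 G H B ` points (ar_space (adjoint_groupoid G H B)) = mpoints (base B) \<and>
    (\<forall>p\<in>mpoints (total B). \<forall>q\<in>mpoints (total B). proj B p = proj B q \<longrightarrow>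
           (\<exists>!g. g \<in> arrs G \<and> anchor B p = tgt G g \<and> q = act B p g)) \<and>
    (\<forall>m\<in>mpoints (base B). \<exists>V :: (real, ('p \<times> 'a tvec \<times> 'o tvec) set set) module.
           carrier V = ad_conn G H B m \<and>
           graded_vector_space V {0, 1 :: nat}
             (\<lambda>i. {ad_component G H B (p, \<alpha>, v) |p \<alpha> v.
                     (p, \<alpha>, v) \<in> points (ad_total G B) \<and> proj B p = m \<and>
                     (if i = 0 then v = 0 else \<alpha> = 0)}) \<and>
           (\<forall>(p, \<alpha>, v)\<in>points (ad_total G B). \<forall>(q, \<beta>, v')\<in>points (ad_total G B). \<forall>g\<in>arrs G.
              proj B p = m \<and> proj B q = m \<and> anchor B p = tgt G g \<and> q = act B p g \<longrightarrow>
              ad_component G H B (p, \<alpha>, v) \<oplus>\<^bsub>V\<^esub> ad_component G H B (q, \<beta>, v') =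
              ad_component G H B
                (act B p g, lam0 G H (ginv G g) \<alpha> + \<beta>, lam1 G H (ginv G g) v + v')) \<and>
           (\<forall>(p, \<alpha>, v)\<in>points (ad_total G B). proj B p = m \<longrightarrow>
              \<zero>\<^bsub>V\<^esub> = ad_component G H B (p, 0, 0) \<and>
              \<ominus>\<^bsub>V\<^esub> ad_component G H B (p, \<alpha>, v) = ad_component G H B (p, - \<alpha>, - v) \<and>
              (\<forall>c. c \<odot>\<^bsub>V\<^esub> ad_component G H B (p, \<alpha>, v) =
                   ad_component G H B (p, tscale c \<alpha>, tscale c v))))"
proof -
  interpret groupoid_with_connection G H by (rule groupoid_with_connection.intro) (rule assms)+
  interpret adjoint_setting G H B by unfold_locales (rule assms)
  have pt: "p \<in> P" "(\<alpha>, v) \<in> fibre (An p)" if "(p, \<alpha>, v) \<in> points T" for p \<alpha> v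
    using that by (simp_all add: T_points)
  have lam_pair: "lam g (\<alpha>, v) = (lam0 G H g \<alpha>, lam1 G H g v)" for g \<alpha> v
    by (simp add: lam_def)
  have foot: "\<forall>(p, \<alpha>, v)\<in>points T. foot (cls (p, \<alpha>, v)) = p"
    using foot_cls pt by (auto simp: split_paired_all)
  have target: "\<forall>(p, \<alpha>, v)\<in>points T. \<forall>g\<in>arrs G. An p = Tg g \<longrightarrow>
      tgt AG (cls (p, \<alpha>, v), g) = cls (Ac p g, lam0 G H (Inv g) \<alpha>, lam1 G H (Inv g) v)"
  proof (clarify)
    fix p \<alpha> v g assume "(p, \<alpha>, v) \<in> points T" and g: "g \<in> arrs G" "An p = Tg g"
    from pt[OF this(1)] show "tgt AG (cls (p, \<alpha>, v), g) = cls (Ac p g, lam0 G H (Inv g) \<alpha>, lam1 G H (Inv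
        g) v)"
      using move_cls[of p "(\<alpha>, v)" g] g by (simp add: lam_pair)
  qed
  have projections: "\<forall>(p, \<alpha>, v)\<in>points T. ad_proj0 G H B (cls (p, \<alpha>, v)) = pr p \<and>
      (\<forall>g\<in>arrs G. An p = Tg g \<longrightarrow> ad_proj1 G H B (cls (p, \<alpha>, v), g) = pr p)"
  proof (clarify)
    fix p \<alpha> v assume "(p, \<alpha>, v) \<in> points T"
    then have "foot (cls (p, \<alpha>, v)) = p" using foot by blast
    then show "ad_proj0 G H B (cls (p, \<alpha>, v)) = pr p \<and>
        (\<forall>g\<in>arrs G. An p = Tg g \<longrightarrow> ad_proj1 G H B (cls (p, \<alpha>, v), g) = pr p)"
      by (simp add: proj0 proj1)
  qed
  have components: "\<exists>V :: (real, ('p \<times> 'a tvec \<times> 'o tvec) set set) module.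
      carrier V = ad_conn G H B m \<and>
      graded_vector_space V {0, 1 :: nat}
        (\<lambda>i. {component (p, \<alpha>, v) |p \<alpha> v. (p, \<alpha>, v) \<in> points T \<and> pr p = m \<and>
                (if i = 0 then v = 0 else \<alpha> = 0)}) \<and>
      (\<forall>(p, \<alpha>, v)\<in>points T. \<forall>(q, \<beta>, v')\<in>points T. \<forall>g\<in>arrs G.
         pr p = m \<and> pr q = m \<and> An p = Tg g \<and> q = Ac p g \<longrightarrow>
         component (p, \<alpha>, v) \<oplus>\<^bsub>V\<^esub> component (q, \<beta>, v') =
         component (Ac p g, lam0 G H (Inv g) \<alpha> + \<beta>, lam1 G H (Inv g) v + v')) \<and>
      (\<forall>(p, \<alpha>, v)\<in>points T. pr p = m \<longrightarrow>
         \<zero>\<^bsub>V\<^esub> = component (p, 0, 0) \<and> \<ominus>\<^bsub>V\<^esub> component (p, \<alpha>, v) = component (p, - \<alpha>, - v) \<and>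
         (\<forall>c. c \<odot>\<^bsub>V\<^esub> component (p, \<alpha>, v) = component (p, tscale c \<alpha>, tscale c v)))"
    if m: "m \<in> mpoints (base B)" for m
  proof -
    obtain V :: "(real, ('p \<times> 'a tvec \<times> 'o tvec) set set) module" where V: "carrier V = ad_conn G H B m"
      "graded_vector_space V {0, 1 :: nat}
        (\<lambda>i. {component (p, \<alpha>, v) |p \<alpha> v. (p, \<alpha>, v) \<in> points T \<and> pr p = m \<and>
                (if i = 0 then v = 0 else \<alpha> = 0)})"
      and add: "\<forall>p\<in>P. \<forall>a\<in>fibre (An p). \<forall>b\<in>fibre (An p). pr p = m \<longrightarrow>
         component (p, a) \<oplus>\<^bsub>V\<^esub> component (p, b) = component (p, a + b)"
      and scale: "\<forall>p\<in>P. \<forall>a\<in>fibre (An p). pr p = m \<longrightarrow>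
         \<zero>\<^bsub>V\<^esub> = component (p, 0) \<and> \<ominus>\<^bsub>V\<^esub> component (p, a) = component (p, - a) \<and>
         (\<forall>c. c \<odot>\<^bsub>V\<^esub> component (p, a) = component (p, pscale c a))"
      using component_vector_space[OF m] by (elim exE conjE)
    show ?thesis
    proof (intro exI[of _ V] conjI V)
      show "\<forall>(p, \<alpha>, v)\<in>points T. \<forall>(q, \<beta>, v')\<in>points T. \<forall>g\<in>arrs G.
         pr p = m \<and> pr q = m \<and> An p = Tg g \<and> q = Ac p g \<longrightarrow>
         component (p, \<alpha>, v) \<oplus>\<^bsub>V\<^esub> component (q, \<beta>, v') =
         component (Ac p g, lam0 G H (Inv g) \<alpha> + \<beta>, lam1 G H (Inv g) v + v')"
      proof (clarify)
        fix p \<alpha> v q \<beta> v' g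
        assume T: "(p, \<alpha>, v) \<in> points T" "(Ac p g, \<beta>, v') \<in> points T" and g: "g \<in> arrs G" "An p = Tg g"
          and m: "m = pr p"
        have p: "Ac p g \<in> P" "lam (Inv g) (\<alpha>, v) \<in> fibre (An (Ac p g))" "pr (Ac p g) = pr p"
          using pt[OF T(1)] g lam_fibre[of g "(\<alpha>, v)"] by simp_all
        have "component (Ac p g, lam (Inv g) (\<alpha>, v)) \<oplus>\<^bsub>V\<^esub> component (Ac p g, \<beta>, v') =
            component (Ac p g, lam (Inv g) (\<alpha>, v) + (\<beta>, v'))"
          by (rule add[rule_format, OF p(1,2) pt(2)[OF T(2)]]) (simp only: p(3) m)
        then show "component (p, \<alpha>, v) \<oplus>\<^bsub>V\<^esub> component (Ac p g, \<beta>, v') =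
            component (Ac p g, lam0 G H (Inv g) \<alpha> + \<beta>, lam1 G H (Inv g) v + v')"
          unfolding component_move[OF pt[OF T(1)] g, symmetric] lam_pair add_Pair .
      qed
      show "\<forall>(p, \<alpha>, v)\<in>points T. pr p = m \<longrightarrow>
         \<zero>\<^bsub>V\<^esub> = component (p, 0, 0) \<and> \<ominus>\<^bsub>V\<^esub> component (p, \<alpha>, v) = component (p, - \<alpha>, - v) \<and>
         (\<forall>c. c \<odot>\<^bsub>V\<^esub> component (p, \<alpha>, v) = component (p, tscale c \<alpha>, tscale c v))"
      proof (intro ballI, clarify)
        fix p \<alpha> v assume T: "(p, \<alpha>, v) \<in> points T" and m: "m = pr p"
        show "\<zero>\<^bsub>V\<^esub> = component (p, 0, 0) \<and> \<ominus>\<^bsub>V\<^esub> component (p, \<alpha>, v) = component (p, - \<alpha>, - v) \<and>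
         (\<forall>c. c \<odot>\<^bsub>V\<^esub> component (p, \<alpha>, v) = component (p, tscale c \<alpha>, tscale c v))"
          using scale[rule_format, OF pt[OF T] m[symmetric]]
          unfolding zero_prod_def uminus_Pair pscale_def fst_conv snd_conv by simp
      qed
    qed
  qed
  show ?thesis
    by (intro conjI ballI equiv_ad_rel foot target adjoint_diffeological_groupoid proj_functor
        projections
        impI translation_unique components; (simp only: AG_simps proj_surjective)?)
qed

end
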